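(* Let $\Bbbk$ be a field of characteristic zero and $D^*\colon c\mathsf{Com}\rightleftarrows\mathsf{cdga}\colon K^\bullet_{\mathrm{alg}}$ the adjunction between cosimplicial commutative $\Bbbk$-algebras and commutative dg $\Bbbk$-algebras described in the context. (1) The adjunction restricts to an adjunction between finitely generated reduced algebras $$D^*\colon c\mathsf{Com}^{\mathrm{fg}}_0\rightleftarrows\mathsf{cdga}^{\mathrm{fg}}_0\colon K^\bullet_{\mathrm{alg}}.$$ (2) If $A^\bullet\in c\mathsf{Com}_0$, then there is a natural isomorphism of reduced cdgas $D^*(\hat A^\bullet)\cong D^*(A^\bullet)$, and the adjunction in (1) extends along the completion functor $c\mathsf{Com}^{\mathrm{fg}}_0\to c\widehat{\mathsf{Alg}}_0$, $A^\bullet\mapsto\hat A^\bullet$, to an adjunction $$D^*\colon c\widehat{\mathsf{Alg}}_0\rightleftarrows\mathsf{cdga}^{\mathrm{fg}}_0\colon K^\bullet_{\mathrm{alg}}.$$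
   Context: $\mathsf{cdga}$: non-negatively cohomologically graded unital commutative dg $\Bbbk$-algebras; $c\mathsf{Com}$: cosimplicial commutative unital $\Bbbk$-algebras. $K^\bullet_{\mathrm{alg}}\colon\mathsf{cdga}\to c\mathsf{Com}$ is (up to natural isomorphism) $K^\bullet_{\mathrm{alg}}(C)=Z^0(C\otimes\Lambda^\bullet)$, where $\Lambda^n=\Bbbk[e_0,\dots,e_n]$ is the free graded commutative algebra with $e_i$ in degree $-1$ and differential the derivation with $e_i\mapsto1$, cosimplicial via $e_i\mapsto e_{\alpha(i)}$; $D^*$ is its left adjoint. $c\mathsf{Com}_0\subseteq c\mathsf{Com}$: the reduced cosimplicial algebras, i.e. those $A^\bullet$ with $A^0=\Bbbk$ (hence canonically augmented); $c\mathsf{Com}^{\mathrm{fg}}_0\subseteq c\mathsf{Com}_0$: those that are moreover finitely generated (levelwise, as algebras). $\hat A^\bullet$ is the completion of $A^\bullet$ with respect to its augmentation ideal. A cdga $C$ is reduced if $C^0=\Bbbk$; $\mathsf{cdga}^{\mathrm{fg}}_0$: reduced cdgas $C$ that are finitely generated, meaning $C^i$ is finite-dimensional over $\Bbbk$ for all $i\ge1$. $c\widehat{\mathsf{Alg}}_0$: cosimplicial objects $A^\bullet$ in the category of complete local Noetherian $\Bbbk$-algebras with residue field $\Bbbk$ and local morphisms, with $A^0=\Bbbk$.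
   Formalization: In (2), D*(Â)≅D*(A) is proved when the augmentation ideals of A are finitely generated (it fails for Aⁿ=Sym(V)^{⊗n}, dim V infinite); for all A in cCom_0 one gets the natural map and that D*(A) represents continuous maps Â→K_alg(C). *)

theory Defs
  imports
    "HOL-Algebra.Generated_Rings"
    "HOL-Algebra.Ideal_Product"
    "HOL-Algebra.Ring_Divisibility"
    "HOL-Algebra.QuotRing"
begin

text \<open>
  The ground field is a ring structure \<open>R\<close>; commutative unital \<open>R\<close>-algebras are structures \<open>M\<close>
  with \<open>algebra R M\<close>. Structures carry their own carrier set, and the carrier types of different
  objects are unrelated, so that hom-sets are taken between objects of different types. Elements
  of hom-sets are extensional functions, so that equality of morphisms is equality in HOL.
\<close>

section \<open>Algebras\<close>

definition alg_hom ::
  "('r, 'p) ring_scheme \<Rightarrow> ('r, 'a, 'x) module_scheme \<Rightarrow> ('r, 'b, 'y) module_scheme \<Rightarrow> ('a \<Rightarrow> 'b) set"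
  where "alg_hom R M N =
    {f \<in> ring_hom M N. \<forall>r\<in>carrier R. \<forall>x\<in>carrier M. f (r \<odot>\<^bsub>M\<^esub> x) = r \<odot>\<^bsub>N\<^esub> f x}"

definition fin_gen_algebra :: "('r, 'p) ring_scheme \<Rightarrow> ('r, 'a, 'x) module_scheme \<Rightarrow> bool"
  where "fin_gen_algebra R M \<longleftrightarrow>
    (\<exists>S \<subseteq> carrier M. finite S \<and>
       generate_ring M (S \<union> (\<lambda>r. r \<odot>\<^bsub>M\<^esub> \<one>\<^bsub>M\<^esub>) ` carrier R) = carrier M)"

definition finite_dim_in ::
  "('r, 'p) ring_scheme \<Rightarrow> ('r, 'a, 'x) module_scheme \<Rightarrow> 'a set \<Rightarrow> bool"
  where "finite_dim_in R M V \<longleftrightarrow>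
    (\<exists>B \<subseteq> V. finite B \<and> (\<forall>x\<in>V. \<exists>a\<in>B \<rightarrow> carrier R. x = (\<Oplus>\<^bsub>M\<^esub>b\<in>B. a b \<odot>\<^bsub>M\<^esub> b)))"

definition is_ground_field ::
  "('r, 'p) ring_scheme \<Rightarrow> ('r, 'a, 'x) module_scheme \<Rightarrow> 'a set \<Rightarrow> bool"
  where "is_ground_field R M V \<longleftrightarrow> bij_betw (\<lambda>r. r \<odot>\<^bsub>M\<^esub> \<one>\<^bsub>M\<^esub>) (carrier R) V"

subsection \<open>Adic completion\<close>

fun ideal_pow :: "('a, 'x) ring_scheme \<Rightarrow> 'a set \<Rightarrow> nat \<Rightarrow> 'a set"
  where
    "ideal_pow M I 0 = carrier M"
  | "ideal_pow M I (Suc k) = ideal_prod M I (ideal_pow M I k)"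

text \<open>
  The inverse limit of the rings \<open>M / I\<^sup>k\<close>: a coset of \<open>I\<^sup>k\<^sup>+\<^sup>1\<close> is mapped to the unique coset of
  \<open>I\<^sup>k\<close> containing it.
\<close>

definition adic_completion :: "('r, 'a, 'x) module_scheme \<Rightarrow> 'a set \<Rightarrow> ('r, nat \<Rightarrow> 'a set) module"
  where "adic_completion M I =
    \<lparr> carrier = {x. \<forall>k. x k \<in> carrier (M Quot ideal_pow M I k) \<and> x (Suc k) \<subseteq> x k},
      monoid.mult = (\<lambda>x y k. x k \<otimes>\<^bsub>M Quot ideal_pow M I k\<^esub> y k),
      one = (\<lambda>k. \<one>\<^bsub>M Quot ideal_pow M I k\<^esub>),
      zero = (\<lambda>k. \<zero>\<^bsub>M Quot ideal_pow M I k\<^esub>),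
      add = (\<lambda>x y k. x k \<oplus>\<^bsub>M Quot ideal_pow M I k\<^esub> y k),
      smult = (\<lambda>r x k. \<Union>a\<in>x k. ideal_pow M I k +>\<^bsub>M\<^esub> (r \<odot>\<^bsub>M\<^esub> a)) \<rparr>"

definition to_completion :: "('a, 'x) ring_scheme \<Rightarrow> 'a set \<Rightarrow> 'a \<Rightarrow> nat \<Rightarrow> 'a set"
  where "to_completion M I a = (\<lambda>k. ideal_pow M I k +>\<^bsub>M\<^esub> a)"

text \<open>The map of completions induced by \<open>f\<close> with \<open>f ` I \<subseteq> J\<close>, where \<open>J\<close> is an ideal of \<open>N\<close>.\<close>

definition completion_map ::
  "('b, 'y) ring_scheme \<Rightarrow> 'b set \<Rightarrow> ('a \<Rightarrow> 'b) \<Rightarrow> (nat \<Rightarrow> 'a set) \<Rightarrow> nat \<Rightarrow> 'b set"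
  where "completion_map N J f x = (\<lambda>k. \<Union>a\<in>x k. ideal_pow N J k +>\<^bsub>N\<^esub> f a)"

definition max_ideal :: "('a, 'x) ring_scheme \<Rightarrow> 'a set"
  where "max_ideal M = (THE I. maximalideal I M)"

definition complete_local_noetherian ::
  "('r, 'p) ring_scheme \<Rightarrow> ('r, 'a, 'x) module_scheme \<Rightarrow> bool"
  where "complete_local_noetherian R M \<longleftrightarrow>
    algebra R M \<and> noetherian_ring M \<and> (\<exists>!I. maximalideal I M) \<and>
    bij_betw (to_completion M (max_ideal M)) (carrier M)
      (carrier (adic_completion M (max_ideal M))) \<and>
    bij_betw (\<lambda>r. max_ideal M +>\<^bsub>M\<^esub> (r \<odot>\<^bsub>M\<^esub> \<one>\<^bsub>M\<^esub>)) (carrier R)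
      (carrier (M Quot max_ideal M))"

section \<open>Cosimplicial commutative algebras\<close>

definition Delta :: "nat \<Rightarrow> nat \<Rightarrow> (nat \<Rightarrow> nat) set"
  where "Delta m n = {\<alpha> \<in> {..m} \<rightarrow>\<^sub>E {..n}. mono_on {..m} \<alpha>}"

record ('r, 'a) cosimp =
  level :: "nat \<Rightarrow> ('r, 'a) module"
  cmap :: "nat \<Rightarrow> nat \<Rightarrow> (nat \<Rightarrow> nat) \<Rightarrow> 'a \<Rightarrow> 'a"

definition cCom :: "('r, 'p) ring_scheme \<Rightarrow> ('r, 'a) cosimp set"
  where "cCom R = {A.
    (\<forall>n. algebra R (level A n)) \<and>
    (\<forall>m n. \<forall>\<alpha>\<in>Delta m n. cmap A m n \<alpha> \<in> alg_hom R (level A m) (level A n)) \<and>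
    (\<forall>n. \<forall>x\<in>carrier (level A n). cmap A n n (\<lambda>i\<in>{..n}. i) x = x) \<and>
    (\<forall>l m n. \<forall>\<alpha>\<in>Delta l m. \<forall>\<beta>\<in>Delta m n. \<forall>x\<in>carrier (level A l).
       cmap A l n (compose {..l} \<beta> \<alpha>) x = cmap A m n \<beta> (cmap A l m \<alpha> x))}"

definition ccom_hom ::
  "('r, 'p) ring_scheme \<Rightarrow> ('r, 'a) cosimp \<Rightarrow> ('r, 'b) cosimp \<Rightarrow> (nat \<Rightarrow> 'a \<Rightarrow> 'b) set"
  where "ccom_hom R A B = {\<phi>.
    (\<forall>n. \<phi> n \<in> alg_hom R (level A n) (level B n) \<inter> extensional (carrier (level A n))) \<and>
    (\<forall>m n. \<forall>\<alpha>\<in>Delta m n. \<forall>x\<in>carrier (level A m).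
       \<phi> n (cmap A m n \<alpha> x) = cmap B m n \<alpha> (\<phi> m x))}"

definition ccom_id :: "('r, 'a) cosimp \<Rightarrow> nat \<Rightarrow> 'a \<Rightarrow> 'a"
  where "ccom_id A = (\<lambda>n. \<lambda>x\<in>carrier (level A n). x)"

definition ccom_comp ::
  "('r, 'a) cosimp \<Rightarrow> (nat \<Rightarrow> 'b \<Rightarrow> 'c) \<Rightarrow> (nat \<Rightarrow> 'a \<Rightarrow> 'b) \<Rightarrow> nat \<Rightarrow> 'a \<Rightarrow> 'c"
  where "ccom_comp A \<psi> \<phi> = (\<lambda>n. compose (carrier (level A n)) (\<psi> n) (\<phi> n))"

definition cCom\<^sub>0 :: "('r, 'p) ring_scheme \<Rightarrow> ('r, 'a) cosimp set"
  where "cCom\<^sub>0 R = {A \<in> cCom R. is_ground_field R (level A 0) (carrier (level A 0))}"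

definition cCom\<^sub>0_fg :: "('r, 'p) ring_scheme \<Rightarrow> ('r, 'a) cosimp set"
  where "cCom\<^sub>0_fg R = {A \<in> cCom\<^sub>0 R. \<forall>n. fin_gen_algebra R (level A n)}"

text \<open>The augmentation of \<open>A\<^sup>n\<close> is induced by the unique map \<open>[n] \<rightarrow> [0]\<close>.\<close>

definition aug_ideal :: "('r, 'a) cosimp \<Rightarrow> nat \<Rightarrow> 'a set"
  where "aug_ideal A n = a_kernel (level A n) (level A 0) (cmap A n 0 (\<lambda>i\<in>{..n}. 0))"

text \<open>
  If an augmentation ideal \<open>I\<close> is not finitely generated, the kernel of the map from the completion
  to \<open>A\<^sup>n / I\<^sup>k\<close> can be larger than the \<open>k\<close>-th power of the augmentation ideal of the completion.
\<close>

definition fin_gen_aug_ideals :: "('r, 'a) cosimp \<Rightarrow> bool"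
  where "fin_gen_aug_ideals A \<longleftrightarrow>
    (\<forall>n. \<exists>S \<subseteq> carrier (level A n). finite S \<and> aug_ideal A n = Idl\<^bsub>level A n\<^esub> S)"

definition compl :: "('r, 'a) cosimp \<Rightarrow> ('r, nat \<Rightarrow> 'a set) cosimp"
  where "compl A =
    \<lparr> level = (\<lambda>n. adic_completion (level A n) (aug_ideal A n)),
      cmap = (\<lambda>m n \<alpha>. completion_map (level A n) (aug_ideal A n) (cmap A m n \<alpha>)) \<rparr>"

definition compl_map ::
  "('r, 'a) cosimp \<Rightarrow> ('r, 'b) cosimp \<Rightarrow> (nat \<Rightarrow> 'a \<Rightarrow> 'b) \<Rightarrow> nat \<Rightarrow> (nat \<Rightarrow> 'a set) \<Rightarrow> nat \<Rightarrow> 'b set"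
  where "compl_map A B \<phi> =
    (\<lambda>n. \<lambda>x\<in>carrier (level (compl A) n). completion_map (level B n) (aug_ideal B n) (\<phi> n) x)"

definition to_compl :: "('r, 'a) cosimp \<Rightarrow> nat \<Rightarrow> 'a \<Rightarrow> nat \<Rightarrow> 'a set"
  where "to_compl A = (\<lambda>n. \<lambda>a\<in>carrier (level A n). to_completion (level A n) (aug_ideal A n) a)"

text \<open>
  Morphisms out of the completion which are continuous for the inverse limit topology on its
  levels and the discrete topology on the levels of the target.
\<close>

definition cont_hom ::
  "('r, 'p) ring_scheme \<Rightarrow> ('r, 'a) cosimp \<Rightarrow> ('r, 'b) cosimp \<Rightarrow> (nat \<Rightarrow> (nat \<Rightarrow> 'a set) \<Rightarrow> 'b) set"
  where "cont_hom R A B = {\<psi> \<in> ccom_hom R (compl A) B.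
    \<forall>n. \<exists>k. \<forall>x\<in>carrier (level (compl A) n).
      x k = \<zero>\<^bsub>level A n Quot ideal_pow (level A n) (aug_ideal A n) k\<^esub> \<longrightarrow> \<psi> n x = \<zero>\<^bsub>level B n\<^esub>}"

definition local_ccom_hom ::
  "('r, 'p) ring_scheme \<Rightarrow> ('r, 'a) cosimp \<Rightarrow> ('r, 'b) cosimp \<Rightarrow> (nat \<Rightarrow> 'a \<Rightarrow> 'b) set"
  where "local_ccom_hom R A B = {\<phi> \<in> ccom_hom R A B.
    \<forall>n. \<phi> n ` max_ideal (level A n) \<subseteq> max_ideal (level B n)}"

definition cAlg\<^sub>0 :: "('r, 'p) ring_scheme \<Rightarrow> ('r, 'a) cosimp set"
  where "cAlg\<^sub>0 R = {A \<in> cCom\<^sub>0 R.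
    (\<forall>n. complete_local_noetherian R (level A n)) \<and>
    (\<forall>m n. \<forall>\<alpha>\<in>Delta m n.
       cmap A m n \<alpha> ` max_ideal (level A m) \<subseteq> max_ideal (level A n))}"

section \<open>Commutative differential graded algebras\<close>

text \<open>
  A cdga is given by its total algebra, the direct sum of the homogeneous parts \<open>hpart C i\<close> with
  \<open>i \<ge> 0\<close>, and its differential. The total algebra is commutative only in the graded sense.
\<close>

record ('r, 'c) dga = "('r, 'c) module" +
  hpart :: "nat \<Rightarrow> 'c set"
  diff :: "'c \<Rightarrow> 'c"

definition sgn_mult :: "('c, 'x) ring_scheme \<Rightarrow> nat \<Rightarrow> 'c \<Rightarrow> 'c"
  where "sgn_mult C k x = (if even k then x else \<ominus>\<^bsub>C\<^esub> x)"

definition cdgas :: "('r, 'p) ring_scheme \<Rightarrow> ('r, 'c) dga set"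
  where "cdgas R = {C.
    ring C \<and> module R C \<and>
    (\<forall>r\<in>carrier R. \<forall>x\<in>carrier C. \<forall>y\<in>carrier C.
       (r \<odot>\<^bsub>C\<^esub> x) \<otimes>\<^bsub>C\<^esub> y = r \<odot>\<^bsub>C\<^esub> (x \<otimes>\<^bsub>C\<^esub> y) \<and>
       x \<otimes>\<^bsub>C\<^esub> (r \<odot>\<^bsub>C\<^esub> y) = r \<odot>\<^bsub>C\<^esub> (x \<otimes>\<^bsub>C\<^esub> y)) \<and>
    (\<forall>i. submodule (hpart C i) R C) \<and>
    (\<forall>x\<in>carrier C. \<exists>!p. (\<forall>i. p i \<in> hpart C i) \<and> finite {i. p i \<noteq> \<zero>\<^bsub>C\<^esub>} \<and>
       x = (\<Oplus>\<^bsub>C\<^esub>i\<in>{i. p i \<noteq> \<zero>\<^bsub>C\<^esub>}. p i)) \<and>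
    \<one>\<^bsub>C\<^esub> \<in> hpart C 0 \<and>
    (\<forall>i j. \<forall>x\<in>hpart C i. \<forall>y\<in>hpart C j.
       x \<otimes>\<^bsub>C\<^esub> y \<in> hpart C (i + j) \<and>
       x \<otimes>\<^bsub>C\<^esub> y = sgn_mult C (i * j) (y \<otimes>\<^bsub>C\<^esub> x)) \<and>
    (\<forall>x\<in>carrier C. \<forall>y\<in>carrier C. diff C (x \<oplus>\<^bsub>C\<^esub> y) = diff C x \<oplus>\<^bsub>C\<^esub> diff C y) \<and>
    (\<forall>r\<in>carrier R. \<forall>x\<in>carrier C. diff C (r \<odot>\<^bsub>C\<^esub> x) = r \<odot>\<^bsub>C\<^esub> diff C x) \<and>
    (\<forall>i. \<forall>x\<in>hpart C i. diff C x \<in> hpart C (Suc i)) \<and>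
    (\<forall>x\<in>carrier C. diff C (diff C x) = \<zero>\<^bsub>C\<^esub>) \<and>
    (\<forall>i. \<forall>x\<in>hpart C i. \<forall>y\<in>carrier C.
       diff C (x \<otimes>\<^bsub>C\<^esub> y) = diff C x \<otimes>\<^bsub>C\<^esub> y \<oplus>\<^bsub>C\<^esub> sgn_mult C i (x \<otimes>\<^bsub>C\<^esub> diff C y))}"

definition cdga_hom ::
  "('r, 'p) ring_scheme \<Rightarrow> ('r, 'c) dga \<Rightarrow> ('r, 'd) dga \<Rightarrow> ('c \<Rightarrow> 'd) set"
  where "cdga_hom R C C' = {g \<in> alg_hom R C C' \<inter> extensional (carrier C).
    (\<forall>i. g ` hpart C i \<subseteq> hpart C' i) \<and> (\<forall>x\<in>carrier C. g (diff C x) = diff C' (g x))}"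

definition cdga_iso ::
  "('r, 'p) ring_scheme \<Rightarrow> ('r, 'c) dga \<Rightarrow> ('r, 'd) dga \<Rightarrow> ('c \<Rightarrow> 'd) set"
  where "cdga_iso R C C' = {g \<in> cdga_hom R C C'. bij_betw g (carrier C) (carrier C')}"

definition cdga_id :: "('r, 'c) dga \<Rightarrow> 'c \<Rightarrow> 'c"
  where "cdga_id C = (\<lambda>x\<in>carrier C. x)"

definition cdga_comp :: "('r, 'c) dga \<Rightarrow> ('d \<Rightarrow> 'e) \<Rightarrow> ('c \<Rightarrow> 'd) \<Rightarrow> 'c \<Rightarrow> 'e"
  where "cdga_comp C h g = compose (carrier C) h g"

definition cdgas\<^sub>0 :: "('r, 'p) ring_scheme \<Rightarrow> ('r, 'c) dga set"
  where "cdgas\<^sub>0 R = {C \<in> cdgas R. is_ground_field R C (hpart C 0)}"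

definition cdgas\<^sub>0_fg :: "('r, 'p) ring_scheme \<Rightarrow> ('r, 'c) dga set"
  where "cdgas\<^sub>0_fg R = {C \<in> cdgas\<^sub>0 R. \<forall>i\<ge>1. finite_dim_in R C (hpart C i)}"

section \<open>The functor \<open>K_alg\<close>\<close>

text \<open>
  \<open>\<Lambda>\<^sup>n\<close> has the basis \<open>e\<^sub>S = e\<^bsub>s1\<^esub> \<cdots> e\<^bsub>sp\<^esub>\<close> for \<open>S = {s1 < \<cdots> < sp} \<subseteq> {0..n}\<close>, of degree \<open>- p\<close>, and

  \<^item> \<open>e\<^sub>S e\<^sub>T = (-1)\<^sup>j e\<^bsub>S \<union> T\<^esub>\<close> with \<open>j = inversions S T\<close> if \<open>S\<close> and \<open>T\<close> are disjoint, and
    \<open>e\<^sub>S e\<^sub>T = 0\<close> otherwise;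
  \<^item> \<open>d e\<^sub>T\<close> is the sum over \<open>t \<in> T\<close> of \<open>(-1)\<^sup>j e\<^bsub>T - {t}\<^esub>\<close> with \<open>j = position t T\<close>;
  \<^item> for monotone \<open>\<alpha>\<close>, \<open>e\<^sub>S\<close> is mapped to \<open>e\<^bsub>\<alpha> ` S\<^esub>\<close> if \<open>\<alpha>\<close> is injective on \<open>S\<close>, and to \<open>0\<close> otherwise.

  An element of \<open>C \<otimes> \<Lambda>\<^sup>n\<close> of total degree \<open>m\<close> is written as the sum over \<open>S\<close> of \<open>f S \<otimes> e\<^sub>S\<close>, hence
  is given by a family \<open>f S \<in> C\<^sup>m\<^sup>+\<^sup>p\<close>, \<open>p = card S\<close>. The product and the differential are those of the
  tensor product of dg algebras,
  \<open>(c \<otimes> e\<^sub>S) (c' \<otimes> e\<^sub>T) = (-1)\<^sup>j c c' \<otimes> e\<^sub>S e\<^sub>T\<close> with \<open>j = card S * deg c'\<close>, and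
  \<open>d (c \<otimes> e\<^sub>S) = d c \<otimes> e\<^sub>S + (-1)\<^sup>j c \<otimes> d e\<^sub>S\<close> with \<open>j = deg c\<close>.
\<close>

definition inversions :: "nat set \<Rightarrow> nat set \<Rightarrow> nat"
  where "inversions S T = card {(s, t). s \<in> S \<and> t \<in> T \<and> t < s}"

definition position :: "nat \<Rightarrow> nat set \<Rightarrow> nat"
  where "position t T = card {s \<in> T. s < t}"

definition tensor_carrier :: "('r, 'c) dga \<Rightarrow> nat \<Rightarrow> nat \<Rightarrow> (nat set \<Rightarrow> 'c) set"
  where "tensor_carrier C n m = (\<Pi>\<^sub>E S\<in>Pow {..n}. hpart C (m + card S))"

text \<open>Here \<open>m'\<close> is the total degree of the second factor.\<close>

definition tensor_mult ::
  "('r, 'c) dga \<Rightarrow> nat \<Rightarrow> nat \<Rightarrow> (nat set \<Rightarrow> 'c) \<Rightarrow> (nat set \<Rightarrow> 'c) \<Rightarrow> nat set \<Rightarrow> 'c"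
  where "tensor_mult C n m' f g = (\<lambda>U\<in>Pow {..n}. \<Oplus>\<^bsub>C\<^esub>S\<in>Pow U.
    sgn_mult C (card S * (m' + card (U - S)) + inversions S (U - S)) (f S \<otimes>\<^bsub>C\<^esub> g (U - S)))"

definition tensor_diff ::
  "('r, 'c) dga \<Rightarrow> nat \<Rightarrow> nat \<Rightarrow> (nat set \<Rightarrow> 'c) \<Rightarrow> nat set \<Rightarrow> 'c"
  where "tensor_diff C n m f = (\<lambda>S\<in>Pow {..n}. diff C (f S) \<oplus>\<^bsub>C\<^esub> (\<Oplus>\<^bsub>C\<^esub>t\<in>{..n} - S.
    sgn_mult C (m + card (insert t S) + position t (insert t S)) (f (insert t S))))"

definition K_level :: "('r, 'c) dga \<Rightarrow> nat \<Rightarrow> ('r, nat set \<Rightarrow> 'c) module"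
  where "K_level C n =
    \<lparr> carrier = {f \<in> tensor_carrier C n 0. tensor_diff C n 0 f = (\<lambda>S\<in>Pow {..n}. \<zero>\<^bsub>C\<^esub>)},
      monoid.mult = tensor_mult C n 0,
      one = (\<lambda>S\<in>Pow {..n}. if S = {} then \<one>\<^bsub>C\<^esub> else \<zero>\<^bsub>C\<^esub>),
      zero = (\<lambda>S\<in>Pow {..n}. \<zero>\<^bsub>C\<^esub>),
      add = (\<lambda>f g. \<lambda>S\<in>Pow {..n}. f S \<oplus>\<^bsub>C\<^esub> g S),
      smult = (\<lambda>r f. \<lambda>S\<in>Pow {..n}. r \<odot>\<^bsub>C\<^esub> f S) \<rparr>"

definition K_alg :: "('r, 'c) dga \<Rightarrow> ('r, nat set \<Rightarrow> 'c) cosimp"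
  where "K_alg C =
    \<lparr> level = K_level C,
      cmap = (\<lambda>m n \<alpha> f. \<lambda>T\<in>Pow {..n}. \<Oplus>\<^bsub>C\<^esub>S\<in>{S \<in> Pow {..m}. inj_on \<alpha> S \<and> \<alpha> ` S = T}. f S) \<rparr>"

definition K_map :: "('r, 'c) dga \<Rightarrow> ('c \<Rightarrow> 'd) \<Rightarrow> nat \<Rightarrow> (nat set \<Rightarrow> 'c) \<Rightarrow> nat set \<Rightarrow> 'd"
  where "K_map C g = (\<lambda>n. \<lambda>f\<in>carrier (level (K_alg C) n). \<lambda>S\<in>Pow {..n}. g (f S))"

section \<open>The left adjoint of \<open>K_alg\<close>\<close>

definition universal_arrow ::
  "('r, 'p) ring_scheme \<Rightarrow> ('r, 'a) cosimp \<Rightarrow> ('r, 'c) dga \<times> (nat \<Rightarrow> 'a \<Rightarrow> nat set \<Rightarrow> 'c) \<Rightarrow> bool"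
  where "universal_arrow R A = (\<lambda>(B, \<eta>).
    B \<in> cdgas R \<and> \<eta> \<in> ccom_hom R A (K_alg B) \<and>
    (\<forall>C\<in>(cdgas R :: ('r, 'c) dga set). \<forall>\<phi>\<in>ccom_hom R A (K_alg C).
       \<exists>!g. g \<in> cdga_hom R B C \<and> ccom_comp A (K_map B g) \<eta> = \<phi>))"

text \<open>
  The carrier type of the values of the left adjoint. Its elements can represent the cosets of an
  ideal in the free associative algebra on symbols \<open>(n, a, S)\<close>, that is, elements of the cdga
  generated by the coefficients \<open>\<eta> n a S\<close> of a universal arrow \<open>\<eta>\<close> for \<open>A\<close>. In this type a
  universal arrow therefore exists, and it is universal for cdgas of every carrier type.
\<close>

type_synonym ('r, 'a) lcarrier = "((nat \<times> 'a \<times> nat set) list \<Rightarrow> 'r) set"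

definition left_adjoint ::
  "('r, 'p) ring_scheme \<Rightarrow> ('r, 'a) cosimp \<Rightarrow>
   ('r, ('r, 'a) lcarrier) dga \<times> (nat \<Rightarrow> 'a \<Rightarrow> nat set \<Rightarrow> ('r, 'a) lcarrier)"
  where "left_adjoint R A = (SOME u. universal_arrow R A u)"

definition D_star :: "('r, 'p) ring_scheme \<Rightarrow> ('r, 'a) cosimp \<Rightarrow> ('r, ('r, 'a) lcarrier) dga"
  where "D_star R A = fst (left_adjoint R A)"

definition D_unit ::
  "('r, 'p) ring_scheme \<Rightarrow> ('r, 'a) cosimp \<Rightarrow> nat \<Rightarrow> 'a \<Rightarrow> nat set \<Rightarrow> ('r, 'a) lcarrier"
  where "D_unit R A = snd (left_adjoint R A)"

definition adjunct ::
  "('r, 'p) ring_scheme \<Rightarrow> ('r, 'a) cosimp \<Rightarrow> (('r, 'a) lcarrier \<Rightarrow> 'c) \<Rightarrow> nat \<Rightarrow> 'a \<Rightarrow> nat set \<Rightarrow> 'c"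
  where "adjunct R A g = ccom_comp A (K_map (D_star R A) g) (D_unit R A)"

definition D_map ::
  "('r, 'p) ring_scheme \<Rightarrow> ('r, 'a) cosimp \<Rightarrow> ('r, 'b) cosimp \<Rightarrow> (nat \<Rightarrow> 'a \<Rightarrow> 'b) \<Rightarrow>
   ('r, 'a) lcarrier \<Rightarrow> ('r, 'b) lcarrier"
  where "D_map R A B \<phi> =
    (THE g. g \<in> cdga_hom R (D_star R A) (D_star R B) \<and> adjunct R A g = ccom_comp A (D_unit R B) \<phi>)"

end

theory Submission
  imports Defs "HOL-Computational_Algebra.Primes"
begin

text \<open>The value of the left adjoint at \<open>A\<close> is generated by the coefficients \<open>\<eta> n a S\<close> of a cochain-valued
  function that is universal among the morphisms from \<open>A\<close> to cosimplicial algebras \<open>K_alg C\<close>; it is realised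
  inside a product of cdgas, and words in the coefficients span it. If \<open>A 0\<close> is the ground field, the
  coefficients at the empty set of elements of the augmentation ideal \<open>I\<close> vanish. Hence elements of
  \<open>I\<^sup>n\<^sup>+\<^sup>2\<close> in level \<open>n\<close>, whose coefficients are indexed by subsets of \<open>{..n}\<close>, are sent to zero, and every
  morphism into \<open>K_alg C\<close> extends to the completion. Finiteness of the left adjoint follows by moving
  the indices of a coefficient with codegeneracies until only generators of the augmentation ideals in
  bounded cosimplicial degree are needed. Complete local rings are Noetherian by taking initial
  monomials, Dickson's lemma and successive approximation.\<close>

section \<open>Finite sums and signs\<close>

text \<open>Carrier types cannot be quantified over in HOL, while the left adjoint has to be
  universal for cdgas of every carrier type. The product therefore runs over all pairs (C, \<phi>)
  whose cdga C lives in the one type \<open>lcarrier\<close>, a solution set as in the adjoint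
  functor theorem. For this to suffice, the subalgebra generated by the coefficients of a morphism
  into any \<open>K_alg C\<close> must have a copy in \<open>lcarrier\<close>: an element is coded
  by the set of all finitely supported coefficient functions on words that evaluate to it. The words
  span a subcomplex because the cocycle equation writes the differential of a coefficient as a
  signed sum of coefficients at larger index sets. The universal arrow is fixed only by a choice, so
  its generation by coefficients is carried over from the constructed arrow. A completion has two
  topologies, by powers of its own augmentation ideal and by kernels to the quotients. They agree
  when the augmentation ideals are finitely generated; the comparison of A with its completion uses
  that condition at this point.\<close>

lemma (in abelian_monoid) finsum_Sigma:
  assumes "finite A" "\<And>a. a \<in> A \<Longrightarrow> finite (B a)"
    and "\<And>a b. a \<in> A \<Longrightarrow> b \<in> B a \<Longrightarrow> f a b \<in> carrier G"
  shows "(\<Oplus>a\<in>A. \<Oplus>b\<in>B a. f a b) = (\<Oplus>p\<in>Sigma A B. f (fst p) (snd p))"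
  using assms
proof (induction A rule: finite_induct)
  case empty
  show ?case by simp
next
  case (insert a A)
  have eq: "Sigma (insert a A) B = Pair a ` B a \<union> Sigma A B" by auto
  have disj: "Pair a ` B a \<inter> Sigma A B = {}" using insert by auto
  have "(\<Oplus>p\<in>Pair a ` B a. f (fst p) (snd p)) = (\<Oplus>b\<in>B a. f a b)"
    using insert.prems by (subst finsum_reindex) (auto intro: inj_onI)
  then have "(\<Oplus>p\<in>Sigma (insert a A) B. f (fst p) (snd p))
      = (\<Oplus>b\<in>B a. f a b) \<oplus> (\<Oplus>p\<in>Sigma A B. f (fst p) (snd p))"
    unfolding eq using insert by (subst finsum_Un_disjoint[OF _ _ disj]) (auto intro!: finite_SigmaI)
  moreover have "(\<Oplus>a\<in>insert a A. \<Oplus>b\<in>B a. f a b) = (\<Oplus>b\<in>B a. f a b) \<oplus> (\<Oplus>a\<in>A. \<Oplus>b\<in>B a. f a b)"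
    using insert by (subst finsum_insert) (auto intro!: finsum_closed)
  ultimately show ?case using insert by auto
qed

lemma (in abelian_monoid) finsum_bij_witness:
  assumes "\<And>a. a \<in> S \<Longrightarrow> i (j a) = a" "\<And>a. a \<in> S \<Longrightarrow> j a \<in> T"
    and "\<And>b. b \<in> T \<Longrightarrow> j (i b) = b" "\<And>b. b \<in> T \<Longrightarrow> i b \<in> S"
    and "\<And>a. a \<in> S \<Longrightarrow> h (j a) = g a" "\<And>b. b \<in> T \<Longrightarrow> h b \<in> carrier G"
  shows "finsum G g S = finsum G h T"
proof -
  have T: "T = j ` S" using assms by force
  have inj: "inj_on j S" using assms(1) by (metis inj_onI)
  have "finsum G h T = (\<Oplus>a\<in>S. h (j a))"
    unfolding T
  proof (rule finsum_reindex)
    show "h \<in> j ` S \<rightarrow> carrier G" using assms(6) T by blast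
  qed (rule inj)
  also have "\<dots> = finsum G g S"
  proof (rule finsum_cong')
    show "g \<in> S \<rightarrow> carrier G" using assms(2,5,6) by (metis Pi_I)
  qed (use assms in auto)
  finally show ?thesis by simp
qed

lemma (in abelian_monoid) finsum_Pow_insert:
  assumes "finite U" "t \<notin> U" "\<And>S. S \<subseteq> insert t U \<Longrightarrow> F S \<in> carrier G"
  shows "(\<Oplus>S\<in>Pow (insert t U). F S) = (\<Oplus>S\<in>Pow U. F S) \<oplus> (\<Oplus>S\<in>Pow U. F (insert t S))"
proof -
  have inj: "inj_on (insert t) (Pow U)" using assms(2) by (intro inj_onI) auto
  have "(\<Oplus>S\<in>Pow (insert t U). F S) = (\<Oplus>S\<in>Pow U. F S) \<oplus> (\<Oplus>S\<in>insert t ` Pow U. F S)"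
    unfolding Pow_insert
  proof (rule finsum_Un_disjoint)
    show "F \<in> insert t ` Pow U \<rightarrow> carrier G"
      using assms(3) by (intro Pi_I) (metis PowD image_iff insert_mono)
    show "F \<in> Pow U \<rightarrow> carrier G" using assms(3) by (auto simp: subset_insertI2)
  qed (use assms(1,2) in auto)
  also have "(\<Oplus>S\<in>insert t ` Pow U. F S) = (\<Oplus>S\<in>Pow U. F (insert t S))"
  proof (rule finsum_reindex)
    show "F \<in> insert t ` Pow U \<rightarrow> carrier G"
      using assms(3) by (intro Pi_I) (metis PowD image_iff insert_mono)
  qed (rule inj)
  finally show ?thesis .
qed

lemma (in ring) ideal_finsum:
  assumes J: "ideal J R" and f: "\<And>a. a \<in> A \<Longrightarrow> f a \<in> J"
  shows "finsum R f A \<in> J"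
  using f
proof (induction A rule: infinite_finite_induct)
  case (insert a A)
  interpret J: ideal J R by (rule J)
  have "f \<in> A \<rightarrow> carrier R" "f a \<in> carrier R" using insert.prems J.Icarr by blast+
  with insert show ?case by (simp add: finsum_insert J.a_closed)
qed (simp_all add: finsum_infinite additive_subgroup.zero_closed[OF ideal.axioms(1)[OF J]])

lemma (in abelian_group) finsum_a_inv:
  assumes "\<And>a. a \<in> A \<Longrightarrow> f a \<in> carrier G"
  shows "(\<Oplus>a\<in>A. \<ominus> f a) = \<ominus> (\<Oplus>a\<in>A. f a)"
  using assms
proof (induction A rule: infinite_finite_induct)
  case (insert a A)
  then show ?case by (simp add: finsum_insert minus_add a_comm finsum_closed Pi_def)
qed (simp_all add: finsum_infinite a_inv_def)

lemma (in abelian_monoid) additive_finsum: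
  assumes "abelian_monoid H" "\<And>x. x \<in> carrier G \<Longrightarrow> h x \<in> carrier H" "h \<zero> = \<zero>\<^bsub>H\<^esub>"
    and "\<And>x y. x \<in> carrier G \<Longrightarrow> y \<in> carrier G \<Longrightarrow> h (x \<oplus> y) = h x \<oplus>\<^bsub>H\<^esub> h y"
    and "\<And>a. a \<in> A \<Longrightarrow> f a \<in> carrier G"
  shows "h (\<Oplus>a\<in>A. f a) = (\<Oplus>\<^bsub>H\<^esub>a\<in>A. h (f a))"
proof -
  interpret H: abelian_monoid H by fact
  show ?thesis using assms(5)
  proof (induction A rule: infinite_finite_induct)
    case (insert a A)
    then show ?case using assms(2-4) by (simp add: finsum_insert H.finsum_insert Pi_def finsum_closed)
  qed (simp_all add: assms finsum_infinite H.finsum_infinite)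
qed

context ring
begin

lemma sgn_mult_closed [simp, intro]: "x \<in> carrier R \<Longrightarrow> sgn_mult R k x \<in> carrier R"
  by (simp add: sgn_mult_def)

lemma sgn_mult_0 [simp]: "sgn_mult R 0 x = x"
  by (simp add: sgn_mult_def)

lemma sgn_mult_zero [simp]: "sgn_mult R k \<zero> = \<zero>"
  by (simp add: sgn_mult_def)

lemma sgn_mult_sgn_mult [simp]: "x \<in> carrier R \<Longrightarrow> sgn_mult R k (sgn_mult R l x) = sgn_mult R (k + l) x"
  by (auto simp add: sgn_mult_def)

lemma sgn_mult_cong: "even k = even l \<Longrightarrow> x = y \<Longrightarrow> sgn_mult R k x = sgn_mult R l y"
  by (simp add: sgn_mult_def)

lemma sgn_mult_Suc: "x \<in> carrier R \<Longrightarrow> sgn_mult R (Suc k) x = \<ominus> sgn_mult R k x"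
  by (simp add: sgn_mult_def)

lemma sgn_mult_l [simp]: "x \<in> carrier R \<Longrightarrow> y \<in> carrier R \<Longrightarrow> sgn_mult R k x \<otimes> y = sgn_mult R k (x \<otimes> y)"
  by (simp add: sgn_mult_def l_minus)

lemma sgn_mult_r [simp]: "x \<in> carrier R \<Longrightarrow> y \<in> carrier R \<Longrightarrow> x \<otimes> sgn_mult R k y = sgn_mult R k (x \<otimes> y)"
  by (simp add: sgn_mult_def r_minus)

lemma sgn_mult_add: "x \<in> carrier R \<Longrightarrow> y \<in> carrier R \<Longrightarrow>
    sgn_mult R k (x \<oplus> y) = sgn_mult R k x \<oplus> sgn_mult R k y"
  by (simp add: sgn_mult_def minus_add a_comm)

lemma sgn_mult_finsum: "(\<And>a. a \<in> A \<Longrightarrow> f a \<in> carrier R) \<Longrightarrow>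
    sgn_mult R k (finsum R f A) = (\<Oplus>a\<in>A. sgn_mult R k (f a))"
  by (simp add: sgn_mult_def finsum_a_inv)

end

section \<open>Inversion counts and their parities\<close>

lemma finite_inversions: "finite S \<Longrightarrow> finite T \<Longrightarrow> finite {(s, t). s \<in> S \<and> t \<in> T \<and> (t::nat) < s}"
  by (rule finite_subset[of _ "S \<times> T"]) auto

lemma inversions_empty [simp]: "inversions {} T = 0" "inversions S {} = 0"
  by (simp_all add: inversions_def)

lemma inversions_Un_left:
  assumes "finite S" "finite S'" "finite T" "S \<inter> S' = {}"
  shows "inversions (S \<union> S') T = inversions S T + inversions S' T"
proof -
  have "{(s, t). s \<in> S \<union> S' \<and> t \<in> T \<and> t < s} =
      {(s, t). s \<in> S \<and> t \<in> T \<and> t < s} \<union> {(s, t). s \<in> S' \<and> t \<in> T \<and> t < s}" by auto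
  then show ?thesis unfolding inversions_def
    using assms by (subst card_Un_disjoint[symmetric]) (auto intro: finite_inversions)
qed

lemma inversions_Un_right:
  assumes "finite S" "finite T" "finite T'" "T \<inter> T' = {}"
  shows "inversions S (T \<union> T') = inversions S T + inversions S T'"
proof -
  have "{(s, t). s \<in> S \<and> t \<in> T \<union> T' \<and> t < s} =
      {(s, t). s \<in> S \<and> t \<in> T \<and> t < s} \<union> {(s, t). s \<in> S \<and> t \<in> T' \<and> t < s}" by auto
  then show ?thesis unfolding inversions_def
    using assms by (subst card_Un_disjoint[symmetric]) (auto intro: finite_inversions)
qed

lemma inversions_insert_left:
  "finite S \<Longrightarrow> finite T \<Longrightarrow> s \<notin> S \<Longrightarrow> inversions (insert s S) T = inversions {s} T + inversions S T"
  using inversions_Un_left[of "{s}" S T] by auto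

lemma inversions_insert_right:
  "finite S \<Longrightarrow> finite T \<Longrightarrow> t \<notin> T \<Longrightarrow> inversions S (insert t T) = inversions S {t} + inversions S T"
  using inversions_Un_right[of S "{t}" T] by auto

text \<open>Comparing s with t sorts S x T into the pairs inverted in one order and those inverted
  in the other; disjointness excludes ties.\<close>

lemma inversions_commute:
  assumes "finite S" "finite T" "S \<inter> T = {}"
  shows "inversions S T + inversions T S = card S * card T"
proof -
  have "inversions T S = card (prod.swap ` {(s, t). s \<in> T \<and> t \<in> S \<and> t < s})"
    unfolding inversions_def by (rule card_image[symmetric]) auto
  also have "prod.swap ` {(s, t). s \<in> T \<and> t \<in> S \<and> t < s} = {(s, t). s \<in> S \<and> t \<in> T \<and> s < t}" by force
  finally have 1: "inversions T S = card {(s, t). s \<in> S \<and> t \<in> T \<and> s < t}" .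
  have "S \<times> T = {(s, t). s \<in> S \<and> t \<in> T \<and> t < s} \<union> {(s, t). s \<in> S \<and> t \<in> T \<and> s < t}"
    using assms(3) by (auto simp: disjoint_iff) (metis linorder_neqE_nat)
  moreover have "finite {(s, t). s \<in> S \<and> t \<in> T \<and> t < s}" "finite {(s, t). s \<in> S \<and> t \<in> T \<and> s < t}"
    by (rule finite_subset[of _ "S \<times> T"]; use assms in auto)+
  moreover have "{(s, t). s \<in> S \<and> t \<in> T \<and> t < s} \<inter> {(s, t). s \<in> S \<and> t \<in> T \<and> s < t} = {}" by auto
  ultimately have "card (S \<times> T) = inversions S T + inversions T S"
    unfolding 1 by (simp only: card_Un_disjoint inversions_def[of S T])
  then show ?thesis by (simp add: card_cartesian_product)
qed

lemma inversions_commute_parity: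
  assumes "finite S" "finite T" "S \<inter> T = {}"
  shows "even (inversions S T) \<longleftrightarrow> even (card S * card T + inversions T S)"
proof -
  have "even x \<longleftrightarrow> even (z + y)" if "x + y = z" for x y z :: nat using that by presburger
  then show ?thesis using inversions_commute[OF assms] by blast
qed

text \<open>A monotone map that is injective on S \<union> T preserves and reflects strict
  inequality there, so it carries the inverted pairs bijectively to the inverted pairs of the
  images.\<close>

lemma inversions_image:
  fixes \<alpha> :: "nat \<Rightarrow> nat"
  assumes "mono_on X \<alpha>" "S \<union> T \<subseteq> X" "inj_on \<alpha> (S \<union> T)"
  shows "inversions (\<alpha> ` S) (\<alpha> ` T) = inversions S T"
proof -
  have "\<alpha> t < \<alpha> s \<longleftrightarrow> t < s" if "s \<in> S" "t \<in> T" for s t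
  proof -
    have X: "s \<in> X" "t \<in> X" using that assms(2) by auto
    have ne: "\<alpha> s = \<alpha> t \<Longrightarrow> s = t" using that assms(3) by (auto dest: inj_onD)
    show ?thesis
    proof (cases s t rule: linorder_cases)
      case less
      then have "\<alpha> s \<le> \<alpha> t" using mono_onD[OF assms(1) X] by simp
      then show ?thesis using less by simp
    next
      case greater
      then have "\<alpha> t \<le> \<alpha> s" using mono_onD[OF assms(1) X(2,1)] by simp
      then show ?thesis using greater ne by (cases "\<alpha> s = \<alpha> t") auto
    qed simp
  qed
  then have "{(s, t). s \<in> \<alpha> ` S \<and> t \<in> \<alpha> ` T \<and> t < s} =
      map_prod \<alpha> \<alpha> ` {(s, t). s \<in> S \<and> t \<in> T \<and> t < s}" by (force simp: image_iff)
  moreover have "inj_on (map_prod \<alpha> \<alpha>) {(s, t). s \<in> S \<and> t \<in> T \<and> t < s}"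
    using assms(3) by (auto intro!: inj_onI dest: inj_onD)
  ultimately show ?thesis unfolding inversions_def by (simp add: card_image)
qed

lemma inversions_singleton: "inversions S {t} = card {s \<in> S. t < s}"
proof -
  have "{(s, t'). s \<in> S \<and> t' \<in> {t} \<and> t' < s} = (\<lambda>s. (s, t)) ` {s \<in> S. t < s}" by auto
  then show ?thesis unfolding inversions_def by (simp add: card_image inj_on_def)
qed

lemma inversions_singleton_left: "inversions {t} S = card {s \<in> S. s < t}"
proof -
  have "{(s, t'). s \<in> {t} \<and> t' \<in> S \<and> t' < s} = Pair t ` {s \<in> S. s < t}" by auto
  then show ?thesis unfolding inversions_def by (simp add: card_image inj_on_def)
qed

section \<open>The cosimplicial algebra of a cdga\<close>

locale cdga =
  fixes R :: "('r, 'p) ring_scheme" and C :: "('r, 'c) dga" (structure)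
  assumes cdgas: "C \<in> cdgas R"
begin

sublocale R: cring R
  using cdgas by (auto simp: cdgas_def module_def)

sublocale ring C
  using cdgas by (simp add: cdgas_def)

sublocale M: module R C
  using cdgas by (simp add: cdgas_def)

lemma smult_mult:
  assumes "r \<in> carrier R" "x \<in> carrier C" "y \<in> carrier C"
  shows "(r \<odot> x) \<otimes> y = r \<odot> (x \<otimes> y)" "x \<otimes> (r \<odot> y) = r \<odot> (x \<otimes> y)"
  using cdgas assms by (simp_all add: cdgas_def)

lemma hpart_submodule: "submodule (hpart C i) R C"
  using cdgas by (simp add: cdgas_def)

lemma hpart_carrier: "x \<in> hpart C i \<Longrightarrow> x \<in> carrier C"
  using hpart_submodule[of i] by (auto simp: submodule_def subgroup_def)

lemma hpart_zero [simp, intro]: "\<zero> \<in> hpart C i"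
  using hpart_submodule[of i] by (auto simp: submodule_def subgroup_def)

lemma hpart_add [intro]: "x \<in> hpart C i \<Longrightarrow> y \<in> hpart C i \<Longrightarrow> x \<oplus> y \<in> hpart C i"
  using hpart_submodule[of i] by (auto simp: submodule_def subgroup_def)

lemma hpart_neg [intro]: "x \<in> hpart C i \<Longrightarrow> \<ominus> x \<in> hpart C i"
  using hpart_submodule[of i] by (auto simp: submodule_def subgroup_def a_inv_def)

lemma hpart_smult [intro]: "r \<in> carrier R \<Longrightarrow> x \<in> hpart C i \<Longrightarrow> r \<odot> x \<in> hpart C i"
  using hpart_submodule[of i] by (auto simp: submodule_def submodule_axioms_def)

lemma hpart_sgn [intro]: "x \<in> hpart C i \<Longrightarrow> sgn_mult C k x \<in> hpart C i"
  by (auto simp: sgn_mult_def)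

lemma hpart_finsum [intro]: "(\<And>a. a \<in> A \<Longrightarrow> f a \<in> hpart C i) \<Longrightarrow> finsum C f A \<in> hpart C i"
proof (induction A rule: infinite_finite_induct)
  case (insert x A)
  then have "f \<in> A \<rightarrow> carrier C" "f x \<in> carrier C" using hpart_carrier by blast+
  with insert show ?case by (simp add: finsum_insert hpart_add)
qed (simp_all add: finsum_infinite)

lemma hpart_one [simp, intro]: "\<one> \<in> hpart C 0"
  using cdgas by (simp add: cdgas_def)

lemma hpart_mult [intro]: "x \<in> hpart C i \<Longrightarrow> y \<in> hpart C j \<Longrightarrow> x \<otimes> y \<in> hpart C (i + j)"
  and graded_comm: "x \<in> hpart C i \<Longrightarrow> y \<in> hpart C j \<Longrightarrow> x \<otimes> y = sgn_mult C (i * j) (y \<otimes> x)"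
  using cdgas unfolding cdgas_def mem_Collect_eq by (elim conjE, blast)+

lemma decomposition: "x \<in> carrier C \<Longrightarrow> \<exists>!p. (\<forall>i. p i \<in> hpart C i) \<and> finite {i. p i \<noteq> \<zero>} \<and>
       x = (\<Oplus>i\<in>{i. p i \<noteq> \<zero>}. p i)"
  using cdgas unfolding cdgas_def by simp

lemma diff_add: "x \<in> carrier C \<Longrightarrow> y \<in> carrier C \<Longrightarrow> diff C (x \<oplus> y) = diff C x \<oplus> diff C y"
  using cdgas by (simp add: cdgas_def)

lemma diff_smult: "r \<in> carrier R \<Longrightarrow> x \<in> carrier C \<Longrightarrow> diff C (r \<odot> x) = r \<odot> diff C x"
  using cdgas by (simp add: cdgas_def)

lemma diff_hpart [intro]: "x \<in> hpart C i \<Longrightarrow> diff C x \<in> hpart C (Suc i)"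
  using cdgas by (simp add: cdgas_def)

lemma diff_diff: "x \<in> carrier C \<Longrightarrow> diff C (diff C x) = \<zero>"
  using cdgas by (simp add: cdgas_def)

lemma diff_mult: "x \<in> hpart C i \<Longrightarrow> y \<in> carrier C \<Longrightarrow>
    diff C (x \<otimes> y) = diff C x \<otimes> y \<oplus> sgn_mult C i (x \<otimes> diff C y)"
  using cdgas by (simp add: cdgas_def)

lemma diff_zero [simp]: "diff C \<zero> = \<zero>"
  using diff_smult[of "\<zero>\<^bsub>R\<^esub>" \<zero>] diff_hpart[OF hpart_zero] hpart_carrier
  by (metis M.smult_l_null R.zero_closed zero_closed)

text \<open>The axioms only place the differential of a homogeneous element; for a general one the
  homogeneous decomposition and additivity are needed.\<close>

lemma diff_closed [simp, intro]: "x \<in> carrier C \<Longrightarrow> diff C x \<in> carrier C"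
proof -
  assume x: "x \<in> carrier C"
  then obtain p where p: "\<forall>i. p i \<in> hpart C i" "finite {i. p i \<noteq> \<zero>}" "x = (\<Oplus>i\<in>{i. p i \<noteq> \<zero>}. p i)"
    using decomposition by blast
  have "diff C (\<Oplus>i\<in>A. p i) \<in> carrier C" if "finite A" for A
    using that
  proof (induction A rule: finite_induct)
    case (insert a A)
    have p': "p i \<in> carrier C" "diff C (p i) \<in> carrier C" for i using p(1) hpart_carrier diff_hpart by blast+
    then have "diff C (finsum C p (insert a A)) = diff C (p a) \<oplus> diff C (finsum C p A)"
      using insert by (simp add: finsum_insert Pi_def diff_add finsum_closed)
    then show ?case using p' insert.IH by simp
  qed simp
  then show ?thesis using p by auto
qed

lemma diff_neg: "x \<in> carrier C \<Longrightarrow> diff C (\<ominus> x) = \<ominus> diff C x"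
  by (metis add.inv_closed diff_add diff_closed diff_zero l_neg minus_equality)

lemma diff_sgn: "x \<in> carrier C \<Longrightarrow> diff C (sgn_mult C k x) = sgn_mult C k (diff C x)"
  by (simp add: sgn_mult_def diff_neg)

lemma diff_finsum: "(\<And>a. a \<in> A \<Longrightarrow> f a \<in> carrier C) \<Longrightarrow> diff C (finsum C f A) = (\<Oplus>a\<in>A. diff C (f a))"
  by (rule additive_finsum) (auto simp: diff_add intro: abelian_monoid_axioms)

section \<open>Cochains of total degree 0 in the tensor product with the exterior algebra\<close>

lemma tensor_carrierD: "f \<in> tensor_carrier C n 0 \<Longrightarrow> S \<subseteq> {..n} \<Longrightarrow> f S \<in> hpart C (card S)"
  unfolding tensor_carrier_def by auto

lemma tensor_carrier_closed: "f \<in> tensor_carrier C n 0 \<Longrightarrow> S \<subseteq> {..n} \<Longrightarrow> f S \<in> carrier C"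
  using tensor_carrierD hpart_carrier by blast

lemma tensor_carrierI:
  "(\<And>S. S \<subseteq> {..n} \<Longrightarrow> f S \<in> hpart C (card S)) \<Longrightarrow> f \<in> extensional (Pow {..n}) \<Longrightarrow> f \<in> tensor_carrier C n 0"
  unfolding tensor_carrier_def by (auto simp: PiE_def)

lemma tensor_eqI: "f \<in> tensor_carrier C n 0 \<Longrightarrow> g \<in> tensor_carrier C n 0 \<Longrightarrow>
    (\<And>S. S \<subseteq> {..n} \<Longrightarrow> f S = g S) \<Longrightarrow> f = g"
  unfolding tensor_carrier_def by (rule PiE_ext) auto

text \<open>In total degree 0 the coefficient \<open>g (U - S)\<close> has degree card (U - S). The
  Koszul sign for moving it past e_S and the shuffle sign of the two index sets combine to the
  shuffle sign of the opposite order, so a single inversion count remains.\<close>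

lemma tensor_mult_eq:
  assumes "f \<in> tensor_carrier C n 0" "g \<in> tensor_carrier C n 0" "U \<subseteq> {..n}"
  shows "tensor_mult C n 0 f g U = (\<Oplus>S\<in>Pow U. sgn_mult C (inversions (U - S) S) (f S \<otimes> g (U - S)))"
proof -
  have fin: "finite U" using assms(3) finite_subset by blast
  show ?thesis unfolding tensor_mult_def using assms(3)
  proof (simp, intro finsum_cong' refl)
    fix S assume S: "S \<in> Pow U"
    show "sgn_mult C (card S * card (U - S) + inversions S (U - S)) (f S \<otimes> g (U - S)) =
         sgn_mult C (inversions (U - S) S) (f S \<otimes> g (U - S))"
      using S fin inversions_commute_parity[of "U - S" S]
      by (intro sgn_mult_cong) (auto simp: finite_subset mult.commute)
  qed (use assms in \<open>auto intro!: sgn_mult_closed m_closed intro: tensor_carrier_closed[of f n] tensor_carrier_closed[of g n]\<close>)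
qed

text \<open>The coefficient at \<open>e_S\<close> of \<open>\<partial> f = 0\<close>, solved for \<open>d (f S)\<close>.\<close>

definition cocycle :: "nat \<Rightarrow> (nat set \<Rightarrow> 'c) \<Rightarrow> bool"
  where "cocycle n f \<longleftrightarrow> (\<forall>S\<subseteq>{..n}.
    diff C (f S) = (\<Oplus>t\<in>{..n} - S. sgn_mult C (inversions S {t}) (f (insert t S))))"

text \<open>card S is the sum of \<open>inversions S {t}\<close> and
  \<open>inversions {t} S\<close>, and the position of t in \<open>insert t S\<close> is the second
  of these. It therefore occurs twice in the exponent and drops out, while the index t itself
  contributes the minus sign.\<close>

lemma tensor_diff_eq:
  assumes f: "f \<in> tensor_carrier C n 0" and S: "S \<subseteq> {..n}"
  shows "tensor_diff C n 0 f S =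
    diff C (f S) \<ominus> (\<Oplus>t\<in>{..n} - S. sgn_mult C (inversions S {t}) (f (insert t S)))"
proof -
  have fin: "finite S" using S finite_subset by blast
  have "(\<Oplus>t\<in>{..n} - S. sgn_mult C (0 + card (insert t S) + position t (insert t S)) (f (insert t S)))
      = (\<Oplus>t\<in>{..n} - S. \<ominus> sgn_mult C (inversions S {t}) (f (insert t S)))"
  proof (intro finsum_cong' refl)
    fix t assume t: "t \<in> {..n} - S"
    have 1: "position t (insert t S) = inversions {t} S"
      unfolding position_def inversions_singleton_left by (rule arg_cong[of _ _ card]) auto
    have 2: "card (insert t S) = Suc (inversions S {t} + inversions {t} S)"
      using t fin inversions_commute[of S "{t}"] by simp
    have "f (insert t S) \<in> carrier C" using f t S by (intro tensor_carrier_closed[of f n]) auto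
    then show "sgn_mult C (0 + card (insert t S) + position t (insert t S)) (f (insert t S))
       = \<ominus> sgn_mult C (inversions S {t}) (f (insert t S))"
      unfolding 1 2 by (subst sgn_mult_Suc[symmetric]) (auto intro: sgn_mult_cong)
  qed (use f S in \<open>auto intro!: tensor_carrier_closed[of f n]\<close>)
  also have "\<dots> = \<ominus> (\<Oplus>t\<in>{..n} - S. sgn_mult C (inversions S {t}) (f (insert t S)))"
    by (rule finsum_a_inv) (use f S in \<open>auto intro!: tensor_carrier_closed[of f n]\<close>)
  finally show ?thesis using S unfolding tensor_diff_def by (simp add: a_minus_def)
qed

lemma mem_K_level_iff: "f \<in> carrier (K_level C n) \<longleftrightarrow> f \<in> tensor_carrier C n 0 \<and> cocycle n f"
proof -
  have "tensor_diff C n 0 f = (\<lambda>S\<in>Pow {..n}. \<zero>) \<longleftrightarrow> cocycle n f" if f: "f \<in> tensor_carrier C n 0"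
  proof -
    have "tensor_diff C n 0 f = (\<lambda>S\<in>Pow {..n}. \<zero>) \<longleftrightarrow> (\<forall>S\<subseteq>{..n}. tensor_diff C n 0 f S = \<zero>)"
      by (auto simp: fun_eq_iff tensor_diff_def)
    also have "\<dots> \<longleftrightarrow> cocycle n f"
      unfolding cocycle_def
    proof (intro all_cong1 imp_cong refl)
      fix S assume S: "S \<subseteq> {..n}"
      have "(\<Oplus>t\<in>{..n} - S. sgn_mult C (inversions S {t}) (f (insert t S))) \<in> carrier C"
        using f S by (auto intro!: finsum_closed tensor_carrier_closed[of f n])
      then show "(tensor_diff C n 0 f S = \<zero>) =
           (diff C (f S) = (\<Oplus>t\<in>{..n} - S. sgn_mult C (inversions S {t}) (f (insert t S))))"
        using tensor_diff_eq[OF f S] tensor_carrier_closed[OF f S] by simp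
    qed
    finally show ?thesis .
  qed
  then show ?thesis unfolding K_level_def by auto
qed

lemma K_level_simps [simp]:
  "monoid.mult (K_level C n) = tensor_mult C n 0"
  "one (K_level C n) = (\<lambda>S\<in>Pow {..n}. if S = {} then \<one> else \<zero>)"
  "zero (K_level C n) = (\<lambda>S\<in>Pow {..n}. \<zero>)"
  "add (K_level C n) = (\<lambda>f g. \<lambda>S\<in>Pow {..n}. f S \<oplus> g S)"
  "smult (K_level C n) = (\<lambda>r f. \<lambda>S\<in>Pow {..n}. r \<odot> f S)"
  by (simp_all add: K_level_def)

lemma tensor_mult_closed:
  assumes "f \<in> tensor_carrier C n 0" "g \<in> tensor_carrier C n 0"
  shows "tensor_mult C n 0 f g \<in> tensor_carrier C n 0"
proof (rule tensor_carrierI)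
  fix U assume U: "U \<subseteq> {..n}"
  have "f S \<otimes> g (U - S) \<in> hpart C (card U)" if "S \<subseteq> U" for S
  proof -
    have "card U = card S + card (U - S)"
      using that U finite_subset by (metis card_Diff_subset card_mono finite_atMost le_add_diff_inverse)
    then show ?thesis using that U assms by (auto intro!: hpart_mult tensor_carrierD[of _ n])
  qed
  then show "tensor_mult C n 0 f g U \<in> hpart C (card U)"
    unfolding tensor_mult_eq[OF assms U] by (auto intro!: hpart_finsum hpart_sgn)
qed (simp add: tensor_mult_def)

text \<open>Exchanging S with its complement in U costs the parity card S * card (U - S) twice: once
  by graded commutativity in C and once in the inversion count.\<close>

lemma tensor_mult_comm:
  assumes f: "f \<in> tensor_carrier C n 0" and g: "g \<in> tensor_carrier C n 0"
  shows "tensor_mult C n 0 f g = tensor_mult C n 0 g f"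
proof (rule tensor_eqI[of _ n])
  fix U assume U: "U \<subseteq> {..n}"
  then have fin: "finite U" using finite_subset by blast
  show "tensor_mult C n 0 f g U = tensor_mult C n 0 g f U"
    unfolding tensor_mult_eq[OF f g U] tensor_mult_eq[OF g f U]
  proof (rule finsum_bij_witness[where i="\<lambda>S. U - S" and j="\<lambda>S. U - S"], goal_cases)
    case (5 S)
    then have S: "S \<subseteq> U" and eq: "U - (U - S) = S" by auto
    have "f S \<otimes> g (U - S) = sgn_mult C (card S * card (U - S)) (g (U - S) \<otimes> f S)"
      using S U f g by (intro graded_comm tensor_carrierD[of _ n]) auto
    moreover have "even (inversions S (U - S)) \<longleftrightarrow> even (inversions (U - S) S + card S * card (U - S))"
      using inversions_commute_parity[of S "U - S"] S fin by (simp add: finite_subset add.commute)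
    moreover have "g (U - S) \<otimes> f S \<in> carrier C"
      using S U by (auto intro!: m_closed tensor_carrier_closed[OF f] tensor_carrier_closed[OF g])
    ultimately show ?case unfolding eq by (auto intro: sgn_mult_cong)
  next
    case (6 S)
    then show ?case using U
      by (auto intro!: sgn_mult_closed m_closed tensor_carrier_closed[OF f] tensor_carrier_closed[OF g])
  qed auto
qed (use assms tensor_mult_closed in auto)

text \<open>Both sides are sums over ordered partitions of U into three blocks. The exponent counts,
  for each pair of blocks, the inversions of the later against the earlier one, and this does not
  depend on the bracketing.\<close>

lemma tensor_mult_assoc:
  assumes f: "f \<in> tensor_carrier C n 0" and g: "g \<in> tensor_carrier C n 0" and h: "h \<in> tensor_carrier C n 0"
  shows "tensor_mult C n 0 (tensor_mult C n 0 f g) h = tensor_mult C n 0 f (tensor_mult C n 0 g h)"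
proof (rule tensor_eqI[of _ n])
  fix U assume U: "U \<subseteq> {..n}"
  then have fin: "finite U" using finite_subset by blast
  note cl = tensor_carrier_closed[OF f] tensor_carrier_closed[OF g] tensor_carrier_closed[OF h]
  have clU: "f S \<in> carrier C" "g S \<in> carrier C" "h S \<in> carrier C" if "S \<subseteq> U" for S
    using that U cl by auto
  have "tensor_mult C n 0 (tensor_mult C n 0 f g) h U =
      (\<Oplus>W\<in>Pow U. sgn_mult C (inversions (U - W) W) ((\<Oplus>S\<in>Pow W. sgn_mult C (inversions (W - S) S)
        (f S \<otimes> g (W - S))) \<otimes> h (U - W)))"
    unfolding tensor_mult_eq[OF tensor_mult_closed[OF f g] h U] using U
    by (intro finsum_cong' refl)
      (auto simp: tensor_mult_eq[OF f g] intro!: sgn_mult_closed m_closed finsum_closed clU)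
  also have "\<dots> = (\<Oplus>W\<in>Pow U. \<Oplus>S\<in>Pow W. sgn_mult C (inversions (U - W) W + inversions (W - S) S)
        (f S \<otimes> g (W - S) \<otimes> h (U - W)))"
  proof (intro finsum_cong' refl)
    fix W assume "W \<in> Pow U"
    then have W: "W \<subseteq> U" and clW: "\<And>S. S \<subseteq> W \<Longrightarrow> f S \<in> carrier C \<and> g (W - S) \<in> carrier C" "h (U - W) \<in> carrier C"
      using clU by (auto intro!: clU)
    have "finite (Pow W)" using W fin finite_subset by auto
    then have "(\<Oplus>S\<in>Pow W. sgn_mult C (inversions (W - S) S) (f S \<otimes> g (W - S))) \<otimes> h (U - W)
       = (\<Oplus>S\<in>Pow W. sgn_mult C (inversions (W - S) S) (f S \<otimes> g (W - S) \<otimes> h (U - W)))"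
      using clW by (subst finsum_ldistr) (auto intro!: finsum_cong' sgn_mult_closed m_closed)
    then show "sgn_mult C (inversions (U - W) W) ((\<Oplus>S\<in>Pow W. sgn_mult C (inversions (W - S) S)
        (f S \<otimes> g (W - S))) \<otimes> h (U - W)) = (\<Oplus>S\<in>Pow W. sgn_mult C (inversions (U - W) W + inversions (W - S) S)
        (f S \<otimes> g (W - S) \<otimes> h (U - W)))"
      using clW by (simp, subst sgn_mult_finsum) (auto intro!: finsum_cong' sgn_mult_closed m_closed)
  qed (auto intro!: finsum_closed sgn_mult_closed m_closed clU)
  also have "\<dots> = (\<Oplus>p\<in>Sigma (Pow U) Pow. sgn_mult C (inversions (U - fst p) (fst p) + inversions (fst p - snd p) (snd p))
        (f (snd p) \<otimes> g (fst p - snd p) \<otimes> h (U - fst p)))"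
    by (rule finsum_Sigma) (use fin finite_subset in \<open>auto intro!: sgn_mult_closed m_closed clU\<close>)
  also have "\<dots> = (\<Oplus>p\<in>Sigma (Pow U) (\<lambda>S. Pow (U - S)). sgn_mult C (inversions (U - fst p) (fst p) + inversions (U - fst p - snd p) (snd p))
        (f (fst p) \<otimes> (g (snd p) \<otimes> h (U - fst p - snd p))))"
  proof (rule finsum_bij_witness[where j="\<lambda>(W, S). (S, W - S)" and i="\<lambda>(S, T). (S \<union> T, S)"], goal_cases)
    case (5 p)
    then obtain W S where p: "p = (W, S)" "W \<subseteq> U" "S \<subseteq> W" by auto
    have eq: "U - S - (W - S) = U - W" using p by auto
    have f1: "finite W" "finite S" using finite_subset[OF p(2) fin] finite_subset[OF p(3)] by auto
    have "U - S = (U - W) \<union> (W - S)" using p by auto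
    then have "inversions (U - S) S = inversions (U - W) S + inversions (W - S) S"
      using f1 fin by (metis inversions_Un_left Diff_disjoint finite_Diff inf_commute Int_Diff Diff_Int_distrib2 inf.idem Int_empty_right)
    moreover have "inversions (U - W) W = inversions (U - W) S + inversions (U - W) (W - S)"
      using inversions_Un_right[of "U - W" S "W - S"] f1 fin p by (simp add: Un_absorb1)
    moreover have "f S \<in> carrier C" "g (W - S) \<in> carrier C" "h (U - W) \<in> carrier C"
      using p by (auto intro!: clU)
    ultimately show ?case using p eq by (auto simp: m_assoc intro!: sgn_mult_cong)
  qed (use fin finite_subset in \<open>auto intro!: sgn_mult_closed m_closed clU\<close>)
  also have "\<dots> = (\<Oplus>S\<in>Pow U. \<Oplus>T\<in>Pow (U - S). sgn_mult C (inversions (U - S) S + inversions (U - S - T) T)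
        (f S \<otimes> (g T \<otimes> h (U - S - T))))"
    by (rule finsum_Sigma[symmetric]) (use fin finite_subset in \<open>auto intro!: sgn_mult_closed m_closed clU\<close>)
  also have "\<dots> = (\<Oplus>S\<in>Pow U. sgn_mult C (inversions (U - S) S) (f S \<otimes> (\<Oplus>T\<in>Pow (U - S).
       sgn_mult C (inversions (U - S - T) T) (g T \<otimes> h (U - S - T)))))"
  proof (intro finsum_cong' refl)
    fix S assume "S \<in> Pow U"
    then have S: "S \<subseteq> U" and clS: "f S \<in> carrier C"
      "\<And>T. T \<subseteq> U - S \<Longrightarrow> g T \<in> carrier C \<and> h (U - S - T) \<in> carrier C"
      by (auto intro!: clU)
    have "finite (Pow (U - S))" using fin by auto
    then have "f S \<otimes> (\<Oplus>T\<in>Pow (U - S). sgn_mult C (inversions (U - S - T) T) (g T \<otimes> h (U - S - T)))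
       = (\<Oplus>T\<in>Pow (U - S). sgn_mult C (inversions (U - S - T) T) (f S \<otimes> (g T \<otimes> h (U - S - T))))"
      using clS by (subst finsum_rdistr) (auto intro!: finsum_cong' sgn_mult_closed m_closed)
    then show "(\<Oplus>T\<in>Pow (U - S). sgn_mult C (inversions (U - S) S + inversions (U - S - T) T)
        (f S \<otimes> (g T \<otimes> h (U - S - T)))) = sgn_mult C (inversions (U - S) S) (f S \<otimes> (\<Oplus>T\<in>Pow (U - S).
       sgn_mult C (inversions (U - S - T) T) (g T \<otimes> h (U - S - T))))"
      using clS by (simp, subst sgn_mult_finsum) (auto intro!: finsum_cong' sgn_mult_closed m_closed)
  qed (auto intro!: finsum_closed sgn_mult_closed m_closed clU)
  also have "\<dots> = tensor_mult C n 0 f (tensor_mult C n 0 g h) U"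
  proof -
    have "tensor_mult C n 0 g h (U - S) = (\<Oplus>T\<in>Pow (U - S).
       sgn_mult C (inversions (U - S - T) T) (g T \<otimes> h (U - S - T)))" for S
      by (rule tensor_mult_eq[OF g h]) (use U in auto)
    then show ?thesis unfolding tensor_mult_eq[OF f tensor_mult_closed[OF g h] U] by simp
  qed
  finally show "tensor_mult C n 0 (tensor_mult C n 0 f g) h U = tensor_mult C n 0 f (tensor_mult C n 0 g h) U" .
qed (use assms tensor_mult_closed in auto)

text \<open>By the Leibniz rule and the cocycle equations of f and g, the differential attaches one
  new index t to one of the two factors. For t outside U these are the terms of the equation to be
  proved. For t in U the index then occurs in both factors, like a square of e_t, and these terms
  have to disappear.\<close>

lemma tensor_mult_sum_diff:
  assumes f: "f \<in> tensor_carrier C n 0" and g: "g \<in> tensor_carrier C n 0"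
    and cf: "cocycle n f" and cg: "cocycle n g"
  shows "cocycle n (tensor_mult C n 0 f g)"
  unfolding cocycle_def
proof (intro allI impI)
  fix U assume U: "U \<subseteq> {..n}"
  then have fin: "finite U" using finite_subset by blast
  let ?N = "{..n}"
  have clf: "f S \<in> carrier C" "diff C (f S) \<in> carrier C" and clg: "g S \<in> carrier C" "diff C (g S) \<in> carrier C"
    if "S \<subseteq> ?N" for S
    using that by (auto intro!: diff_closed tensor_carrier_closed[OF f] tensor_carrier_closed[OF g])
  have clS: "finite S" "U - S \<subseteq> ?N" "S \<subseteq> ?N" "finite (U - S)" if "S \<subseteq> U" for S
    using that U fin finite_subset by auto
  \<comment> \<open>In \<open>a S t\<close> the index t comes from the differential of
    \<open>f S\<close>, in \<open>b S t\<close> from that of \<open>g (U - S)\<close>; only the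
    latter carries the Leibniz sign card S.\<close>
  define a where "a S t = sgn_mult C (inversions (U - S) S + inversions S {t}) (f (insert t S) \<otimes> g (U - S))" for S t
  define b where "b S t = sgn_mult C (inversions (U - S) S + card S + inversions (U - S) {t})
      (f S \<otimes> g (insert t (U - S)))" for S t
  have acl: "a S t \<in> carrier C" and bcl: "b S t \<in> carrier C" if "S \<subseteq> U" "t \<in> ?N" for S t
    using that clS[OF that(1)] unfolding a_def b_def
    by (auto intro!: sgn_mult_closed m_closed clf clg)
  have 1: "diff C (sgn_mult C (inversions (U - S) S) (f S \<otimes> g (U - S))) =
      (\<Oplus>t\<in>?N - S. a S t) \<oplus> (\<Oplus>t\<in>?N - (U - S). b S t)" if S: "S \<subseteq> U" for S
  proof -
    note S' = clS[OF S]
    have dS: "diff C (f V) = (\<Oplus>t\<in>?N - V. sgn_mult C (inversions V {t}) (f (insert t V)))"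
      and dT: "diff C (g V) = (\<Oplus>t\<in>?N - V. sgn_mult C (inversions V {t}) (g (insert t V)))" if "V \<subseteq> ?N" for V
      using cf cg that unfolding cocycle_def by blast+
    have fS: "f S \<in> hpart C (card S)" using f S' by (intro tensor_carrierD)
    have ins: "insert t S \<subseteq> ?N" "insert t (U - S) \<subseteq> ?N" if "t \<in> ?N" for t using that S' by auto
    have "diff C (f S) \<otimes> g (U - S) = (\<Oplus>t\<in>?N - S. sgn_mult C (inversions S {t}) (f (insert t S) \<otimes> g (U - S)))"
      unfolding dS[OF S'(3)] using S' ins
      by (subst finsum_ldistr) (auto intro!: finsum_cong' clf clg sgn_mult_closed m_closed sgn_mult_l)
    then have A: "sgn_mult C (inversions (U - S) S) (diff C (f S) \<otimes> g (U - S)) = (\<Oplus>t\<in>?N - S. a S t)"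
      using S' ins unfolding a_def
      by (simp, subst sgn_mult_finsum)
        (auto intro!: finsum_cong' clf clg sgn_mult_closed m_closed sgn_mult_sgn_mult)
    have "f S \<otimes> diff C (g (U - S)) = (\<Oplus>t\<in>?N - (U - S). sgn_mult C (inversions (U - S) {t})
        (f S \<otimes> g (insert t (U - S))))"
      unfolding dT[OF S'(2)] using S' ins
      by (subst finsum_rdistr) (auto intro!: finsum_cong' clf clg sgn_mult_closed m_closed sgn_mult_r)
    then have B: "sgn_mult C (inversions (U - S) S + card S) (f S \<otimes> diff C (g (U - S))) = (\<Oplus>t\<in>?N - (U - S). b S t)"
      using S' ins unfolding b_def
      by (simp, subst sgn_mult_finsum)
        (auto intro!: finsum_cong' clf clg sgn_mult_closed m_closed sgn_mult_sgn_mult)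
    have "diff C (f S \<otimes> g (U - S)) = diff C (f S) \<otimes> g (U - S) \<oplus> sgn_mult C (card S) (f S \<otimes> diff C (g (U - S)))"
      using S' by (intro diff_mult fS clg)
    then show ?thesis unfolding A[symmetric] B[symmetric] using S'
      by (simp add: diff_sgn sgn_mult_add clf clg)
  qed
  have 2: "(\<Oplus>t\<in>?N - S. a S t) = (\<Oplus>t\<in>?N - U. a S t) \<oplus> (\<Oplus>t\<in>U - S. a S t)" if S: "S \<subseteq> U" for S
  proof -
    have "?N - S = (?N - U) \<union> (U - S)" using S U by auto
    then show ?thesis using S acl U fin by (simp, intro finsum_Un_disjoint) auto
  qed
  have 3: "(\<Oplus>t\<in>?N - (U - S). b S t) = (\<Oplus>t\<in>?N - U. b S t) \<oplus> (\<Oplus>t\<in>S. b S t)" if S: "S \<subseteq> U" for S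
  proof -
    have "?N - (U - S) = (?N - U) \<union> S" using S U by auto
    then show ?thesis using S bcl U clS[OF S] by (simp, intro finsum_Un_disjoint) auto
  qed
  have bcl': "b S t \<in> carrier C" if "S \<subseteq> U" "t \<in> S" for S t
    using that U by (intro bcl) auto
  have cls: "(\<Oplus>t\<in>?N - U. a S t) \<in> carrier C" "(\<Oplus>t\<in>U - S. a S t) \<in> carrier C"
     "(\<Oplus>t\<in>?N - U. b S t) \<in> carrier C" "(\<Oplus>t\<in>S. b S t) \<in> carrier C" if "S \<subseteq> U" for S
    using acl bcl that U by (auto intro!: finsum_closed)
  have finP: "finite (Pow U)" using fin by simp
  text \<open>The terms in which the differential hits an index of the complementary factor cancel in pairs.\<close>
  have 4: "(\<Oplus>S\<in>Pow U. \<Oplus>t\<in>U - S. a S t) = \<ominus> (\<Oplus>S\<in>Pow U. \<Oplus>t\<in>S. b S t)"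
  proof -
    have "(\<Oplus>S\<in>Pow U. \<Oplus>t\<in>U - S. a S t) = (\<Oplus>p\<in>Sigma (Pow U) (\<lambda>S. U - S). a (fst p) (snd p))"
      using fin acl U by (intro finsum_Sigma) auto
    also have "\<dots> = (\<Oplus>p\<in>Sigma (Pow U) (\<lambda>S. S). \<ominus> b (fst p) (snd p))"
    proof (rule finsum_bij_witness[where j="\<lambda>(S, t). (insert t S, t)" and i="\<lambda>(S, t). (S - {t}, t)"], goal_cases)
      case (5 p)
      then obtain S t where p: "p = (S, t)" "S \<subseteq> U" "t \<in> U" "t \<notin> S" by auto
      define T where "T = U - insert t S"
      note S' = clS[OF p(2)]
      have eq: "U - S = insert t T" "t \<notin> T" "finite T" "t \<notin> S" "finite S" using p fin S' by (auto simp: T_def)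
      \<comment> \<open>The comparisons of t with S contribute card S, whereas the Leibniz sign of
        the partner term contributes card (insert t S); the difference of one makes the two terms
        opposite.\<close>
      have "even (inversions {t} S + inversions S {t}) \<longleftrightarrow> even (card S)"
        using inversions_commute[of "{t}" S] eq by simp
      then have "even (inversions (U - S) S + inversions S {t}) \<longleftrightarrow>
          even (Suc (inversions T (insert t S) + card (insert t S) + inversions T {t}))"
        using eq by (simp add: inversions_insert_left[of T] inversions_insert_right[of T S]) argo
      then have "a S t = sgn_mult C (Suc (inversions T (insert t S) + card (insert t S) + inversions T {t}))
          (f (insert t S) \<otimes> g (insert t T))"
        unfolding a_def eq(1) by (intro sgn_mult_cong) (auto simp: eq)
      also have "\<dots> = \<ominus> b (insert t S) t"
        unfolding b_def T_def[symmetric] using p U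
        by (intro sgn_mult_Suc m_closed clf clg) (auto simp: T_def)
      finally show ?case using p by simp
    next
      case (6 p)
      then show ?case using bcl' by auto
    qed auto
    also have "\<dots> = \<ominus> (\<Oplus>p\<in>Sigma (Pow U) (\<lambda>S. S). b (fst p) (snd p))"
      using bcl' by (intro finsum_a_inv) auto
    also have "(\<Oplus>p\<in>Sigma (Pow U) (\<lambda>S. S). b (fst p) (snd p)) = (\<Oplus>S\<in>Pow U. \<Oplus>t\<in>S. b S t)"
      using fin bcl' clS(1) by (intro finsum_Sigma[symmetric]) auto
    finally show ?thesis .
  qed
  have "diff C (tensor_mult C n 0 f g U) =
      (\<Oplus>S\<in>Pow U. diff C (sgn_mult C (inversions (U - S) S) (f S \<otimes> g (U - S))))"
    unfolding tensor_mult_eq[OF f g U] using clS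
    by (intro diff_finsum sgn_mult_closed m_closed) (auto intro!: clf clg)
  also have "\<dots> = (\<Oplus>S\<in>Pow U. ((\<Oplus>t\<in>?N - U. a S t) \<oplus> (\<Oplus>t\<in>?N - U. b S t)) \<oplus>
      ((\<Oplus>t\<in>U - S. a S t) \<oplus> (\<Oplus>t\<in>S. b S t)))"
    using cls by (intro finsum_cong' refl) (auto simp: 1 2 3 a_ac)
  also have "\<dots> = (\<Oplus>S\<in>Pow U. (\<Oplus>t\<in>?N - U. a S t) \<oplus> (\<Oplus>t\<in>?N - U. b S t)) \<oplus>
      ((\<Oplus>S\<in>Pow U. \<Oplus>t\<in>U - S. a S t) \<oplus> (\<Oplus>S\<in>Pow U. \<Oplus>t\<in>S. b S t))"
    using cls by (simp add: finsum_addf Pi_def)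
  also have "\<dots> = (\<Oplus>S\<in>Pow U. (\<Oplus>t\<in>?N - U. a S t) \<oplus> (\<Oplus>t\<in>?N - U. b S t))"
    unfolding 4 using cls by (simp add: l_neg Pi_def finsum_closed)
  also have "\<dots> = (\<Oplus>S\<in>Pow U. \<Oplus>t\<in>?N - U. a S t \<oplus> b S t)"
    using acl bcl by (intro finsum_cong' refl) (auto simp: finsum_addf Pi_def intro!: finsum_closed)
  also have "\<dots> = (\<Oplus>p\<in>Pow U \<times> (?N - U). a (fst p) (snd p) \<oplus> b (fst p) (snd p))"
    using fin acl bcl by (intro finsum_Sigma) auto
  also have "\<dots> = (\<Oplus>p\<in>(?N - U) \<times> Pow U. a (snd p) (fst p) \<oplus> b (snd p) (fst p))"
    by (rule finsum_bij_witness[where i=prod.swap and j=prod.swap]) (use acl bcl in auto)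
  also have "\<dots> = (\<Oplus>t\<in>?N - U. \<Oplus>S\<in>Pow U. a S t \<oplus> b S t)"
    using fin acl bcl by (intro finsum_Sigma[symmetric]) auto
  \<comment> \<open>The product at \<open>insert t U\<close> is split by the factor that receives t:
    subsets of U give the \<open>b\<close>-terms, subsets containing t the
    \<open>a\<close>-terms.\<close>
  also have "\<dots> = (\<Oplus>t\<in>?N - U. sgn_mult C (inversions U {t}) (tensor_mult C n 0 f g (insert t U)))"
  proof (intro finsum_cong' refl)
    fix t assume t: "t \<in> ?N - U"
    then have t': "t \<notin> U" "insert t U \<subseteq> ?N" using U by auto
    have cl: "sgn_mult C k (f S \<otimes> g (insert t U - S)) \<in> carrier C" if "S \<subseteq> insert t U" for S k
      using that t' by (intro sgn_mult_closed m_closed clf clg) auto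
    have "sgn_mult C (inversions U {t}) (tensor_mult C n 0 f g (insert t U)) =
      (\<Oplus>S\<in>Pow (insert t U). sgn_mult C (inversions U {t} + inversions (insert t U - S) S) (f S \<otimes> g (insert t U - S)))"
      unfolding tensor_mult_eq[OF f g t'(2)] using cl[where k=0] cl
      by (subst sgn_mult_finsum) (auto intro!: finsum_cong')
    also have "\<dots> = (\<Oplus>S\<in>Pow U. sgn_mult C (inversions U {t} + inversions (insert t U - S) S) (f S \<otimes> g (insert t U - S))) \<oplus>
       (\<Oplus>S\<in>Pow U. sgn_mult C (inversions U {t} + inversions (insert t U - insert t S) (insert t S)) (f (insert t S) \<otimes> g (insert t U - insert t S)))"
      by (rule finsum_Pow_insert) (use fin t' cl in auto)
    also have "(\<Oplus>S\<in>Pow U. sgn_mult C (inversions U {t} + inversions (insert t U - S) S) (f S \<otimes> g (insert t U - S))) = (\<Oplus>S\<in>Pow U. b S t)"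
    proof (intro finsum_cong' refl)
      fix S assume "S \<in> Pow U"
      then have S: "S \<subseteq> U" by simp
      note S' = clS[OF S]
      have eq: "insert t U - S = insert t (U - S)" "t \<notin> S" using S t' by auto
      have U': "inversions U {t} = inversions S {t} + inversions (U - S) {t}"
        using inversions_Un_left[of S "U - S" "{t}"] S' S by (simp add: Un_absorb1)
      have "even (inversions {t} S + inversions S {t}) \<longleftrightarrow> even (card S)"
        using inversions_commute[of "{t}" S] eq S' by simp
      then show "sgn_mult C (inversions U {t} + inversions (insert t U - S) S) (f S \<otimes> g (insert t U - S)) = b S t"
        unfolding b_def eq U' using S' t'
        by (intro sgn_mult_cong refl) (simp add: inversions_insert_left[of "U - S"], argo)
    qed (use bcl t in auto)
    also have "(\<Oplus>S\<in>Pow U. sgn_mult C (inversions U {t} + inversions (insert t U - insert t S) (insert t S)) (f (insert t S) \<otimes> g (insert t U - insert t S))) = (\<Oplus>S\<in>Pow U. a S t)"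
    proof (intro finsum_cong' refl)
      fix S assume "S \<in> Pow U"
      then have S: "S \<subseteq> U" by simp
      note S' = clS[OF S]
      have eq: "insert t U - insert t S = U - S" "t \<notin> S" using S t' by auto
      have U': "inversions U {t} = inversions S {t} + inversions (U - S) {t}"
        using inversions_Un_left[of S "U - S" "{t}"] S' S by (simp add: Un_absorb1)
      show "sgn_mult C (inversions U {t} + inversions (insert t U - insert t S) (insert t S)) (f (insert t S) \<otimes> g (insert t U - insert t S)) = a S t"
        unfolding a_def eq U' using S' t' eq
        by (intro sgn_mult_cong refl) (simp add: inversions_insert_right[of "U - S" S], argo)
    qed (use acl t in auto)
    also have "(\<Oplus>S\<in>Pow U. b S t) \<oplus> (\<Oplus>S\<in>Pow U. a S t) = (\<Oplus>S\<in>Pow U. a S t \<oplus> b S t)"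
      using acl bcl t by (subst finsum_addf) (auto intro!: finsum_closed a_comm)
    finally show "(\<Oplus>S\<in>Pow U. a S t \<oplus> b S t) = sgn_mult C (inversions U {t}) (tensor_mult C n 0 f g (insert t U))" by simp
  next
    show "(\<lambda>t. sgn_mult C (inversions U {t}) (tensor_mult C n 0 f g (insert t U))) \<in> ?N - U \<rightarrow> carrier C"
      using U tensor_carrier_closed[OF tensor_mult_closed[OF f g]] by auto
  qed
  finally show "diff C (tensor_mult C n 0 f g U) =
    (\<Oplus>t\<in>?N - U. sgn_mult C (inversions U {t}) (tensor_mult C n 0 f g (insert t U)))" .
qed

lemma diff_one: "diff C \<one> = \<zero>"
proof -
  have "diff C (\<one> \<otimes> \<one>) = diff C \<one> \<otimes> \<one> \<oplus> sgn_mult C 0 (\<one> \<otimes> diff C \<one>)"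
    by (rule diff_mult) auto
  then show ?thesis by simp
qed

lemma cocycle_one: "cocycle n (\<lambda>S\<in>Pow {..n}. if S = {} then \<one> else \<zero>)"
proof -
  note diff_one
  moreover have "(\<Oplus>t\<in>{..n} - S. sgn_mult C (inversions S {t})
      ((\<lambda>S\<in>Pow {..n}. if S = {} then \<one> else \<zero>) (insert t S))) = \<zero>" if "S \<subseteq> {..n}" for S
    using that by (intro add.finprod_one_eqI) auto
  ultimately show ?thesis unfolding cocycle_def by simp
qed

lemma tensor_one_mult:
  assumes f: "f \<in> tensor_carrier C n 0"
  shows "tensor_mult C n 0 (\<lambda>S\<in>Pow {..n}. if S = {} then \<one> else \<zero>) f = f"
proof (rule tensor_eqI[of _ n])
  let ?one = "\<lambda>S\<in>Pow {..n}. if S = {} then \<one> else \<zero>"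
  have one: "?one \<in> tensor_carrier C n 0" by (rule tensor_carrierI) auto
  show "tensor_mult C n 0 ?one f \<in> tensor_carrier C n 0" by (rule tensor_mult_closed[OF one f])
  fix U assume U: "U \<subseteq> {..n}"
  then have "finite U" using finite_subset by blast
  have "tensor_mult C n 0 ?one f U = (\<Oplus>S\<in>Pow U. if {} = S then f U else \<zero>)"
    unfolding tensor_mult_eq[OF one f U]
  proof (intro finsum_cong' refl)
    fix S assume "S \<in> Pow U"
    then have "S \<subseteq> {..n}" "U - S \<subseteq> {..n}" using U by auto
    then show "sgn_mult C (inversions (U - S) S) (?one S \<otimes> f (U - S)) = (if {} = S then f U else \<zero>)"
      using tensor_carrier_closed[OF f, of "U - S"] tensor_carrier_closed[OF f U] by simp
  qed (use tensor_carrier_closed[OF f U] in auto)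
  also have "\<dots> = f U"
    using \<open>finite U\<close> tensor_carrier_closed[OF f U] by (intro finsum_singleton[of "{}" "Pow U" "\<lambda>_. f U"]) auto
  finally show "tensor_mult C n 0 ?one f U = f U" .
qed (rule f)

lemma tensor_add_mult:
  assumes f: "f \<in> tensor_carrier C n 0" and g: "g \<in> tensor_carrier C n 0" and h: "h \<in> tensor_carrier C n 0"
  shows "tensor_mult C n 0 (\<lambda>S\<in>Pow {..n}. f S \<oplus> g S) h =
    (\<lambda>S\<in>Pow {..n}. tensor_mult C n 0 f h S \<oplus> tensor_mult C n 0 g h S)"
proof -
  let ?s = "\<lambda>S\<in>Pow {..n}. f S \<oplus> g S"
  have s: "?s \<in> tensor_carrier C n 0"
    by (intro tensor_carrierI) (auto intro!: hpart_add tensor_carrierD[OF f] tensor_carrierD[OF g])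
  show ?thesis
  proof (rule tensor_eqI[of _ n])
    show "(\<lambda>S\<in>Pow {..n}. tensor_mult C n 0 f h S \<oplus> tensor_mult C n 0 g h S) \<in> tensor_carrier C n 0"
      by (intro tensor_carrierI) (auto intro!: hpart_add tensor_carrierD[OF tensor_mult_closed[OF f h]]
          tensor_carrierD[OF tensor_mult_closed[OF g h]])
    show "tensor_mult C n 0 ?s h \<in> tensor_carrier C n 0" by (rule tensor_mult_closed[OF s h])
    fix U assume U: "U \<subseteq> {..n}"
    have cl: "f S \<in> carrier C" "g S \<in> carrier C" "h S \<in> carrier C" if "S \<subseteq> U" for S
      using that U by (auto intro!: tensor_carrier_closed[OF f] tensor_carrier_closed[OF g] tensor_carrier_closed[OF h])
    show "tensor_mult C n 0 ?s h U = (\<lambda>S\<in>Pow {..n}. tensor_mult C n 0 f h S \<oplus> tensor_mult C n 0 g h S) U"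
    proof -
      have "tensor_mult C n 0 ?s h U = (\<Oplus>S\<in>Pow U. sgn_mult C (inversions (U - S) S) (f S \<otimes> h (U - S)) \<oplus>
          sgn_mult C (inversions (U - S) S) (g S \<otimes> h (U - S)))"
        unfolding tensor_mult_eq[OF s h U] using U
        by (intro finsum_cong' refl) (auto simp: l_distr cl sgn_mult_add subset_trans intro!: sgn_mult_closed m_closed cl)
      also have "\<dots> = tensor_mult C n 0 f h U \<oplus> tensor_mult C n 0 g h U"
        unfolding tensor_mult_eq[OF f h U] tensor_mult_eq[OF g h U]
        by (rule finsum_addf) (auto intro!: sgn_mult_closed m_closed cl)
      finally show ?thesis using U by simp
    qed
  qed
qed

lemma tensor_smult_mult:
  assumes f: "f \<in> tensor_carrier C n 0" and g: "g \<in> tensor_carrier C n 0" and r: "r \<in> carrier R"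
  shows "tensor_mult C n 0 (\<lambda>S\<in>Pow {..n}. r \<odot> f S) g = (\<lambda>S\<in>Pow {..n}. r \<odot> tensor_mult C n 0 f g S)"
proof -
  let ?s = "\<lambda>S\<in>Pow {..n}. r \<odot> f S"
  have s: "?s \<in> tensor_carrier C n 0"
    using r by (intro tensor_carrierI) (auto intro!: hpart_smult tensor_carrierD[OF f])
  show ?thesis
  proof (rule tensor_eqI[of _ n])
    show "(\<lambda>S\<in>Pow {..n}. r \<odot> tensor_mult C n 0 f g S) \<in> tensor_carrier C n 0"
      using r by (intro tensor_carrierI) (auto intro!: hpart_smult tensor_carrierD[OF tensor_mult_closed[OF f g]])
    show "tensor_mult C n 0 ?s g \<in> tensor_carrier C n 0" by (rule tensor_mult_closed[OF s g])
    fix U assume U: "U \<subseteq> {..n}"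
    have cl: "f S \<in> carrier C" "g S \<in> carrier C" if "S \<subseteq> U" for S
      using that U by (auto intro!: tensor_carrier_closed[OF f] tensor_carrier_closed[OF g])
    have sg: "sgn_mult C k (r \<odot> x) = r \<odot> sgn_mult C k x" if "x \<in> carrier C" for k x
      using that r by (simp add: sgn_mult_def M.smult_r_minus)
    have "r \<odot> tensor_mult C n 0 f g U =
        (\<Oplus>S\<in>Pow U. r \<odot> sgn_mult C (inversions (U - S) S) (f S \<otimes> g (U - S)))"
      unfolding tensor_mult_eq[OF f g U] using r
      by (intro additive_finsum[OF abelian_monoid_axioms, of "\<lambda>x. r \<odot> x"])
        (auto intro!: sgn_mult_closed m_closed cl simp: M.smult_r_distr)
    also have "\<dots> = tensor_mult C n 0 ?s g U"
      unfolding tensor_mult_eq[OF s g U] using U r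
      by (intro finsum_cong' refl) (auto simp: smult_mult cl sg intro!: sgn_mult_closed m_closed cl)
    finally show "tensor_mult C n 0 ?s g U = (\<lambda>S\<in>Pow {..n}. r \<odot> tensor_mult C n 0 f g S) U"
      using U by simp
  qed
qed

end

section \<open>Structure maps of the cosimplicial algebra\<close>

context cdga
begin

text \<open>The index sets S for which \<alpha> sends e_S to e_T. A set on which \<alpha> is not
  injective lies in no fibre, since its e_S is sent to 0.\<close>

definition fib :: "nat \<Rightarrow> (nat \<Rightarrow> nat) \<Rightarrow> nat set \<Rightarrow> nat set set"
  where "fib m \<alpha> T = {S \<in> Pow {..m}. inj_on \<alpha> S \<and> \<alpha> ` S = T}"

definition push :: "nat \<Rightarrow> nat \<Rightarrow> (nat \<Rightarrow> nat) \<Rightarrow> (nat set \<Rightarrow> 'c) \<Rightarrow> nat set \<Rightarrow> 'c"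
  where "push m n \<alpha> f = (\<lambda>T\<in>Pow {..n}. \<Oplus>S\<in>fib m \<alpha> T. f S)"

lemma cmap_K_alg: "cmap (K_alg C) m n \<alpha> = push m n \<alpha>"
  by (simp add: K_alg_def push_def fib_def fun_eq_iff)

lemma level_K_alg: "level (K_alg C) = K_level C"
  by (simp add: K_alg_def)

lemma fibD: "S \<in> fib m \<alpha> T \<Longrightarrow> S \<subseteq> {..m} \<and> inj_on \<alpha> S \<and> \<alpha> ` S = T \<and> finite S \<and> card S = card T"
  unfolding fib_def by (auto simp: card_image finite_subset)

lemma fibI: "S \<subseteq> {..m} \<Longrightarrow> inj_on \<alpha> S \<Longrightarrow> \<alpha> ` S = T \<Longrightarrow> S \<in> fib m \<alpha> T"
  unfolding fib_def by simp

lemma finite_fib [simp]: "finite (fib m \<alpha> T)"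
  unfolding fib_def by simp

lemma fib_empty [simp]: "fib m \<alpha> {} = {{}}"
  unfolding fib_def by auto

lemma push_eq: "T \<subseteq> {..n} \<Longrightarrow> push m n \<alpha> f T = (\<Oplus>S\<in>fib m \<alpha> T. f S)"
  by (simp add: push_def)

lemma push_closed:
  assumes f: "f \<in> tensor_carrier C m 0"
  shows "push m n \<alpha> f \<in> tensor_carrier C n 0"
proof (rule tensor_carrierI)
  fix T assume "T \<subseteq> {..n}"
  then show "push m n \<alpha> f T \<in> hpart C (card T)"
    unfolding push_def using tensor_carrierD[OF f] fibD by (auto intro!: hpart_finsum) metis
qed (simp add: push_def)

lemma fib_sum_closed: "f \<in> tensor_carrier C m 0 \<Longrightarrow> (\<Oplus>S\<in>fib m \<alpha> T. f S) \<in> carrier C"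
  by (intro finsum_closed Pi_I tensor_carrier_closed[of f m]) (auto simp: fib_def)

lemma push_id:
  assumes f: "f \<in> tensor_carrier C n 0"
  shows "push n n (\<lambda>i\<in>{..n}. i) f = f"
proof (rule tensor_eqI[OF push_closed[OF f] f])
  fix T assume T: "T \<subseteq> {..n}"
  have "fib n (\<lambda>i\<in>{..n}. i) T = {T}"
    using T by (auto simp: fib_def inj_on_def subset_iff image_iff)
  then show "push n n (\<lambda>i\<in>{..n}. i) f T = f T"
    using T tensor_carrier_closed[OF f T] by (simp add: push_eq)
qed

text \<open>The composite is injective on S exactly if \<alpha> is injective on S and \<beta> on the
  image. A fibre of the composite is thus the disjoint union of the fibres of \<alpha> over the
  members of a fibre of \<beta>.\<close>

lemma push_compose:
  assumes f: "f \<in> tensor_carrier C l 0" and \<alpha>: "\<alpha> \<in> Delta l m" and \<beta>: "\<beta> \<in> Delta m n"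
  shows "push l n (compose {..l} \<beta> \<alpha>) f = push m n \<beta> (push l m \<alpha> f)"
proof (rule tensor_eqI[OF push_closed[OF f] push_closed[OF push_closed[OF f]]])
  fix V assume V: "V \<subseteq> {..n}"
  have am: "\<alpha> i \<le> m" if "i \<le> l" for i using \<alpha> that by (auto simp: Delta_def PiE_def Pi_def)
  have cp: "compose {..l} \<beta> \<alpha> ` S = \<beta> ` \<alpha> ` S"
    "inj_on (compose {..l} \<beta> \<alpha>) S \<longleftrightarrow> inj_on \<alpha> S \<and> inj_on \<beta> (\<alpha> ` S)" if "S \<subseteq> {..l}" for S
  proof -
    have e: "compose {..l} \<beta> \<alpha> i = (\<beta> \<circ> \<alpha>) i" if "i \<in> S" for i
      using that \<open>S \<subseteq> {..l}\<close> by (auto simp: compose_def)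
    show "compose {..l} \<beta> \<alpha> ` S = \<beta> ` \<alpha> ` S" using e by (simp add: image_comp cong: image_cong)
    have "inj_on (compose {..l} \<beta> \<alpha>) S \<longleftrightarrow> inj_on (\<beta> \<circ> \<alpha>) S" using e by (rule inj_on_cong)
    also have "\<dots> \<longleftrightarrow> inj_on \<alpha> S \<and> inj_on \<beta> (\<alpha> ` S)" using comp_inj_on_iff inj_on_imageI2 comp_inj_on inj_on_imageI by metis
    finally show "inj_on (compose {..l} \<beta> \<alpha>) S \<longleftrightarrow> inj_on \<alpha> S \<and> inj_on \<beta> (\<alpha> ` S)" .
  qed
  have "push m n \<beta> (push l m \<alpha> f) V = (\<Oplus>T\<in>fib m \<beta> V. \<Oplus>S\<in>fib l \<alpha> T. f S)"
    unfolding push_eq[OF V]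
    by (intro finsum_cong' refl) (auto simp: push_eq dest: fibD intro!: fib_sum_closed f)
  also have "\<dots> = (\<Oplus>p\<in>Sigma (fib m \<beta> V) (fib l \<alpha>). f (snd p))"
    by (rule finsum_Sigma) (auto intro!: tensor_carrier_closed[OF f] dest: fibD)
  also have "\<dots> = (\<Oplus>S\<in>fib l (compose {..l} \<beta> \<alpha>) V. f S)"
  proof (rule finsum_bij_witness[where i="\<lambda>S. (\<alpha> ` S, S)" and j=snd], goal_cases)
    case (2 p)
    then obtain T S where p: "p = (T, S)" "T \<in> fib m \<beta> V" "S \<in> fib l \<alpha> T" by auto
    note S = fibD[OF p(3)] and T = fibD[OF p(2)]
    show ?case unfolding p snd_conv using S T cp[of S] by (intro fibI) auto
  next
    case (4 S)
    then have S: "S \<subseteq> {..l}" by (simp add: fib_def)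
    then show ?case using 4 cp[OF S] am by (auto dest!: fibD intro!: fibI)
  next
    case (6 S)
    then show ?case using tensor_carrier_closed[OF f] by (auto dest: fibD)
  qed (auto dest: fibD)
  finally show "push l n (compose {..l} \<beta> \<alpha>) f V = push m n \<beta> (push l m \<alpha> f) V"
    by (simp add: push_eq[OF V])
qed

lemma push_one:
  "push m n \<alpha> (\<lambda>S\<in>Pow {..m}. if S = {} then \<one> else \<zero>) = (\<lambda>S\<in>Pow {..n}. if S = {} then \<one> else \<zero>)"
proof -
  have "(\<Oplus>S\<in>fib m \<alpha> T. (\<lambda>S\<in>Pow {..m}. if S = {} then \<one> else \<zero>) S) = \<zero>" if "T \<noteq> {}" for T
    using that by (intro add.finprod_one_eqI) (auto dest: fibD)
  moreover have "(\<Oplus>S\<in>fib m \<alpha> {}. (\<lambda>S\<in>Pow {..m}. if S = {} then \<one> else \<zero>) S) = \<one>" by simp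
  ultimately show ?thesis unfolding push_def by (intro restrict_ext) (simp del: restrict_apply fib_empty)
qed

lemma push_add:
  assumes f: "f \<in> tensor_carrier C m 0" and g: "g \<in> tensor_carrier C m 0"
  shows "push m n \<alpha> (\<lambda>S\<in>Pow {..m}. f S \<oplus> g S) = (\<lambda>S\<in>Pow {..n}. push m n \<alpha> f S \<oplus> push m n \<alpha> g S)"
proof -
  have cl: "f S \<in> carrier C" "g S \<in> carrier C" if "S \<in> fib m \<alpha> T" for S T
    using fibD[OF that] tensor_carrier_closed[OF f] tensor_carrier_closed[OF g] by auto
  have "(\<Oplus>S\<in>fib m \<alpha> T. (\<lambda>S\<in>Pow {..m}. f S \<oplus> g S) S) = (\<Oplus>S\<in>fib m \<alpha> T. f S) \<oplus> (\<Oplus>S\<in>fib m \<alpha> T. g S)" for T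
  proof -
    have "(\<Oplus>S\<in>fib m \<alpha> T. (\<lambda>S\<in>Pow {..m}. f S \<oplus> g S) S) = (\<Oplus>S\<in>fib m \<alpha> T. f S \<oplus> g S)"
      by (intro finsum_cong' refl) (use cl in \<open>auto dest: fibD\<close>)
    also have "\<dots> = (\<Oplus>S\<in>fib m \<alpha> T. f S) \<oplus> (\<Oplus>S\<in>fib m \<alpha> T. g S)"
      by (rule finsum_addf) (use cl in auto)
    finally show ?thesis .
  qed
  then show ?thesis unfolding push_def by (intro restrict_ext) (simp del: restrict_apply add: restrict_apply[of _ "Pow {..n}"])
qed

lemma push_smult:
  assumes f: "f \<in> tensor_carrier C m 0" and r: "r \<in> carrier R"
  shows "push m n \<alpha> (\<lambda>S\<in>Pow {..m}. r \<odot> f S) = (\<lambda>S\<in>Pow {..n}. r \<odot> push m n \<alpha> f S)"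
proof -
  have cl: "f S \<in> carrier C" if "S \<in> fib m \<alpha> T" for S T
    using fibD[OF that] tensor_carrier_closed[OF f] by auto
  have "(\<Oplus>S\<in>fib m \<alpha> T. (\<lambda>S\<in>Pow {..m}. r \<odot> f S) S) = r \<odot> (\<Oplus>S\<in>fib m \<alpha> T. f S)" for T
  proof -
    have "(\<Oplus>S\<in>fib m \<alpha> T. (\<lambda>S\<in>Pow {..m}. r \<odot> f S) S) = (\<Oplus>S\<in>fib m \<alpha> T. r \<odot> f S)"
      by (intro finsum_cong' refl) (use cl r in \<open>auto dest: fibD\<close>)
    also have "\<dots> = r \<odot> (\<Oplus>S\<in>fib m \<alpha> T. f S)"
      using r by (intro additive_finsum[OF abelian_monoid_axioms, of "\<lambda>x. r \<odot> x", symmetric])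
        (auto simp: M.smult_r_distr intro: cl)
    finally show ?thesis .
  qed
  then show ?thesis unfolding push_def by (intro restrict_ext) (simp del: restrict_apply add: restrict_apply[of _ "Pow {..n}"])
qed

text \<open>A splitting of a set in the fibre over V is the same as a splitting of V together with a
  set in the fibre over each part: the union of two such sets is mapped injectively because their
  images are disjoint. The signs agree since \<alpha> preserves inversions inside a set on which it
  is injective.\<close>

lemma push_mult:
  assumes f: "f \<in> tensor_carrier C m 0" and g: "g \<in> tensor_carrier C m 0" and \<alpha>: "\<alpha> \<in> Delta m n"
  shows "push m n \<alpha> (tensor_mult C m 0 f g) = tensor_mult C n 0 (push m n \<alpha> f) (push m n \<alpha> g)"
proof (rule tensor_eqI[OF push_closed[OF tensor_mult_closed[OF f g]] tensor_mult_closed[OF push_closed[OF f] push_closed[OF g]]])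
  fix V assume V: "V \<subseteq> {..n}"
  then have finV: "finite V" using finite_subset by blast
  have mono: "mono_on {..m} \<alpha>" using \<alpha> by (simp add: Delta_def)
  note clf = tensor_carrier_closed[OF f] and clg = tensor_carrier_closed[OF g]
  have "push m n \<alpha> (tensor_mult C m 0 f g) V = (\<Oplus>U\<in>fib m \<alpha> V. \<Oplus>S\<in>Pow U. sgn_mult C (inversions (U - S) S) (f S \<otimes> g (U - S)))"
    unfolding push_eq[OF V]
    by (intro finsum_cong' refl) (auto dest!: fibD simp: tensor_mult_eq[OF f g] intro!: finsum_closed sgn_mult_closed m_closed clf clg)
  also have "\<dots> = (\<Oplus>p\<in>Sigma (fib m \<alpha> V) Pow. sgn_mult C (inversions (fst p - snd p) (snd p)) (f (snd p) \<otimes> g (fst p - snd p)))"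
    by (rule finsum_Sigma) (auto dest!: fibD intro!: sgn_mult_closed m_closed clf clg)
  also have "\<dots> = (\<Oplus>p\<in>Sigma (Pow V) (\<lambda>S. fib m \<alpha> S \<times> fib m \<alpha> (V - S)).
      sgn_mult C (inversions (V - fst p) (fst p)) (f (fst (snd p)) \<otimes> g (snd (snd p))))"
  proof (rule finsum_bij_witness[where j="\<lambda>(U, S). (\<alpha> ` S, S, U - S)" and i="\<lambda>(_, S, T). (S \<union> T, S)"], goal_cases)
    case (1 p)
    then show ?case by auto
  next
    case (2 p)
    then obtain U S where p: "p = (U, S)" "U \<in> fib m \<alpha> V" "S \<subseteq> U" by auto
    note U = fibD[OF p(2)]
    have "V - \<alpha> ` S = \<alpha> ` (U - S)" using U p(3) by (auto simp: inj_on_image_set_diff[of \<alpha> U])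
    then show ?case using U p by (auto intro!: fibI intro: inj_on_subset)
  next
    case (3 p)
    then obtain S' S T where p: "p = (S', S, T)" "S' \<subseteq> V" "S \<in> fib m \<alpha> S'" "T \<in> fib m \<alpha> (V - S')" by auto
    have "\<alpha> ` S = S'" "\<alpha> ` T \<inter> S' = {}" using fibD[OF p(3)] fibD[OF p(4)] by auto
    then have "S \<union> T - S = T" by auto
    then show ?case using p fibD[OF p(3)] by simp
  next
    case (4 p)
    then obtain S' S T where p: "p = (S', S, T)" "S' \<subseteq> V" "S \<in> fib m \<alpha> S'" "T \<in> fib m \<alpha> (V - S')" by auto
    note S = fibD[OF p(3)] and T = fibD[OF p(4)]
    have "inj_on \<alpha> (S \<union> T)" using S T by (auto simp: inj_on_Un)
    moreover have "\<alpha> ` (S \<union> T) = V" using S T p(2) by (auto simp: image_Un)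
    ultimately show ?case using p S T by (auto intro!: fibI)
  next
    case (5 p)
    then obtain U S where p: "p = (U, S)" "U \<in> fib m \<alpha> V" "S \<subseteq> U" by auto
    note U = fibD[OF p(2)]
    have "V - \<alpha> ` S = \<alpha> ` (U - S)" using U p(3) by (auto simp: inj_on_image_set_diff[of \<alpha> U])
    moreover have "inversions (\<alpha> ` (U - S)) (\<alpha> ` S) = inversions (U - S) S"
      by (rule inversions_image[OF mono]) (use U p(3) in \<open>auto intro: inj_on_subset\<close>)
    ultimately show ?case using p by simp
  next
    case (6 p)
    then show ?case by (auto dest!: fibD intro!: sgn_mult_closed m_closed clf clg)
  qed
  also have "\<dots> = (\<Oplus>S\<in>Pow V. \<Oplus>p\<in>fib m \<alpha> S \<times> fib m \<alpha> (V - S). sgn_mult C (inversions (V - S) S) (f (fst p) \<otimes> g (snd p)))"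
    by (rule finsum_Sigma[symmetric]) (use finV in \<open>auto dest!: fibD intro!: sgn_mult_closed m_closed clf clg\<close>)
  also have "\<dots> = (\<Oplus>S\<in>Pow V. sgn_mult C (inversions (V - S) S) (push m n \<alpha> f S \<otimes> push m n \<alpha> g (V - S)))"
  proof (intro finsum_cong' refl)
    fix S assume "S \<in> Pow V"
    then have S: "S \<subseteq> {..n}" "V - S \<subseteq> {..n}" using V by auto
    have clF: "f X \<in> carrier C" if "X \<in> fib m \<alpha> S" for X using fibD[OF that] clf by auto
    have clG: "g X \<in> carrier C" if "X \<in> fib m \<alpha> (V - S)" for X using fibD[OF that] clg by auto
    have "(\<Oplus>p\<in>fib m \<alpha> S \<times> fib m \<alpha> (V - S). sgn_mult C (inversions (V - S) S) (f (fst p) \<otimes> g (snd p)))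
       = sgn_mult C (inversions (V - S) S) (\<Oplus>p\<in>fib m \<alpha> S \<times> fib m \<alpha> (V - S). f (fst p) \<otimes> g (snd p))"
      by (rule sgn_mult_finsum[symmetric]) (auto intro!: m_closed clF clG)
    also have "(\<Oplus>p\<in>fib m \<alpha> S \<times> fib m \<alpha> (V - S). f (fst p) \<otimes> g (snd p))
       = (\<Oplus>X\<in>fib m \<alpha> S. \<Oplus>Y\<in>fib m \<alpha> (V - S). f X \<otimes> g Y)"
      by (rule finsum_Sigma[symmetric]) (auto intro!: m_closed clF clG)
    also have "\<dots> = (\<Oplus>X\<in>fib m \<alpha> S. f X \<otimes> push m n \<alpha> g (V - S))"
      unfolding push_eq[OF S(2)]
      by (intro finsum_cong' refl finsum_rdistr[symmetric]) (auto intro!: m_closed clF clG finsum_closed)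
    also have "\<dots> = push m n \<alpha> f S \<otimes> push m n \<alpha> g (V - S)"
      unfolding push_eq[OF S(1)] using S
      by (intro finsum_ldistr[symmetric]) (auto intro!: clF tensor_carrier_closed[OF push_closed[OF g]])
    finally show "(\<Oplus>p\<in>fib m \<alpha> S \<times> fib m \<alpha> (V - S). sgn_mult C (inversions (V - S) S) (f (fst p) \<otimes> g (snd p)))
      = sgn_mult C (inversions (V - S) S) (push m n \<alpha> f S \<otimes> push m n \<alpha> g (V - S))" .
  qed (use V in \<open>auto intro!: sgn_mult_closed m_closed tensor_carrier_closed[OF push_closed[OF g]] tensor_carrier_closed[OF push_closed[OF f]]\<close>)
  also have "\<dots> = tensor_mult C n 0 (push m n \<alpha> f) (push m n \<alpha> g) V"
    by (rule tensor_mult_eq[OF push_closed[OF f] push_closed[OF g] V, symmetric])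
  finally show "push m n \<alpha> (tensor_mult C m 0 f g) V = tensor_mult C n 0 (push m n \<alpha> f) (push m n \<alpha> g) V" .
qed

text \<open>The obstacle is formed by the terms \<open>f (insert t S)\<close> for which \<alpha> t
  already lies in T: nothing on the right-hand side corresponds to them. Let s be the member of S
  that collides with t. Exchanging s and t keeps \<open>insert t S\<close> and is an involution
  without fixed points. It reverses the sign because monotonicity leaves no further element of S
  between s and t.\<close>

lemma push_cocycle:
  assumes f: "f \<in> tensor_carrier C m 0" and cf: "cocycle m f" and \<alpha>: "\<alpha> \<in> Delta m n"
  shows "cocycle n (push m n \<alpha> f)"
  unfolding cocycle_def
proof (intro allI impI)
  fix T assume T: "T \<subseteq> {..n}"
  have mono: "mono_on {..m} \<alpha>" and rng: "\<And>i. i \<le> m \<Longrightarrow> \<alpha> i \<le> n"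
    using \<alpha> by (auto simp: Delta_def PiE_def Pi_def)
  note clf = tensor_carrier_closed[OF f]
  define c where "c p = sgn_mult C (inversions (fst p) {snd p}) (f (insert (snd p) (fst p)))" for p
  have ccl: "c (S, t) \<in> carrier C" if "S \<subseteq> {..m}" "t \<le> m" for S t
    using that unfolding c_def by (auto intro!: sgn_mult_closed clf)
  define X where "X = {(S, t). S \<in> fib m \<alpha> T \<and> t \<le> m \<and> t \<notin> S}"
  define G where "G = {(S, t). S \<in> fib m \<alpha> T \<and> t \<le> m \<and> \<alpha> t \<notin> T}"
  define r where "r S t = inv_into S \<alpha> (\<alpha> t)" for S t
  define B where "B = {(S, t). S \<in> fib m \<alpha> T \<and> t \<le> m \<and> t \<notin> S \<and> \<alpha> t \<in> T}"
  define B1 where "B1 = {(S, t) \<in> B. r S t < t}"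
  define B2 where "B2 = {(S, t) \<in> B. t < r S t}"
  define j where "j = (\<lambda>(S, t). (insert t (S - {r S t}), r S t))"
  have cX: "c p \<in> carrier C" if "p \<in> X \<union> G \<union> B" for p
    using that by (auto simp: X_def G_def B_def dest!: fibD intro!: ccl)
  have finX: "finite X" "finite G" "finite B" "finite B1" "finite B2"
    by (rule finite_subset[of _ "fib m \<alpha> T \<times> {..m}"]; auto simp: X_def G_def B_def B1_def B2_def)+
  have jB: "j (S, t) \<in> B \<and> j (j (S, t)) = (S, t) \<and> r (fst (j (S, t))) (snd (j (S, t))) = t \<and> r S t \<noteq> t \<and>
      c (j (S, t)) = \<ominus> c (S, t)" if "(S, t) \<in> B" for S t
  proof -
    have S: "S \<subseteq> {..m}" "inj_on \<alpha> S" "\<alpha> ` S = T" "finite S" "t \<le> m" "t \<notin> S" "\<alpha> t \<in> \<alpha> ` S"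
      using that by (auto simp: B_def dest!: fibD)
    define s where "s = r S t"
    have s: "s \<in> S" "\<alpha> s = \<alpha> t"
      using inv_into_into[OF S(7)] f_inv_into_f[OF S(7)] by (simp_all add: s_def r_def)
    define V where "V = S - {s}"
    have V: "S = insert s V" "s \<notin> V" "t \<notin> V" "finite V" "V \<subseteq> {..m}" "s \<le> m" "s \<noteq> t" using s S by (auto simp: V_def)
    have j: "j (S, t) = (insert t V, s)" by (simp add: j_def s_def V_def)
    have inj: "inj_on \<alpha> (insert t V)" using S(2) s(2) V by auto
    have "\<alpha> ` insert t V = T" using S(3) s(2) V by auto
    then have fb: "insert t V \<in> fib m \<alpha> T" using inj V S by (auto intro!: fibI)
    have r': "r (insert t V) s = t"
      unfolding r_def s(2) by (rule inv_into_f_f[OF inj]) simp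
    have jj: "j (insert t V, s) = (S, t)" unfolding j_def using r' V by auto
    have lt: "t < v \<longleftrightarrow> s < v" if "v \<in> V" for v
    proof -
      have vm: "v \<le> m" "\<alpha> v \<noteq> \<alpha> s" using that V S(2) by (auto simp: inj_on_def)
      have "v \<noteq> s" "v \<noteq> t" using that V by auto
      then show ?thesis
        using mono_onD[OF mono, of s v] mono_onD[OF mono, of v t] mono_onD[OF mono, of t v] mono_onD[OF mono, of v s]
          vm V(6) S(5) s(2) by (metis antisym atMost_iff linorder_less_linear order_less_imp_le order_less_trans)
    qed
    have iV: "inversions V {t} = inversions V {s}"
      unfolding inversions_singleton using lt by (intro arg_cong[of _ _ card]) auto
    have "inversions {s} {t} + inversions {t} {s} = 1"
      using inversions_commute[of "{s}" "{t}"] V by simp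
    moreover have "inversions (insert t V) {s} = inversions {t} {s} + inversions V {s}"
        "inversions S {t} = inversions {s} {t} + inversions V {t}"
      unfolding V(1) by (rule inversions_insert_left; use V in simp)+
    ultimately have par: "even (inversions (insert t V) {s}) \<longleftrightarrow> even (Suc (inversions S {t}))"
      using iV by presburger
    have "c (j (S, t)) = sgn_mult C (Suc (inversions S {t})) (f (insert t S))"
      unfolding j c_def fst_conv snd_conv using par V by (intro sgn_mult_cong) (auto simp: insert_commute)
    also have "\<dots> = \<ominus> c (S, t)"
      unfolding c_def using S by (simp add: sgn_mult_Suc clf)
    finally have c': "c (insert t V, s) = \<ominus> c (S, t)" unfolding j .
    have "\<alpha> s \<in> T" "s \<notin> insert t V" using s(1) S(3) V by blast+
    then have "(insert t V, s) \<in> B" using fb V(6) by (simp add: B_def)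
    then show ?thesis unfolding j jj fst_conv snd_conv using r' V(7) c' by (simp add: s_def[symmetric])
  qed
  \<comment> \<open>The involution matches \<open>B1\<close> with \<open>B2\<close>. Applied to all
    of \<open>B\<close> at once it would only show that the sum equals its own negative.\<close>
  have "(\<Oplus>p\<in>B. c p) = (\<Oplus>p\<in>B1. c p) \<oplus> (\<Oplus>p\<in>B2. c p)"
  proof -
    have "B = B1 \<union> B2" using jB by (auto simp: B1_def B2_def) (metis linorder_neqE_nat)
    moreover have "c \<in> B1 \<rightarrow> carrier C" "c \<in> B2 \<rightarrow> carrier C" "B1 \<inter> B2 = {}"
      using cX by (auto simp: B1_def B2_def)
    ultimately show ?thesis using finsum_Un_disjoint[OF finX(4,5)] by simp
  qed
  also have "(\<Oplus>p\<in>B2. c p) = (\<Oplus>p\<in>B1. c (j p))"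
  proof (rule finsum_bij_witness[where i=j and j=j], goal_cases)
    case (2 p)
    then show ?case using jB by (force simp: B1_def B2_def j_def)
  next
    case (4 p)
    then show ?case using jB by (force simp: B1_def B2_def j_def)
  next
    case (5 p)
    then show ?case using jB by (auto simp: B2_def)
  next
    case (6 p)
    then show ?case using jB cX by (auto simp: B1_def)
  qed (use jB in \<open>auto simp: B1_def B2_def\<close>)
  also have "\<dots> = (\<Oplus>p\<in>B1. \<ominus> c p)"
    by (intro finsum_cong' refl) (use jB cX in \<open>auto simp: B1_def\<close>)
  also have "\<dots> = \<ominus> (\<Oplus>p\<in>B1. c p)"
    by (rule finsum_a_inv) (use cX in \<open>auto simp: B1_def\<close>)
  finally have B0: "(\<Oplus>p\<in>B. c p) = \<zero>"
    using cX by (simp add: r_neg finsum_closed Pi_def B1_def)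
  have "diff C (push m n \<alpha> f T) = (\<Oplus>S\<in>fib m \<alpha> T. \<Oplus>t\<in>{..m} - S. c (S, t))"
  proof -
    have "diff C (push m n \<alpha> f T) = (\<Oplus>S\<in>fib m \<alpha> T. diff C (f S))"
      unfolding push_eq[OF T] by (rule diff_finsum) (auto dest!: fibD intro!: clf)
    also have "\<dots> = (\<Oplus>S\<in>fib m \<alpha> T. \<Oplus>t\<in>{..m} - S. c (S, t))"
    proof (intro finsum_cong' refl)
      fix S assume "S \<in> fib m \<alpha> T"
      then have "S \<subseteq> {..m}" by (simp add: fib_def)
      then show "diff C (f S) = (\<Oplus>t\<in>{..m} - S. c (S, t))" using cf by (simp add: cocycle_def c_def)
    qed (auto dest!: fibD intro!: finsum_closed ccl)
    finally show ?thesis .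
  qed
  also have "\<dots> = (\<Oplus>p\<in>Sigma (fib m \<alpha> T) (\<lambda>S. {..m} - S). c (fst p, snd p))"
    by (rule finsum_Sigma) (auto dest!: fibD intro!: ccl)
  also have "\<dots> = (\<Oplus>p\<in>X. c p)"
  proof -
    have "Sigma (fib m \<alpha> T) (\<lambda>S. {..m} - S) = X" by (auto simp: X_def)
    then show ?thesis by simp
  qed
  also have "\<dots> = (\<Oplus>p\<in>G. c p) \<oplus> (\<Oplus>p\<in>B. c p)"
  proof -
    have "X = G \<union> B" by (auto simp: X_def G_def B_def dest: fibD)
    then show ?thesis using finX cX by (simp, intro finsum_Un_disjoint) (auto simp: G_def B_def)
  qed
  also have "\<dots> = (\<Oplus>p\<in>G. c p)" unfolding B0 using cX by (simp add: finsum_closed Pi_def)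
  \<comment> \<open>If \<alpha> t is not in T, then \<open>insert t S\<close> lies in the fibre over
    T with \<alpha> t added; conversely t is recovered as the preimage of the added element.\<close>
  also have "\<dots> = (\<Oplus>p\<in>Sigma ({..n} - T) (\<lambda>u. fib m \<alpha> (insert u T)). sgn_mult C (inversions T {fst p}) (f (snd p)))"
  proof (rule finsum_bij_witness[where j="\<lambda>(S, t). (\<alpha> t, insert t S)" and
        i="\<lambda>(u, S). (S - {inv_into S \<alpha> u}, inv_into S \<alpha> u)"], goal_cases)
    case (1 p)
    then obtain S t where p: "p = (S, t)" "S \<in> fib m \<alpha> T" "t \<le> m" "\<alpha> t \<notin> T" by (auto simp: G_def)
    note S = fibD[OF p(2)]
    have "inj_on \<alpha> (insert t S)" "t \<notin> S" using p S by auto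
    then show ?case using p inv_into_f_f[of \<alpha> "insert t S" t] by auto
  next
    case (2 p)
    then show ?case using rng by (auto simp: G_def dest!: fibD intro!: fibI)
  next
    case (3 p)
    then obtain u S where p: "p = (u, S)" "u \<le> n" "u \<notin> T" "S \<in> fib m \<alpha> (insert u T)" by auto
    have "u \<in> \<alpha> ` S" using fibD[OF p(4)] by auto
    then show ?case using p(1) inv_into_into[of u \<alpha> S] f_inv_into_f[of u \<alpha> S] by auto
  next
    case (4 p)
    then obtain u S where p: "p = (u, S)" "u \<le> n" "u \<notin> T" "S \<in> fib m \<alpha> (insert u T)" by auto
    define s where "s = inv_into S \<alpha> u"
    have S: "S \<subseteq> {..m}" "inj_on \<alpha> S" "\<alpha> ` S = insert u T" using fibD[OF p(4)] by auto
    have s: "s \<in> S" "\<alpha> s = u" using S(3) inv_into_into[of u \<alpha> S] f_inv_into_f[of u \<alpha> S] by (auto simp: s_def)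
    have "\<alpha> ` (S - {s}) = T" using inj_on_image_set_diff[OF S(2), of S "{s}"] s S(3) p(3) by auto
    then have "S - {s} \<in> fib m \<alpha> T" using S by (auto intro!: fibI intro: inj_on_subset)
    then show ?case using p s S by (auto simp: G_def s_def[symmetric])
  next
    case (5 p)
    then obtain S t where p: "p = (S, t)" "S \<in> fib m \<alpha> T" "t \<le> m" "\<alpha> t \<notin> T" by (auto simp: G_def)
    note S = fibD[OF p(2)]
    have "inj_on \<alpha> (S \<union> {t})" using p S by auto
    then have "inversions (\<alpha> ` S) (\<alpha> ` {t}) = inversions S {t}"
      using S p by (intro inversions_image[OF mono]) auto
    then show ?case using p S by (simp add: c_def)
  next
    case (6 p)
    then show ?case by (auto dest!: fibD intro!: sgn_mult_closed clf)
  qed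
  also have "\<dots> = (\<Oplus>u\<in>{..n} - T. \<Oplus>S\<in>fib m \<alpha> (insert u T). sgn_mult C (inversions T {u}) (f S))"
    by (rule finsum_Sigma[symmetric]) (auto dest!: fibD intro!: sgn_mult_closed clf)
  also have "\<dots> = (\<Oplus>u\<in>{..n} - T. sgn_mult C (inversions T {u}) (push m n \<alpha> f (insert u T)))"
  proof (intro finsum_cong' refl)
    fix u assume "u \<in> {..n} - T"
    then have "insert u T \<subseteq> {..n}" using T by auto
    then show "(\<Oplus>S\<in>fib m \<alpha> (insert u T). sgn_mult C (inversions T {u}) (f S)) =
        sgn_mult C (inversions T {u}) (push m n \<alpha> f (insert u T))"
      by (simp only: push_eq, intro sgn_mult_finsum[symmetric]) (auto dest!: fibD intro!: clf)
  qed (use T in \<open>auto intro!: sgn_mult_closed tensor_carrier_closed[OF push_closed[OF f]]\<close>)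
  finally show "diff C (push m n \<alpha> f T) = (\<Oplus>u\<in>{..n} - T. sgn_mult C (inversions T {u}) (push m n \<alpha> f (insert u T)))" .
qed

lemma K_carrierD: "f \<in> carrier (K_level C n) \<Longrightarrow> f \<in> tensor_carrier C n 0"
  "f \<in> carrier (K_level C n) \<Longrightarrow> cocycle n f"
  by (simp_all add: mem_K_level_iff)

lemma tensor_add_closed:
  assumes f: "f \<in> tensor_carrier C n 0" and g: "g \<in> tensor_carrier C n 0"
  shows "(\<lambda>S\<in>Pow {..n}. f S \<oplus> g S) \<in> tensor_carrier C n 0"
  by (intro tensor_carrierI) (auto intro!: hpart_add tensor_carrierD[OF f] tensor_carrierD[OF g])

lemma tensor_smult_closed:
  assumes f: "f \<in> tensor_carrier C n 0" and r: "r \<in> carrier R"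
  shows "(\<lambda>S\<in>Pow {..n}. r \<odot> f S) \<in> tensor_carrier C n 0"
  using r by (intro tensor_carrierI) (auto intro!: hpart_smult tensor_carrierD[OF f])

lemma tensor_zero_closed: "(\<lambda>S\<in>Pow {..n}. \<zero>) \<in> tensor_carrier C n 0"
  by (intro tensor_carrierI) auto

lemma smult_sgn: "r \<in> carrier R \<Longrightarrow> x \<in> carrier C \<Longrightarrow> sgn_mult C k (r \<odot> x) = r \<odot> sgn_mult C k x"
  by (simp add: sgn_mult_def M.smult_r_minus)

lemma K_add_closed:
  assumes f: "f \<in> carrier (K_level C n)" and g: "g \<in> carrier (K_level C n)"
  shows "(\<lambda>S\<in>Pow {..n}. f S \<oplus> g S) \<in> carrier (K_level C n)"
proof -
  note f' = K_carrierD[OF f] and g' = K_carrierD[OF g]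
  note cl = tensor_carrier_closed[OF f'(1)] tensor_carrier_closed[OF g'(1)]
  have "diff C (f S \<oplus> g S) = (\<Oplus>t\<in>{..n} - S. sgn_mult C (inversions S {t}) (f (insert t S) \<oplus> g (insert t S)))"
    if S: "S \<subseteq> {..n}" for S
  proof -
    have "(\<Oplus>t\<in>{..n} - S. sgn_mult C (inversions S {t}) (f (insert t S) \<oplus> g (insert t S))) =
      (\<Oplus>t\<in>{..n} - S. sgn_mult C (inversions S {t}) (f (insert t S)) \<oplus> sgn_mult C (inversions S {t}) (g (insert t S)))"
      using S by (intro finsum_cong' refl sgn_mult_add) (auto intro!: cl)
    also have "\<dots> = diff C (f S) \<oplus> diff C (g S)"
      using f'(2) g'(2) S unfolding cocycle_def by (subst finsum_addf) (auto intro!: cl)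
    finally show ?thesis using S by (simp add: diff_add cl)
  qed
  then have "cocycle n (\<lambda>S\<in>Pow {..n}. f S \<oplus> g S)"
    unfolding cocycle_def by (auto intro!: finsum_cong' cl sgn_mult_closed a_closed)
  then show ?thesis unfolding mem_K_level_iff using tensor_add_closed[OF f'(1) g'(1)] by blast
qed

lemma K_smult_closed:
  assumes f: "f \<in> carrier (K_level C n)" and r: "r \<in> carrier R"
  shows "(\<lambda>S\<in>Pow {..n}. r \<odot> f S) \<in> carrier (K_level C n)"
proof -
  note f' = K_carrierD[OF f]
  note cl = tensor_carrier_closed[OF f'(1)]
  have "diff C (r \<odot> f S) = (\<Oplus>t\<in>{..n} - S. sgn_mult C (inversions S {t}) (r \<odot> f (insert t S)))"
    if S: "S \<subseteq> {..n}" for S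
  proof -
    have "diff C (r \<odot> f S) = r \<odot> (\<Oplus>t\<in>{..n} - S. sgn_mult C (inversions S {t}) (f (insert t S)))"
      using f'(2) S r unfolding cocycle_def by (simp add: diff_smult cl)
    also have "\<dots> = (\<Oplus>t\<in>{..n} - S. r \<odot> sgn_mult C (inversions S {t}) (f (insert t S)))"
      using r S by (intro additive_finsum[OF abelian_monoid_axioms, of "\<lambda>x. r \<odot> x"])
        (auto simp: M.smult_r_distr intro!: cl)
    also have "\<dots> = (\<Oplus>t\<in>{..n} - S. sgn_mult C (inversions S {t}) (r \<odot> f (insert t S)))"
      using r S by (intro finsum_cong' refl smult_sgn[symmetric]) (auto intro!: cl)
    finally show ?thesis .
  qed
  then have "cocycle n (\<lambda>S\<in>Pow {..n}. r \<odot> f S)"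
    unfolding cocycle_def using r by (auto intro!: finsum_cong' cl sgn_mult_closed M.smult_closed)
  then show ?thesis unfolding mem_K_level_iff using tensor_smult_closed[OF f'(1) r] by blast
qed

lemma K_zero_closed: "(\<lambda>S\<in>Pow {..n}. \<zero>) \<in> carrier (K_level C n)"
proof -
  have "cocycle n (\<lambda>S\<in>Pow {..n}. \<zero>)"
    unfolding cocycle_def by (auto intro!: add.finprod_one_eqI[symmetric])
  then show ?thesis unfolding mem_K_level_iff using tensor_zero_closed by blast
qed

lemma K_one_closed: "(\<lambda>S\<in>Pow {..n}. if S = {} then \<one> else \<zero>) \<in> carrier (K_level C n)"
  unfolding mem_K_level_iff using cocycle_one by (auto intro!: tensor_carrierI)

lemma K_mult_closed: "f \<in> carrier (K_level C n) \<Longrightarrow> g \<in> carrier (K_level C n) \<Longrightarrow>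
    tensor_mult C n 0 f g \<in> carrier (K_level C n)"
  unfolding mem_K_level_iff by (simp add: tensor_mult_closed tensor_mult_sum_diff)

lemma K_apply_closed: "f \<in> carrier (K_level C n) \<Longrightarrow> S \<subseteq> {..n} \<Longrightarrow> f S \<in> carrier C"
  using K_carrierD(1) tensor_carrier_closed by blast

lemma K_eqI: "f \<in> carrier (K_level C n) \<Longrightarrow> g \<in> carrier (K_level C n) \<Longrightarrow>
    (\<And>S. S \<subseteq> {..n} \<Longrightarrow> f S = g S) \<Longrightarrow> f = g"
  by (rule tensor_eqI[OF K_carrierD(1) K_carrierD(1)])

lemma K_algebra: "algebra R (K_level C n)"
proof (rule algebraI)
  let ?K = "K_level C n"
  show "cring R" by (rule R.cring_axioms)
  have ab: "abelian_group ?K"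
  proof (rule abelian_groupI)
    fix x assume x: "x \<in> carrier ?K"
    show "\<exists>y\<in>carrier ?K. y \<oplus>\<^bsub>?K\<^esub> x = \<zero>\<^bsub>?K\<^esub>"
    proof
      show "(\<lambda>S\<in>Pow {..n}. \<ominus>\<^bsub>R\<^esub> \<one>\<^bsub>R\<^esub> \<odot> x S) \<in> carrier ?K" using x by (intro K_smult_closed) auto
      show "(\<lambda>S\<in>Pow {..n}. \<ominus>\<^bsub>R\<^esub> \<one>\<^bsub>R\<^esub> \<odot> x S) \<oplus>\<^bsub>?K\<^esub> x = \<zero>\<^bsub>?K\<^esub>"
        using K_apply_closed[OF x] by (auto simp: fun_eq_iff M.smult_l_minus l_neg)
    qed
  next
    fix x assume x: "x \<in> carrier ?K"
    show "\<zero>\<^bsub>?K\<^esub> \<oplus>\<^bsub>?K\<^esub> x = x"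
      by (rule K_eqI[of _ n]) (use x K_add_closed[OF K_zero_closed x] in \<open>auto simp: K_apply_closed\<close>)
  qed (auto simp: K_add_closed K_zero_closed a_ac K_apply_closed intro!: restrict_ext)
  have cm: "comm_monoid ?K"
  proof (rule comm_monoidI)
    fix x y z assume "x \<in> carrier ?K" "y \<in> carrier ?K" "z \<in> carrier ?K"
    then show "x \<otimes>\<^bsub>?K\<^esub> y \<otimes>\<^bsub>?K\<^esub> z = x \<otimes>\<^bsub>?K\<^esub> (y \<otimes>\<^bsub>?K\<^esub> z)"
      by (simp add: tensor_mult_assoc K_carrierD)
  next
    fix x assume "x \<in> carrier ?K"
    then show "\<one>\<^bsub>?K\<^esub> \<otimes>\<^bsub>?K\<^esub> x = x" by (simp add: tensor_one_mult K_carrierD)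
  next
    fix x y assume "x \<in> carrier ?K" "y \<in> carrier ?K"
    then show "x \<otimes>\<^bsub>?K\<^esub> y = y \<otimes>\<^bsub>?K\<^esub> x" unfolding K_level_simps by (intro tensor_mult_comm K_carrierD)
  qed (simp_all add: K_mult_closed K_one_closed)
  show "cring ?K"
    by (rule cringI[OF ab cm]) (simp add: tensor_add_mult K_carrierD)
qed (auto simp: K_smult_closed tensor_smult_mult K_carrierD M.smult_l_distr M.smult_r_distr
    M.smult_assoc1 K_apply_closed intro!: restrict_ext intro: K_eqI[OF K_smult_closed])

lemma push_K: "f \<in> carrier (K_level C m) \<Longrightarrow> \<alpha> \<in> Delta m n \<Longrightarrow> push m n \<alpha> f \<in> carrier (K_level C n)"
  unfolding mem_K_level_iff by (simp add: push_closed push_cocycle)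

lemma push_alg_hom: "\<alpha> \<in> Delta m n \<Longrightarrow> push m n \<alpha> \<in> alg_hom R (K_level C m) (K_level C n)"
  unfolding alg_hom_def mem_Collect_eq
  by (intro conjI ballI ring_hom_memI)
    (simp_all add: push_K push_mult push_add push_one push_smult K_carrierD)

theorem K_alg_cCom: "K_alg C \<in> cCom R"
  unfolding cCom_def mem_Collect_eq cmap_K_alg level_K_alg
  by (auto simp: K_algebra push_alg_hom push_id push_compose K_carrierD)

end

subsection \<open>Functoriality\<close>

lemma alg_homD:
  assumes "f \<in> alg_hom R M N"
  shows "x \<in> carrier M \<Longrightarrow> f x \<in> carrier N"
    and "x \<in> carrier M \<Longrightarrow> y \<in> carrier M \<Longrightarrow> f (x \<otimes>\<^bsub>M\<^esub> y) = f x \<otimes>\<^bsub>N\<^esub> f y"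
    and "x \<in> carrier M \<Longrightarrow> y \<in> carrier M \<Longrightarrow> f (x \<oplus>\<^bsub>M\<^esub> y) = f x \<oplus>\<^bsub>N\<^esub> f y"
    and "f \<one>\<^bsub>M\<^esub> = \<one>\<^bsub>N\<^esub>"
    and "r \<in> carrier R \<Longrightarrow> x \<in> carrier M \<Longrightarrow> f (r \<odot>\<^bsub>M\<^esub> x) = r \<odot>\<^bsub>N\<^esub> f x"
  using assms by (auto simp: alg_hom_def ring_hom_def)

lemma cdga_homD:
  assumes "g \<in> cdga_hom R C C'"
  shows "g \<in> alg_hom R C C'" "g \<in> extensional (carrier C)"
    and "x \<in> hpart C i \<Longrightarrow> g x \<in> hpart C' i"
    and "x \<in> carrier C \<Longrightarrow> g (diff C x) = diff C' (g x)"
  using assms by (auto simp: cdga_hom_def)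

locale cdga_map = C: cdga R C + D: cdga R D
  for R :: "('r, 'p) ring_scheme" and C :: "('r, 'c) dga" and D :: "('r, 'd) dga" +
  fixes g
  assumes hom: "g \<in> cdga_hom R C D"
begin

lemmas closed = alg_homD(1)[OF cdga_homD(1)[OF hom]]
  and mult = alg_homD(2)[OF cdga_homD(1)[OF hom]]
  and add = alg_homD(3)[OF cdga_homD(1)[OF hom]]
  and one = alg_homD(4)[OF cdga_homD(1)[OF hom]]
  and smult = alg_homD(5)[OF cdga_homD(1)[OF hom]]
  and hpart = cdga_homD(3)[OF hom]
  and diff = cdga_homD(4)[OF hom]

lemma zero: "g \<zero>\<^bsub>C\<^esub> = \<zero>\<^bsub>D\<^esub>"
  using smult[of "\<zero>\<^bsub>R\<^esub>" "\<zero>\<^bsub>C\<^esub>"] closed by simp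

lemma neg: "x \<in> carrier C \<Longrightarrow> g (\<ominus>\<^bsub>C\<^esub> x) = \<ominus>\<^bsub>D\<^esub> g x"
  using add[of "\<ominus>\<^bsub>C\<^esub> x" x] closed zero
  by (metis C.add.inv_closed C.l_neg D.minus_equality)

lemma sgn: "x \<in> carrier C \<Longrightarrow> g (sgn_mult C k x) = sgn_mult D k (g x)"
  by (simp add: sgn_mult_def neg)

lemma finsum: "(\<And>a. a \<in> A \<Longrightarrow> f a \<in> carrier C) \<Longrightarrow> g (finsum C f A) = (\<Oplus>\<^bsub>D\<^esub>a\<in>A. g (f a))"
  by (rule C.additive_finsum[OF D.abelian_monoid_axioms]) (auto simp: closed zero add)

lemma K_map_apply: "f \<in> carrier (K_level C n) \<Longrightarrow> K_map C g n f = (\<lambda>S\<in>Pow {..n}. g (f S))"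
  by (simp add: K_map_def C.level_K_alg)

lemma K_map_closed:
  assumes f: "f \<in> carrier (K_level C n)"
  shows "(\<lambda>S\<in>Pow {..n}. g (f S)) \<in> carrier (K_level D n)"
  unfolding D.mem_K_level_iff
proof
  note f' = C.K_carrierD[OF f] and cl = C.K_apply_closed[OF f]
  show "(\<lambda>S\<in>Pow {..n}. g (f S)) \<in> tensor_carrier D n 0"
    using C.tensor_carrierD[OF f'(1)] by (intro D.tensor_carrierI) (auto intro: hpart)
  have "diff D (g (f S)) = (\<Oplus>\<^bsub>D\<^esub>t\<in>{..n} - S. sgn_mult D (inversions S {t}) (g (f (insert t S))))"
    if S: "S \<subseteq> {..n}" for S
  proof -
    have cl': "f (insert t S) \<in> carrier C" if "t \<le> n" for t using S that by (intro cl) auto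
    have "diff D (g (f S)) = g (diff C (f S))" using S by (simp add: diff cl)
    also have "\<dots> = g (\<Oplus>\<^bsub>C\<^esub>t\<in>{..n} - S. sgn_mult C (inversions S {t}) (f (insert t S)))"
      using f'(2) S by (simp add: C.cocycle_def)
    also have "\<dots> = (\<Oplus>\<^bsub>D\<^esub>t\<in>{..n} - S. g (sgn_mult C (inversions S {t}) (f (insert t S))))"
      by (rule finsum) (auto intro: cl')
    also have "\<dots> = (\<Oplus>\<^bsub>D\<^esub>t\<in>{..n} - S. sgn_mult D (inversions S {t}) (g (f (insert t S))))"
      by (intro D.finsum_cong' refl) (auto simp: sgn cl' intro!: D.sgn_mult_closed closed)
    finally show ?thesis .
  qed
  then show "D.cocycle n (\<lambda>S\<in>Pow {..n}. g (f S))"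
    unfolding D.cocycle_def by (auto intro!: D.finsum_cong' D.sgn_mult_closed closed cl)
qed

lemma K_map_mult:
  assumes f: "f \<in> carrier (K_level C n)" and h: "h \<in> carrier (K_level C n)"
  shows "(\<lambda>S\<in>Pow {..n}. g (tensor_mult C n 0 f h S)) =
    tensor_mult D n 0 (\<lambda>S\<in>Pow {..n}. g (f S)) (\<lambda>S\<in>Pow {..n}. g (h S))"
proof (rule D.K_eqI[OF K_map_closed[OF C.K_mult_closed[OF f h]] D.K_mult_closed[OF K_map_closed[OF f] K_map_closed[OF h]]])
  fix U assume U: "U \<subseteq> {..n}"
  note cl = C.K_apply_closed[OF f] C.K_apply_closed[OF h]
  have "g (tensor_mult C n 0 f h U) = (\<Oplus>\<^bsub>D\<^esub>S\<in>Pow U. g (sgn_mult C (inversions (U - S) S) (f S \<otimes>\<^bsub>C\<^esub> h (U - S))))"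
    unfolding C.tensor_mult_eq[OF C.K_carrierD(1)[OF f] C.K_carrierD(1)[OF h] U]
    using U by (intro finsum) (auto intro!: C.sgn_mult_closed C.m_closed cl)
  also have "\<dots> = (\<Oplus>\<^bsub>D\<^esub>S\<in>Pow U. sgn_mult D (inversions (U - S) S) ((\<lambda>S\<in>Pow {..n}. g (f S)) S \<otimes>\<^bsub>D\<^esub> (\<lambda>S\<in>Pow {..n}. g (h S)) (U - S)))"
  proof (intro D.finsum_cong' refl)
    fix S assume "S \<in> Pow U"
    then have "S \<subseteq> {..n}" "U - S \<subseteq> {..n}" using U by auto
    then show "g (sgn_mult C (inversions (U - S) S) (f S \<otimes>\<^bsub>C\<^esub> h (U - S))) =
       sgn_mult D (inversions (U - S) S) ((\<lambda>S\<in>Pow {..n}. g (f S)) S \<otimes>\<^bsub>D\<^esub> (\<lambda>S\<in>Pow {..n}. g (h S)) (U - S))"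
      by (simp add: sgn mult cl)
  next
    show "(\<lambda>S. sgn_mult D (inversions (U - S) S) ((\<lambda>S\<in>Pow {..n}. g (f S)) S \<otimes>\<^bsub>D\<^esub> (\<lambda>S\<in>Pow {..n}. g (h S)) (U - S)))
        \<in> Pow U \<rightarrow> carrier D"
    proof
      fix S assume "S \<in> Pow U"
      then have "S \<subseteq> {..n}" "U - S \<subseteq> {..n}" using U by auto
      then show "sgn_mult D (inversions (U - S) S) ((\<lambda>S\<in>Pow {..n}. g (f S)) S \<otimes>\<^bsub>D\<^esub> (\<lambda>S\<in>Pow {..n}. g (h S)) (U - S)) \<in> carrier D"
        by (simp add: cl closed)
    qed
  qed
  finally show "(\<lambda>S\<in>Pow {..n}. g (tensor_mult C n 0 f h S)) U =
      tensor_mult D n 0 (\<lambda>S\<in>Pow {..n}. g (f S)) (\<lambda>S\<in>Pow {..n}. g (h S)) U"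
    using U by (simp add: D.tensor_mult_eq[OF D.K_carrierD(1)[OF K_map_closed[OF f]] D.K_carrierD(1)[OF K_map_closed[OF h]] U])
qed

lemma K_map_push:
  assumes f: "f \<in> carrier (K_level C m)" and \<alpha>: "\<alpha> \<in> Delta m n"
  shows "(\<lambda>S\<in>Pow {..n}. g (C.push m n \<alpha> f S)) = D.push m n \<alpha> (\<lambda>S\<in>Pow {..m}. g (f S))"
proof (rule D.K_eqI[OF K_map_closed[OF C.push_K[OF f \<alpha>]] D.push_K[OF K_map_closed[OF f] \<alpha>]])
  fix T assume T: "T \<subseteq> {..n}"
  have "C.fib = D.fib" by (intro ext) (simp add: C.fib_def D.fib_def)
  then have "g (C.push m n \<alpha> f T) = (\<Oplus>\<^bsub>D\<^esub>S\<in>D.fib m \<alpha> T. g (f S))"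
    unfolding C.push_eq[OF T]
    by (simp, intro finsum) (auto dest!: D.fibD intro!: C.K_apply_closed[OF f])
  also have "\<dots> = D.push m n \<alpha> (\<lambda>S\<in>Pow {..m}. g (f S)) T"
    unfolding D.push_eq[OF T]
    by (intro D.finsum_cong' refl) (auto dest!: D.fibD intro!: closed C.K_apply_closed[OF f])
  finally show "(\<lambda>S\<in>Pow {..n}. g (C.push m n \<alpha> f S)) T = D.push m n \<alpha> (\<lambda>S\<in>Pow {..m}. g (f S)) T"
    using T by simp
qed

lemma K_map_hom: "K_map C g \<in> ccom_hom R (K_alg C) (K_alg D)"
proof -
  have "K_map C g n \<in> alg_hom R (K_level C n) (K_level D n)" for n
    unfolding alg_hom_def mem_Collect_eq
  proof (intro conjI ballI ring_hom_memI)
    fix x y assume x: "x \<in> carrier (K_level C n)" and y: "y \<in> carrier (K_level C n)"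
    show "K_map C g n (x \<otimes>\<^bsub>K_level C n\<^esub> y) = K_map C g n x \<otimes>\<^bsub>K_level D n\<^esub> K_map C g n y"
      using x y by (simp add: K_map_apply K_map_mult C.K_mult_closed)
    show "K_map C g n (x \<oplus>\<^bsub>K_level C n\<^esub> y) = K_map C g n x \<oplus>\<^bsub>K_level D n\<^esub> K_map C g n y"
      using x y by (auto simp: K_map_apply C.K_add_closed C.K_apply_closed add intro!: restrict_ext)
  next
    fix x r assume x: "x \<in> carrier (K_level C n)" and r: "r \<in> carrier R"
    show "K_map C g n (r \<odot>\<^bsub>K_level C n\<^esub> x) = r \<odot>\<^bsub>K_level D n\<^esub> K_map C g n x"
      using x r by (auto simp: K_map_apply C.K_smult_closed C.K_apply_closed smult intro!: restrict_ext)
  next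
    show "K_map C g n \<one>\<^bsub>K_level C n\<^esub> = \<one>\<^bsub>K_level D n\<^esub>"
      using K_map_apply[OF C.K_one_closed] by (auto simp: one zero intro!: restrict_ext)
  qed (simp add: K_map_apply K_map_closed)
  moreover have "K_map C g n \<in> extensional (carrier (K_level C n))" for n
    by (simp add: K_map_def C.level_K_alg)
  ultimately show ?thesis
    unfolding ccom_hom_def mem_Collect_eq C.cmap_K_alg D.cmap_K_alg C.level_K_alg D.level_K_alg
    by (auto simp: K_map_apply C.push_K K_map_push)
qed

end

section \<open>The cdga generated by a family of maps\<close>

lemma (in cdga) decomposition_unique:
  assumes "x \<in> carrier C"
    and "\<And>i. p i \<in> hpart C i" "finite {i. p i \<noteq> \<zero>}" "x = (\<Oplus>i\<in>{i. p i \<noteq> \<zero>}. p i)"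
    and "\<And>i. p' i \<in> hpart C i" "finite {i. p' i \<noteq> \<zero>}" "x = (\<Oplus>i\<in>{i. p' i \<noteq> \<zero>}. p' i)"
  shows "p = p'"
  by (rule ex1E[OF decomposition[OF assms(1)]]) (use assms in \<open>metis (mono_tags, lifting)\<close>)

text \<open>A jointly injective family of structure-preserving maps into cdgas reflects every axiom
  that is an equation or a membership in a homogeneous part, and also the uniqueness of homogeneous
  decompositions. Their existence is not of this kind and enters as \<open>decomp\<close>, with one
  finite set of degrees for the whole family.\<close>

lemma cdgas_reflect:
  fixes Q :: "('r, 'q) dga" (structure) and E :: "'i \<Rightarrow> ('r, 'c) dga" and e :: "'i \<Rightarrow> 'q \<Rightarrow> 'c"
  assumes R: "cring R"
    and E: "\<And>x. x \<in> X \<Longrightarrow> E x \<in> cdgas R"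
    and e_closed: "\<And>x q. x \<in> X \<Longrightarrow> q \<in> carrier Q \<Longrightarrow> e x q \<in> carrier (E x)"
    and inj: "\<And>q q'. q \<in> carrier Q \<Longrightarrow> q' \<in> carrier Q \<Longrightarrow> (\<And>x. x \<in> X \<Longrightarrow> e x q = e x q') \<Longrightarrow> q = q'"
    and closed: "\<zero> \<in> carrier Q" "\<one> \<in> carrier Q"
      "\<And>q q'. q \<in> carrier Q \<Longrightarrow> q' \<in> carrier Q \<Longrightarrow> q \<otimes> q' \<in> carrier Q"
      "\<And>q q'. q \<in> carrier Q \<Longrightarrow> q' \<in> carrier Q \<Longrightarrow> q \<oplus> q' \<in> carrier Q"
      "\<And>r q. r \<in> carrier R \<Longrightarrow> q \<in> carrier Q \<Longrightarrow> r \<odot> q \<in> carrier Q"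
      "\<And>q. q \<in> carrier Q \<Longrightarrow> diff Q q \<in> carrier Q"
    and e: "\<And>x. x \<in> X \<Longrightarrow> e x \<zero> = \<zero>\<^bsub>E x\<^esub>" "\<And>x. x \<in> X \<Longrightarrow> e x \<one> = \<one>\<^bsub>E x\<^esub>"
      "\<And>x q q'. x \<in> X \<Longrightarrow> q \<in> carrier Q \<Longrightarrow> q' \<in> carrier Q \<Longrightarrow> e x (q \<otimes> q') = e x q \<otimes>\<^bsub>E x\<^esub> e x q'"
      "\<And>x q q'. x \<in> X \<Longrightarrow> q \<in> carrier Q \<Longrightarrow> q' \<in> carrier Q \<Longrightarrow> e x (q \<oplus> q') = e x q \<oplus>\<^bsub>E x\<^esub> e x q'"
      "\<And>x r q. x \<in> X \<Longrightarrow> r \<in> carrier R \<Longrightarrow> q \<in> carrier Q \<Longrightarrow> e x (r \<odot> q) = r \<odot>\<^bsub>E x\<^esub> e x q"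
      "\<And>x q. x \<in> X \<Longrightarrow> q \<in> carrier Q \<Longrightarrow> e x (diff Q q) = diff (E x) (e x q)"
    and hpart: "\<And>i. hpart Q i = {q \<in> carrier Q. \<forall>x\<in>X. e x q \<in> hpart (E x) i}"
    and decomp: "\<And>q. q \<in> carrier Q \<Longrightarrow> \<exists>I p. finite I \<and> (\<forall>i. p i \<in> hpart Q i) \<and> (\<forall>i. i \<notin> I \<longrightarrow> p i = \<zero>) \<and>
        (\<forall>x\<in>X. e x q = (\<Oplus>\<^bsub>E x\<^esub>i\<in>I. e x (p i)))"
  shows "Q \<in> cdgas R \<and> (\<forall>x\<in>X. restrict (e x) (carrier Q) \<in> cdga_hom R Q (E x))"
proof -
  interpret R: cring R by (rule R)
  have cd: "cdga R (E x)" if "x \<in> X" for x using E[OF that] by (rule cdga.intro)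
  have rx: "ring (E x)" "Module.module R (E x)" if "x \<in> X" for x
    using E[OF that] by (simp_all add: cdgas_def)
  note ax = e closed e_closed ring.ring_simprules[OF rx(1)] monoid.r_one[OF ring.axioms(2)[OF rx(1)]] module.smult_l_distr[OF rx(2)] module.smult_r_distr[OF rx(2)]
    module.smult_assoc1[OF rx(2)] module.smult_one[OF rx(2)] module.smult_l_minus[OF rx(2)] module.smult_closed[OF rx(2)]
  have ab: "abelian_group Q"
  proof (rule abelian_groupI)
    fix q assume q: "q \<in> carrier Q"
    show "\<exists>q'\<in>carrier Q. q' \<oplus> q = \<zero>"
    proof
      show "\<ominus>\<^bsub>R\<^esub> \<one>\<^bsub>R\<^esub> \<odot> q \<in> carrier Q" using q by (intro closed) auto
      show "\<ominus>\<^bsub>R\<^esub> \<one>\<^bsub>R\<^esub> \<odot> q \<oplus> q = \<zero>" by (rule inj) (use q in \<open>auto simp: ax\<close>)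
    qed
  qed (rule closed inj; auto simp: ax)+
  interpret Q: abelian_group Q by (rule ab)
  have ringQ: "ring Q"
    by (rule ringI[OF ab monoidI]) (rule closed inj; auto simp: ax)+
  interpret Q: ring Q by (rule ringQ)
  have modQ: "Module.module R Q"
    by (rule moduleI[OF R ab]) (rule closed inj; auto simp: ax)+
  interpret M: Module.module R Q by (rule modQ)
  have e_neg: "e x (\<ominus> q) = \<ominus>\<^bsub>E x\<^esub> e x q" if "x \<in> X" "q \<in> carrier Q" for x q
  proof -
    interpret E: ring "E x" by (rule rx[OF that(1)])
    have "e x (\<ominus> q) \<oplus>\<^bsub>E x\<^esub> e x q = \<zero>\<^bsub>E x\<^esub>"
      using e(4)[OF that(1), of "\<ominus> q" q] that by (simp add: Q.l_neg e)
    then show ?thesis using that by (simp add: E.minus_equality e_closed)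
  qed
  have e_sgn: "e x (sgn_mult Q k q) = sgn_mult (E x) k (e x q)" if "x \<in> X" "q \<in> carrier Q" for x k q
    using that by (simp add: sgn_mult_def e_neg)
  have e_sum: "e x (finsum Q f A) = (\<Oplus>\<^bsub>E x\<^esub>a\<in>A. e x (f a))" if "x \<in> X" "\<And>a. a \<in> A \<Longrightarrow> f a \<in> carrier Q"
    for x :: 'i and f :: "nat \<Rightarrow> 'q" and A
  proof -
    interpret E: ring "E x" by (rule rx[OF that(1)])
    show ?thesis using that
      by (intro Q.additive_finsum[OF E.abelian_monoid_axioms]) (auto simp: e e_closed)
  qed
  have hc: "hpart Q i \<subseteq> carrier Q" for i by (auto simp: hpart)
  have hx: "e x q \<in> hpart (E x) i" if "q \<in> hpart Q i" "x \<in> X" for x q i using that by (auto simp: hpart)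
  have sub: "submodule (hpart Q i) R Q" for i
  proof (rule M.submoduleI)
    show "\<zero> \<in> hpart Q i" by (auto simp: hpart e closed intro: cdga.hpart_zero[OF cd])
  qed (auto simp: hpart e closed e_neg intro: cdga.hpart_add[OF cd] cdga.hpart_neg[OF cd] cdga.hpart_smult[OF cd])
  have dec: "\<exists>!p. (\<forall>i. p i \<in> hpart Q i) \<and> finite {i. p i \<noteq> \<zero>} \<and> q = (\<Oplus>i\<in>{i. p i \<noteq> \<zero>}. p i)"
    if q: "q \<in> carrier Q" for q
  proof -
    obtain I p where p: "finite I" "\<And>i. p i \<in> hpart Q i" "\<And>i. i \<notin> I \<Longrightarrow> p i = \<zero>"
      "\<And>x. x \<in> X \<Longrightarrow> e x q = (\<Oplus>\<^bsub>E x\<^esub>i\<in>I. e x (p i))"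
      using decomp[OF q] by blast
    have pc: "p i \<in> carrier Q" for i using p(2) hc by blast
    have "q = (\<Oplus>i\<in>I. p i)"
      by (rule inj) (use q pc p in \<open>auto simp: e_sum\<close>)
    also have "\<dots> = (\<Oplus>i\<in>{i. p i \<noteq> \<zero>}. p i)"
      by (rule Q.add.finprod_mono_neutral_cong_right) (use p pc in auto)
    finally have 1: "q = (\<Oplus>i\<in>{i. p i \<noteq> \<zero>}. p i)" .
    have fin: "finite {i. p i \<noteq> \<zero>}" using p(1,3) by (metis (mono_tags) finite_subset mem_Collect_eq subsetI)
    show ?thesis
    proof (rule ex1I[of _ p], goal_cases)
      case 1
      then show ?case using fin 1 \<open>q = (\<Oplus>i\<in>{i. p i \<noteq> \<zero>}. p i)\<close> p(2) by blast
    next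
      case (2 p')
      \<comment> \<open>A nonzero component may vanish at x, so the supports have to be compared
        before uniqueness in \<open>E x\<close> applies.\<close>
      have e_eq: "e x q = (\<Oplus>\<^bsub>E x\<^esub>i\<in>{i. e x (s i) \<noteq> \<zero>\<^bsub>E x\<^esub>}. e x (s i)) \<and> finite {i. e x (s i) \<noteq> \<zero>\<^bsub>E x\<^esub>}"
        if x: "x \<in> X" and s: "\<And>i. s i \<in> hpart Q i" "finite {i. s i \<noteq> \<zero>}" "q = (\<Oplus>i\<in>{i. s i \<noteq> \<zero>}. s i)" for x s
      proof -
        interpret E: ring "E x" by (rule rx[OF x])
        have sc: "s i \<in> carrier Q" for i using s(1) hc by blast
        have sb: "{i. e x (s i) \<noteq> \<zero>\<^bsub>E x\<^esub>} \<subseteq> {i. s i \<noteq> \<zero>}" using x by (auto simp: e)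
        have "e x q = e x (\<Oplus>i\<in>{i. s i \<noteq> \<zero>}. s i)" by (rule arg_cong[OF s(3)])
        also have "\<dots> = (\<Oplus>\<^bsub>E x\<^esub>i\<in>{i. s i \<noteq> \<zero>}. e x (s i))" using x sc by (intro e_sum)
        also have "\<dots> = (\<Oplus>\<^bsub>E x\<^esub>i\<in>{i. e x (s i) \<noteq> \<zero>\<^bsub>E x\<^esub>}. e x (s i))"
          by (rule E.add.finprod_mono_neutral_cong_right) (use s(2) sb x sc e_closed in auto)
        finally show ?thesis using finite_subset[OF sb s(2)] by blast
      qed
      show ?case
      proof
        fix i
        show "p' i = p i"
        proof (rule inj)
          fix x assume x: "x \<in> X"
          have "(\<lambda>i. e x (p' i)) = (\<lambda>i. e x (p i))"
            using e_eq[OF x, of p] e_eq[OF x, of p'] 2 fin 1 p(2) hx[OF _ x]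
            by (intro cdga.decomposition_unique[OF cd[OF x] e_closed[OF x q]]) simp_all
          then show "e x (p' i) = e x (p i)" by meson
        qed (use 2 hc p(2) in blast)+
      qed
    qed
  qed
  have one: "\<one> \<in> hpart Q 0" by (auto simp: hpart e closed intro: cdga.hpart_one[OF cd])
  have mult: "q \<otimes> q' \<in> hpart Q (i + j) \<and> q \<otimes> q' = sgn_mult Q (i * j) (q' \<otimes> q)"
    if "q \<in> hpart Q i" "q' \<in> hpart Q j" for q q' i j
  proof
    have qc: "q \<in> carrier Q" "q' \<in> carrier Q" using that hc by blast+
    show "q \<otimes> q' \<in> hpart Q (i + j)"
      using that by (auto simp: hpart e closed intro!: cdga.hpart_mult[OF cd])
    show "q \<otimes> q' = sgn_mult Q (i * j) (q' \<otimes> q)"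
    proof (rule inj)
      fix x assume x: "x \<in> X"
      show "e x (q \<otimes> q') = e x (sgn_mult Q (i * j) (q' \<otimes> q))"
        using cdga.graded_comm[OF cd[OF x] hx[OF that(1) x] hx[OF that(2) x]] x qc by (simp add: e e_sgn closed)
    qed (use qc closed in auto)
  qed
  have leib: "diff Q (q \<otimes> q') = diff Q q \<otimes> q' \<oplus> sgn_mult Q i (q \<otimes> diff Q q')"
    if "q \<in> hpart Q i" "q' \<in> carrier Q" for q q' i
  proof (rule inj)
    have qc: "q \<in> carrier Q" using that hc by blast
    fix x assume x: "x \<in> X"
    show "e x (diff Q (q \<otimes> q')) = e x (diff Q q \<otimes> q' \<oplus> sgn_mult Q i (q \<otimes> diff Q q'))"
      using cdga.diff_mult[OF cd[OF x] hx[OF that(1) x] e_closed[OF x that(2)]] x qc that(2)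
      by (simp add: e e_sgn closed Q.sgn_mult_closed)
  qed (use that hc in \<open>auto intro!: closed Q.sgn_mult_closed\<close>)
  have rest: "diff Q (q \<oplus> q') = diff Q q \<oplus> diff Q q'" "diff Q (diff Q q) = \<zero>"
    if "q \<in> carrier Q" "q' \<in> carrier Q" for q q'
    by (rule inj; use that in \<open>auto simp: e closed e_closed cdga.diff_add[OF cd] cdga.diff_diff[OF cd]\<close>)+
  have rest2: "(r \<odot> q) \<otimes> q' = r \<odot> (q \<otimes> q')" "q \<otimes> (r \<odot> q') = r \<odot> (q \<otimes> q')"
    "diff Q (r \<odot> q) = r \<odot> diff Q q"
    if "r \<in> carrier R" "q \<in> carrier Q" "q' \<in> carrier Q" for r q q'
    by (rule inj; use that in \<open>auto simp: e closed e_closed cdga.smult_mult[OF cd] cdga.diff_smult[OF cd]\<close>)+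
  have rest3: "diff Q q \<in> hpart Q (Suc i)" if "q \<in> hpart Q i" for q i
    using that by (auto simp: hpart e closed intro!: cdga.diff_hpart[OF cd])
  show ?thesis
  proof (intro conjI ballI)
    show "Q \<in> cdgas R"
    unfolding cdgas_def mem_Collect_eq
    by (intro conjI allI ballI ringQ modQ rest2 sub dec one mult[THEN conjunct1] mult[THEN conjunct2] rest rest3 leib) assumption+
    show "restrict (e x) (carrier Q) \<in> cdga_hom R Q (E x)" if "x \<in> X" for x
      using that hc hx unfolding cdga_hom_def alg_hom_def
      by (auto simp: e closed e_closed subset_iff intro!: ring_hom_memI)
  qed
qed

definition word :: "('r, 'c) dga \<Rightarrow> (nat \<Rightarrow> 'a \<Rightarrow> nat set \<Rightarrow> 'c) \<Rightarrow> (nat \<times> 'a \<times> nat set) list \<Rightarrow> 'c"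
  where "word B \<eta> w = foldr (\<lambda>(n, a, S) y. \<eta> n a S \<otimes>\<^bsub>B\<^esub> y) w \<one>\<^bsub>B\<^esub>"

lemma word_simps [simp]: "word B \<eta> [] = \<one>\<^bsub>B\<^esub>" "word B \<eta> ((n, a, S) # w) = \<eta> n a S \<otimes>\<^bsub>B\<^esub> word B \<eta> w"
  by (simp_all add: word_def)

definition symbols :: "('r, 'a) cosimp \<Rightarrow> (nat \<times> 'a \<times> nat set) set"
  where "symbols A = {(n, a, S). a \<in> carrier (level A n) \<and> S \<subseteq> {..n}}"

definition wdeg :: "(nat \<times> 'a \<times> nat set) list \<Rightarrow> nat"
  where "wdeg w = (\<Sum>(n, a, S)\<leftarrow>w. card S)"

lemma wdeg_simps [simp]: "wdeg [] = 0" "wdeg ((n, a, S) # w) = card S + wdeg w"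
  by (simp_all add: wdeg_def)

text \<open>Combinations of words as an inductive set: statements about the span are then proved by
  induction, with no coefficient functions or finite sums.\<close>

inductive_set word_span for R :: "('r, 'p) ring_scheme" and B :: "('r, 'c) dga" and \<eta> :: "nat \<Rightarrow> 'a \<Rightarrow> nat set \<Rightarrow> 'c"
  and W :: "(nat \<times> 'a \<times> nat set) list set" where
  zero: "\<zero>\<^bsub>B\<^esub> \<in> word_span R B \<eta> W"
| step: "r \<in> carrier R \<Longrightarrow> w \<in> W \<Longrightarrow> y \<in> word_span R B \<eta> W \<Longrightarrow> r \<odot>\<^bsub>B\<^esub> word B \<eta> w \<oplus>\<^bsub>B\<^esub> y \<in> word_span R B \<eta> W"

abbreviation words_of_degree :: "('r, 'a) cosimp \<Rightarrow> nat \<Rightarrow> (nat \<times> 'a \<times> nat set) list set"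
  where "words_of_degree A i \<equiv> {w \<in> lists (symbols A). wdeg w = i}"

lemma cdgas_module: "C \<in> cdgas R \<Longrightarrow> Module.module R C"
  by (simp add: cdgas_def)

lemma ccom_homD:
  assumes "\<phi> \<in> ccom_hom R A B"
  shows "\<phi> n \<in> alg_hom R (level A n) (level B n)" "\<phi> n \<in> extensional (carrier (level A n))"
    and "\<alpha> \<in> Delta m n \<Longrightarrow> x \<in> carrier (level A m) \<Longrightarrow> \<phi> n (cmap A m n \<alpha> x) = cmap B m n \<alpha> (\<phi> m x)"
  using assms by (auto simp: ccom_hom_def)

lemma cComD:
  assumes "A \<in> cCom R"
  shows "algebra R (level A n)"
    and "\<alpha> \<in> Delta m n \<Longrightarrow> cmap A m n \<alpha> \<in> alg_hom R (level A m) (level A n)"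
    and "x \<in> carrier (level A n) \<Longrightarrow> cmap A n n (\<lambda>i\<in>{..n}. i) x = x"
    and "\<alpha> \<in> Delta l m \<Longrightarrow> \<beta> \<in> Delta m n \<Longrightarrow> x \<in> carrier (level A l) \<Longrightarrow>
       cmap A l n (compose {..l} \<beta> \<alpha>) x = cmap A m n \<beta> (cmap A l m \<alpha> x)"
  using assms unfolding cCom_def by simp_all

text \<open>There are two instances: the family of all morphisms from A into \<open>K_alg\<close> of
  cdgas with one fixed carrier type, which yields the universal arrow, and a single morphism into a
  cdga of any type, which yields a copy of the subalgebra that its coefficients generate.\<close>

locale K_family =
  fixes R :: "('r, 'p) ring_scheme" and A :: "('r, 'a) cosimp" and X :: "'i set"
    and E :: "'i \<Rightarrow> ('r, 'c) dga" and \<phi> :: "'i \<Rightarrow> nat \<Rightarrow> 'a \<Rightarrow> nat set \<Rightarrow> 'c"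
  assumes A: "A \<in> cCom R"
    and E: "\<And>x. x \<in> X \<Longrightarrow> E x \<in> cdgas R"
    and \<phi>: "\<And>x. x \<in> X \<Longrightarrow> \<phi> x \<in> ccom_hom R A (K_alg (E x))"
begin

sublocale R: cring R
  using cComD(1)[OF A, of 0] by (simp add: algebra_def module_def)

lemma cd: "x \<in> X \<Longrightarrow> cdga R (E x)"
  using E by (rule cdga.intro)

lemma phi_closed: "x \<in> X \<Longrightarrow> a \<in> carrier (level A n) \<Longrightarrow> \<phi> x n a \<in> carrier (K_level (E x) n)"
  using alg_homD(1)[OF ccom_homD(1)[OF \<phi>]] cdga.level_K_alg[OF cd] by fastforce

lemma phi_hpart: "x \<in> X \<Longrightarrow> a \<in> carrier (level A n) \<Longrightarrow> S \<subseteq> {..n} \<Longrightarrow> \<phi> x n a S \<in> hpart (E x) (card S)"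
  using phi_closed cdga.K_carrierD(1)[OF cd] cdga.tensor_carrierD[OF cd] by metis

lemma phi_carrier: "x \<in> X \<Longrightarrow> a \<in> carrier (level A n) \<Longrightarrow> S \<subseteq> {..n} \<Longrightarrow> \<phi> x n a S \<in> carrier (E x)"
  using phi_hpart cdga.hpart_carrier[OF cd] by metis

abbreviation "wd x \<equiv> word (E x) (\<phi> x)"

lemma wd_hpart:
  assumes x: "x \<in> X" and w: "w \<in> lists (symbols A)"
  shows "wd x w \<in> hpart (E x) (wdeg w)"
  using w
proof (induction w)
  case (Cons s w)
  then show ?case using cdga.hpart_mult[OF cd[OF x]] phi_hpart[OF x] by (cases s) (auto simp: symbols_def)
qed (use cdga.hpart_one[OF cd[OF x]] in simp)

lemma wd_carrier: "x \<in> X \<Longrightarrow> w \<in> lists (symbols A) \<Longrightarrow> wd x w \<in> carrier (E x)"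
  using wd_hpart cdga.hpart_carrier[OF cd] by metis

lemma wd_append:
  assumes x: "x \<in> X" and w: "w \<in> lists (symbols A)" and w': "w' \<in> lists (symbols A)"
  shows "wd x (w @ w') = wd x w \<otimes>\<^bsub>E x\<^esub> wd x w'"
proof -
  interpret E: cdga R "E x" by (rule cd[OF x])
  show ?thesis using w
  proof (induction w)
    case (Cons s w)
    then show ?case using wd_carrier[OF x] w' phi_carrier[OF x] by (cases s) (auto simp: symbols_def E.m_assoc)
  qed (use wd_carrier[OF x w'] in simp)
qed

text \<open>The span of the words inside the product of the \<open>E x\<close>. One linear
  combination serves all x at the same time, so only finitely many degrees occur in an element
  although X may be infinite.\<close>

inductive_set V :: "(nat \<times> 'a \<times> nat set) list set \<Rightarrow> ('i \<Rightarrow> 'c) set"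
  for W :: "(nat \<times> 'a \<times> nat set) list set" where
  V_zero: "(\<lambda>x\<in>X. \<zero>\<^bsub>E x\<^esub>) \<in> V W"
| V_step: "r \<in> carrier R \<Longrightarrow> w \<in> W \<Longrightarrow> v \<in> V W \<Longrightarrow> (\<lambda>x\<in>X. r \<odot>\<^bsub>E x\<^esub> wd x w \<oplus>\<^bsub>E x\<^esub> v x) \<in> V W"

abbreviation "VA \<equiv> V (lists (symbols A))"

lemma V_ext: "v \<in> V W \<Longrightarrow> v \<in> extensional X"
  by (induction rule: V.induct) (simp_all only: restrict_extensional)

lemma V_carrier: "v \<in> V W \<Longrightarrow> W \<subseteq> lists (symbols A) \<Longrightarrow> x \<in> X \<Longrightarrow> v x \<in> carrier (E x)"
proof (induction rule: V.induct)
  case V_zero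
  then interpret E: cdga R "E x" using cd by blast
  show ?case using V_zero by simp
next
  case (V_step r w v)
  then interpret E: cdga R "E x" using cd by blast
  show ?case using V_step wd_carrier[of x w] by auto
qed

lemma V_hpart: "v \<in> V (words_of_degree A i) \<Longrightarrow> x \<in> X \<Longrightarrow> v x \<in> hpart (E x) i"
proof (induction rule: V.induct)
  case V_zero
  then interpret E: cdga R "E x" using cd by blast
  show ?case using V_zero by simp
next
  case (V_step r w v)
  then interpret E: cdga R "E x" using cd by blast
  show ?case using V_step wd_hpart[of x w] by (auto intro!: E.hpart_add E.hpart_smult)
qed

lemma V_mono: "v \<in> V W \<Longrightarrow> W \<subseteq> W' \<Longrightarrow> v \<in> V W'"
  by (induction rule: V.induct) (auto intro: V.V_zero V.V_step simp del: restrict_apply)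

lemma V_add:
  assumes v: "v \<in> V W" and v': "v' \<in> V W" and W: "W \<subseteq> lists (symbols A)"
  shows "(\<lambda>x\<in>X. v x \<oplus>\<^bsub>E x\<^esub> v' x) \<in> V W"
  using v
proof (induction rule: V.induct)
  case V_zero
  have "(\<lambda>x\<in>X. (\<lambda>x\<in>X. \<zero>\<^bsub>E x\<^esub>) x \<oplus>\<^bsub>E x\<^esub> v' x) = v'"
  proof (rule extensionalityI[of _ X])
    fix x assume x: "x \<in> X"
    then interpret E: cdga R "E x" using cd by blast
    show "(\<lambda>x\<in>X. (\<lambda>x\<in>X. \<zero>\<^bsub>E x\<^esub>) x \<oplus>\<^bsub>E x\<^esub> v' x) x = v' x" using V_carrier[OF v' W x] x by simp
  qed (use V_ext[OF v'] in auto)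
  then show ?case using v' by simp
next
  case (V_step r w v)
  have "(\<lambda>x\<in>X. (\<lambda>x\<in>X. r \<odot>\<^bsub>E x\<^esub> wd x w \<oplus>\<^bsub>E x\<^esub> v x) x \<oplus>\<^bsub>E x\<^esub> v' x) =
     (\<lambda>x\<in>X. r \<odot>\<^bsub>E x\<^esub> wd x w \<oplus>\<^bsub>E x\<^esub> (\<lambda>x\<in>X. v x \<oplus>\<^bsub>E x\<^esub> v' x) x)"
  proof (rule restrict_ext, goal_cases)
    case x: (1 x)
    then interpret E: cdga R "E x" by (rule cd)
    have "wd x w \<in> carrier (E x)" using V_step W by (intro wd_carrier[OF x]) auto
    then show ?case
      using V_carrier[OF v' W x] V_carrier[OF V_step(3) W x] x V_step(1) by (simp add: E.a_assoc)
  qed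
  then show ?case using V.V_step[OF V_step(1,2,4)] by (simp only:)
qed

lemma V_smult:
  assumes v: "v \<in> V W" and s: "s \<in> carrier R" and W: "W \<subseteq> lists (symbols A)"
  shows "(\<lambda>x\<in>X. s \<odot>\<^bsub>E x\<^esub> v x) \<in> V W"
  using v
proof (induction rule: V.induct)
  case V_zero
  have "(\<lambda>x\<in>X. s \<odot>\<^bsub>E x\<^esub> (\<lambda>x\<in>X. \<zero>\<^bsub>E x\<^esub>) x) = (\<lambda>x\<in>X. \<zero>\<^bsub>E x\<^esub>)"
  proof (rule restrict_ext, goal_cases)
    case x: (1 x)
    then interpret E: cdga R "E x" by (rule cd)
    show ?case using x s by simp
  qed
  then show ?case using V.V_zero by (simp only:)
next
  case (V_step r w v)
  have "(\<lambda>x\<in>X. s \<odot>\<^bsub>E x\<^esub> (\<lambda>x\<in>X. r \<odot>\<^bsub>E x\<^esub> wd x w \<oplus>\<^bsub>E x\<^esub> v x) x) =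
     (\<lambda>x\<in>X. (s \<otimes>\<^bsub>R\<^esub> r) \<odot>\<^bsub>E x\<^esub> wd x w \<oplus>\<^bsub>E x\<^esub> (\<lambda>x\<in>X. s \<odot>\<^bsub>E x\<^esub> v x) x)"
  proof (rule restrict_ext, goal_cases)
    case x: (1 x)
    then interpret E: cdga R "E x" by (rule cd)
    have "wd x w \<in> carrier (E x)" using V_step W by (intro wd_carrier[OF x]) auto
    then show ?case
      using V_carrier[OF V_step(3) W x] x V_step(1) s by (simp add: E.M.smult_r_distr E.M.smult_assoc1)
  qed
  then show ?case using V.V_step[OF R.m_closed[OF s V_step(1)] V_step(2,4)] by (simp only:)
qed

lemma V_word: "w \<in> W \<Longrightarrow> W \<subseteq> lists (symbols A) \<Longrightarrow> (\<lambda>x\<in>X. wd x w) \<in> V W"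
proof -
  assume w: "w \<in> W" "W \<subseteq> lists (symbols A)"
  have "(\<lambda>x\<in>X. \<one>\<^bsub>R\<^esub> \<odot>\<^bsub>E x\<^esub> wd x w \<oplus>\<^bsub>E x\<^esub> (\<lambda>x\<in>X. \<zero>\<^bsub>E x\<^esub>) x) = (\<lambda>x\<in>X. wd x w)"
  proof (rule restrict_ext, goal_cases)
    case x: (1 x)
    then interpret E: cdga R "E x" by (rule cd)
    show ?case
      using wd_carrier[OF x, of w] subsetD[OF w(2,1)] x by simp
  qed
  then show ?thesis using V.V_step[OF R.one_closed w(1) V.V_zero] by simp
qed

text \<open>Reduces closure under a family of linear maps to the case of words; left and right
  multiplication and the differential are all treated in this way.\<close>

lemma V_linear:
  assumes v: "v \<in> VA"
    and h0: "\<And>x. x \<in> X \<Longrightarrow> h x \<zero>\<^bsub>E x\<^esub> = \<zero>\<^bsub>E x\<^esub>"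
    and h: "\<And>x r a b. x \<in> X \<Longrightarrow> r \<in> carrier R \<Longrightarrow> a \<in> carrier (E x) \<Longrightarrow> b \<in> carrier (E x) \<Longrightarrow>
      h x (r \<odot>\<^bsub>E x\<^esub> a \<oplus>\<^bsub>E x\<^esub> b) = r \<odot>\<^bsub>E x\<^esub> h x a \<oplus>\<^bsub>E x\<^esub> h x b"
    and w: "\<And>w. w \<in> lists (symbols A) \<Longrightarrow> (\<lambda>x\<in>X. h x (wd x w)) \<in> VA"
  shows "(\<lambda>x\<in>X. h x (v x)) \<in> VA"
  using v
proof (induction rule: V.induct)
  case V_zero
  have "(\<lambda>x\<in>X. h x ((\<lambda>x\<in>X. \<zero>\<^bsub>E x\<^esub>) x)) = (\<lambda>x\<in>X. \<zero>\<^bsub>E x\<^esub>)"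
    by (rule restrict_ext) (simp add: h0)
  then show ?case using V.V_zero by (simp only:)
next
  case (V_step r w v)
  have "(\<lambda>x\<in>X. h x ((\<lambda>x\<in>X. r \<odot>\<^bsub>E x\<^esub> wd x w \<oplus>\<^bsub>E x\<^esub> v x) x)) =
     (\<lambda>x\<in>X. (\<lambda>x\<in>X. r \<odot>\<^bsub>E x\<^esub> (\<lambda>x\<in>X. h x (wd x w)) x) x \<oplus>\<^bsub>E x\<^esub> (\<lambda>x\<in>X. h x (v x)) x)"
    by (rule restrict_ext) (simp add: h V_step(1) V_carrier[OF V_step(3) order_refl] wd_carrier[OF _ V_step(2)])
  then show ?case using V_add[OF V_smult[OF w[OF V_step(2)] V_step(1) order_refl] V_step(4) order_refl] by (simp only:)
qed

lemma V_word_mult: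
  assumes v: "v \<in> VA" and u: "u \<in> lists (symbols A)"
  shows "(\<lambda>x\<in>X. wd x u \<otimes>\<^bsub>E x\<^esub> v x) \<in> VA"
proof (rule V_linear[OF v, where h="\<lambda>x y. wd x u \<otimes>\<^bsub>E x\<^esub> y"])
  fix w assume w: "w \<in> lists (symbols A)"
  have "(\<lambda>x\<in>X. wd x u \<otimes>\<^bsub>E x\<^esub> wd x w) = (\<lambda>x\<in>X. wd x (u @ w))"
    by (rule restrict_ext) (simp add: wd_append u w)
  then show "(\<lambda>x\<in>X. wd x u \<otimes>\<^bsub>E x\<^esub> wd x w) \<in> VA" using V_word[of "u @ w" "lists (symbols A)"] u w by (simp only: append_in_lists_conv simp_thms order_refl)
next
  fix x assume x: "x \<in> X"
  then interpret E: cdga R "E x" using cd by blast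
  note u' = wd_carrier[OF x u]
  show "wd x u \<otimes>\<^bsub>E x\<^esub> \<zero>\<^bsub>E x\<^esub> = \<zero>\<^bsub>E x\<^esub>" using u' by simp
  show "wd x u \<otimes>\<^bsub>E x\<^esub> (r \<odot>\<^bsub>E x\<^esub> a \<oplus>\<^bsub>E x\<^esub> b) = r \<odot>\<^bsub>E x\<^esub> (wd x u \<otimes>\<^bsub>E x\<^esub> a) \<oplus>\<^bsub>E x\<^esub> wd x u \<otimes>\<^bsub>E x\<^esub> b"
    if "r \<in> carrier R" "a \<in> carrier (E x)" "b \<in> carrier (E x)" for r a b
    using that u' by (simp add: E.r_distr E.smult_mult)
qed

lemma V_mult:
  assumes v: "v \<in> VA" and v': "v' \<in> VA"
  shows "(\<lambda>x\<in>X. v x \<otimes>\<^bsub>E x\<^esub> v' x) \<in> VA"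
proof (rule V_linear[OF v, where h="\<lambda>x y. y \<otimes>\<^bsub>E x\<^esub> v' x"])
  fix x assume x: "x \<in> X"
  then interpret E: cdga R "E x" using cd by blast
  note v'' = V_carrier[OF v' order_refl x]
  show "\<zero>\<^bsub>E x\<^esub> \<otimes>\<^bsub>E x\<^esub> v' x = \<zero>\<^bsub>E x\<^esub>" using v'' by simp
  show "(r \<odot>\<^bsub>E x\<^esub> a \<oplus>\<^bsub>E x\<^esub> b) \<otimes>\<^bsub>E x\<^esub> v' x = r \<odot>\<^bsub>E x\<^esub> (a \<otimes>\<^bsub>E x\<^esub> v' x) \<oplus>\<^bsub>E x\<^esub> b \<otimes>\<^bsub>E x\<^esub> v' x"
    if "r \<in> carrier R" "a \<in> carrier (E x)" "b \<in> carrier (E x)" for r a b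
    using that v'' by (simp add: E.l_distr E.smult_mult)
qed (rule V_word_mult[OF v'])

lemma V_sgn:
  assumes "v \<in> VA"
  shows "(\<lambda>x\<in>X. sgn_mult (E x) k (v x)) \<in> VA"
proof (cases "even k")
  case True
  then have "(\<lambda>x\<in>X. sgn_mult (E x) k (v x)) = v"
    using V_ext[OF assms] by (intro extensionalityI[of _ X]) (auto simp: sgn_mult_def)
  then show ?thesis using assms by simp
next
  case False
  have "(\<lambda>x\<in>X. sgn_mult (E x) k (v x)) = (\<lambda>x\<in>X. \<ominus>\<^bsub>R\<^esub> \<one>\<^bsub>R\<^esub> \<odot>\<^bsub>E x\<^esub> v x)"
  proof (rule restrict_ext, goal_cases)
    case x: (1 x)
    then interpret E: cdga R "E x" by (rule cd)
    show ?case
      using False V_carrier[OF assms order_refl x] by (simp add: sgn_mult_def E.M.smult_l_minus)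
  qed
  then show ?thesis using V_smult[OF assms, of "\<ominus>\<^bsub>R\<^esub> \<one>\<^bsub>R\<^esub>"] by simp
qed

lemma V_sum:
  assumes "finite T" "\<And>t. t \<in> T \<Longrightarrow> f t \<in> VA"
  shows "(\<lambda>x\<in>X. \<Oplus>\<^bsub>E x\<^esub>t\<in>T. f t x) \<in> VA"
  using assms
proof (induction T rule: finite_induct)
  case empty
  have "(\<lambda>x\<in>X. \<Oplus>\<^bsub>E x\<^esub>t\<in>{}. f t x) = (\<lambda>x\<in>X. \<zero>\<^bsub>E x\<^esub>)"
  proof (rule restrict_ext, goal_cases)
    case x: (1 x)
    then interpret E: cdga R "E x" by (rule cd)
    show ?case by simp
  qed
  then show ?case using V.V_zero by (simp only:)
next
  case (insert t T)
  have "(\<lambda>x\<in>X. \<Oplus>\<^bsub>E x\<^esub>t\<in>insert t T. f t x) = (\<lambda>x\<in>X. f t x \<oplus>\<^bsub>E x\<^esub> (\<lambda>x\<in>X. \<Oplus>\<^bsub>E x\<^esub>t\<in>T. f t x) x)"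
  proof (rule restrict_ext, goal_cases)
    case x: (1 x)
    then interpret E: cdga R "E x" by (rule cd)
    show ?case
      using insert x V_carrier[OF _ order_refl x] by (auto intro!: E.finsum_insert)
  qed
  moreover have "f t \<in> VA" by (rule insert.prems) simp
  moreover have "(\<lambda>x\<in>X. \<Oplus>\<^bsub>E x\<^esub>t\<in>T. f t x) \<in> VA" by (rule insert.IH, rule insert.prems) simp
  ultimately show ?case using V_add[of "f t" "lists (symbols A)" "\<lambda>x\<in>X. \<Oplus>\<^bsub>E x\<^esub>t\<in>T. f t x", OF _ _ order_refl]
    by (simp only:)
qed

lemma V_gen: "a \<in> carrier (level A n) \<Longrightarrow> S \<subseteq> {..n} \<Longrightarrow> (\<lambda>x\<in>X. \<phi> x n a S) \<in> VA"
proof -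
  assume a: "a \<in> carrier (level A n)" "S \<subseteq> {..n}"
  have "(\<lambda>x\<in>X. \<phi> x n a S) = (\<lambda>x\<in>X. wd x [(n, a, S)])"
  proof (rule restrict_ext, goal_cases)
    case x: (1 x)
    then interpret E: cdga R "E x" by (rule cd)
    show ?case using phi_carrier[OF x a] by simp
  qed
  then show ?thesis using V_word[of "[(n, a, S)]"] a by (auto simp: symbols_def)
qed

text \<open>This is the cocycle equation of \<open>\<phi> x n a\<close> at S, in which the index
  sets and signs are the same for all x. Closure of the span under the differential rests on
  it.\<close>

lemma V_diff_gen:
  assumes a: "a \<in> carrier (level A n)" "S \<subseteq> {..n}"
  shows "(\<lambda>x\<in>X. diff (E x) (\<phi> x n a S)) \<in> VA"
proof -
  have "(\<lambda>x\<in>X. diff (E x) (\<phi> x n a S)) = (\<lambda>x\<in>X. \<Oplus>\<^bsub>E x\<^esub>t\<in>{..n} - S.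
      (\<lambda>x\<in>X. sgn_mult (E x) (inversions S {t}) ((\<lambda>x\<in>X. \<phi> x n a (insert t S)) x)) x)"
  proof (rule restrict_ext, goal_cases)
    case x: (1 x)
    then interpret E: cdga R "E x" by (rule cd)
    show ?case
      using E.K_carrierD(2)[OF phi_closed[OF x a(1)]] a x by (simp add: E.cocycle_def)
  qed
  moreover have "\<dots> \<in> VA" by (intro V_sum V_sgn V_gen) (use a in auto)
  ultimately show ?thesis by simp
qed

lemma V_diff_word: "w \<in> lists (symbols A) \<Longrightarrow> (\<lambda>x\<in>X. diff (E x) (wd x w)) \<in> VA"
proof (induction w)
  case Nil
  have "(\<lambda>x\<in>X. diff (E x) (wd x [])) = (\<lambda>x\<in>X. \<zero>\<^bsub>E x\<^esub>)"
  proof (rule restrict_ext, goal_cases)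
    case x: (1 x)
    then interpret E: cdga R "E x" by (rule cd)
    show ?case by (simp add: E.diff_one)
  qed
  then show ?case using V.V_zero by (simp only:)
next
  case (Cons s w)
  obtain n a S where s: "s = (n, a, S)" by (cases s)
  have a: "a \<in> carrier (level A n)" "S \<subseteq> {..n}" and w: "w \<in> lists (symbols A)"
    using Cons.prems s by (auto simp: symbols_def)
  have "(\<lambda>x\<in>X. diff (E x) (wd x (s # w))) = (\<lambda>x\<in>X.
      (\<lambda>x\<in>X. (\<lambda>x\<in>X. diff (E x) (\<phi> x n a S)) x \<otimes>\<^bsub>E x\<^esub> (\<lambda>x\<in>X. wd x w) x) x \<oplus>\<^bsub>E x\<^esub>
      (\<lambda>x\<in>X. sgn_mult (E x) (card S) ((\<lambda>x\<in>X. (\<lambda>x\<in>X. \<phi> x n a S) x \<otimes>\<^bsub>E x\<^esub> (\<lambda>x\<in>X. diff (E x) (wd x w)) x) x)) x)"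
  proof (rule restrict_ext, goal_cases)
    case x: (1 x)
    then interpret E: cdga R "E x" by (rule cd)
    show ?case
      using x E.diff_mult[OF phi_hpart[OF x a] wd_carrier[OF x w]] by (simp add: s)
  qed
  moreover have "\<dots> \<in> VA"
    by (intro V_add V_mult V_sgn V_diff_gen V_gen V_word Cons.IH a order_refl w)
  ultimately show ?case by (simp only:)
qed

lemma V_diff:
  assumes "v \<in> VA"
  shows "(\<lambda>x\<in>X. diff (E x) (v x)) \<in> VA"
  by (rule V_linear[OF assms, where h="\<lambda>x. diff (E x)"])
    (auto simp: cdga.diff_zero[OF cd] cdga.diff_add[OF cd] cdga.diff_smult[OF cd]
      module.smult_closed[OF cdgas_module[OF E]] simp del: restrict_apply intro: V_diff_word)

text \<open>Sorting a combination by the degrees of its words works for all x at once, since the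
  degree of a word does not depend on x.\<close>

lemma V_decomp:
  assumes "v \<in> VA"
  shows "\<exists>I p. finite I \<and> (\<forall>i. p i \<in> V (words_of_degree A i)) \<and> (\<forall>i. i \<notin> I \<longrightarrow> p i = (\<lambda>x\<in>X. \<zero>\<^bsub>E x\<^esub>)) \<and>
     (\<forall>x\<in>X. v x = (\<Oplus>\<^bsub>E x\<^esub>i\<in>I. p i x))"
  using assms
proof (induction rule: V.induct)
  case V_zero
  show ?case
  proof (rule exI[of _ "{}"], rule exI[of _ "\<lambda>_. \<lambda>x\<in>X. \<zero>\<^bsub>E x\<^esub>"], intro conjI ballI allI impI)
    fix x assume x: "x \<in> X"
    then interpret E: cdga R "E x" using cd by blast
    show "(\<lambda>x\<in>X. \<zero>\<^bsub>E x\<^esub>) x = (\<Oplus>\<^bsub>E x\<^esub>i\<in>{}. (\<lambda>x\<in>X. \<zero>\<^bsub>E x\<^esub>) x)" using x by simp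
  qed (auto simp del: restrict_apply intro: V.V_zero)
next
  case (V_step r w v)
  then obtain I p where p: "finite I" "\<And>i. p i \<in> V (words_of_degree A i)" "\<And>i. i \<notin> I \<Longrightarrow> p i = (\<lambda>x\<in>X. \<zero>\<^bsub>E x\<^esub>)"
     "\<And>x. x \<in> X \<Longrightarrow> v x = (\<Oplus>\<^bsub>E x\<^esub>i\<in>I. p i x)" by blast
  define d where "d = wdeg w"
  define p' where "p' = p(d := \<lambda>x\<in>X. r \<odot>\<^bsub>E x\<^esub> wd x w \<oplus>\<^bsub>E x\<^esub> p d x)"
  have "p' i \<in> V (words_of_degree A i)" for i
    using p(2) V.V_step[OF V_step(1) _ p(2)[of d], of w] V_step(2) by (auto simp: p'_def d_def)
  moreover have "p' i = (\<lambda>x\<in>X. \<zero>\<^bsub>E x\<^esub>)" if "i \<notin> insert d I" for i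
    using that p(3) by (auto simp: p'_def)
  moreover have "(\<lambda>x\<in>X. r \<odot>\<^bsub>E x\<^esub> wd x w \<oplus>\<^bsub>E x\<^esub> v x) x = (\<Oplus>\<^bsub>E x\<^esub>i\<in>insert d I. p' i x)" if x: "x \<in> X" for x
  proof -
    interpret E: cdga R "E x" using cd x by blast
    have pc: "p i x \<in> carrier (E x)" for i
      using V_carrier[OF p(2) _ x] by auto
    have wc: "wd x w \<in> carrier (E x)" using wd_carrier[OF x V_step(2)] .
    have ins: "insert d I = insert d (I - {d})" by auto
    have "v x = (\<Oplus>\<^bsub>E x\<^esub>i\<in>insert d I. p i x)"
      unfolding p(4)[OF x] using p(1,3) pc x
      by (intro E.add.finprod_mono_neutral_cong_left) auto
    also have "\<dots> = p d x \<oplus>\<^bsub>E x\<^esub> (\<Oplus>\<^bsub>E x\<^esub>i\<in>I - {d}. p i x)"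
      by (subst ins, rule E.finsum_insert) (use p(1) pc in auto)
    also have "(\<Oplus>\<^bsub>E x\<^esub>i\<in>I - {d}. p i x) = (\<Oplus>\<^bsub>E x\<^esub>i\<in>I - {d}. p' i x)"
      by (rule E.finsum_cong') (use pc in \<open>auto simp: p'_def\<close>)
    finally have "r \<odot>\<^bsub>E x\<^esub> wd x w \<oplus>\<^bsub>E x\<^esub> v x = p' d x \<oplus>\<^bsub>E x\<^esub> (\<Oplus>\<^bsub>E x\<^esub>i\<in>I - {d}. p' i x)"
      using x pc wc V_step(1) by (simp add: p'_def E.a_assoc Pi_def)
    also have "\<dots> = (\<Oplus>\<^bsub>E x\<^esub>i\<in>insert d I. p' i x)"
      by (subst ins, rule E.finsum_insert[symmetric]) (use p(1) pc wc x V_step(1) in \<open>auto simp: p'_def\<close>)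
    finally show ?thesis using x by simp
  qed
  moreover have "finite (insert d I)" using p(1) by simp
  ultimately show ?case by blast
qed

end

section \<open>Coding the generated subalgebra by coefficient functions\<close>

context K_family
begin

text \<open>F is only a bound on the support of c; different bounds for the same c give the same
  v.\<close>

definition rep :: "('i \<Rightarrow> 'c) \<Rightarrow> ((nat \<times> 'a \<times> nat set) list \<Rightarrow> 'r) \<Rightarrow> (nat \<times> 'a \<times> nat set) list set \<Rightarrow> bool"
  where "rep v c F \<longleftrightarrow> finite F \<and> F \<subseteq> lists (symbols A) \<and> (\<forall>w. c w \<in> carrier R) \<and> (\<forall>w. w \<notin> F \<longrightarrow> c w = \<zero>\<^bsub>R\<^esub>) \<and>
     v = (\<lambda>x\<in>X. \<Oplus>\<^bsub>E x\<^esub>w\<in>F. c w \<odot>\<^bsub>E x\<^esub> wd x w)"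

lemma rep_mono:
  assumes "rep v c F" "F \<subseteq> F'" "finite F'" "F' \<subseteq> lists (symbols A)"
  shows "rep v c F'"
proof -
  have "(\<Oplus>\<^bsub>E x\<^esub>w\<in>F. c w \<odot>\<^bsub>E x\<^esub> wd x w) = (\<Oplus>\<^bsub>E x\<^esub>w\<in>F'. c w \<odot>\<^bsub>E x\<^esub> wd x w)" if x: "x \<in> X" for x
  proof -
    interpret E: cdga R "E x" using cd x by blast
    have "c w \<odot>\<^bsub>E x\<^esub> wd x w \<in> carrier (E x)" if "w \<in> F'" for w
      using assms(1) subsetD[OF assms(4) that] wd_carrier[OF x, of w] unfolding rep_def by blast
    moreover have "c w \<odot>\<^bsub>E x\<^esub> wd x w = \<zero>\<^bsub>E x\<^esub>" if "w \<in> F' - F" for w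
    proof -
      have "w \<in> lists (symbols A)" "c w = \<zero>\<^bsub>R\<^esub>" using that assms(1,4) unfolding rep_def by blast+
      then show ?thesis using wd_carrier[OF x] by simp
    qed
    ultimately show ?thesis
      using assms by (intro E.add.finprod_mono_neutral_cong_left) auto
  qed
  then show ?thesis using assms unfolding rep_def by (auto intro!: restrict_ext)
qed

text \<open>Two finite bounds on the support can be enlarged to a common one, where the same
  coefficient function gives the same sums.\<close>

lemma rep_unique:
  assumes "rep v c F" "rep v' c F'"
  shows "v = v'"
proof -
  have "finite (F \<union> F')" "F \<union> F' \<subseteq> lists (symbols A)" using assms unfolding rep_def by blast+
  then have "rep v c (F \<union> F')" "rep v' c (F \<union> F')"
    using rep_mono[OF assms(1)] rep_mono[OF assms(2)] by simp_all
  then show ?thesis by (simp add: rep_def)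
qed

lemma rep_exists: "v \<in> VA \<Longrightarrow> \<exists>c F. rep v c F"
proof (induction rule: V.induct)
  case V_zero
  have "rep (\<lambda>x\<in>X. \<zero>\<^bsub>E x\<^esub>) (\<lambda>_. \<zero>\<^bsub>R\<^esub>) {}"
    unfolding rep_def
  proof (intro conjI)
    show "(\<lambda>x\<in>X. \<zero>\<^bsub>E x\<^esub>) = (\<lambda>x\<in>X. \<Oplus>\<^bsub>E x\<^esub>w\<in>{}. \<zero>\<^bsub>R\<^esub> \<odot>\<^bsub>E x\<^esub> wd x w)"
    proof (rule restrict_ext)
      fix x assume x: "x \<in> X"
      interpret E: cdga R "E x" using cd x by blast
      show "\<zero>\<^bsub>E x\<^esub> = (\<Oplus>\<^bsub>E x\<^esub>w\<in>{}. \<zero>\<^bsub>R\<^esub> \<odot>\<^bsub>E x\<^esub> wd x w)" by simp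
    qed
  qed auto
  then show ?case by blast
next
  case (V_step r w v)
  then obtain c F0 where c0: "rep v c F0" by blast
  define F where "F = insert w F0"
  have "finite F" "F \<subseteq> lists (symbols A)" using c0 V_step(2) unfolding rep_def F_def by blast+
  then have c: "rep v c F" using rep_mono[OF c0] by (auto simp: F_def)
  \<comment> \<open>The word w may already occur in the combination, so its coefficient is increased
    and not set.\<close>
  define c' where "c' = c(w := c w \<oplus>\<^bsub>R\<^esub> r)"
  have "rep (\<lambda>x\<in>X. r \<odot>\<^bsub>E x\<^esub> wd x w \<oplus>\<^bsub>E x\<^esub> v x) c' F"
    unfolding rep_def
  proof (intro conjI)
    show "(\<lambda>x\<in>X. r \<odot>\<^bsub>E x\<^esub> wd x w \<oplus>\<^bsub>E x\<^esub> v x) = (\<lambda>x\<in>X. \<Oplus>\<^bsub>E x\<^esub>w\<in>F. c' w \<odot>\<^bsub>E x\<^esub> wd x w)"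
    proof (rule restrict_ext)
      fix x assume x: "x \<in> X"
      interpret E: cdga R "E x" using cd x by blast
      have F: "F = insert w (F - {w})" "finite (F - {w})" using c by (auto simp: F_def rep_def)
      have wc: "wd x u \<in> carrier (E x)" if "u \<in> F" for u using that c by (intro wd_carrier[OF x]) (auto simp: rep_def)
      have cc: "c u \<in> carrier R" for u using c by (auto simp: rep_def)
      have wF: "wd x w \<in> carrier (E x)" using wc F by blast
      have "v x = (\<Oplus>\<^bsub>E x\<^esub>w\<in>F. c w \<odot>\<^bsub>E x\<^esub> wd x w)" using c x by (simp add: rep_def)
      also have "\<dots> = c w \<odot>\<^bsub>E x\<^esub> wd x w \<oplus>\<^bsub>E x\<^esub> (\<Oplus>\<^bsub>E x\<^esub>w\<in>F - {w}. c w \<odot>\<^bsub>E x\<^esub> wd x w)"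
        by (subst F(1), rule E.finsum_insert) (use F wc cc wF in auto)
      also have "(\<Oplus>\<^bsub>E x\<^esub>w\<in>F - {w}. c w \<odot>\<^bsub>E x\<^esub> wd x w) = (\<Oplus>\<^bsub>E x\<^esub>w\<in>F - {w}. c' w \<odot>\<^bsub>E x\<^esub> wd x w)"
        by (rule E.finsum_cong') (use wc cc in \<open>auto simp: c'_def\<close>)
      finally have v: "v x = c w \<odot>\<^bsub>E x\<^esub> wd x w \<oplus>\<^bsub>E x\<^esub> (\<Oplus>\<^bsub>E x\<^esub>w\<in>F - {w}. c' w \<odot>\<^bsub>E x\<^esub> wd x w)" .
      have s: "(\<Oplus>\<^bsub>E x\<^esub>w\<in>F - {w}. c' w \<odot>\<^bsub>E x\<^esub> wd x w) \<in> carrier (E x)"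
        by (rule E.finsum_closed) (use wc cc in \<open>auto simp: c'_def\<close>)
      have "(\<Oplus>\<^bsub>E x\<^esub>w\<in>F. c' w \<odot>\<^bsub>E x\<^esub> wd x w) = c' w \<odot>\<^bsub>E x\<^esub> wd x w \<oplus>\<^bsub>E x\<^esub> (\<Oplus>\<^bsub>E x\<^esub>w\<in>F - {w}. c' w \<odot>\<^bsub>E x\<^esub> wd x w)"
        by (subst F(1), rule E.finsum_insert) (use F wc cc wF V_step(1) in \<open>auto simp: c'_def\<close>)
      also have "c' w \<odot>\<^bsub>E x\<^esub> wd x w = r \<odot>\<^bsub>E x\<^esub> wd x w \<oplus>\<^bsub>E x\<^esub> c w \<odot>\<^bsub>E x\<^esub> wd x w"
        using wF cc V_step(1) by (simp add: c'_def E.M.smult_l_distr E.a_comm)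
      finally show "r \<odot>\<^bsub>E x\<^esub> wd x w \<oplus>\<^bsub>E x\<^esub> v x = (\<Oplus>\<^bsub>E x\<^esub>w\<in>F. c' w \<odot>\<^bsub>E x\<^esub> wd x w)"
        unfolding v using wF cc V_step(1) s by (simp add: E.a_assoc)
    qed
  qed (use c V_step in \<open>auto simp: rep_def c'_def F_def\<close>)
  then show ?case by blast
qed

text \<open>The fibre over v of the evaluation map on the free associative algebra with generators
  \<open>symbols A\<close>. Distinct elements of \<open>VA\<close> have disjoint nonempty fibres,
  and the type of these sets does not depend on the type of the \<open>E x\<close>.\<close>

definition code :: "('i \<Rightarrow> 'c) \<Rightarrow> ('r, 'a) lcarrier"
  where "code v = {c. \<exists>F. rep v c F}"

definition dec :: "('r, 'a) lcarrier \<Rightarrow> 'i \<Rightarrow> 'c"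
  where "dec = inv_into VA code"

lemma code_inj: "inj_on code VA"
proof (rule inj_onI)
  fix v v' assume v: "v \<in> VA" "v' \<in> VA" "code v = code v'"
  obtain c F where "rep v c F" using rep_exists[OF v(1)] by blast
  then have "c \<in> code v'" using v(3) by (auto simp: code_def)
  then show "v = v'" using rep_unique \<open>rep v c F\<close> by (auto simp: code_def)
qed

lemma dec_code: "v \<in> VA \<Longrightarrow> dec (code v) = v"
  unfolding dec_def by (rule inv_into_f_f[OF code_inj])

definition Q :: "('r, ('r, 'a) lcarrier) dga"
  where "Q = \<lparr> carrier = code ` VA,
     monoid.mult = (\<lambda>p q. code (\<lambda>x\<in>X. dec p x \<otimes>\<^bsub>E x\<^esub> dec q x)),
     one = code (\<lambda>x\<in>X. \<one>\<^bsub>E x\<^esub>),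
     zero = code (\<lambda>x\<in>X. \<zero>\<^bsub>E x\<^esub>),
     add = (\<lambda>p q. code (\<lambda>x\<in>X. dec p x \<oplus>\<^bsub>E x\<^esub> dec q x)),
     smult = (\<lambda>r q. code (\<lambda>x\<in>X. r \<odot>\<^bsub>E x\<^esub> dec q x)),
     hpart = (\<lambda>i. {q \<in> code ` VA. \<forall>x\<in>X. dec q x \<in> hpart (E x) i}),
     diff = (\<lambda>q. code (\<lambda>x\<in>X. diff (E x) (dec q x))) \<rparr>"

lemma dec_V: "q \<in> carrier Q \<Longrightarrow> dec q \<in> VA"
  by (auto simp: Q_def dec_code)

lemma one_V: "(\<lambda>x\<in>X. \<one>\<^bsub>E x\<^esub>) \<in> VA"
  using V_word[of "[]" "lists (symbols A)"] by (simp only: word_simps lists.Nil order_refl)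

lemma code_Q: "v \<in> VA \<Longrightarrow> code v \<in> carrier Q"
  by (simp add: Q_def)

lemmas V_ops = V_mult[OF dec_V dec_V] V_add[OF dec_V dec_V order_refl] V_smult[OF dec_V _ order_refl] V_diff[OF dec_V] one_V
  V.V_zero[of "lists (symbols A)"]

definition proj :: "'i \<Rightarrow> ('r, 'a) lcarrier \<Rightarrow> 'c"
  where "proj x = (\<lambda>q\<in>carrier Q. dec q x)"

lemma Q_zero_code: "\<zero>\<^bsub>Q\<^esub> = code (\<lambda>x\<in>X. \<zero>\<^bsub>E x\<^esub>)"
  by (simp add: Q_def)

lemma V_hpart_VA: "v \<in> V (words_of_degree A i) \<Longrightarrow> v \<in> VA"
  by (erule V_mono) auto

text \<open>The axioms are reflected along the evaluations of the decoded element at the points of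
  X, which are jointly injective because elements of \<open>VA\<close> are extensional on X.\<close>

lemma Q_cdgas: "Q \<in> cdgas R"
  and proj_hom: "x \<in> X \<Longrightarrow> proj x \<in> cdga_hom R Q (E x)"
proof -
  have 1: "Q \<in> cdgas R \<and> (\<forall>x\<in>X. restrict (\<lambda>q. dec q x) (carrier Q) \<in> cdga_hom R Q (E x))"
  proof (rule cdgas_reflect[where X=X and E=E and e="\<lambda>x q. dec q x" and Q=Q])
    show "q = q'" if "q \<in> carrier Q" "q' \<in> carrier Q" "\<And>x. x \<in> X \<Longrightarrow> dec q x = dec q' x" for q q'
    proof -
      have "dec q = dec q'"
        using that V_ext[OF dec_V] by (intro extensionalityI[of _ X]) auto
      then show ?thesis using that(1,2) by (auto simp: Q_def dec_code)
    qed
    show "dec q x \<in> carrier (E x)" if "x \<in> X" "q \<in> carrier Q" for x q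
      using V_carrier[OF dec_V[OF that(2)] order_refl that(1)] .
    show "\<zero>\<^bsub>Q\<^esub> \<in> carrier Q" "\<one>\<^bsub>Q\<^esub> \<in> carrier Q"
      using code_Q[OF V_ops(6)] code_Q[OF V_ops(5)] by (simp_all only: Q_def dga.simps module.simps ring.simps monoid.simps)
    show "dec \<zero>\<^bsub>Q\<^esub> x = \<zero>\<^bsub>E x\<^esub>" "dec \<one>\<^bsub>Q\<^esub> x = \<one>\<^bsub>E x\<^esub>" if "x \<in> X" for x
      using that dec_code[OF V_ops(6)] dec_code[OF V_ops(5)] by (simp_all add: Q_def)
    fix q q' assume q: "q \<in> carrier Q" "q' \<in> carrier Q"
    have eq: "q \<otimes>\<^bsub>Q\<^esub> q' = code (\<lambda>x\<in>X. dec q x \<otimes>\<^bsub>E x\<^esub> dec q' x)" "q \<oplus>\<^bsub>Q\<^esub> q' = code (\<lambda>x\<in>X. dec q x \<oplus>\<^bsub>E x\<^esub> dec q' x)"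
      by (simp_all add: Q_def)
    show "q \<otimes>\<^bsub>Q\<^esub> q' \<in> carrier Q" "q \<oplus>\<^bsub>Q\<^esub> q' \<in> carrier Q"
      unfolding eq by (rule code_Q V_ops q)+
    show "dec (q \<otimes>\<^bsub>Q\<^esub> q') x = dec q x \<otimes>\<^bsub>E x\<^esub> dec q' x" "dec (q \<oplus>\<^bsub>Q\<^esub> q') x = dec q x \<oplus>\<^bsub>E x\<^esub> dec q' x" if "x \<in> X" for x
      unfolding eq dec_code[OF V_ops(1)[OF q]] dec_code[OF V_ops(2)[OF q]] using that by simp_all
  next
    fix r q assume q: "r \<in> carrier R" "q \<in> carrier Q"
    have eq: "r \<odot>\<^bsub>Q\<^esub> q = code (\<lambda>x\<in>X. r \<odot>\<^bsub>E x\<^esub> dec q x)"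
      by (simp add: Q_def)
    show "r \<odot>\<^bsub>Q\<^esub> q \<in> carrier Q" unfolding eq by (rule code_Q V_ops q)+
    show "dec (r \<odot>\<^bsub>Q\<^esub> q) x = r \<odot>\<^bsub>E x\<^esub> dec q x" if "x \<in> X" for x
      unfolding eq dec_code[OF V_ops(3)[OF q(2,1)]] using that by simp_all
  next
    fix q assume q: "q \<in> carrier Q"
    have eq: "diff Q q = code (\<lambda>x\<in>X. diff (E x) (dec q x))"
      by (simp add: Q_def)
    show "diff Q q \<in> carrier Q" unfolding eq by (rule code_Q V_ops q)+
    show "dec (diff Q q) x = diff (E x) (dec q x)" if "x \<in> X" for x
      unfolding eq dec_code[OF V_ops(4)[OF q]] using that by simp_all
    obtain I p where p: "finite I" "\<And>i. p i \<in> V (words_of_degree A i)" "\<And>i. i \<notin> I \<Longrightarrow> p i = (\<lambda>x\<in>X. \<zero>\<^bsub>E x\<^esub>)"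
     "\<And>x. x \<in> X \<Longrightarrow> dec q x = (\<Oplus>\<^bsub>E x\<^esub>i\<in>I. p i x)"
      using V_decomp[OF dec_V[OF q]] by blast
    have dp: "dec (code (p i)) = p i" for i using dec_code[OF V_hpart_VA[OF p(2)]] .
    show "\<exists>I p. finite I \<and> (\<forall>i. p i \<in> hpart Q i) \<and> (\<forall>i. i \<notin> I \<longrightarrow> p i = \<zero>\<^bsub>Q\<^esub>) \<and>
        (\<forall>x\<in>X. dec q x = (\<Oplus>\<^bsub>E x\<^esub>i\<in>I. dec (p i) x))"
    proof (rule exI[of _ I], rule exI[of _ "\<lambda>i. code (p i)"], intro conjI allI impI ballI)
      show "code (p i) \<in> hpart Q i" for i
        using code_Q[OF V_hpart_VA[OF p(2)]] V_hpart[OF p(2)] by (auto simp: Q_def dp)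
      show "code (p i) = \<zero>\<^bsub>Q\<^esub>" if "i \<notin> I" for i using p(3)[OF that] by (simp only: Q_zero_code)
    qed (use p dp in auto)
  qed (auto simp: E R.cring_axioms Q_def)
  show "Q \<in> cdgas R" using 1 by blast
  show "proj x \<in> cdga_hom R Q (E x)" if "x \<in> X" using 1 that unfolding proj_def by blast
qed

lemma dec_eqI: "q \<in> carrier Q \<Longrightarrow> q' \<in> carrier Q \<Longrightarrow> (\<And>x. x \<in> X \<Longrightarrow> proj x q = proj x q') \<Longrightarrow> q = q'"
proof -
  assume q: "q \<in> carrier Q" "q' \<in> carrier Q" and "\<And>x. x \<in> X \<Longrightarrow> proj x q = proj x q'"
  then have "dec q = dec q'"
    using V_ext[OF dec_V] by (intro extensionalityI[of _ X]) (auto simp: proj_def)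
  then show ?thesis using q by (auto simp: Q_def dec_code)
qed

sublocale Q: cdga R Q
  by (rule cdga.intro[OF Q_cdgas])

definition eta :: "nat \<Rightarrow> 'a \<Rightarrow> nat set \<Rightarrow> ('r, 'a) lcarrier"
  where "eta n = (\<lambda>a\<in>carrier (level A n). \<lambda>S\<in>Pow {..n}. code (\<lambda>x\<in>X. \<phi> x n a S))"

lemma pm: "x \<in> X \<Longrightarrow> cdga_map R Q (E x) (proj x)"
  by (intro cdga_map.intro cdga_map_axioms.intro cd proj_hom Q.cdga_axioms)

lemma eta_Q: "a \<in> carrier (level A n) \<Longrightarrow> S \<subseteq> {..n} \<Longrightarrow> eta n a S \<in> carrier Q"
  using code_Q[OF V_gen] by (simp add: eta_def)

lemma proj_eta:
  assumes "x \<in> X" "a \<in> carrier (level A n)" "S \<subseteq> {..n}"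
  shows "proj x (eta n a S) = \<phi> x n a S"
  using eta_Q[OF assms(2,3)] dec_code[OF V_gen[OF assms(2,3)]] assms by (simp add: proj_def eta_def)

lemma Q_hpartI: "q \<in> carrier Q \<Longrightarrow> (\<And>x. x \<in> X \<Longrightarrow> proj x q \<in> hpart (E x) i) \<Longrightarrow> q \<in> hpart Q i"
  by (simp add: Q_def proj_def)

lemma eta_K:
  assumes a: "a \<in> carrier (level A n)"
  shows "eta n a \<in> carrier (K_level Q n)"
  unfolding Q.mem_K_level_iff
proof
  show t: "eta n a \<in> tensor_carrier Q n 0"
  proof (rule Q.tensor_carrierI)
    fix S assume S: "S \<subseteq> {..n}"
    show "eta n a S \<in> hpart Q (card S)"
      using phi_hpart[OF _ a S] by (intro Q_hpartI eta_Q a S) (simp add: proj_eta a S)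
  qed (simp add: eta_def a)
  show "Q.cocycle n (eta n a)"
    unfolding Q.cocycle_def
  proof (intro allI impI)
    fix S assume S: "S \<subseteq> {..n}"
    have cl: "eta n a (insert t S) \<in> carrier Q" if "t \<le> n" for t using that S a by (intro eta_Q) auto
    show "diff Q (eta n a S) = (\<Oplus>\<^bsub>Q\<^esub>t\<in>{..n} - S. sgn_mult Q (inversions S {t}) (eta n a (insert t S)))"
    proof (rule dec_eqI)
      fix x assume x: "x \<in> X"
      interpret P: cdga_map R Q "E x" "proj x" by (rule pm[OF x])
      have cl': "\<phi> x n a (insert t S) \<in> carrier (E x)" if "t \<le> n" for t using that S a x by (intro phi_carrier) auto
      have "proj x (\<Oplus>\<^bsub>Q\<^esub>t\<in>{..n} - S. sgn_mult Q (inversions S {t}) (eta n a (insert t S)))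
         = (\<Oplus>\<^bsub>E x\<^esub>t\<in>{..n} - S. proj x (sgn_mult Q (inversions S {t}) (eta n a (insert t S))))"
        by (rule P.finsum) (auto intro: cl)
      also have "\<dots> = (\<Oplus>\<^bsub>E x\<^esub>t\<in>{..n} - S. sgn_mult (E x) (inversions S {t}) (\<phi> x n a (insert t S)))"
        by (intro P.D.finsum_cong' refl) (use S a x cl cl' in \<open>auto simp: P.sgn proj_eta\<close>)
      also have "\<dots> = diff (E x) (\<phi> x n a S)"
        using P.D.K_carrierD(2)[OF phi_closed[OF x a]] S by (simp add: P.D.cocycle_def)
      finally show "proj x (diff Q (eta n a S)) = proj x (\<Oplus>\<^bsub>Q\<^esub>t\<in>{..n} - S. sgn_mult Q (inversions S {t}) (eta n a (insert t S)))"
        using S a x by (simp add: P.diff eta_Q proj_eta)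
    qed (auto intro!: Q.diff_closed Q.finsum_closed Q.sgn_mult_closed eta_Q a S cl)
  qed
qed

text \<open>Identities in \<open>K_level Q\<close> are tested after all projections, where they
  become the corresponding identities for \<open>\<phi> x\<close>.\<close>

lemma K_Q_eqI:
  assumes "f \<in> carrier (K_level Q n)" "g \<in> carrier (K_level Q n)"
    and "\<And>x. x \<in> X \<Longrightarrow> K_map Q (proj x) n f = K_map Q (proj x) n g"
  shows "f = g"
proof (rule Q.K_eqI[OF assms(1,2)], rule dec_eqI)
  fix S x assume S: "S \<subseteq> {..n}" and x: "x \<in> X"
  interpret P: cdga_map R Q "E x" "proj x" by (rule pm[OF x])
  have "(\<lambda>S\<in>Pow {..n}. proj x (f S)) S = (\<lambda>S\<in>Pow {..n}. proj x (g S)) S"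
    using assms(3)[OF x] assms(1,2) by (simp only: P.K_map_apply)
  then show "proj x (f S) = proj x (g S)" using S by simp
qed (use assms Q.K_apply_closed in auto)

lemma K_proj_eta:
  assumes x: "x \<in> X" and a: "a \<in> carrier (level A n)"
  shows "K_map Q (proj x) n (eta n a) = \<phi> x n a"
proof -
  interpret P: cdga_map R Q "E x" "proj x" by (rule pm[OF x])
  show ?thesis
  proof (rule P.D.K_eqI)
    show "K_map Q (proj x) n (eta n a) \<in> carrier (K_level (E x) n)"
      using P.K_map_closed[OF eta_K[OF a]] P.K_map_apply[OF eta_K[OF a]] by simp
    show "\<phi> x n a \<in> carrier (K_level (E x) n)" by (rule phi_closed[OF x a])
  qed (simp add: P.K_map_apply[OF eta_K[OF a]] proj_eta x a)
qed

lemma eta_hom: "eta \<in> ccom_hom R A (K_alg Q)"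
proof -
  have lev: "algebra R (level A n)" for n using cComD(1)[OF A] .
  have km: "K_map Q (proj x) n \<in> alg_hom R (K_level Q n) (K_level (E x) n)"
    and kc: "\<And>m \<alpha> f. \<alpha> \<in> Delta m n \<Longrightarrow> f \<in> carrier (K_level Q m) \<Longrightarrow>
        K_map Q (proj x) n (Q.push m n \<alpha> f) = cmap (K_alg (E x)) m n \<alpha> (K_map Q (proj x) m f)"
    and ph: "\<phi> x n \<in> alg_hom R (level A n) (K_level (E x) n)" if x: "x \<in> X" for x n
  proof -
    interpret P: cdga_map R Q "E x" "proj x" by (rule pm[OF x])
    note h = P.K_map_hom
    show "K_map Q (proj x) n \<in> alg_hom R (K_level Q n) (K_level (E x) n)"
      using ccom_homD(1)[OF h] by (simp add: Q.level_K_alg P.D.level_K_alg)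
    show "K_map Q (proj x) n (Q.push m n \<alpha> f) = cmap (K_alg (E x)) m n \<alpha> (K_map Q (proj x) m f)"
      if "\<alpha> \<in> Delta m n" "f \<in> carrier (K_level Q m)" for m \<alpha> f
      using ccom_homD(3)[OF h that(1), of f] that by (simp add: Q.level_K_alg Q.cmap_K_alg)
    show "\<phi> x n \<in> alg_hom R (level A n) (K_level (E x) n)"
      using ccom_homD(1)[OF \<phi>[OF x], of n] by (simp add: P.D.level_K_alg)
  qed
  have "eta n \<in> alg_hom R (level A n) (K_level Q n)" for n
  proof -
    interpret L: algebra R "level A n" by (rule lev)
    interpret K: algebra R "K_level Q n" by (rule Q.K_algebra)
    show ?thesis
      unfolding alg_hom_def mem_Collect_eq
    proof (intro conjI ballI ring_hom_memI)
      fix a b assume a: "a \<in> carrier (level A n)" and b: "b \<in> carrier (level A n)"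
      show "eta n (a \<otimes>\<^bsub>level A n\<^esub> b) = eta n a \<otimes>\<^bsub>K_level Q n\<^esub> eta n b"
        by (rule K_Q_eqI[where n=n]) (use a b in \<open>simp_all del: Q.K_level_simps add: eta_K K_proj_eta alg_homD(2)[OF km] alg_homD(2)[OF ph]\<close>)
      show "eta n (a \<oplus>\<^bsub>level A n\<^esub> b) = eta n a \<oplus>\<^bsub>K_level Q n\<^esub> eta n b"
        by (rule K_Q_eqI[where n=n]) (use a b in \<open>simp_all del: Q.K_level_simps add: eta_K K_proj_eta alg_homD(3)[OF km] alg_homD(3)[OF ph]\<close>)
    next
      fix a r assume a: "a \<in> carrier (level A n)" and r: "r \<in> carrier R"
      show "eta n (r \<odot>\<^bsub>level A n\<^esub> a) = r \<odot>\<^bsub>K_level Q n\<^esub> eta n a"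
        by (rule K_Q_eqI[where n=n]) (use a r in \<open>simp_all del: Q.K_level_simps add: eta_K K_proj_eta alg_homD(5)[OF km] alg_homD(5)[OF ph]\<close>)
    next
      show "eta n \<one>\<^bsub>level A n\<^esub> = \<one>\<^bsub>K_level Q n\<^esub>"
        by (rule K_Q_eqI[where n=n]) (simp_all del: Q.K_level_simps add: eta_K K_proj_eta alg_homD(4)[OF km] alg_homD(4)[OF ph])
    qed (rule eta_K)
  qed
  moreover have "eta n (cmap A m n \<alpha> a) = Q.push m n \<alpha> (eta m a)"
    if \<alpha>: "\<alpha> \<in> Delta m n" and a: "a \<in> carrier (level A m)" for m n \<alpha> a
  proof (rule K_Q_eqI)
    have c: "cmap A m n \<alpha> a \<in> carrier (level A n)" using alg_homD(1)[OF cComD(2)[OF A \<alpha>] a] .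
    then show "eta n (cmap A m n \<alpha> a) \<in> carrier (K_level Q n)" by (rule eta_K)
    show "Q.push m n \<alpha> (eta m a) \<in> carrier (K_level Q n)" by (intro Q.push_K eta_K a \<alpha>)
    show "K_map Q (proj x) n (eta n (cmap A m n \<alpha> a)) = K_map Q (proj x) n (Q.push m n \<alpha> (eta m a))" if x: "x \<in> X" for x
      using ccom_homD(3)[OF \<phi>[OF x] \<alpha> a] by (simp add: K_proj_eta x a c kc \<alpha> eta_K)
  qed
  ultimately show ?thesis
    unfolding ccom_hom_def mem_Collect_eq Q.cmap_K_alg Q.level_K_alg by (auto simp: eta_def)
qed

lemma proj_word:
  assumes x: "x \<in> X" and w: "w \<in> lists (symbols A)"
  shows "word Q eta w \<in> carrier Q \<and> proj x (word Q eta w) = wd x w"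
proof -
  interpret P: cdga_map R Q "E x" "proj x" by (rule pm[OF x])
  show ?thesis using w
  proof (induction w)
    case (Cons s w)
    then show ?case by (cases s) (auto simp: symbols_def P.mult proj_eta x eta_Q)
  qed (simp add: P.one)
qed

lemma word_Q: "w \<in> lists (symbols A) \<Longrightarrow> word Q eta w \<in> carrier Q"
proof (induction w)
  case (Cons s w)
  then show ?case by (cases s) (auto simp: symbols_def eta_Q)
qed simp

lemma code_span:
  assumes "v \<in> V W" and W: "W \<subseteq> lists (symbols A)"
  shows "code v \<in> word_span R Q eta W"
  using assms(1)
proof (induction rule: V.induct)
  case V_zero
  show ?case using word_span.zero[of Q R eta W] by (simp only: Q_zero_code)
next
  case (V_step r w v)
  have w: "w \<in> lists (symbols A)" and v: "v \<in> VA" using V_step(2,3) W V_mono by blast+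
  have "r \<odot>\<^bsub>Q\<^esub> word Q eta w \<oplus>\<^bsub>Q\<^esub> code v = code (\<lambda>x\<in>X. r \<odot>\<^bsub>E x\<^esub> wd x w \<oplus>\<^bsub>E x\<^esub> v x)"
  proof (rule dec_eqI)
    have m: "(\<lambda>x\<in>X. r \<odot>\<^bsub>E x\<^esub> wd x w \<oplus>\<^bsub>E x\<^esub> v x) \<in> VA" by (rule V.V_step[OF V_step(1) w v])
    show c: "code (\<lambda>x\<in>X. r \<odot>\<^bsub>E x\<^esub> wd x w \<oplus>\<^bsub>E x\<^esub> v x) \<in> carrier Q" by (rule code_Q[OF m])
    show "r \<odot>\<^bsub>Q\<^esub> word Q eta w \<oplus>\<^bsub>Q\<^esub> code v \<in> carrier Q"
      using V_step(1) word_Q[OF w] code_Q[OF v] by simp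
    fix x assume x: "x \<in> X"
    interpret P: cdga_map R Q "E x" "proj x" by (rule pm[OF x])
    have "proj x (code v) = v x" using code_Q[OF v] by (simp add: proj_def dec_code[OF v])
    moreover have "proj x (code (\<lambda>x\<in>X. r \<odot>\<^bsub>E x\<^esub> wd x w \<oplus>\<^bsub>E x\<^esub> v x)) = (\<lambda>x\<in>X. r \<odot>\<^bsub>E x\<^esub> wd x w \<oplus>\<^bsub>E x\<^esub> v x) x"
      using c by (simp only: proj_def restrict_apply' dec_code[OF m])
    ultimately show "proj x (r \<odot>\<^bsub>Q\<^esub> word Q eta w \<oplus>\<^bsub>Q\<^esub> code v) = proj x (code (\<lambda>x\<in>X. r \<odot>\<^bsub>E x\<^esub> wd x w \<oplus>\<^bsub>E x\<^esub> v x))"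
      using x V_step(1) code_Q[OF v] proj_word[OF x w] by (simp add: P.add P.smult)
  qed
  then show ?case using word_span.step[OF V_step(1,2,4)] by (simp only:)
qed

text \<open>The parts of q by word degree are, at each x, also its homogeneous parts. As q is
  homogeneous of degree i, uniqueness of decompositions leaves only the words of degree i.\<close>

lemma hpart_Q_span: "q \<in> hpart Q i \<Longrightarrow> q \<in> word_span R Q eta (words_of_degree A i)"
proof -
  assume q: "q \<in> hpart Q i"
  then have qc: "q \<in> carrier Q" by (rule Q.hpart_carrier)
  obtain I p where p: "finite I" "\<And>i. p i \<in> V (words_of_degree A i)" "\<And>i. i \<notin> I \<Longrightarrow> p i = (\<lambda>x\<in>X. \<zero>\<^bsub>E x\<^esub>)"
     "\<And>x. x \<in> X \<Longrightarrow> dec q x = (\<Oplus>\<^bsub>E x\<^esub>i\<in>I. p i x)"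
    using V_decomp[OF dec_V[OF qc]] by blast
  have "dec q x = p i x" if x: "x \<in> X" for x
  proof -
    interpret E: cdga R "E x" using cd x by blast
    have ph: "p j x \<in> hpart (E x) j" for j by (rule V_hpart[OF p(2) x])
    have pc: "p j x \<in> carrier (E x)" for j using E.hpart_carrier[OF ph] .
    have sub: "{j. p j x \<noteq> \<zero>\<^bsub>E x\<^esub>} \<subseteq> I"
    proof
      fix j assume "j \<in> {j. p j x \<noteq> \<zero>\<^bsub>E x\<^esub>}"
      then show "j \<in> I" using p(3)[of j] x by (cases "j \<in> I") auto
    qed
    have qh: "dec q x \<in> hpart (E x) i" using q x by (simp add: Q_def)
    \<comment> \<open>The decomposition with a single term, to be compared with the one by word
      degree.\<close>
    define s where "s j = (if j = i then dec q x else \<zero>\<^bsub>E x\<^esub>)" for j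
    have ssub: "{j. s j \<noteq> \<zero>\<^bsub>E x\<^esub>} \<subseteq> {i}" by (auto simp: s_def)
    have sc: "s j \<in> carrier (E x)" for j using E.hpart_carrier[OF qh] by (simp add: s_def)
    have "s = (\<lambda>j. p j x)"
    proof (rule E.decomposition_unique[of "dec q x"])
      show "dec q x = (\<Oplus>\<^bsub>E x\<^esub>j\<in>{j. p j x \<noteq> \<zero>\<^bsub>E x\<^esub>}. p j x)"
        unfolding p(4)[OF x] by (rule E.add.finprod_mono_neutral_cong_right) (use p(1) sub pc in auto)
      have "(\<Oplus>\<^bsub>E x\<^esub>j\<in>{j. s j \<noteq> \<zero>\<^bsub>E x\<^esub>}. s j) = (\<Oplus>\<^bsub>E x\<^esub>j\<in>{i}. s j)"
        by (rule E.add.finprod_mono_neutral_cong_left) (use ssub sc in auto)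
      also have "\<dots> = dec q x" using sc[of i] by (simp add: s_def)
      finally show "dec q x = (\<Oplus>\<^bsub>E x\<^esub>j\<in>{j. s j \<noteq> \<zero>\<^bsub>E x\<^esub>}. s j)" by simp
      show "finite {j. s j \<noteq> \<zero>\<^bsub>E x\<^esub>}" "finite {j. p j x \<noteq> \<zero>\<^bsub>E x\<^esub>}"
        using ssub sub p(1) finite_subset by blast+
    qed (use qh ph E.hpart_carrier in \<open>auto simp: s_def\<close>)
    then show ?thesis by (metis s_def)
  qed
  then have "dec q = p i"
    using V_ext[OF dec_V[OF qc]] V_ext[OF p(2)] by (intro extensionalityI[of _ X]) auto
  then have "q = code (p i)" using qc by (auto simp: Q_def dec_code)
  then show ?thesis using code_span[OF p(2)[of i]] by auto
qed

end

section \<open>The adjunction\<close>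

lemma ccom_comp_apply: "x \<in> carrier (level A n) \<Longrightarrow> ccom_comp A \<psi> \<phi> n x = \<psi> n (\<phi> n x)"
  by (simp add: ccom_comp_def compose_def)

lemma ccom_hom_eqI:
  assumes "\<phi> \<in> ccom_hom R A B" "\<psi> \<in> ccom_hom R A B"
    and "\<And>n x. x \<in> carrier (level A n) \<Longrightarrow> \<phi> n x = \<psi> n x"
  shows "\<phi> = \<psi>"
proof
  fix n show "\<phi> n = \<psi> n"
    by (rule extensionalityI[OF ccom_homD(2)[OF assms(1)] ccom_homD(2)[OF assms(2)] assms(3)])
qed

lemma ccom_comp_hom:
  assumes A: "A \<in> cCom R" and \<phi>: "\<phi> \<in> ccom_hom R A B" and \<psi>: "\<psi> \<in> ccom_hom R B E"
  shows "ccom_comp A \<psi> \<phi> \<in> ccom_hom R A E"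
proof -
  have "compose (carrier (level A n)) (\<psi> n) (\<phi> n) \<in> alg_hom R (level A n) (level E n)" for n
  proof -
    interpret algebra R "level A n" by (rule cComD(1)[OF A])
    have "compose (carrier (level A n)) (\<psi> n) (\<phi> n) \<in> ring_hom (level A n) (level E n)"
      using alg_homD[OF ccom_homD(1)[OF \<phi>]] alg_homD[OF ccom_homD(1)[OF \<psi>]]
      by (intro ring_hom_memI) (simp_all add: compose_def)
    then show ?thesis
      using alg_homD[OF ccom_homD(1)[OF \<phi>]] alg_homD[OF ccom_homD(1)[OF \<psi>]]
      by (simp add: alg_hom_def compose_def)
  qed
  then show ?thesis
    using alg_homD(1)[OF ccom_homD(1)[OF \<phi>]] alg_homD(1)[OF cComD(2)[OF A]] ccom_homD(3)[OF \<phi>] ccom_homD(3)[OF \<psi>]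
    unfolding ccom_hom_def ccom_comp_def by (simp add: compose_def)
qed

lemma ccom_comp_assoc:
  assumes "\<phi> \<in> ccom_hom R A B"
  shows "ccom_comp A \<chi> (ccom_comp A \<psi> \<phi>) = ccom_comp A (ccom_comp B \<chi> \<psi>) \<phi>"
  using alg_homD(1)[OF ccom_homD(1)[OF assms]]
  by (auto simp: ccom_comp_def compose_def fun_eq_iff)

lemma ccom_id_hom:
  assumes "A \<in> cCom R"
  shows "ccom_id A \<in> ccom_hom R A A"
proof -
  have "(\<lambda>x\<in>carrier (level A n). x) \<in> alg_hom R (level A n) (level A n)" for n
  proof -
    interpret algebra R "level A n" by (rule cComD(1)[OF assms])
    show ?thesis unfolding alg_hom_def by (auto intro!: ring_hom_memI)
  qed
  then show ?thesis
    using alg_homD(1)[OF cComD(2)[OF assms]] unfolding ccom_hom_def ccom_id_def by simp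
qed

lemma ccom_comp_id: "\<phi> \<in> ccom_hom R A B \<Longrightarrow> ccom_comp A \<phi> (ccom_id A) = \<phi>"
proof -
  assume \<phi>: "\<phi> \<in> ccom_hom R A B"
  show ?thesis
    using extensional_arb[OF ccom_homD(2)[OF \<phi>]]
    by (auto simp: ccom_comp_def ccom_id_def compose_def fun_eq_iff)
qed

lemma ccom_id_comp: "\<phi> \<in> ccom_hom R A B \<Longrightarrow> ccom_comp A (ccom_id B) \<phi> = \<phi>"
proof -
  assume \<phi>: "\<phi> \<in> ccom_hom R A B"
  show ?thesis
    using extensional_arb[OF ccom_homD(2)[OF \<phi>]] alg_homD(1)[OF ccom_homD(1)[OF \<phi>]]
    by (auto simp: ccom_comp_def ccom_id_def compose_def fun_eq_iff)
qed

lemma cdga_map_intro: "C \<in> cdgas R \<Longrightarrow> D \<in> cdgas R \<Longrightarrow> g \<in> cdga_hom R C D \<Longrightarrow> cdga_map R C D g"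
  by (intro cdga_map.intro cdga_map_axioms.intro cdga.intro)

lemma cdga_hom_eqI:
  assumes "g \<in> cdga_hom R C D" "h \<in> cdga_hom R C D" "\<And>x. x \<in> carrier C \<Longrightarrow> g x = h x"
  shows "g = h"
  by (rule extensionalityI[OF cdga_homD(2)[OF assms(1)] cdga_homD(2)[OF assms(2)] assms(3)])

lemma cdga_comp_hom:
  assumes C: "C \<in> cdgas R" and g: "g \<in> cdga_hom R C D" and h: "h \<in> cdga_hom R D E"
  shows "cdga_comp C h g \<in> cdga_hom R C E"
proof -
  interpret C: cdga R C by (rule cdga.intro[OF C])
  note g' = cdga_homD[OF g] and h' = cdga_homD[OF h]
  note ga = alg_homD[OF g'(1)] and ha = alg_homD[OF h'(1)]
  have "compose (carrier C) h g \<in> ring_hom C E"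
    using ga ha by (intro ring_hom_memI) (simp_all add: compose_def)
  then have "compose (carrier C) h g \<in> alg_hom R C E"
    using ga ha by (simp add: alg_hom_def compose_def)
  then show ?thesis
    using ga g' h' C.hpart_carrier unfolding cdga_hom_def cdga_comp_def
    by (auto simp: compose_def)
qed

lemma cdga_id_hom:
  assumes C: "C \<in> cdgas R"
  shows "cdga_id C \<in> cdga_hom R C C"
proof -
  interpret C: cdga R C by (rule cdga.intro[OF C])
  have "(\<lambda>x\<in>carrier C. x) \<in> ring_hom C C" by (intro ring_hom_memI) simp_all
  then show ?thesis using C.hpart_carrier unfolding cdga_hom_def cdga_id_def alg_hom_def by auto
qed

lemma K_map_hom:
  assumes "C \<in> cdgas R" "C' \<in> cdgas R" "g \<in> cdga_hom R C C'"
  shows "K_map C g \<in> ccom_hom R (K_alg C) (K_alg C')"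
  using cdga_map.K_map_hom[OF cdga_map_intro[OF assms]] .

lemma K_alg_cCom: "C \<in> cdgas R \<Longrightarrow> K_alg C \<in> cCom R"
  by (rule cdga.K_alg_cCom[OF cdga.intro])

lemma K_map_id:
  assumes C: "C \<in> cdgas R"
  shows "K_map C (cdga_id C) = ccom_id (K_alg C)"
proof -
  interpret C: cdga R C by (rule cdga.intro[OF C])
  have "(\<lambda>S\<in>Pow {..n}. cdga_id C (f S)) = f" if f: "f \<in> carrier (K_level C n)" for n f
  proof -
    have "f \<in> extensional (Pow {..n})" using C.K_carrierD(1)[OF f] by (auto simp: tensor_carrier_def PiE_def)
    then show ?thesis using C.K_apply_closed[OF f] by (intro extensionalityI[of _ "Pow {..n}"]) (auto simp: cdga_id_def)
  qed
  then show ?thesis unfolding K_map_def ccom_id_def by (intro ext restrict_ext) (simp add: C.level_K_alg)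
qed

lemma K_map_comp:
  assumes C: "C \<in> cdgas R" and C': "C' \<in> cdgas R" and g: "g \<in> cdga_hom R C C'"
  shows "K_map C (cdga_comp C h g) = ccom_comp (K_alg C) (K_map C' h) (K_map C g)"
proof
  fix n
  interpret G: cdga_map R C C' g by (rule cdga_map_intro[OF C C' g])
  show "K_map C (cdga_comp C h g) n = ccom_comp (K_alg C) (K_map C' h) (K_map C g) n"
    unfolding K_map_def ccom_comp_def compose_def G.C.level_K_alg G.D.level_K_alg
    using G.K_map_closed G.C.K_apply_closed
    by (intro restrict_ext) (auto simp: cdga_comp_def compose_def intro!: restrict_ext)
qed

text \<open>Formulated for each degree with words of that degree only, so that the shape of degree 0
  and the finite dimension of the other degrees can be read off from the words.\<close>

definition generated :: "('r, 'p) ring_scheme \<Rightarrow> ('r, 'a) cosimp \<Rightarrow> ('r, 'c) dga \<Rightarrow> (nat \<Rightarrow> 'a \<Rightarrow> nat set \<Rightarrow> 'c) \<Rightarrow> bool"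
  where "generated R A B \<eta> \<longleftrightarrow> (\<forall>i. hpart B i \<subseteq> word_span R B \<eta> (words_of_degree A i))"

lemma K_hom_closed:
  assumes B: "B \<in> cdgas R" and \<eta>: "\<eta> \<in> ccom_hom R A (K_alg B)" and a: "a \<in> carrier (level A n)"
  shows "\<eta> n a \<in> carrier (K_level B n)"
  using alg_homD(1)[OF ccom_homD(1)[OF \<eta>] a] by (simp add: cdga.level_K_alg[OF cdga.intro[OF B]])

lemma K_hom_hpart:
  assumes "B \<in> cdgas R" "\<eta> \<in> ccom_hom R A (K_alg B)" "a \<in> carrier (level A n)" "S \<subseteq> {..n}"
  shows "\<eta> n a S \<in> hpart B (card S)"
  using cdga.tensor_carrierD[OF cdga.intro[OF assms(1)] cdga.K_carrierD(1)[OF cdga.intro[OF assms(1)] K_hom_closed[OF assms(1-3)]] assms(4)] .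

lemma word_hpart:
  assumes B: "B \<in> cdgas R" and \<eta>: "\<eta> \<in> ccom_hom R A (K_alg B)" and w: "w \<in> lists (symbols A)"
  shows "word B \<eta> w \<in> hpart B (wdeg w)"
proof -
  interpret cdga R B by (rule cdga.intro[OF B])
  show ?thesis using w
  proof (induction w)
    case (Cons s w)
    then show ?case using K_hom_hpart[OF B \<eta>] by (cases s) (auto simp: symbols_def intro!: hpart_mult)
  qed simp
qed

text \<open>Equality spreads from the coefficients to words by multiplicativity and then to the
  spans of words, which exhaust the homogeneous parts.\<close>

lemma hom_eq_of_generated:
  assumes B: "B \<in> cdgas R" and \<eta>: "\<eta> \<in> ccom_hom R A (K_alg B)" and gen: "generated R A B \<eta>"
    and C: "C \<in> cdgas R" and g: "g \<in> cdga_hom R B C" and h: "h \<in> cdga_hom R B C"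
    and eq: "\<And>n a S. a \<in> carrier (level A n) \<Longrightarrow> S \<subseteq> {..n} \<Longrightarrow> g (\<eta> n a S) = h (\<eta> n a S)"
  shows "g = h"
proof (rule cdga_hom_eqI[OF g h])
  interpret G: cdga_map R B C g by (rule cdga_map_intro[OF B C g])
  interpret H: cdga_map R B C h by (rule cdga_map_intro[OF B C h])
  have wc: "word B \<eta> w \<in> carrier B" if "w \<in> lists (symbols A)" for w
    using word_hpart[OF B \<eta> that] by (rule G.C.hpart_carrier)
  have w: "g (word B \<eta> w) = h (word B \<eta> w)" if "w \<in> lists (symbols A)" for w
    using that
  proof (induction w)
    case (Cons s w)
    obtain n a S where s: "s = (n, a, S)" by (cases s)
    have "(n, a, S) \<in> symbols A" using Cons.hyps unfolding s by simp
    then have a: "a \<in> carrier (level A n)" "S \<subseteq> {..n}" unfolding symbols_def by blast+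
    have "\<eta> n a S \<in> carrier B" using K_hom_hpart[OF B \<eta> a] by (rule G.C.hpart_carrier)
    then show ?case using Cons wc[of w] eq[OF a] by (simp add: s G.mult H.mult)
  qed (simp add: G.one H.one)
  have sp: "y \<in> carrier B \<and> g y = h y" if "y \<in> word_span R B \<eta> (words_of_degree A i)" for y i
    using that
  proof (induction rule: word_span.induct)
    case zero
    show ?case by (simp add: G.zero H.zero)
  next
    case (step r w y)
    then show ?case using wc[of w] w[of w] by (simp add: G.add H.add G.smult H.smult)
  qed
  have hp: "g y = h y" if "y \<in> hpart B i" for y i
    using sp gen that unfolding generated_def by blast
  fix x assume "x \<in> carrier B"
  then obtain p where p: "\<And>i. p i \<in> hpart B i" "x = (\<Oplus>\<^bsub>B\<^esub>i\<in>{i. p i \<noteq> \<zero>\<^bsub>B\<^esub>}. p i)"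
    using G.C.decomposition[of x] by blast
  have pc: "p i \<in> carrier B" for i using p(1) by (rule G.C.hpart_carrier)
  have "g x = (\<Oplus>\<^bsub>C\<^esub>i\<in>{i. p i \<noteq> \<zero>\<^bsub>B\<^esub>}. g (p i))" unfolding p(2) by (rule G.finsum[OF pc])
  also have "\<dots> = (\<Oplus>\<^bsub>C\<^esub>i\<in>{i. p i \<noteq> \<zero>\<^bsub>B\<^esub>}. h (p i))" using hp[OF p(1)] by simp
  also have "\<dots> = h x" unfolding p(2) by (rule H.finsum[OF pc, symmetric])
  finally show "g x = h x" .
qed

lemma K_map_comp_apply:
  assumes B: "B \<in> cdgas R" and \<eta>: "\<eta> \<in> ccom_hom R A (K_alg B)" and a: "a \<in> carrier (level A n)" and S: "S \<subseteq> {..n}"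
  shows "ccom_comp A (K_map B g) \<eta> n a S = g (\<eta> n a S)"
  using K_hom_closed[OF B \<eta> a] S a
  by (simp add: ccom_comp_apply K_map_def cdga.level_K_alg[OF cdga.intro[OF B]])

lemma hom_unique_of_generated:
  assumes B: "B \<in> cdgas R" and \<eta>: "\<eta> \<in> ccom_hom R A (K_alg B)" and gen: "generated R A B \<eta>"
    and C: "C \<in> cdgas R" and g: "g \<in> cdga_hom R B C" and h: "h \<in> cdga_hom R B C"
    and eq: "ccom_comp A (K_map B g) \<eta> = ccom_comp A (K_map B h) \<eta>"
  shows "g = h"
  using K_map_comp_apply[OF B \<eta>, where g=g] K_map_comp_apply[OF B \<eta>, where g=h] eq
  by (intro hom_eq_of_generated[OF B \<eta> gen C g h]) metis

lemma (in K_family) eta_generated: "generated R A Q eta"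
  unfolding generated_def using hpart_Q_span by blast

lemma (in K_family) comp_proj_eta:
  assumes x: "x \<in> X"
  shows "ccom_comp A (K_map Q (proj x)) eta = \<phi> x"
  by (rule ccom_hom_eqI[OF ccom_comp_hom[OF A eta_hom K_map_hom[OF Q_cdgas E[OF x] proj_hom[OF x]]] \<phi>[OF x]])
    (simp add: ccom_comp_apply K_proj_eta x)

text \<open>The projection to the factor of a given morphism is the map that this morphism induces,
  and uniqueness holds because the coefficients generate. Generation is recorded in the conclusion
  since it has to be transferred to the arrow that is chosen later.\<close>

lemma universal_arrow_exists:
  fixes A :: "('r, 'a) cosimp"
  assumes A: "A \<in> cCom R"
  shows "\<exists>(B :: ('r, ('r, 'a) lcarrier) dga) \<eta>. universal_arrow R A (B, \<eta>) \<and> generated R A B \<eta>"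
proof -
  define X where "X = {x :: ('r, ('r, 'a) lcarrier) dga \<times> (nat \<Rightarrow> 'a \<Rightarrow> nat set \<Rightarrow> ('r, 'a) lcarrier).
      fst x \<in> cdgas R \<and> snd x \<in> ccom_hom R A (K_alg (fst x))}"
  interpret F: K_family R A X fst snd
    by unfold_locales (auto simp: X_def A)
  have "universal_arrow R A (F.Q, F.eta)"
    unfolding universal_arrow_def prod.case
  proof (intro conjI ballI F.Q_cdgas F.eta_hom)
    fix C :: "('r, ('r, 'a) lcarrier) dga" and \<phi>
    assume C: "C \<in> cdgas R" and \<phi>: "\<phi> \<in> ccom_hom R A (K_alg C)"
    then have x: "(C, \<phi>) \<in> X" by (simp add: X_def)
    show "\<exists>!g. g \<in> cdga_hom R F.Q C \<and> ccom_comp A (K_map F.Q g) F.eta = \<phi>"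
    proof (rule ex1I[of _ "F.proj (C, \<phi>)"])
      show "F.proj (C, \<phi>) \<in> cdga_hom R F.Q C \<and> ccom_comp A (K_map F.Q (F.proj (C, \<phi>))) F.eta = \<phi>"
        using F.proj_hom[OF x] F.comp_proj_eta[OF x] by simp
      then show "g = F.proj (C, \<phi>)" if "g \<in> cdga_hom R F.Q C \<and> ccom_comp A (K_map F.Q g) F.eta = \<phi>" for g
        using that by (intro hom_unique_of_generated[OF F.Q_cdgas F.eta_hom F.eta_generated C]) auto
    qed
  qed
  then show ?thesis using F.eta_generated by blast
qed

lemma universal_arrowD:
  assumes "universal_arrow R A (B, \<eta>)"
  shows "B \<in> cdgas R" "\<eta> \<in> ccom_hom R A (K_alg B)"
  using assms by (auto simp: universal_arrow_def)

text \<open>A cdga of an arbitrary carrier type receives its maps from the copy, in the type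
  of the left adjoint, of the subalgebra that is generated by the coefficients.\<close>

lemma universal_arrow_any_type:
  fixes A :: "('r, 'a) cosimp" and B :: "('r, ('r, 'a) lcarrier) dga" and C :: "('r, 'c) dga"
  assumes A: "A \<in> cCom R" and u: "universal_arrow R A (B, \<eta>)"
    and C: "C \<in> cdgas R" and \<phi>: "\<phi> \<in> ccom_hom R A (K_alg C)"
  shows "\<exists>g\<in>cdga_hom R B C. ccom_comp A (K_map B g) \<eta> = \<phi>"
proof -
  interpret F: K_family R A "{()}" "\<lambda>_. C" "\<lambda>_. \<phi>"
    by unfold_locales (auto simp: A C \<phi>)
  note B = universal_arrowD[OF u]
  have F: "F.Q \<in> cdgas R" "F.eta \<in> ccom_hom R A (K_alg F.Q)"
    by (rule F.Q_cdgas, rule F.eta_hom)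
  obtain h where h: "h \<in> cdga_hom R B F.Q" "ccom_comp A (K_map B h) \<eta> = F.eta"
    using u F unfolding universal_arrow_def prod.case by blast
  have p: "F.proj () \<in> cdga_hom R F.Q C" by (rule F.proj_hom) simp
  have "ccom_comp A (K_map B (cdga_comp B (F.proj ()) h)) \<eta> = ccom_comp A (ccom_comp (K_alg B) (K_map F.Q (F.proj ())) (K_map B h)) \<eta>"
    by (simp only: K_map_comp[OF B(1) F(1) h(1)])
  also have "\<dots> = ccom_comp A (K_map F.Q (F.proj ())) F.eta"
    by (simp only: ccom_comp_assoc[OF B(2), symmetric] h(2))
  also have "\<dots> = \<phi>" using F.comp_proj_eta by simp
  finally show ?thesis using cdga_comp_hom[OF B(1) h(1) p] by blast
qed

text \<open>The comparison maps v to and w from the constructed arrow satisfy w v = id, so w is onto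
  in every degree. It sends words to words and thereby carries generation over to the given
  arrow.\<close>

lemma universal_arrow_generated:
  fixes A :: "('r, 'a) cosimp" and B :: "('r, ('r, 'a) lcarrier) dga"
  assumes A: "A \<in> cCom R" and u: "universal_arrow R A (B, \<eta>)"
  shows "generated R A B \<eta>"
proof -
  note B = universal_arrowD[OF u]
  obtain B0 :: "('r, ('r, 'a) lcarrier) dga" and \<eta>0 where u0: "universal_arrow R A (B0, \<eta>0)" and g0: "generated R A B0 \<eta>0"
    using universal_arrow_exists[OF A] by blast
  note B0 = universal_arrowD[OF u0]
  obtain v where v: "v \<in> cdga_hom R B B0" "ccom_comp A (K_map B v) \<eta> = \<eta>0"
    using universal_arrow_any_type[OF A u B0] by blast
  obtain w where w: "w \<in> cdga_hom R B0 B" "ccom_comp A (K_map B0 w) \<eta>0 = \<eta>"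
    using universal_arrow_any_type[OF A u0 B] by blast
  interpret W: cdga_map R B0 B w by (rule cdga_map_intro[OF B0(1) B(1) w(1)])
  have "cdga_comp B w v \<in> cdga_hom R B B" by (rule cdga_comp_hom[OF B(1) v(1) w(1)])
  moreover have "ccom_comp A (K_map B (cdga_comp B w v)) \<eta> = \<eta>"
    by (simp only: K_map_comp[OF B(1) B0(1) v(1)] ccom_comp_assoc[OF B(2), symmetric] v(2) w(2))
  moreover have "cdga_id B \<in> cdga_hom R B B" by (rule cdga_id_hom[OF B(1)])
  moreover have "ccom_comp A (K_map B (cdga_id B)) \<eta> = \<eta>"
    by (simp only: K_map_id[OF B(1)] ccom_id_comp[OF B(2)])
  ultimately have wv: "cdga_comp B w v = cdga_id B"
    using u B unfolding universal_arrow_def prod.case by blast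
  have wc: "word B0 \<eta>0 x \<in> carrier B0" if "x \<in> lists (symbols A)" for x
    using word_hpart[OF B0 that] by (rule W.C.hpart_carrier)
  have word: "w (word B0 \<eta>0 x) = word B \<eta> x" if "x \<in> lists (symbols A)" for x
    using that
  proof (induction x)
    case (Cons s x)
    obtain n a S where s: "s = (n, a, S)" by (cases s)
    have "(n, a, S) \<in> symbols A" using Cons.hyps unfolding s by simp
    then have a: "a \<in> carrier (level A n)" "S \<subseteq> {..n}" unfolding symbols_def by blast+
    have "\<eta>0 n a S \<in> carrier B0" using K_hom_hpart[OF B0 a] by (rule W.C.hpart_carrier)
    moreover have "w (\<eta>0 n a S) = \<eta> n a S" using K_map_comp_apply[OF B0 a, of w] w(2) by simp
    ultimately show ?case using Cons wc[of x] by (simp add: s W.mult)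
  qed (simp add: W.one)
  have span: "y \<in> carrier B0 \<and> w y \<in> word_span R B \<eta> (words_of_degree A i)"
    if "y \<in> word_span R B0 \<eta>0 (words_of_degree A i)" for y i
    using that
  proof (induction rule: word_span.induct)
    case zero
    show ?case using word_span.zero by (simp add: W.zero)
  next
    case (step r x y)
    have "w (r \<odot>\<^bsub>B0\<^esub> word B0 \<eta>0 x \<oplus>\<^bsub>B0\<^esub> y) = r \<odot>\<^bsub>B\<^esub> word B \<eta> x \<oplus>\<^bsub>B\<^esub> w y"
      using step wc[of x] word[of x] by (simp add: W.add W.smult)
    then show ?case using step wc[of x] word_span.step[OF step(1,2), of "w y" B \<eta>] by simp
  qed
  show ?thesis
    unfolding generated_def
  proof (intro allI subsetI)
    fix i y assume y: "y \<in> hpart B i"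
    have "y \<in> carrier B" using y by (rule W.D.hpart_carrier)
    then have "w (v y) = y" using fun_cong[OF wv, of y] by (simp add: cdga_comp_def cdga_id_def compose_def)
    moreover have "v y \<in> word_span R B0 \<eta>0 (words_of_degree A i)"
      using g0 cdga_homD(3)[OF v(1) y] unfolding generated_def by blast
    ultimately show "y \<in> word_span R B \<eta> (words_of_degree A i)" using span[of "v y" i] by simp
  qed
qed

lemma left_adjoint_universal:
  fixes A :: "('r, 'a) cosimp"
  assumes "A \<in> cCom R"
  shows "universal_arrow R A (D_star R A, D_unit R A)"
proof -
  have "\<exists>u :: ('r, ('r, 'a) lcarrier) dga \<times> (nat \<Rightarrow> 'a \<Rightarrow> nat set \<Rightarrow> ('r, 'a) lcarrier). universal_arrow R A u"
    using universal_arrow_exists[OF assms] by blast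
  then have "universal_arrow R A (left_adjoint R A)" unfolding left_adjoint_def by (rule someI_ex)
  then show ?thesis by (simp add: D_star_def D_unit_def)
qed

lemma D_star_cdgas: "A \<in> cCom R \<Longrightarrow> D_star R A \<in> cdgas R"
  by (rule universal_arrowD(1)[OF left_adjoint_universal])

lemma D_unit_hom: "A \<in> cCom R \<Longrightarrow> D_unit R A \<in> ccom_hom R A (K_alg (D_star R A))"
  by (rule universal_arrowD(2)[OF left_adjoint_universal])

lemma D_star_generated: "A \<in> cCom R \<Longrightarrow> generated R A (D_star R A) (D_unit R A)"
  by (rule universal_arrow_generated[OF _ left_adjoint_universal])

lemma adjunct_hom:
  assumes A: "A \<in> cCom R" and C: "C \<in> cdgas R" and g: "g \<in> cdga_hom R (D_star R A) C"
  shows "adjunct R A g \<in> ccom_hom R A (K_alg C)"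
  unfolding adjunct_def
  by (rule ccom_comp_hom[OF A D_unit_hom[OF A] K_map_hom[OF D_star_cdgas[OF A] C g]])

lemma adjunct_inj:
  assumes "A \<in> cCom R" "C \<in> cdgas R" "g \<in> cdga_hom R (D_star R A) C" "h \<in> cdga_hom R (D_star R A) C"
    and "adjunct R A g = adjunct R A h"
  shows "g = h"
  using assms hom_unique_of_generated[OF D_star_cdgas D_unit_hom D_star_generated] unfolding adjunct_def by blast

lemma adjunct_bij:
  assumes A: "A \<in> cCom R" and C: "C \<in> cdgas R"
  shows "bij_betw (adjunct R A) (cdga_hom R (D_star R A) C) (ccom_hom R A (K_alg C))"
proof (rule bij_betw_imageI)
  show "inj_on (adjunct R A) (cdga_hom R (D_star R A) C)"
    using adjunct_inj[OF A C] by (blast intro: inj_onI)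
  show "adjunct R A ` cdga_hom R (D_star R A) C = ccom_hom R A (K_alg C)"
  proof
    show "ccom_hom R A (K_alg C) \<subseteq> adjunct R A ` cdga_hom R (D_star R A) C"
      using universal_arrow_any_type[OF A left_adjoint_universal[OF A] C] unfolding adjunct_def by blast
  qed (use adjunct_hom[OF A C] in blast)
qed

lemma adjunct_comp_right:
  assumes A: "A \<in> cCom R" and C: "C \<in> cdgas R" and g: "g \<in> cdga_hom R (D_star R A) C"
  shows "adjunct R A (cdga_comp (D_star R A) h g) = ccom_comp A (K_map C h) (adjunct R A g)"
  unfolding adjunct_def K_map_comp[OF D_star_cdgas[OF A] C g] ccom_comp_assoc[OF D_unit_hom[OF A], symmetric] ..

text \<open>\<open>D_map\<close> is a definite description; the adjunction bijection supplies both
  existence and uniqueness.\<close>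

lemma D_map_char:
  assumes A: "A \<in> cCom R" and B: "B \<in> cCom R" and \<phi>: "\<phi> \<in> ccom_hom R A B"
  shows "D_map R A B \<phi> \<in> cdga_hom R (D_star R A) (D_star R B)"
    and "adjunct R A (D_map R A B \<phi>) = ccom_comp A (D_unit R B) \<phi>"
proof -
  have h: "ccom_comp A (D_unit R B) \<phi> \<in> ccom_hom R A (K_alg (D_star R B))"
    by (rule ccom_comp_hom[OF A \<phi> D_unit_hom[OF B]])
  have "ccom_comp A (D_unit R B) \<phi> \<in> adjunct R A ` cdga_hom R (D_star R A) (D_star R B)"
    using bij_betw_imp_surj_on[OF adjunct_bij[OF A D_star_cdgas[OF B]]] h by simp
  then obtain g0 where g0: "g0 \<in> cdga_hom R (D_star R A) (D_star R B)" "adjunct R A g0 = ccom_comp A (D_unit R B) \<phi>"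
    by auto
  have "\<exists>!g. g \<in> cdga_hom R (D_star R A) (D_star R B) \<and> adjunct R A g = ccom_comp A (D_unit R B) \<phi>"
  proof (rule ex1I[of _ g0])
    fix g assume "g \<in> cdga_hom R (D_star R A) (D_star R B) \<and> adjunct R A g = ccom_comp A (D_unit R B) \<phi>"
    then show "g = g0" using g0 by (intro adjunct_inj[OF A D_star_cdgas[OF B] _ g0(1)]) simp_all
  qed (use g0 in simp)
  from theI'[OF this] show "D_map R A B \<phi> \<in> cdga_hom R (D_star R A) (D_star R B)"
    and "adjunct R A (D_map R A B \<phi>) = ccom_comp A (D_unit R B) \<phi>"
    unfolding D_map_def by blast+
qed

lemma adjunct_comp_left:
  assumes A: "A \<in> cCom R" and B: "B \<in> cCom R" and \<phi>: "\<phi> \<in> ccom_hom R A B"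
  shows "adjunct R A (cdga_comp (D_star R A) g (D_map R A B \<phi>)) = ccom_comp A (adjunct R B g) \<phi>"
proof -
  note d = D_map_char[OF A B \<phi>]
  have "adjunct R A (cdga_comp (D_star R A) g (D_map R A B \<phi>)) = ccom_comp A (K_map (D_star R B) g) (adjunct R A (D_map R A B \<phi>))"
    by (rule adjunct_comp_right[OF A D_star_cdgas[OF B] d(1)])
  also have "\<dots> = ccom_comp A (adjunct R B g) \<phi>"
    unfolding d(2) unfolding adjunct_def by (rule ccom_comp_assoc[OF \<phi>])
  finally show ?thesis .
qed

lemma adjunct_id: "A \<in> cCom R \<Longrightarrow> adjunct R A (cdga_id (D_star R A)) = D_unit R A"
  unfolding adjunct_def K_map_id[OF D_star_cdgas] by (rule ccom_id_comp[OF D_unit_hom])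

lemma D_map_id:
  assumes A: "A \<in> cCom R"
  shows "D_map R A A (ccom_id A) = cdga_id (D_star R A)"
proof (rule adjunct_inj[OF A D_star_cdgas[OF A]])
  note d = D_map_char[OF A A ccom_id_hom[OF A]]
  show "D_map R A A (ccom_id A) \<in> cdga_hom R (D_star R A) (D_star R A)" by (rule d)
  show "cdga_id (D_star R A) \<in> cdga_hom R (D_star R A) (D_star R A)" by (rule cdga_id_hom[OF D_star_cdgas[OF A]])
  show "adjunct R A (D_map R A A (ccom_id A)) = adjunct R A (cdga_id (D_star R A))"
    unfolding d(2) adjunct_id[OF A] by (rule ccom_comp_id[OF D_unit_hom[OF A]])
qed

lemma D_map_comp:
  assumes A: "A \<in> cCom R" and B: "B \<in> cCom R" and E: "E \<in> cCom R"
    and \<phi>: "\<phi> \<in> ccom_hom R A B" and \<psi>: "\<psi> \<in> ccom_hom R B E"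
  shows "D_map R A E (ccom_comp A \<psi> \<phi>) = cdga_comp (D_star R A) (D_map R B E \<psi>) (D_map R A B \<phi>)"
proof (rule adjunct_inj[OF A D_star_cdgas[OF E]])
  note d = D_map_char[OF A E ccom_comp_hom[OF A \<phi> \<psi>]]
  show "D_map R A E (ccom_comp A \<psi> \<phi>) \<in> cdga_hom R (D_star R A) (D_star R E)" by (rule d)
  show "cdga_comp (D_star R A) (D_map R B E \<psi>) (D_map R A B \<phi>) \<in> cdga_hom R (D_star R A) (D_star R E)"
    by (rule cdga_comp_hom[OF D_star_cdgas[OF A] D_map_char(1)[OF A B \<phi>] D_map_char(1)[OF B E \<psi>]])
  show "adjunct R A (D_map R A E (ccom_comp A \<psi> \<phi>)) =
      adjunct R A (cdga_comp (D_star R A) (D_map R B E \<psi>) (D_map R A B \<phi>))"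
    unfolding d(2) adjunct_comp_left[OF A B \<phi>] D_map_char(2)[OF B E \<psi>] by (rule ccom_comp_assoc[OF \<phi>])
qed

section \<open>Reduced objects\<close>

subsection \<open>Spans\<close>

text \<open>The scalars K form a separate argument because M does not record its ground
  ring.\<close>

inductive_set lspan for M :: "('r, 'a, 'x) module_scheme" and K :: "'r set" and F :: "'a set" where
  lspan_zero: "\<zero>\<^bsub>M\<^esub> \<in> lspan M K F"
| lspan_step: "r \<in> K \<Longrightarrow> b \<in> F \<Longrightarrow> y \<in> lspan M K F \<Longrightarrow> r \<odot>\<^bsub>M\<^esub> b \<oplus>\<^bsub>M\<^esub> y \<in> lspan M K F"

lemma lspan_mono: "x \<in> lspan M K F \<Longrightarrow> F \<subseteq> F' \<Longrightarrow> x \<in> lspan M K F'"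
  by (induction rule: lspan.induct) (auto intro: lspan.intros)

context module
begin

abbreviation "sp F \<equiv> lspan M (carrier R) F"

lemma sp_carrier: "F \<subseteq> carrier M \<Longrightarrow> x \<in> sp F \<Longrightarrow> x \<in> carrier M"
  by (rotate_tac 1, induction rule: lspan.induct) auto

lemma sp_add:
  assumes F: "F \<subseteq> carrier M" and x: "x \<in> sp F" and y: "y \<in> sp F"
  shows "x \<oplus>\<^bsub>M\<^esub> y \<in> sp F"
  using x
proof (induction rule: lspan.induct)
  case lspan_zero
  show ?case using y sp_carrier[OF F y] by simp
next
  case (lspan_step r b z)
  have "(r \<odot>\<^bsub>M\<^esub> b \<oplus>\<^bsub>M\<^esub> z) \<oplus>\<^bsub>M\<^esub> y = r \<odot>\<^bsub>M\<^esub> b \<oplus>\<^bsub>M\<^esub> (z \<oplus>\<^bsub>M\<^esub> y)"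
    using lspan_step F sp_carrier[OF F] y by (intro M.a_assoc) auto
  then show ?case using lspan.lspan_step[OF lspan_step(1,2,4)] by simp
qed

lemma sp_smult:
  assumes F: "F \<subseteq> carrier M" and x: "x \<in> sp F" and s: "s \<in> carrier R"
  shows "s \<odot>\<^bsub>M\<^esub> x \<in> sp F"
  using x
proof (induction rule: lspan.induct)
  case lspan_zero
  show ?case using s lspan.lspan_zero[of M] by simp
next
  case (lspan_step r b z)
  have "s \<odot>\<^bsub>M\<^esub> (r \<odot>\<^bsub>M\<^esub> b \<oplus>\<^bsub>M\<^esub> z) = (s \<otimes> r) \<odot>\<^bsub>M\<^esub> b \<oplus>\<^bsub>M\<^esub> s \<odot>\<^bsub>M\<^esub> z"
    using lspan_step F sp_carrier[OF F] s by (subst smult_r_distr) (auto simp: smult_assoc1)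
  moreover have "(s \<otimes> r) \<odot>\<^bsub>M\<^esub> b \<oplus>\<^bsub>M\<^esub> s \<odot>\<^bsub>M\<^esub> z \<in> sp F"
    by (rule lspan.lspan_step) (use lspan_step s in auto)
  ultimately show ?case by simp
qed

lemma sp_base: "b \<in> F \<Longrightarrow> F \<subseteq> carrier M \<Longrightarrow> b \<in> sp F"
  using lspan_step[OF R.one_closed _ lspan_zero, of b F] by (metis M.r_zero smult_one subsetD)

lemma sp_neg: "F \<subseteq> carrier M \<Longrightarrow> x \<in> sp F \<Longrightarrow> \<ominus>\<^bsub>M\<^esub> x \<in> sp F"
  using sp_smult[of F x "\<ominus> \<one>"] sp_carrier[of F x] smult_l_minus[of \<one> x] by simp

lemma sp_finsum:
  assumes "F \<subseteq> carrier M" "\<And>a. a \<in> I \<Longrightarrow> f a \<in> sp F"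
  shows "finsum M f I \<in> sp F"
  using assms(2)
proof (induction I rule: infinite_finite_induct)
  case (insert a I)
  then have "f \<in> I \<rightarrow> carrier M" "f a \<in> carrier M" using sp_carrier[OF assms(1)] by blast+
  then show ?case using insert sp_add[OF assms(1)] by (simp add: M.finsum_insert)
qed (simp_all add: lspan_zero M.finsum_infinite)

lemma sp_coeffs:
  assumes F: "finite F" "F \<subseteq> carrier M" and x: "x \<in> sp F"
  shows "\<exists>a\<in>F \<rightarrow> carrier R. x = (\<Oplus>\<^bsub>M\<^esub>b\<in>F. a b \<odot>\<^bsub>M\<^esub> b)"
  using x
proof (induction rule: lspan.induct)
  case lspan_zero
  have "(\<Oplus>\<^bsub>M\<^esub>b\<in>F. \<zero> \<odot>\<^bsub>M\<^esub> b) = \<zero>\<^bsub>M\<^esub>" using F by (intro M.add.finprod_one_eqI) auto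
  then show ?case by (intro bexI[of _ "\<lambda>_. \<zero>"]) auto
next
  case (lspan_step r c y)
  then obtain a where a: "a \<in> F \<rightarrow> carrier R" "y = (\<Oplus>\<^bsub>M\<^esub>b\<in>F. a b \<odot>\<^bsub>M\<^esub> b)" by auto
  define a' where "a' = a(c := r \<oplus> a c)"
  have ac: "a b \<in> carrier R" "b \<in> carrier M" if "b \<in> F" for b using a(1) F that by auto
  have ins: "F = insert c (F - {c})" using lspan_step by auto
  have c: "c \<in> F" "r \<in> carrier R" using lspan_step by auto
  have "y = a c \<odot>\<^bsub>M\<^esub> c \<oplus>\<^bsub>M\<^esub> (\<Oplus>\<^bsub>M\<^esub>b\<in>F - {c}. a b \<odot>\<^bsub>M\<^esub> b)"
    unfolding a(2) by (subst ins, rule M.finsum_insert) (use F ac c in auto)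
  also have "(\<Oplus>\<^bsub>M\<^esub>b\<in>F - {c}. a b \<odot>\<^bsub>M\<^esub> b) = (\<Oplus>\<^bsub>M\<^esub>b\<in>F - {c}. a' b \<odot>\<^bsub>M\<^esub> b)"
    by (rule M.finsum_cong') (use ac in \<open>auto simp: a'_def\<close>)
  finally have y: "y = a c \<odot>\<^bsub>M\<^esub> c \<oplus>\<^bsub>M\<^esub> (\<Oplus>\<^bsub>M\<^esub>b\<in>F - {c}. a' b \<odot>\<^bsub>M\<^esub> b)" .
  have s: "(\<Oplus>\<^bsub>M\<^esub>b\<in>F - {c}. a' b \<odot>\<^bsub>M\<^esub> b) \<in> carrier M"
    by (rule M.finsum_closed) (use ac in \<open>auto simp: a'_def\<close>)
  have "(\<Oplus>\<^bsub>M\<^esub>b\<in>F. a' b \<odot>\<^bsub>M\<^esub> b) = a' c \<odot>\<^bsub>M\<^esub> c \<oplus>\<^bsub>M\<^esub> (\<Oplus>\<^bsub>M\<^esub>b\<in>F - {c}. a' b \<odot>\<^bsub>M\<^esub> b)"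
    by (subst ins, rule M.finsum_insert) (use F ac c in \<open>auto simp: a'_def\<close>)
  also have "\<dots> = r \<odot>\<^bsub>M\<^esub> c \<oplus>\<^bsub>M\<^esub> y"
    unfolding y using ac[OF c(1)] c s by (simp add: a'_def smult_l_distr M.a_assoc)
  finally have "r \<odot>\<^bsub>M\<^esub> c \<oplus>\<^bsub>M\<^esub> y = (\<Oplus>\<^bsub>M\<^esub>b\<in>F. a' b \<odot>\<^bsub>M\<^esub> b)" by simp
  moreover have "a' \<in> F \<rightarrow> carrier R" using ac c by (auto simp: a'_def)
  ultimately show ?case by blast
qed

lemma finite_dim_inI:
  assumes "finite F" "F \<subseteq> V" "V \<subseteq> carrier M" "V \<subseteq> sp F"
  shows "finite_dim_in R M V"
  unfolding finite_dim_in_def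
proof (intro exI[of _ F] conjI ballI assms(1,2))
  fix x assume "x \<in> V"
  then show "\<exists>a\<in>F \<rightarrow> carrier R. x = (\<Oplus>\<^bsub>M\<^esub>b\<in>F. a b \<odot>\<^bsub>M\<^esub> b)" using sp_coeffs[of F x] assms by blast
qed

lemma finite_dim_inD:
  assumes "finite_dim_in R M V" "V \<subseteq> carrier M"
  obtains F where "finite F" "F \<subseteq> V" "V \<subseteq> sp F"
proof -
  obtain F where F: "finite F" "F \<subseteq> V" "\<And>x. x \<in> V \<Longrightarrow> \<exists>a\<in>F \<rightarrow> carrier R. x = (\<Oplus>\<^bsub>M\<^esub>b\<in>F. a b \<odot>\<^bsub>M\<^esub> b)"
    using assms(1) unfolding finite_dim_in_def by blast
  have "V \<subseteq> sp F"
  proof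
    fix x assume "x \<in> V"
    then obtain a where a: "a \<in> F \<rightarrow> carrier R" "x = (\<Oplus>\<^bsub>M\<^esub>b\<in>F. a b \<odot>\<^bsub>M\<^esub> b)" using F(3) by blast
    have "F \<subseteq> carrier M" using F(2) assms(2) by blast
    then show "x \<in> sp F" unfolding a(2) using a(1) by (intro sp_finsum sp_smult sp_base) auto
  qed
  then show ?thesis using F that by blast
qed

text \<open>Induction on the spanning set. If V is not contained in the span without the last
  generator c, some v in V has a nonzero c-coordinate. Subtracting multiples of v leads from V into
  its intersection with the smaller span, and v is added to the generators found there.\<close>

lemma subspace_finite:
  assumes fld: "field R" and F: "finite F" "F \<subseteq> carrier M"
    and V: "V \<subseteq> sp F" "\<zero>\<^bsub>M\<^esub> \<in> V" "\<And>x y. x \<in> V \<Longrightarrow> y \<in> V \<Longrightarrow> x \<oplus>\<^bsub>M\<^esub> y \<in> V" "\<And>r x. r \<in> carrier R \<Longrightarrow> x \<in> V \<Longrightarrow> r \<odot>\<^bsub>M\<^esub> x \<in> V"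
  shows "\<exists>G. finite G \<and> G \<subseteq> V \<and> V \<subseteq> sp G"
  using F V
proof (induction F arbitrary: V rule: finite_induct)
  case empty
  have "x = \<zero>\<^bsub>M\<^esub>" if "x \<in> sp {}" for x using that by (induction rule: lspan.induct) auto
  then show ?case using empty by (intro exI[of _ "{}"]) (auto simp: lspan_zero)
next
  case (insert c F)
  interpret fR: field R by (rule fld)
  have Fc: "F \<subseteq> carrier M" "c \<in> carrier M" using insert.prems by auto
  have dec: "\<exists>r u. r \<in> carrier R \<and> u \<in> sp F \<and> x = r \<odot>\<^bsub>M\<^esub> c \<oplus>\<^bsub>M\<^esub> u" if "x \<in> sp (insert c F)" for x
    using that
  proof (induction rule: lspan.induct)
    case lspan_zero
    have "\<zero>\<^bsub>M\<^esub> = \<zero> \<odot>\<^bsub>M\<^esub> c \<oplus>\<^bsub>M\<^esub> \<zero>\<^bsub>M\<^esub>" using Fc by simp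
    then show ?case using lspan.lspan_zero by blast
  next
    case (lspan_step s b y)
    then obtain r u where ru: "r \<in> carrier R" "u \<in> sp F" "y = r \<odot>\<^bsub>M\<^esub> c \<oplus>\<^bsub>M\<^esub> u" by blast
    have uc: "u \<in> carrier M" using sp_carrier[OF Fc(1) ru(2)] .
    show ?case
    proof (cases "b = c")
      case True
      then have "s \<odot>\<^bsub>M\<^esub> b \<oplus>\<^bsub>M\<^esub> y = (s \<oplus> r) \<odot>\<^bsub>M\<^esub> c \<oplus>\<^bsub>M\<^esub> u"
        using ru uc Fc lspan_step(1) by (simp add: smult_l_distr M.a_assoc)
      then show ?thesis using ru lspan_step(1) by blast
    next
      case False
      then have b: "b \<in> F" using lspan_step(2) by blast
      then have "b \<in> carrier M" using Fc by blast
      then have "s \<odot>\<^bsub>M\<^esub> b \<oplus>\<^bsub>M\<^esub> y = r \<odot>\<^bsub>M\<^esub> c \<oplus>\<^bsub>M\<^esub> (s \<odot>\<^bsub>M\<^esub> b \<oplus>\<^bsub>M\<^esub> u)"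
        using ru uc Fc lspan_step(1) by (simp add: M.a_lcomm)
      moreover have "s \<odot>\<^bsub>M\<^esub> b \<oplus>\<^bsub>M\<^esub> u \<in> sp F" using lspan.lspan_step[OF lspan_step(1) b ru(2)] .
      ultimately show ?thesis using ru by blast
    qed
  qed
  have sub: "V \<inter> sp F \<subseteq> sp F" "\<zero>\<^bsub>M\<^esub> \<in> V \<inter> sp F" "\<And>x y. x \<in> V \<inter> sp F \<Longrightarrow> y \<in> V \<inter> sp F \<Longrightarrow> x \<oplus>\<^bsub>M\<^esub> y \<in> V \<inter> sp F"
    "\<And>r x. r \<in> carrier R \<Longrightarrow> x \<in> V \<inter> sp F \<Longrightarrow> r \<odot>\<^bsub>M\<^esub> x \<in> V \<inter> sp F"
    by (auto intro: insert.prems sp_add[OF Fc(1)] sp_smult[OF Fc(1)] lspan_zero)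
  obtain G where G: "finite G" "G \<subseteq> V \<inter> sp F" "V \<inter> sp F \<subseteq> sp G"
    using insert.IH[OF Fc(1) sub] by blast
  have Gc: "G \<subseteq> carrier M" using G(2) sp_carrier[OF Fc(1)] by blast
  show ?case
  proof (cases "V \<subseteq> sp F")
    case True
    then show ?thesis using G by blast
  next
    case False
    then obtain v where v: "v \<in> V" "v \<notin> sp F" by blast
    obtain r u where ru: "r \<in> carrier R" "u \<in> sp F" "v = r \<odot>\<^bsub>M\<^esub> c \<oplus>\<^bsub>M\<^esub> u"
      using dec v(1) insert.prems(2) by blast
    have uc: "u \<in> carrier M" using sp_carrier[OF Fc(1) ru(2)] .
    have "r \<noteq> \<zero>" using v ru uc Fc by auto
    then have rU: "inv r \<in> carrier R" "inv r \<otimes> r = \<one>" using fR.field_Units ru(1) by auto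
    have vc: "v \<in> carrier M" using ru uc Fc by auto
    have "x \<in> sp (insert v G)" if x: "x \<in> V" for x
    proof -
      obtain s w where sw: "s \<in> carrier R" "w \<in> sp F" "x = s \<odot>\<^bsub>M\<^esub> c \<oplus>\<^bsub>M\<^esub> w"
        using dec x insert.prems(2) by blast
      have wc: "w \<in> carrier M" using sp_carrier[OF Fc(1) sw(2)] .
      \<comment> \<open>The multiple of v that removes the c-coordinate s of x, where r is the
        c-coordinate of v.\<close>
      define t where "t = s \<otimes> inv r"
      have t: "t \<in> carrier R" "t \<otimes> r = s" using sw(1) rU ru(1) by (simp_all add: t_def R.m_assoc)
      define z where "z = (\<ominus> t) \<odot>\<^bsub>M\<^esub> v \<oplus>\<^bsub>M\<^esub> x"
      have "(\<ominus> t) \<odot>\<^bsub>M\<^esub> v = \<ominus>\<^bsub>M\<^esub> (s \<odot>\<^bsub>M\<^esub> c) \<oplus>\<^bsub>M\<^esub> (\<ominus> t) \<odot>\<^bsub>M\<^esub> u"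
        using t uc Fc ru(1) sw(1) unfolding ru(3)
        by (simp add: smult_l_minus smult_r_distr M.minus_add smult_assoc1[symmetric] R.l_minus)
      moreover have "(\<ominus>\<^bsub>M\<^esub> X \<oplus>\<^bsub>M\<^esub> Y) \<oplus>\<^bsub>M\<^esub> (X \<oplus>\<^bsub>M\<^esub> w) = Y \<oplus>\<^bsub>M\<^esub> w"
        if "X \<in> carrier M" "Y \<in> carrier M" for X Y
        using that wc M.a_comm[of "\<ominus>\<^bsub>M\<^esub> X" Y] by (simp add: M.a_assoc M.r_neg1)
      ultimately have "z = (\<ominus> t) \<odot>\<^bsub>M\<^esub> u \<oplus>\<^bsub>M\<^esub> w"
        unfolding z_def sw(3) using t uc Fc sw(1) by simp
      then have "z \<in> sp F" using sp_add[OF Fc(1) sp_smult[OF Fc(1) ru(2)] sw(2)] t(1) by simp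
      moreover have "z \<in> V" unfolding z_def by (intro insert.prems(4,5) x v(1) R.a_inv_closed t(1))
      ultimately have "z \<in> sp (insert v G)" using G(3) lspan_mono[of z M "carrier R" G "insert v G"] by blast
      moreover have "x = t \<odot>\<^bsub>M\<^esub> v \<oplus>\<^bsub>M\<^esub> z"
        unfolding z_def using t(1) vc wc sw Fc by (simp add: smult_l_minus M.a_assoc[symmetric] M.r_neg)
      ultimately show ?thesis using lspan_step[OF t(1), of v "insert v G" z M] by simp
    qed
    then show ?thesis using G v(1) by (intro exI[of _ "insert v G"]) auto
  qed
qed

end

subsection \<open>Reducedness of the left adjoint\<close>

abbreviation collapse :: "nat \<Rightarrow> nat \<Rightarrow> nat"
  where "collapse n \<equiv> (\<lambda>i\<in>{..n}. 0)"

lemma collapse_Delta: "collapse n \<in> Delta n 0"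
  by (auto simp: Delta_def mono_on_def)

lemma compose_collapse: "\<alpha> \<in> Delta m n \<Longrightarrow> compose {..m} (collapse n) \<alpha> = collapse m"
  by (auto simp: Delta_def compose_def fun_eq_iff PiE_def Pi_def)

lemma cmap_collapse:
  assumes "A \<in> cCom R" "\<alpha> \<in> Delta m n" "x \<in> carrier (level A m)"
  shows "cmap A n 0 (collapse n) (cmap A m n \<alpha> x) = cmap A m 0 (collapse m) x"
  using cComD(4)[OF assms(1,2) collapse_Delta assms(3)] compose_collapse[OF assms(2)] by simp

context cdga
begin

lemma push_empty: "f \<in> tensor_carrier C m 0 \<Longrightarrow> push m n \<alpha> f {} = f {}"
  using tensor_carrier_closed[of f m "{}"] by (simp add: push_eq)

lemma tensor_mult_empty: "f \<in> tensor_carrier C n 0 \<Longrightarrow> g \<in> tensor_carrier C n 0 \<Longrightarrow>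
    tensor_mult C n 0 f g {} = f {} \<otimes> g {}"
  using tensor_carrier_closed[of f n "{}"] tensor_carrier_closed[of g n "{}"] by (simp add: tensor_mult_eq)

end

text \<open>An algebra regarded as a cdga in degree 0. A map from \<open>D_star R A\<close> to
  \<open>deg0 (level A 0)\<close> keeps the unit of \<open>D_star R A\<close> from vanishing, which
  spanning by words alone does not exclude.\<close>

definition deg0 :: "('r, 'a, 'x) module_scheme \<Rightarrow> ('r, 'a) dga"
  where "deg0 M = \<lparr> carrier = carrier M, monoid.mult = monoid.mult M, one = one M, zero = zero M,
    add = add M, smult = smult M, hpart = (\<lambda>i. if i = 0 then carrier M else {\<zero>\<^bsub>M\<^esub>}), diff = (\<lambda>_. \<zero>\<^bsub>M\<^esub>) \<rparr>"

lemma deg0_simps [simp]: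
  "carrier (deg0 M) = carrier M" "monoid.mult (deg0 M) = monoid.mult M" "one (deg0 M) = one M"
  "zero (deg0 M) = zero M" "add (deg0 M) = add M" "smult (deg0 M) = smult M"
  "hpart (deg0 M) = (\<lambda>i. if i = 0 then carrier M else {\<zero>\<^bsub>M\<^esub>})" "diff (deg0 M) = (\<lambda>_. \<zero>\<^bsub>M\<^esub>)"
  by (simp_all add: deg0_def)

lemma deg0_cdgas:
  assumes "algebra R M"
  shows "deg0 M \<in> cdgas R"
proof -
  interpret algebra R M by fact
  have ab: "abelian_group (deg0 M)"
    by (rule abelian_groupI) (auto simp: M.a_ac intro!: bexI[of _ "\<ominus>\<^bsub>M\<^esub> x" for x] M.l_neg)
  have rg: "ring (deg0 M)"
    by (rule ringI[OF ab]) (auto intro!: monoidI simp: m_assoc l_distr r_distr)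
  have md: "Module.module R (deg0 M)"
    by (rule moduleI[OF R_cring ab]) (auto simp: smult_l_distr smult_r_distr smult_assoc1)
  interpret D: ring "deg0 M" by (rule rg)
  interpret D: Module.module R "deg0 M" by (rule md)
  have inv: "\<ominus>\<^bsub>deg0 M\<^esub> x = \<ominus>\<^bsub>M\<^esub> x" if "x \<in> carrier M" for x
    using that D.minus_equality[of "\<ominus>\<^bsub>M\<^esub> x" x] by (simp add: M.l_neg)
  have sg: "sgn_mult (deg0 M) k \<zero>\<^bsub>M\<^esub> = \<zero>\<^bsub>M\<^esub>" for k
    using D.sgn_mult_zero by simp
  have sub: "submodule (hpart (deg0 M) i) R (deg0 M)" for i
    by (rule D.submoduleI) (auto simp: inv)
  have dec: "\<exists>!p. (\<forall>i. p i \<in> hpart (deg0 M) i) \<and> finite {i. p i \<noteq> \<zero>\<^bsub>deg0 M\<^esub>} \<and>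
       x = (\<Oplus>\<^bsub>deg0 M\<^esub>i\<in>{i. p i \<noteq> \<zero>\<^bsub>deg0 M\<^esub>}. p i)" if x: "x \<in> carrier (deg0 M)" for x
  proof -
    have sum: "(\<Oplus>\<^bsub>deg0 M\<^esub>i\<in>{i. p i \<noteq> \<zero>\<^bsub>deg0 M\<^esub>}. p i) = p 0 \<and> finite {i. p i \<noteq> \<zero>\<^bsub>deg0 M\<^esub>}"
      if p: "\<And>i. p i \<in> hpart (deg0 M) i" for p
    proof -
      have p': "p 0 \<in> carrier M" "\<And>i. i \<noteq> 0 \<Longrightarrow> p i = \<zero>\<^bsub>M\<^esub>"
        using p[of 0] p[where i=i for i] by (simp, metis deg0_simps(7) singletonD)
      then have sb: "{i. p i \<noteq> \<zero>\<^bsub>deg0 M\<^esub>} \<subseteq> {0}" by auto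
      have pc: "p i \<in> carrier M" for i using p' by (cases "i = 0") auto
      have "(\<Oplus>\<^bsub>deg0 M\<^esub>i\<in>{i. p i \<noteq> \<zero>\<^bsub>deg0 M\<^esub>}. p i) = (\<Oplus>\<^bsub>deg0 M\<^esub>i\<in>{0}. p i)"
        by (rule D.add.finprod_mono_neutral_cong_left) (use sb pc in auto)
      also have "\<dots> = p 0" using p'(1) by simp
      finally show ?thesis using finite_subset[OF sb] by auto
    qed
    define q where "q i = (if i = 0 then x else \<zero>\<^bsub>M\<^esub>)" for i :: nat
    have h: "q i \<in> hpart (deg0 M) i" for i using x by (auto simp: q_def)
    have q0: "q 0 = x" by (simp add: q_def)
    show ?thesis
    proof (rule ex1I[of _ q])
      show "(\<forall>i. q i \<in> hpart (deg0 M) i) \<and> finite {i. q i \<noteq> \<zero>\<^bsub>deg0 M\<^esub>} \<and>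
          x = (\<Oplus>\<^bsub>deg0 M\<^esub>i\<in>{i. q i \<noteq> \<zero>\<^bsub>deg0 M\<^esub>}. q i)"
        using h sum[of q, OF h] q0 by simp
      fix p assume p: "(\<forall>i. p i \<in> hpart (deg0 M) i) \<and> finite {i. p i \<noteq> \<zero>\<^bsub>deg0 M\<^esub>} \<and>
         x = (\<Oplus>\<^bsub>deg0 M\<^esub>i\<in>{i. p i \<noteq> \<zero>\<^bsub>deg0 M\<^esub>}. p i)"
      then have "x = p 0" using sum[of p] by simp
      moreover have "p i = \<zero>\<^bsub>M\<^esub>" if "i \<noteq> 0" for i
        using p that by (metis (no_types, lifting) deg0_simps(7) singletonD)
      ultimately show "p = q" by (auto simp: fun_eq_iff q_def)
    qed
  qed
  have mult: "x \<otimes>\<^bsub>deg0 M\<^esub> y \<in> hpart (deg0 M) (i + j) \<and> x \<otimes>\<^bsub>deg0 M\<^esub> y = sgn_mult (deg0 M) (i * j) (y \<otimes>\<^bsub>deg0 M\<^esub> x)"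
    if "x \<in> hpart (deg0 M) i" "y \<in> hpart (deg0 M) j" for x y i j
    using that by (auto simp: sg m_comm split: if_splits)
  show ?thesis
    unfolding cdgas_def mem_Collect_eq
  proof (intro conjI allI ballI rg md sub dec mult[THEN conjunct1] mult[THEN conjunct2])
    fix r x y assume "r \<in> carrier R" "x \<in> carrier (deg0 M)" "y \<in> carrier (deg0 M)"
    then show "r \<odot>\<^bsub>deg0 M\<^esub> x \<otimes>\<^bsub>deg0 M\<^esub> y = r \<odot>\<^bsub>deg0 M\<^esub> (x \<otimes>\<^bsub>deg0 M\<^esub> y)"
      "x \<otimes>\<^bsub>deg0 M\<^esub> (r \<odot>\<^bsub>deg0 M\<^esub> y) = r \<odot>\<^bsub>deg0 M\<^esub> (x \<otimes>\<^bsub>deg0 M\<^esub> y)"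
      using smult_assoc2[of r x y] smult_assoc2[of r y x] by (simp_all add: m_comm[of x])
  next
    fix i x y assume "x \<in> hpart (deg0 M) i" "y \<in> carrier (deg0 M)"
    then show "diff (deg0 M) (x \<otimes>\<^bsub>deg0 M\<^esub> y) = diff (deg0 M) x \<otimes>\<^bsub>deg0 M\<^esub> y \<oplus>\<^bsub>deg0 M\<^esub> sgn_mult (deg0 M) i (x \<otimes>\<^bsub>deg0 M\<^esub> diff (deg0 M) y)"
      by (auto simp: sg split: if_splits)
  qed auto
qed

text \<open>\<open>K_alg\<close> of an algebra in degree 0 is constant: coefficients at nonempty
  sets lie in zero parts, and the one at the empty set is unaffected by the structure maps. The
  augmentations of A therefore form a morphism to it.\<close>

lemma deg0_hom:
  assumes A: "A \<in> cCom R"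
  shows "(\<lambda>n. \<lambda>a\<in>carrier (level A n). \<lambda>S\<in>Pow {..n}. if S = {} then cmap A n 0 (collapse n) a else \<zero>\<^bsub>level A 0\<^esub>)
    \<in> ccom_hom R A (K_alg (deg0 (level A 0)))"
proof -
  let ?M = "level A 0" and ?D = "deg0 (level A 0)"
  interpret M: algebra R ?M by (rule cComD(1)[OF A])
  interpret D: cdga R ?D by (rule cdga.intro[OF deg0_cdgas[OF cComD(1)[OF A]]])
  define e where "e n = cmap A n 0 (collapse n)" for n
  define \<phi> where "\<phi> n = (\<lambda>a\<in>carrier (level A n). \<lambda>S\<in>Pow {..n}. if S = {} then e n a else \<zero>\<^bsub>?M\<^esub>)" for n
  have eh: "e n \<in> alg_hom R (level A n) ?M" for n unfolding e_def by (rule cComD(2)[OF A collapse_Delta])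
  have ec: "e n a \<in> carrier ?M" if "a \<in> carrier (level A n)" for n a by (rule alg_homD(1)[OF eh that])
  have t: "\<phi> n a \<in> tensor_carrier ?D n 0" if "a \<in> carrier (level A n)" for n a
    using that ec by (intro D.tensor_carrierI) (auto simp: \<phi>_def finite_subset)
  have K: "\<phi> n a \<in> carrier (K_level ?D n)" if a: "a \<in> carrier (level A n)" for n a
  proof -
    have "(\<Oplus>\<^bsub>?D\<^esub>t\<in>{..n} - S. sgn_mult ?D (inversions S {t}) (\<phi> n a (insert t S))) = \<zero>\<^bsub>?D\<^esub>" if "S \<subseteq> {..n}" for S
      using that a D.sgn_mult_zero by (intro D.add.finprod_one_eqI) (auto simp: \<phi>_def)
    then have "D.cocycle n (\<phi> n a)" by (simp add: D.cocycle_def)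
    then show ?thesis using t[OF a] by (simp add: D.mem_K_level_iff)
  qed
  have eqI: "f = g" if "f \<in> tensor_carrier ?D n 0" "g \<in> tensor_carrier ?D n 0" "f {} = g {}" for f g n
  proof (rule D.tensor_eqI[OF that(1,2)])
    fix S assume S: "S \<subseteq> {..n}"
    then show "f S = g S"
      using D.tensor_carrierD[OF that(1) S] D.tensor_carrierD[OF that(2) S] that(3) finite_subset[OF S]
      by (cases "S = {}") auto
  qed
  have emp: "\<phi> n a {} = e n a" if "a \<in> carrier (level A n)" for n a using that by (simp add: \<phi>_def)
  have "\<phi> n \<in> alg_hom R (level A n) (K_level ?D n)" for n
  proof -
    interpret L: algebra R "level A n" by (rule cComD(1)[OF A])
    interpret K: algebra R "K_level ?D n" by (rule D.K_algebra)
    note kt = D.K_carrierD(1)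
    show ?thesis
      unfolding alg_hom_def mem_Collect_eq
    proof (intro conjI ballI ring_hom_memI)
      fix a b assume a: "a \<in> carrier (level A n)" and b: "b \<in> carrier (level A n)"
      show "\<phi> n (a \<otimes>\<^bsub>level A n\<^esub> b) = \<phi> n a \<otimes>\<^bsub>K_level ?D n\<^esub> \<phi> n b"
        using a b by (intro eqI[of _ n]) (simp_all add: t D.tensor_mult_closed D.tensor_mult_empty emp alg_homD(2)[OF eh])
      show "\<phi> n (a \<oplus>\<^bsub>level A n\<^esub> b) = \<phi> n a \<oplus>\<^bsub>K_level ?D n\<^esub> \<phi> n b"
        using a b kt[OF K.a_closed[OF K[OF a] K[OF b]]] by (intro eqI[of _ n]) (simp_all add: t emp alg_homD(3)[OF eh])
    next
      fix a r assume a: "a \<in> carrier (level A n)" and r: "r \<in> carrier R"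
      show "\<phi> n (r \<odot>\<^bsub>level A n\<^esub> a) = r \<odot>\<^bsub>K_level ?D n\<^esub> \<phi> n a"
        using a r kt[OF K.smult_closed[OF r K[OF a]]] by (intro eqI[of _ n]) (simp_all add: t emp alg_homD(5)[OF eh])
    next
      show "\<phi> n \<one>\<^bsub>level A n\<^esub> = \<one>\<^bsub>K_level ?D n\<^esub>"
        using kt[OF K.one_closed] by (intro eqI[of _ n]) (simp_all add: t emp alg_homD(4)[OF eh])
    qed (rule K)
  qed
  moreover have "\<phi> n (cmap A m n \<alpha> a) = D.push m n \<alpha> (\<phi> m a)" if "\<alpha> \<in> Delta m n" "a \<in> carrier (level A m)" for m n \<alpha> a
    using that alg_homD(1)[OF cComD(2)[OF A that(1)]] cmap_collapse[OF A that(1,2)]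
    by (intro eqI[of _ n]) (simp_all add: t D.push_closed D.push_empty emp e_def)
  ultimately have "\<phi> \<in> ccom_hom R A (K_alg ?D)"
    unfolding ccom_hom_def mem_Collect_eq D.cmap_K_alg D.level_K_alg by (auto simp: \<phi>_def)
  moreover have "\<phi> = (\<lambda>n. \<lambda>a\<in>carrier (level A n). \<lambda>S\<in>Pow {..n}. if S = {} then cmap A n 0 (collapse n) a else \<zero>\<^bsub>?M\<^esub>)"
    unfolding \<phi>_def e_def ..
  ultimately show ?thesis by (simp only:)
qed

lemma cCom0D:
  assumes "A \<in> cCom\<^sub>0 R"
  shows "A \<in> cCom R"
    and "x \<in> carrier (level A 0) \<Longrightarrow> \<exists>r\<in>carrier R. x = r \<odot>\<^bsub>level A 0\<^esub> \<one>\<^bsub>level A 0\<^esub>"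
    and "inj_on (\<lambda>r. r \<odot>\<^bsub>level A 0\<^esub> \<one>\<^bsub>level A 0\<^esub>) (carrier R)"
  using assms by (auto simp: cCom\<^sub>0_def is_ground_field_def bij_betw_def)

lemma scalars_nontrivial:
  assumes "field R" "Module.module R M" "inj_on (\<lambda>r. r \<odot>\<^bsub>M\<^esub> \<one>\<^bsub>M\<^esub>) (carrier R)" "\<one>\<^bsub>M\<^esub> \<in> carrier M"
  shows "\<one>\<^bsub>M\<^esub> \<noteq> \<zero>\<^bsub>M\<^esub>"
proof
  interpret R: field R by fact
  interpret M: Module.module R M by fact
  assume "\<one>\<^bsub>M\<^esub> = \<zero>\<^bsub>M\<^esub>"
  then have "\<one>\<^bsub>R\<^esub> \<odot>\<^bsub>M\<^esub> \<one>\<^bsub>M\<^esub> = \<zero>\<^bsub>R\<^esub> \<odot>\<^bsub>M\<^esub> \<one>\<^bsub>M\<^esub>" using assms(4) by simp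
  then show False using inj_onD[OF assms(3)] R.one_not_zero by blast
qed

lemma ground_fieldI:
  assumes fld: "field R" and M: "Module.module R M" and one: "\<one>\<^bsub>M\<^esub> \<noteq> \<zero>\<^bsub>M\<^esub>" "\<one>\<^bsub>M\<^esub> \<in> carrier M"
    and V: "\<And>r. r \<in> carrier R \<Longrightarrow> r \<odot>\<^bsub>M\<^esub> \<one>\<^bsub>M\<^esub> \<in> V" "\<And>x. x \<in> V \<Longrightarrow> \<exists>r\<in>carrier R. x = r \<odot>\<^bsub>M\<^esub> \<one>\<^bsub>M\<^esub>"
  shows "is_ground_field R M V"
proof -
  interpret R: field R by fact
  interpret M: Module.module R M by fact
  have "r = s" if rs: "r \<in> carrier R" "s \<in> carrier R" "r \<odot>\<^bsub>M\<^esub> \<one>\<^bsub>M\<^esub> = s \<odot>\<^bsub>M\<^esub> \<one>\<^bsub>M\<^esub>" for r s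
  proof (rule ccontr)
    assume "r \<noteq> s"
    define t where "t = r \<ominus>\<^bsub>R\<^esub> s"
    have t: "t \<in> carrier R" "t \<noteq> \<zero>\<^bsub>R\<^esub>" using rs \<open>r \<noteq> s\<close> by (simp_all add: t_def)
    have "t \<odot>\<^bsub>M\<^esub> \<one>\<^bsub>M\<^esub> = \<zero>\<^bsub>M\<^esub>"
      unfolding t_def a_minus_def using rs one by (simp add: M.smult_l_distr M.smult_l_minus M.M.r_neg)
    moreover have i: "inv\<^bsub>R\<^esub> t \<in> carrier R" "inv\<^bsub>R\<^esub> t \<otimes>\<^bsub>R\<^esub> t = \<one>\<^bsub>R\<^esub>" using t R.field_Units by auto
    ultimately have "\<one>\<^bsub>R\<^esub> \<odot>\<^bsub>M\<^esub> \<one>\<^bsub>M\<^esub> = \<zero>\<^bsub>M\<^esub>"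
      using t one M.smult_assoc1[of "inv\<^bsub>R\<^esub> t" t "\<one>\<^bsub>M\<^esub>"] by simp
    then show False using one by simp
  qed
  then show ?thesis using V unfolding is_ground_field_def bij_betw_def inj_on_def by blast
qed

text \<open>Reducedness is asked of A only. It alone makes the coefficients at the empty set
  scalars, so that morphisms into \<open>K_alg\<close> of an arbitrary cdga are covered.\<close>

locale reduced_hom = cdga R B for R :: "('r, 'p) ring_scheme" and B :: "('r, 'c) dga" (structure) +
  fixes A :: "('r, 'a) cosimp" and \<eta>
  assumes fld: "field R" and A: "A \<in> cCom\<^sub>0 R" and \<eta>: "\<eta> \<in> ccom_hom R A (K_alg B)"
begin

lemmas A' = cCom0D(1)[OF A]

lemma eta_K: "a \<in> carrier (level A n) \<Longrightarrow> \<eta> n a \<in> carrier (K_level B n)"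
  by (rule K_hom_closed[OF cdgas \<eta>])

lemma eta_hpart: "a \<in> carrier (level A n) \<Longrightarrow> S \<subseteq> {..n} \<Longrightarrow> \<eta> n a S \<in> hpart B (card S)"
  by (rule K_hom_hpart[OF cdgas \<eta>])

lemma eta_carrier: "a \<in> carrier (level A n) \<Longrightarrow> S \<subseteq> {..n} \<Longrightarrow> \<eta> n a S \<in> carrier B"
  using eta_hpart hpart_carrier by blast

lemma eta_hom: "\<eta> n \<in> alg_hom R (level A n) (K_level B n)"
  using ccom_homD(1)[OF \<eta>, of n] by (simp add: level_K_alg)

lemma eta_cmap: "\<alpha> \<in> Delta m n \<Longrightarrow> a \<in> carrier (level A m) \<Longrightarrow> \<eta> n (cmap A m n \<alpha> a) = push m n \<alpha> (\<eta> m a)"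
  using ccom_homD(3)[OF \<eta>] by (simp add: cmap_K_alg)

lemma eta_add:
  assumes "a \<in> carrier (level A n)" "b \<in> carrier (level A n)" "S \<subseteq> {..n}"
  shows "\<eta> n (a \<oplus>\<^bsub>level A n\<^esub> b) S = \<eta> n a S \<oplus> \<eta> n b S"
  using alg_homD(3)[OF eta_hom assms(1,2)] assms(3) by simp

lemma eta_smult:
  assumes "a \<in> carrier (level A n)" "r \<in> carrier R" "S \<subseteq> {..n}"
  shows "\<eta> n (r \<odot>\<^bsub>level A n\<^esub> a) S = r \<odot> \<eta> n a S"
  using alg_homD(5)[OF eta_hom assms(2,1)] assms(3) by simp

lemma eta_one: "S \<subseteq> {..n} \<Longrightarrow> \<eta> n \<one>\<^bsub>level A n\<^esub> S = (if S = {} then \<one> else \<zero>)"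
  using alg_homD(4)[OF eta_hom] by simp

lemma eta_mult:
  assumes "a \<in> carrier (level A n)" "b \<in> carrier (level A n)" "U \<subseteq> {..n}"
  shows "\<eta> n (a \<otimes>\<^bsub>level A n\<^esub> b) U = (\<Oplus>S\<in>Pow U. sgn_mult B (inversions (U - S) S) (\<eta> n a S \<otimes> \<eta> n b (U - S)))"
  using alg_homD(2)[OF eta_hom assms(1,2)] tensor_mult_eq[OF K_carrierD(1) K_carrierD(1) assms(3), OF eta_K eta_K] assms by simp

text \<open>No structure map changes the coefficient at the empty set, so it can be computed after
  the map to level 0, where the element is a scalar.\<close>

lemma eta_augmentation:
  assumes a: "a \<in> carrier (level A n)" and r: "r \<in> carrier R"
    and eq: "cmap A n 0 (collapse n) a = r \<odot>\<^bsub>level A 0\<^esub> \<one>\<^bsub>level A 0\<^esub>"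
  shows "\<eta> n a {} = r \<odot> \<one>"
proof -
  interpret L: algebra R "level A 0" by (rule cComD(1)[OF A'])
  have "\<eta> n a {} = push n 0 (collapse n) (\<eta> n a) {}"
    using push_empty[OF K_carrierD(1)[OF eta_K[OF a]]] by simp
  also have "\<dots> = \<eta> 0 (r \<odot>\<^bsub>level A 0\<^esub> \<one>\<^bsub>level A 0\<^esub>) {}"
    using eta_cmap[OF collapse_Delta a] eq by simp
  also have "\<dots> = r \<odot> \<one>" using r by (simp add: eta_smult eta_one)
  finally show ?thesis .
qed

lemma eta_scalar:
  assumes "a \<in> carrier (level A n)"
  obtains r where "r \<in> carrier R" "cmap A n 0 (collapse n) a = r \<odot>\<^bsub>level A 0\<^esub> \<one>\<^bsub>level A 0\<^esub>" "\<eta> n a {} = r \<odot> \<one>"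
  using cCom0D(2)[OF A alg_homD(1)[OF cComD(2)[OF A' collapse_Delta] assms]] eta_augmentation[OF assms] by blast

lemma eta_aug_ideal: "a \<in> aug_ideal A n \<Longrightarrow> a \<in> carrier (level A n) \<and> \<eta> n a {} = \<zero>"
proof -
  assume a: "a \<in> aug_ideal A n"
  interpret L: algebra R "level A 0" by (rule cComD(1)[OF A'])
  have a': "a \<in> carrier (level A n)" "cmap A n 0 (collapse n) a = \<zero>\<^bsub>level A 0\<^esub>"
    using a by (auto simp: aug_ideal_def a_kernel_def kernel_def)
  then have "\<eta> n a {} = \<zero>\<^bsub>R\<^esub> \<odot> \<one>" by (intro eta_augmentation) auto
  then show ?thesis using a' by simp
qed

text \<open>Every index set in a word of degree 0 is empty, and coefficients at the empty set are
  scalars.\<close>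

lemma word_degree_0:
  assumes "w \<in> lists (symbols A)" "wdeg w = 0"
  shows "\<exists>r\<in>carrier R. word B \<eta> w = r \<odot> \<one>"
  using assms
proof (induction w)
  case Nil
  show ?case by (intro bexI[of _ "\<one>\<^bsub>R\<^esub>"]) auto
next
  case (Cons s w)
  obtain n a S where s: "s = (n, a, S)" by (cases s)
  have "(n, a, S) \<in> symbols A" using Cons.hyps unfolding s by simp
  then have a: "a \<in> carrier (level A n)" "S \<subseteq> {..n}" unfolding symbols_def by blast+
  have "S = {}" using Cons.prems finite_subset[OF a(2)] by (simp add: s)
  moreover obtain q where q: "q \<in> carrier R" "\<eta> n a {} = q \<odot> \<one>" using eta_scalar[OF a(1)] by metis
  moreover obtain r where r: "r \<in> carrier R" "word B \<eta> w = r \<odot> \<one>" using Cons s by auto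
  ultimately have "word B \<eta> (s # w) = (q \<otimes>\<^bsub>R\<^esub> r) \<odot> \<one>"
    by (simp add: s smult_mult M.smult_assoc1[symmetric] R.m_comm)
  then show ?case using q r by blast
qed

end

locale reduced_generated = reduced_hom +
  assumes gen: "generated R A B \<eta>"
begin

lemma hpart_0: "x \<in> hpart B 0 \<Longrightarrow> \<exists>r\<in>carrier R. x = r \<odot> \<one>"
proof -
  assume "x \<in> hpart B 0"
  then have "x \<in> word_span R B \<eta> (words_of_degree A 0)" using gen unfolding generated_def by blast
  then show ?thesis
  proof (induction rule: word_span.induct)
    case zero
    show ?case by (intro bexI[of _ "\<zero>\<^bsub>R\<^esub>"]) auto
  next
    case (step r w y)
    then obtain q s where "q \<in> carrier R" "word B \<eta> w = q \<odot> \<one>" "s \<in> carrier R" "y = s \<odot> \<one>"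
      using word_degree_0[of w] by auto
    then have "r \<odot> word B \<eta> w \<oplus> y = (r \<otimes>\<^bsub>R\<^esub> q \<oplus>\<^bsub>R\<^esub> s) \<odot> \<one>" "r \<otimes>\<^bsub>R\<^esub> q \<oplus>\<^bsub>R\<^esub> s \<in> carrier R"
      using step(1) by (simp_all add: M.smult_l_distr M.smult_assoc1)
    then show ?case by blast
  qed
qed

end

text \<open>The codegeneracy that identifies j and Suc j.\<close>

definition sd :: "nat \<Rightarrow> nat \<Rightarrow> nat \<Rightarrow> nat"
  where "sd m j = (\<lambda>i\<in>{..Suc m}. if i \<le> j then i else i - 1)"

lemma sd_Delta: "j \<le> m \<Longrightarrow> sd m j \<in> Delta (Suc m) m"
  by (auto simp: Delta_def sd_def mono_on_def)

lemma sd_eq: "k \<le> Suc m \<Longrightarrow> t \<le> Suc m \<Longrightarrow> sd m j k = sd m j t \<Longrightarrow> k = t \<or> (k = j \<and> t = Suc j) \<or> (k = Suc j \<and> t = j)"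
  by (auto simp: sd_def split: if_splits)

context cdga
begin

text \<open>The codegeneracy identifies only j and Suc j, so a set with the same image can differ
  from T in these two indices only; here neither of them occurs.\<close>

lemma fib_sd_vacant:
  assumes j: "j \<le> m" and T: "T \<subseteq> {..Suc m}" "j \<notin> T" "Suc j \<notin> T"
  shows "fib (Suc m) (sd m j) (sd m j ` T) = {T}"
proof
  have "inj_on (sd m j) T" using T sd_eq[of _ m _ j] by (intro inj_onI) (metis atMost_iff subsetD)
  then show "{T} \<subseteq> fib (Suc m) (sd m j) (sd m j ` T)" using T by (auto intro: fibI)
  show "fib (Suc m) (sd m j) (sd m j ` T) \<subseteq> {T}"
  proof
    fix S assume "S \<in> fib (Suc m) (sd m j) (sd m j ` T)"
    then have S: "S \<subseteq> {..Suc m}" "sd m j ` S = sd m j ` T" using fibD by blast+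
    have "k \<in> T" if k: "k \<in> S" for k
    proof -
      obtain t where t: "t \<in> T" "sd m j k = sd m j t" using imageI[OF k(1), of "sd m j"] S(2) by auto
      then show ?thesis using sd_eq[of k m t j] k S(1) T by auto
    qed
    moreover have "k \<in> S" if k: "k \<in> T" for k
    proof -
      obtain t where t: "t \<in> S" "sd m j k = sd m j t" using imageI[OF k(1), of "sd m j"] S(2) by auto
      then show ?thesis using sd_eq[of k m t j] k S(1) T by auto
    qed
    ultimately show "S \<in> {T}" by blast
  qed
qed

text \<open>With exactly one of the two identified indices present, it may be either of them, whence
  two sets. This fibre with two members is what allows a codegeneracy to move a vacancy.\<close>

lemma fib_sd_swap:
  assumes j: "j \<le> m" and T: "T \<subseteq> {..Suc m}" "j \<notin> T" "Suc j \<in> T"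
  shows "fib (Suc m) (sd m j) (sd m j ` T) = {T, insert j (T - {Suc j})}"
proof
  let ?T = "insert j (T - {Suc j})"
  have jj: "sd m j j = j" "sd m j (Suc j) = j" using j by (simp_all add: sd_def)
  have i: "inj_on (sd m j) T" using T sd_eq[of _ m _ j] by (intro inj_onI) (metis atMost_iff subsetD)
  have T': "?T \<subseteq> {..Suc m}" using T j by auto
  then have i': "inj_on (sd m j) ?T" using sd_eq[of _ m _ j]
    by (intro inj_onI) (metis DiffE atMost_iff insertE insertI1 n_not_Suc_n subsetD)
  have im: "sd m j ` ?T = sd m j ` T"
  proof -
    have "T = insert (Suc j) (T - {Suc j})" using T by blast
    then have "sd m j ` T = insert j (sd m j ` (T - {Suc j}))" using jj by (metis image_insert)
    then show ?thesis using jj by simp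
  qed
  show "{T, ?T} \<subseteq> fib (Suc m) (sd m j) (sd m j ` T)"
    using fibI[OF T' i' im] fibI[OF T(1) i refl] by blast
  show "fib (Suc m) (sd m j) (sd m j ` T) \<subseteq> {T, ?T}"
  proof
    fix S assume "S \<in> fib (Suc m) (sd m j) (sd m j ` T)"
    then have S: "S \<subseteq> {..Suc m}" "sd m j ` S = sd m j ` T" "inj_on (sd m j) S" using fibD by blast+
    have 1: "k \<in> T" if k: "k \<in> S" "k \<noteq> j" "k \<noteq> Suc j" for k
    proof -
      obtain t where t: "t \<in> T" "sd m j k = sd m j t" using imageI[OF k(1), of "sd m j"] S(2) by auto
      then show ?thesis using sd_eq[of k m t j] k S(1) T by auto
    qed
    have 2: "k \<in> S" if k: "k \<in> T" "k \<noteq> j" "k \<noteq> Suc j" for k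
    proof -
      obtain t where t: "t \<in> S" "sd m j k = sd m j t" using imageI[OF k(1), of "sd m j"] S(2) by auto
      then show ?thesis using sd_eq[of k m t j] k S(1) T by auto
    qed
    have "j \<in> sd m j ` S" using S(2) T(3) jj by (metis imageI)
    then have "j \<in> S \<or> Suc j \<in> S" using j S(1) by (auto simp: sd_def split: if_splits)
    moreover have "\<not> (j \<in> S \<and> Suc j \<in> S)" using S(3) jj by (metis inj_onD n_not_Suc_n)
    ultimately consider "j \<in> S" "Suc j \<notin> S" | "j \<notin> S" "Suc j \<in> S" by blast
    then show "S \<in> {T, ?T}"
    proof cases
      case 1
      have "S = ?T"
      proof (rule Set.set_eqI)
        fix k show "k \<in> S \<longleftrightarrow> k \<in> ?T"
          using 1 \<open>k \<in> S \<Longrightarrow> k \<noteq> j \<Longrightarrow> k \<noteq> Suc j \<Longrightarrow> k \<in> T\<close> 2[of k] by (cases "k = j"; cases "k = Suc j") auto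
      qed
      then show ?thesis by simp
    next
      case c: 2
      have "S = T"
      proof (rule Set.set_eqI)
        fix k show "k \<in> S \<longleftrightarrow> k \<in> T"
          using c T 1[of k] 2[of k] by (cases "k = j"; cases "k = Suc j") auto
      qed
      then show ?thesis by simp
    qed
  qed
qed

end

context reduced_generated
begin

text \<open>The degree \<open>p\<close> part is spanned by decomposable elements together with the coefficients of generators of
  the augmentation ideals in cosimplicial degree at most \<open>p\<close>.\<close>

lemma hpart_finite:
  assumes fg: "fin_gen_aug_ideals A"
  shows "\<exists>F. finite F \<and> F \<subseteq> hpart B p \<and> hpart B p \<subseteq> lspan B (carrier R) F"
proof (induction p rule: less_induct)
  case (less p)
  show ?case
  proof (cases "p = 0")
    case True
    have "x \<in> M.sp {\<one>}" if x: "x \<in> hpart B 0" for x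
    proof -
      obtain r where "r \<in> carrier R" "x = r \<odot> \<one>" using hpart_0[OF x] by blast
      then show ?thesis using M.sp_smult[of "{\<one>}" \<one> r] M.sp_base[of \<one> "{\<one>}"] by simp
    qed
    then show ?thesis using True by (intro exI[of _ "{\<one>}"]) auto
  next
    case False
    define F where "F = (\<lambda>i. SOME F. finite F \<and> F \<subseteq> hpart B i \<and> hpart B i \<subseteq> M.sp F)"
    have F: "finite (F i)" "F i \<subseteq> hpart B i" "hpart B i \<subseteq> M.sp (F i)" if "i < p" for i
      using someI_ex[OF less[OF that]] unfolding F_def by blast+
    have pne: "p > 0" using False by simp
    define G where "G = (\<lambda>n. SOME S. S \<subseteq> carrier (level A n) \<and> finite S \<and> aug_ideal A n = Idl\<^bsub>level A n\<^esub> S)"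
    have G: "G n \<subseteq> carrier (level A n)" "finite (G n)" "aug_ideal A n = Idl\<^bsub>level A n\<^esub> G n" for n
      using someI_ex[of "\<lambda>S. S \<subseteq> carrier (level A n) \<and> finite S \<and> aug_ideal A n = Idl\<^bsub>level A n\<^esub> S"] fg
      unfolding G_def fin_gen_aug_ideals_def by blast+
    define P where "P = (\<Union>i\<in>{1..<p}. (\<lambda>(b, b'). b \<otimes> b') ` (F i \<times> F (p - i)))"
    \<comment> \<open>Among the levels n up to p, only p - 1 and p have subsets of {..n} with p
      elements.\<close>
    define H where "H = (\<Union>n\<in>{..p}. (\<lambda>(s, T). \<eta> n s T) ` (G n \<times> {T \<in> Pow {..n}. card T = p}))"
    have fin: "finite (P \<union> H)" unfolding P_def H_def using F(1) G(2) by auto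
    have PH: "P \<union> H \<subseteq> hpart B p"
    proof
      fix x assume "x \<in> P \<union> H"
      then consider i b b' where "i \<in> {1..<p}" "b \<in> F i" "b' \<in> F (p - i)" "x = b \<otimes> b'"
        | n s T where "s \<in> G n" "T \<subseteq> {..n}" "card T = p" "x = \<eta> n s T" by (auto simp: P_def H_def)
      then show "x \<in> hpart B p"
      proof cases
        case 1
        then have "b \<in> hpart B i" "b' \<in> hpart B (p - i)" using F(2)[of i] F(2)[of "p - i"] by auto
        then show ?thesis using hpart_mult[of b i b' "p - i"] 1 by simp
      next
        case 2
        then show ?thesis using eta_hpart[of s n T] G(1) by auto
      qed
    qed
    then have PHc: "P \<union> H \<subseteq> carrier B" using hpart_carrier by blast
    define W where "W = M.sp (P \<union> H)"
    have Wadd: "x \<oplus> y \<in> W" if "x \<in> W" "y \<in> W" for x y using that M.sp_add[OF PHc] by (simp add: W_def)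
    have Wsm: "r \<odot> x \<in> W" if "r \<in> carrier R" "x \<in> W" for r x using that M.sp_smult[OF PHc] by (simp add: W_def)
    have Wneg: "\<ominus> x \<in> W" if "x \<in> W" for x using that M.sp_neg[OF PHc] by (simp add: W_def)
    have Wsgn: "sgn_mult B k x \<in> W" if "x \<in> W" for x k using that Wneg by (simp add: sgn_mult_def)
    have W0: "\<zero> \<in> W" by (simp add: W_def lspan_zero)
    have Wc: "x \<in> carrier B" if "x \<in> W" for x using that M.sp_carrier[OF PHc] by (simp add: W_def)
    \<comment> \<open>Both factors have degree below p, so they are expanded in the spanning sets
      from the induction hypothesis.\<close>
    have prods: "x \<otimes> y \<in> W" if "x \<in> hpart B i" "y \<in> hpart B j" "i + j = p" "1 \<le> i" "1 \<le> j" for x y i j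
    proof -
      have ij: "i < p" "j < p" "j = p - i" using that by auto
      have Fi: "F i \<subseteq> carrier B" "F j \<subseteq> carrier B" using F(2) ij hpart_carrier by blast+
      have 1: "b \<otimes> z \<in> W" if b: "b \<in> F i" and z: "z \<in> M.sp (F j)" for b z
        using z
      proof (induction rule: lspan.induct)
        case lspan_zero
        then show ?case using W0 b Fi by auto
      next
        case (lspan_step r c z)
        have "b \<otimes> c \<in> P" unfolding P_def using b lspan_step(2) ij that by (auto intro!: bexI[of _ i])
        then have "b \<otimes> c \<in> W" unfolding W_def using PHc by (intro M.sp_base) auto
        moreover have "b \<otimes> (r \<odot> c \<oplus> z) = r \<odot> (b \<otimes> c) \<oplus> b \<otimes> z"
          using b lspan_step Fi M.sp_carrier[OF Fi(2)] by (simp add: r_distr smult_mult subset_iff)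
        ultimately show ?case using lspan_step Wadd Wsm by simp
      qed
      have yF: "y \<in> M.sp (F j)" using F(3)[OF ij(2)] that by blast
      have yc: "y \<in> carrier B" using M.sp_carrier[OF Fi(2) yF] .
      have "x \<in> M.sp (F i)" using F(3)[OF ij(1)] that by blast
      then show ?thesis
      proof (induction rule: lspan.induct)
        case lspan_zero
        then show ?case using W0 yc by auto
      next
        case (lspan_step r c z)
        have "(r \<odot> c \<oplus> z) \<otimes> y = r \<odot> (c \<otimes> y) \<oplus> z \<otimes> y"
          using lspan_step Fi M.sp_carrier[OF Fi(1)] yc by (simp add: l_distr smult_mult subset_iff)
        then show ?case using lspan_step Wadd Wsm 1[OF lspan_step(2) yF] by simp
      qed
    qed
    have low: "\<eta> n a T \<in> W" if n: "n \<le> p" and a: "a \<in> carrier (level A n)" and T: "T \<subseteq> {..n}" "card T = p" for n a T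
    proof -
      interpret L: algebra R "level A n" by (rule cComD(1)[OF A'])
      interpret L0: algebra R "level A 0" by (rule cComD(1)[OF A'])
      have Tne: "T \<noteq> {}" using T False by auto
      \<comment> \<open>\<open>I\<close> is an ideal: in the coefficient of a product x a at U, the
        splitting with S = {} gives a scalar multiple of the coefficient of a, the one with S = U
        vanishes, and all others are decomposable. As it contains the generators, it is the whole
        augmentation ideal.\<close>
      define I where "I = {a \<in> aug_ideal A n. \<forall>T\<subseteq>{..n}. card T = p \<longrightarrow> \<eta> n a T \<in> W}"
      have augc: "x \<in> carrier (level A n)" if "x \<in> aug_ideal A n" for x using eta_aug_ideal[OF that] by blast
      have ah: "cmap A n 0 (collapse n) \<in> alg_hom R (level A n) (level A 0)" by (rule cComD(2)[OF A' collapse_Delta])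
      have "ideal (Idl\<^bsub>level A n\<^esub> G n) (level A n)" by (rule L.genideal_ideal[OF G(1)])
      then interpret J: ideal "aug_ideal A n" "level A n" using G(3) by simp
      have "ideal I (level A n)"
      proof (rule idealI[OF L.ring_axioms])
        show "subgroup I (add_monoid (level A n))"
        proof
          show "I \<subseteq> carrier (add_monoid (level A n))" using augc by (auto simp: I_def)
          show "x \<otimes>\<^bsub>add_monoid (level A n)\<^esub> y \<in> I" if "x \<in> I" "y \<in> I" for x y
            using that augc Wadd by (auto simp: I_def eta_add)
          have "\<eta> n \<zero>\<^bsub>level A n\<^esub> T \<in> W" if "T \<subseteq> {..n}" for T
            using eta_smult[of "\<zero>\<^bsub>level A n\<^esub>" n "\<zero>\<^bsub>R\<^esub>" T] that eta_carrier[of "\<zero>\<^bsub>level A n\<^esub>" n T] W0 by simp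
          then show "\<one>\<^bsub>add_monoid (level A n)\<^esub> \<in> I" by (simp add: I_def)
          fix x assume x: "x \<in> I"
          then have xc: "x \<in> carrier (level A n)" using augc by (simp add: I_def)
          have eq: "inv\<^bsub>add_monoid (level A n)\<^esub> x = \<ominus>\<^bsub>R\<^esub> \<one>\<^bsub>R\<^esub> \<odot>\<^bsub>level A n\<^esub> x"
            using xc L.smult_l_minus[of "\<one>\<^bsub>R\<^esub>" x] by (simp add: a_inv_def[of "level A n", symmetric])
          have "inv\<^bsub>add_monoid (level A n)\<^esub> x \<in> aug_ideal A n"
            using x J.a_inv_closed by (simp add: I_def a_inv_def)
          then show "inv\<^bsub>add_monoid (level A n)\<^esub> x \<in> I"
            using x xc Wsm by (auto simp: I_def eq eta_smult)
        qed
        fix a x assume a: "a \<in> I" and x: "x \<in> carrier (level A n)"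
        have a': "a \<in> aug_ideal A n" "a \<in> carrier (level A n)" "\<eta> n a {} = \<zero>" using a eta_aug_ideal by (auto simp: I_def)
        obtain r where r: "r \<in> carrier R" "\<eta> n x {} = r \<odot> \<one>" using eta_scalar[OF x] by metis
        have "\<eta> n (x \<otimes>\<^bsub>level A n\<^esub> a) U \<in> W" if U: "U \<subseteq> {..n}" "card U = p" for U
          unfolding eta_mult[OF x a'(2) U(1)] W_def
        proof (intro M.sp_finsum[OF PHc], fold W_def)
          fix S assume "S \<in> Pow U"
          then have S: "S \<subseteq> U" "S \<subseteq> {..n}" "U - S \<subseteq> {..n}" "finite S" "finite U"
            using U finite_subset[of U "{..n}"] finite_subset[of S "{..n}"] by auto
          have c: "\<eta> n x S \<in> carrier B" "\<eta> n a (U - S) \<in> carrier B" using S eta_carrier x a' by auto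
          consider "S = {}" | "S = U" | "S \<noteq> {}" "U - S \<noteq> {}" using S by blast
          then have "\<eta> n x S \<otimes> \<eta> n a (U - S) \<in> W"
          proof cases
            case 1
            have "\<eta> n a U \<in> W" using a U by (simp add: I_def)
            moreover have "(r \<odot> \<one>) \<otimes> \<eta> n a U = r \<odot> \<eta> n a U" using r c 1 by (simp add: smult_mult)
            ultimately show ?thesis using 1 r Wsm by simp
          next
            case 2
            then show ?thesis using a' c W0 by simp
          next
            case 3
            have "card S \<le> p" using card_mono[OF S(5,1)] U by simp
            then have "card S + card (U - S) = p" using S U by (simp add: card_Diff_subset)
            moreover have "1 \<le> card S" "1 \<le> card (U - S)" using 3 S by (auto simp: Suc_le_eq card_gt_0_iff)
            ultimately show ?thesis using S x a' by (intro prods[of _ "card S" _ "card (U - S)"] eta_hpart) auto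
          qed
          then show "sgn_mult B (inversions (U - S) S) (\<eta> n x S \<otimes> \<eta> n a (U - S)) \<in> W" by (rule Wsgn)
        qed
        then show "x \<otimes>\<^bsub>level A n\<^esub> a \<in> I" using J.I_l_closed[OF a'(1) x] by (simp add: I_def)
        then show "a \<otimes>\<^bsub>level A n\<^esub> x \<in> I" using L.m_comm[OF a'(2) x] by simp
      qed
      moreover have "G n \<subseteq> I"
      proof
        fix s assume s: "s \<in> G n"
        have "\<eta> n s T \<in> W" if "T \<subseteq> {..n}" "card T = p" for T
        proof -
          have "\<eta> n s T \<in> H" unfolding H_def using s that n by (auto intro!: bexI[of _ n])
          then show ?thesis unfolding W_def using PHc by (intro M.sp_base) auto
        qed
        moreover have "s \<in> aug_ideal A n" using s L.genideal_self[OF G(1)] G(3) by blast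
        ultimately show "s \<in> I" by (simp add: I_def)
      qed
      ultimately have "aug_ideal A n \<subseteq> I" unfolding G(3) by (rule L.genideal_minimal)
      then have IW: "\<eta> n x T \<in> W" if "x \<in> aug_ideal A n" for x using that T by (auto simp: I_def)
      obtain r where r: "r \<in> carrier R" "cmap A n 0 (collapse n) a = r \<odot>\<^bsub>level A 0\<^esub> \<one>\<^bsub>level A 0\<^esub>"
        using eta_scalar[OF a] by metis
      \<comment> \<open>Subtracting the value of the augmentation moves a into the augmentation
        ideal without changing its coefficients at nonempty sets.\<close>
      define x where "x = a \<oplus>\<^bsub>level A n\<^esub> (\<ominus>\<^bsub>R\<^esub> r) \<odot>\<^bsub>level A n\<^esub> \<one>\<^bsub>level A n\<^esub>"
      have "cmap A n 0 (collapse n) x = \<zero>\<^bsub>level A 0\<^esub>"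
        using a r unfolding x_def by (simp add: alg_homD(3)[OF ah] alg_homD(5)[OF ah] alg_homD(4)[OF ah] L0.smult_l_minus L0.r_neg)
      moreover have "x \<in> carrier (level A n)" unfolding x_def using a r by simp
      ultimately have xa: "x \<in> aug_ideal A n" unfolding aug_ideal_def a_kernel_def kernel_def by simp
      have "a = x \<oplus>\<^bsub>level A n\<^esub> r \<odot>\<^bsub>level A n\<^esub> \<one>\<^bsub>level A n\<^esub>"
        unfolding x_def using a r by (simp add: L.smult_l_minus L.a_assoc L.l_neg)
      then have "\<eta> n a T = \<eta> n x T \<oplus> r \<odot> \<eta> n \<one>\<^bsub>level A n\<^esub> T"
        using T augc[OF xa] r by (metis L.one_closed L.smult_closed eta_add eta_smult)
      also have "\<dots> = \<eta> n x T" using Tne r T IW[OF xa] Wc by (simp add: eta_one)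
      finally show ?thesis using IW[OF xa] by simp
    qed
    text \<open>If two adjacent indices are vacant, the coefficient comes from a codegeneracy; otherwise
      a codegeneracy moves a vacancy by one place, up to sign.\<close>
    have all: "\<eta> n a T \<in> W" if "a \<in> carrier (level A n)" "T \<subseteq> {..n}" "card T = p" for n a T
      using that
    proof (induction n arbitrary: a T)
      case 0
      then show ?case using low[of 0] by simp
    next
      case (Suc m)
      show ?case
      proof (cases "Suc m \<le> p")
        case True
        then show ?thesis using low Suc.prems by blast
      next
        case False
        have dn: "push (Suc m) m (sd m j) (\<eta> (Suc m) a) (sd m j ` T) \<in> W"
          if j: "j \<le> m" and T: "T \<subseteq> {..Suc m}" "card T = p" "inj_on (sd m j) T" for j T
        proof -
          have "cmap A (Suc m) m (sd m j) a \<in> carrier (level A m)"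
            by (rule alg_homD(1)[OF cComD(2)[OF A' sd_Delta[OF j]] Suc.prems(1)])
          moreover have "sd m j ` T \<subseteq> {..m}" using sd_Delta[OF j] T(1) by (auto simp: Delta_def PiE_def Pi_def)
          ultimately have "\<eta> m (cmap A (Suc m) m (sd m j) a) (sd m j ` T) \<in> W"
            using T by (intro Suc.IH) (simp_all add: card_image)
          then show ?thesis using eta_cmap[OF sd_Delta[OF j] Suc.prems(1)] by simp
        qed
        \<comment> \<open>Induction on the distance of the two vacancies. If Suc u is occupied,
          \<open>dn\<close> puts into \<open>W\<close> the sum of the coefficients at T and at the
          set with vacancy Suc u in place of u; the vacancies of the latter set are closer
          together.\<close>
        have move: "\<eta> (Suc m) a T \<in> W" if "u < v" "v \<le> Suc m" "u \<notin> T" "v \<notin> T" "T \<subseteq> {..Suc m}" "card T = p" for u v T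
          using that
        proof (induction "v - u" arbitrary: u T)
          case 0
          then show ?case by simp
        next
          case (Suc d)
          have um: "u \<le> m" using Suc.prems by simp
          have rng: "sd m u ` T \<subseteq> {..m}" using sd_Delta[OF um] Suc.prems(5) by (auto simp: Delta_def PiE_def Pi_def)
          show ?case
          proof (cases "Suc u \<in> T")
            case False
            note fb = fib_sd_vacant[OF um Suc.prems(5,3) False]
            have "inj_on (sd m u) T" using fibD[of T "Suc m" "sd m u" "sd m u ` T"] by (simp add: fb)
            then have "push (Suc m) m (sd m u) (\<eta> (Suc m) a) (sd m u ` T) \<in> W" using Suc.prems um by (intro dn)
            then show ?thesis using eta_carrier[OF \<open>a \<in> carrier (level A (Suc m))\<close> Suc.prems(5)] by (simp add: push_eq[OF rng] fb)
          next
            case True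
            let ?T = "insert u (T - {Suc u})"
            note fb = fib_sd_swap[OF um Suc.prems(5,3) True]
            have "inj_on (sd m u) T" using fibD[of T "Suc m" "sd m u" "sd m u ` T"] by (simp add: fb)
            then have "push (Suc m) m (sd m u) (\<eta> (Suc m) a) (sd m u ` T) \<in> W" using Suc.prems um by (intro dn)
            moreover have T': "?T \<subseteq> {..Suc m}" "T \<noteq> ?T" using Suc.prems um by auto
            have e: "\<eta> (Suc m) a T \<in> carrier B" "\<eta> (Suc m) a ?T \<in> carrier B"
              using eta_carrier[OF \<open>a \<in> carrier (level A (Suc m))\<close>] Suc.prems(5) T' by auto
            moreover have "push (Suc m) m (sd m u) (\<eta> (Suc m) a) (sd m u ` T) = \<eta> (Suc m) a T \<oplus> \<eta> (Suc m) a ?T"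
              using T' e by (simp add: push_eq[OF rng] fb)
            moreover have "\<eta> (Suc m) a ?T \<in> W"
            proof (rule Suc.hyps(1))
              have ne: "Suc u \<noteq> v" using True Suc.prems by auto
              show "d = v - Suc u" "Suc u < v" "Suc u \<notin> ?T" "v \<notin> ?T" using Suc.hyps(2) Suc.prems ne by auto
              have finT: "finite T" using Suc.prems(5) finite_subset by blast
              show "card ?T = p" using Suc.prems True finT pne by simp
            qed (use Suc.prems T' in auto)
            ultimately have "(\<eta> (Suc m) a T \<oplus> \<eta> (Suc m) a ?T) \<oplus> \<ominus> \<eta> (Suc m) a ?T \<in> W" using Wadd Wneg by simp
            then show ?thesis using e by (simp add: a_assoc r_neg)
          qed
        qed
        have finT: "finite T" using Suc.prems(2) finite_subset by blast
        \<comment> \<open>The m + 2 indices leave at least two vacant ones since p is at most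
          m.\<close>
        have "card ({..Suc m} - T) = Suc (Suc m) - p" using Suc.prems finT by (simp add: card_Diff_subset)
        then have "card ({..Suc m} - T) \<ge> 2" using False by simp
        then obtain u v where uv: "u \<in> {..Suc m} - T" "v \<in> {..Suc m} - T" "u \<noteq> v"
          by (metis Suc_1 card_le_Suc_iff insertCI One_nat_def)
        then show ?thesis
        proof (cases "u < v")
          case True
          then show ?thesis using move[of u v T] uv Suc.prems by auto
        next
          case False
          then show ?thesis using move[of v u T] uv Suc.prems by auto
        qed
      qed
    qed
    have words: "word B \<eta> w \<in> W" if "w \<in> lists (symbols A)" "wdeg w = p" for w
      using that
    proof (induction w)
      case Nil
      then show ?case using False by simp
    next
      case (Cons s w)
      obtain n a S where s: "s = (n, a, S)" by (cases s)
      have "(n, a, S) \<in> symbols A" using Cons.hyps unfolding s by simp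
      then have a: "a \<in> carrier (level A n)" "S \<subseteq> {..n}" unfolding symbols_def by blast+
      have wh: "word B \<eta> w \<in> hpart B (wdeg w)" using Cons.hyps by (intro word_hpart[OF cdgas \<eta>]) auto
      have d: "card S + wdeg w = p" using Cons.prems by (simp add: s)
      consider "card S = 0" | "wdeg w = 0" | "1 \<le> card S" "1 \<le> wdeg w" by linarith
      then show ?case
      proof cases
        case 1
        then have "S = {}" using finite_subset[OF a(2)] by simp
        moreover obtain r where r: "r \<in> carrier R" "\<eta> n a {} = r \<odot> \<one>" using eta_scalar[OF a(1)] by metis
        moreover have "word B \<eta> w \<in> W" using Cons d 1 by simp
        ultimately show ?thesis using Wsm hpart_carrier[OF wh] by (simp add: s smult_mult)
      next
        case 2
        then obtain r where r: "r \<in> carrier R" "word B \<eta> w = r \<odot> \<one>" using word_degree_0[of w] Cons.hyps by auto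
        have "\<eta> n a S \<in> W" using all a d 2 by simp
        then show ?thesis using r Wsm eta_carrier[OF a] by (simp add: s smult_mult)
      next
        case 3
        then show ?thesis using prods[OF eta_hpart[OF a] wh d] by (simp add: s)
      qed
    qed
    have "hpart B p \<subseteq> W"
    proof
      fix x assume "x \<in> hpart B p"
      then have "x \<in> word_span R B \<eta> (words_of_degree A p)" using gen unfolding generated_def by blast
      then show "x \<in> W"
        by (induction rule: word_span.induct) (auto intro!: W0 Wadd Wsm words)
    qed
    then show ?thesis using fin PH unfolding W_def by blast
  qed
qed

end

lemma D_star_cdgas0:
  assumes fld: "field R" and A: "A \<in> cCom\<^sub>0 R"
  shows "D_star R A \<in> cdgas\<^sub>0 R"
proof -
  note A' = cCom0D(1)[OF A]
  let ?B = "D_star R A"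
  interpret reduced_generated R ?B A "D_unit R A"
    by (intro reduced_generated.intro reduced_hom.intro reduced_hom_axioms.intro reduced_generated_axioms.intro cdga.intro
        fld A D_star_cdgas[OF A'] D_unit_hom[OF A'] D_star_generated[OF A'])
  interpret R: field R by (rule fld)
  let ?D = "deg0 (level A 0)"
  interpret L: algebra R "level A 0" by (rule cComD(1)[OF A'])
  have D: "?D \<in> cdgas R" by (rule deg0_cdgas[OF cComD(1)[OF A']])
  obtain g where g: "g \<in> cdga_hom R ?B ?D"
    using deg0_hom[OF A'] bij_betw_imp_surj_on[OF adjunct_bij[OF A' D]] by blast
  interpret g: cdga_map R ?B ?D g by (rule cdga_map_intro[OF cdgas D g])
  have "\<one>\<^bsub>level A 0\<^esub> \<noteq> \<zero>\<^bsub>level A 0\<^esub>"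
    by (rule scalars_nontrivial[OF fld L.module cCom0D(3)[OF A] L.one_closed])
  then have "\<one>\<^bsub>?B\<^esub> \<noteq> \<zero>\<^bsub>?B\<^esub>" using g.one g.zero by auto
  then have "is_ground_field R ?B (hpart ?B 0)"
    using hpart_0 by (intro ground_fieldI[OF fld M.module_axioms]) auto
  then show ?thesis using cdgas by (simp add: cdgas\<^sub>0_def)
qed

lemma D_star_cdgas0_fg:
  assumes fld: "field R" and A: "A \<in> cCom\<^sub>0 R" and fg: "fin_gen_aug_ideals A"
  shows "D_star R A \<in> cdgas\<^sub>0_fg R"
proof -
  note A' = cCom0D(1)[OF A]
  interpret reduced_generated R "D_star R A" A "D_unit R A"
    by (intro reduced_generated.intro reduced_hom.intro reduced_hom_axioms.intro reduced_generated_axioms.intro cdga.intro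
        fld A D_star_cdgas[OF A'] D_unit_hom[OF A'] D_star_generated[OF A'])
  have "finite_dim_in R (D_star R A) (hpart (D_star R A) i)" for i
    using hpart_finite[OF fg, of i] M.finite_dim_inI hpart_carrier by blast
  then show ?thesis using D_star_cdgas0[OF fld A] by (simp add: cdgas\<^sub>0_fg_def)
qed

subsection \<open>Finite-dimensional levels\<close>

lemma cdgas0D:
  assumes "C \<in> cdgas\<^sub>0 R"
  shows "C \<in> cdgas R" and "x \<in> hpart C 0 \<Longrightarrow> \<exists>r\<in>carrier R. x = r \<odot>\<^bsub>C\<^esub> \<one>\<^bsub>C\<^esub>"
    and "inj_on (\<lambda>r. r \<odot>\<^bsub>C\<^esub> \<one>\<^bsub>C\<^esub>) (carrier R)"
  using assms by (auto simp: cdgas\<^sub>0_def is_ground_field_def bij_betw_def)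

context cdga
begin

lemma hpart_finite_span:
  assumes "C \<in> cdgas\<^sub>0_fg R"
  shows "\<exists>F. finite F \<and> F \<subseteq> hpart C i \<and> hpart C i \<subseteq> M.sp F"
proof (cases "i = 0")
  case True
  have C0: "C \<in> cdgas\<^sub>0 R" using assms by (simp add: cdgas\<^sub>0_fg_def)
  have "x \<in> M.sp {\<one>}" if "x \<in> hpart C 0" for x
    using cdgas0D(2)[OF C0 that] M.sp_smult[of "{\<one>}" \<one>] M.sp_base[of \<one> "{\<one>}"] by auto
  then show ?thesis using True by (intro exI[of _ "{\<one>}"]) auto
next
  case False
  then have fd: "finite_dim_in R C (hpart C i)" using assms by (simp add: cdgas\<^sub>0_fg_def)
  have "hpart C i \<subseteq> carrier C" using hpart_carrier by blast
  then obtain F where "finite F" "F \<subseteq> hpart C i" "hpart C i \<subseteq> M.sp F" by (rule M.finite_dim_inD[OF fd])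
  then show ?thesis by (intro exI[of _ F] conjI)
qed

text \<open>Cochains without the cocycle condition, a space with an evident spanning set. The
  cocycles form a subspace of it, to which \<open>subspace_finite\<close> applies.\<close>

definition tensor_module :: "nat \<Rightarrow> ('r, nat set \<Rightarrow> 'c) module"
  where "tensor_module n = (K_level C n)\<lparr>carrier := tensor_carrier C n 0\<rparr>"

lemma tensor_module_simps [simp]:
  "carrier (tensor_module n) = tensor_carrier C n 0"
  "zero (tensor_module n) = zero (K_level C n)" "add (tensor_module n) = add (K_level C n)"
  "smult (tensor_module n) = smult (K_level C n)"
  by (simp_all add: tensor_module_def)

lemma tensor_extI:
  "f \<in> extensional (Pow {..n}) \<Longrightarrow> g \<in> extensional (Pow {..n}) \<Longrightarrow> (\<And>S. S \<subseteq> {..n} \<Longrightarrow> f S = g S) \<Longrightarrow> f = g"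
  by (rule extensionalityI[of _ "Pow {..n}"]) auto

lemma tensor_ext: "f \<in> tensor_carrier C n 0 \<Longrightarrow> f \<in> extensional (Pow {..n})"
  by (simp add: tensor_carrier_def PiE_def)

lemma tensor_module_module: "Module.module R (tensor_module n)"
proof (rule moduleI[OF R.cring_axioms])
  let ?T = "tensor_module n"
  show "abelian_group ?T"
  proof (rule abelian_groupI)
    fix x assume x: "x \<in> carrier ?T"
    show "\<exists>y\<in>carrier ?T. y \<oplus>\<^bsub>?T\<^esub> x = \<zero>\<^bsub>?T\<^esub>"
    proof
      show "(\<lambda>S\<in>Pow {..n}. \<ominus>\<^bsub>R\<^esub> \<one>\<^bsub>R\<^esub> \<odot> x S) \<in> carrier ?T" using x by (simp add: tensor_smult_closed)
      show "(\<lambda>S\<in>Pow {..n}. \<ominus>\<^bsub>R\<^esub> \<one>\<^bsub>R\<^esub> \<odot> x S) \<oplus>\<^bsub>?T\<^esub> x = \<zero>\<^bsub>?T\<^esub>"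
        using x tensor_carrier_closed[of x n] by (auto simp: fun_eq_iff M.smult_l_minus l_neg)
    qed
    show "\<zero>\<^bsub>?T\<^esub> \<oplus>\<^bsub>?T\<^esub> x = x"
      using x tensor_carrier_closed[of x n] tensor_ext[of x n] by (intro tensor_extI[of _ n]) simp_all
  qed (auto simp: tensor_add_closed tensor_zero_closed a_ac tensor_carrier_closed intro!: restrict_ext)
next
  fix x assume "x \<in> carrier (tensor_module n)"
  then show "\<one>\<^bsub>R\<^esub> \<odot>\<^bsub>tensor_module n\<^esub> x = x"
    using tensor_carrier_closed[of x n] tensor_ext[of x n] by (intro tensor_extI[of _ n]) simp_all
qed (auto simp: tensor_smult_closed M.smult_l_distr M.smult_r_distr
    M.smult_assoc1 tensor_carrier_closed intro!: restrict_ext)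

lemma tensor_module_lspan: "lspan (tensor_module n) (carrier R) F = lspan (K_level C n) (carrier R) F"
proof (intro equalityI subsetI)
  fix x assume "x \<in> lspan (tensor_module n) (carrier R) F"
  then show "x \<in> lspan (K_level C n) (carrier R) F"
  proof (induction rule: lspan.induct)
    case lspan_zero
    show ?case using lspan.lspan_zero[of "K_level C n"] by (simp only: tensor_module_simps)
  next
    case (lspan_step r b y)
    then show ?case using lspan.lspan_step[of r "carrier R" b F y "K_level C n"] by (simp only: tensor_module_simps)
  qed
next
  fix x assume "x \<in> lspan (K_level C n) (carrier R) F"
  then show "x \<in> lspan (tensor_module n) (carrier R) F"
  proof (induction rule: lspan.induct)
    case lspan_zero
    show ?case using lspan.lspan_zero[of "tensor_module n"] by (simp only: tensor_module_simps)
  next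
    case (lspan_step r b y)
    then show ?case using lspan.lspan_step[of r "carrier R" b F y "tensor_module n"] by (simp only: tensor_module_simps)
  qed
qed

text \<open>Cochains that are supported on one index set and take a value in a spanning set of the
  relevant part of C span all cochains; the cocycles among these inherit a finite spanning
  set.\<close>

lemma K_level_finite_span:
  assumes fld: "field R" and C: "C \<in> cdgas\<^sub>0_fg R"
  shows "\<exists>G. finite G \<and> G \<subseteq> carrier (K_level C n) \<and> carrier (K_level C n) \<subseteq> lspan (K_level C n) (carrier R) G"
proof -
  let ?T = "tensor_module n"
  interpret T: Module.module R ?T by (rule tensor_module_module)
  define F where "F = (\<lambda>i. SOME F. finite F \<and> F \<subseteq> hpart C i \<and> hpart C i \<subseteq> M.sp F)"
  have F: "finite (F i)" "F i \<subseteq> hpart C i" "hpart C i \<subseteq> M.sp (F i)" for i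
    using someI_ex[OF hpart_finite_span[OF C, of i]] unfolding F_def by blast+
  have Fc: "F i \<subseteq> carrier C" for i using F(2) hpart_carrier by blast
  define single where "single S b = (\<lambda>S'\<in>Pow {..n}. if S' = S then b else \<zero>)" for S :: "nat set" and b
  have single: "single S b \<in> tensor_carrier C n 0" if "b \<in> hpart C (card S)" for S b
    using that by (intro tensor_carrierI) (auto simp: single_def)
  define G where "G = (\<Union>S\<in>Pow {..n}. single S ` F (card S))"
  have Gc: "G \<subseteq> carrier ?T" using single F(2) by (auto simp: G_def)
  have fin: "finite G" using F(1) by (auto simp: G_def)
  have sp1: "single S x \<in> T.sp G" if S: "S \<subseteq> {..n}" and x: "x \<in> M.sp (F (card S))" for S x
    using x
  proof (induction rule: lspan.induct)
    case lspan_zero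
    have "single S \<zero> = \<zero>\<^bsub>?T\<^esub>" by (auto simp: single_def fun_eq_iff)
    then show ?case using lspan.lspan_zero[of ?T] by (simp only:)
  next
    case (lspan_step r b y)
    have yc: "y \<in> carrier C" using M.sp_carrier[OF Fc lspan_step(3)] .
    have "single S (r \<odot> b \<oplus> y) = r \<odot>\<^bsub>?T\<^esub> single S b \<oplus>\<^bsub>?T\<^esub> single S y"
      using lspan_step yc Fc by (auto simp: single_def fun_eq_iff)
    moreover have "single S b \<in> G" using S lspan_step by (auto simp: G_def)
    ultimately show ?case using lspan.lspan_step[OF lspan_step(1) _ lspan_step(4), of "single S b"] by (simp only:)
  qed
  have "f \<in> T.sp G" if f: "f \<in> tensor_carrier C n 0" for f
  proof -
    have "(\<lambda>S\<in>Pow {..n}. if S \<in> X then f S else \<zero>) \<in> T.sp G" if "finite X" "X \<subseteq> Pow {..n}" for X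
      using that
    proof (induction X rule: finite_induct)
      case empty
      have "(\<lambda>S\<in>Pow {..n}. if S \<in> {} then f S else \<zero>) = \<zero>\<^bsub>?T\<^esub>" by simp
      then show ?case by (simp only: lspan.lspan_zero)
    next
      case (insert S X)
      have "(\<lambda>S'\<in>Pow {..n}. if S' \<in> insert S X then f S' else \<zero>) = single S (f S) \<oplus>\<^bsub>?T\<^esub> (\<lambda>S'\<in>Pow {..n}. if S' \<in> X then f S' else \<zero>)"
        using insert tensor_carrier_closed[OF f] by (auto simp: single_def fun_eq_iff)
      moreover have "f S \<in> M.sp (F (card S))" using tensor_carrierD[OF f, of S] F(3) insert by auto
      moreover have "S \<subseteq> {..n}" using insert by simp
      moreover have "(\<lambda>S'\<in>Pow {..n}. if S' \<in> X then f S' else \<zero>) \<in> T.sp G" using insert(3) insert.prems by blast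
      ultimately show ?case by (simp only: T.sp_add[OF Gc sp1])
    qed
    from this[of "Pow {..n}"] have "(\<lambda>S\<in>Pow {..n}. if S \<in> Pow {..n} then f S else \<zero>) \<in> T.sp G" by simp
    moreover have "(\<lambda>S\<in>Pow {..n}. if S \<in> Pow {..n} then f S else \<zero>) = f"
      by (rule tensor_extI[of _ n]) (use tensor_ext[OF f] in auto)
    ultimately show ?thesis by simp
  qed
  then have "carrier (K_level C n) \<subseteq> T.sp G" using K_carrierD(1) by blast
  then have "\<exists>G. finite G \<and> G \<subseteq> carrier (K_level C n) \<and> carrier (K_level C n) \<subseteq> T.sp G"
    by (rule T.subspace_finite[OF fld fin Gc]) (use K_zero_closed K_add_closed K_smult_closed in auto)
  then show ?thesis unfolding tensor_module_lspan .
qed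

text \<open>The cocycle equation at the empty set reads f {0} = d (f {}), so an element of level 0
  carries no more information than an element of the degree 0 part of C.\<close>

lemma K_0_eqI:
  assumes f: "f \<in> carrier (K_level C 0)" and g: "g \<in> carrier (K_level C 0)" and eq: "f {} = g {}"
  shows "f = g"
proof (rule K_eqI[OF f g])
  have e: "h {0} = diff C (h {})" if h: "h \<in> carrier (K_level C 0)" for h
    using K_carrierD(2)[OF h] K_apply_closed[OF h, of "{0}"] by (simp add: cocycle_def)
  fix S :: "nat set" assume "S \<subseteq> {..0}"
  then have "S = {} \<or> S = {0}" by auto
  then show "f S = g S" using e[OF f] e[OF g] eq by auto
qed

lemma K_0_ground_field:
  assumes fld: "field R" and C: "C \<in> cdgas\<^sub>0 R"
  shows "is_ground_field R (K_level C 0) (carrier (K_level C 0))"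
proof -
  interpret K: algebra R "K_level C 0" by (rule K_algebra)
  interpret F: field R by (rule fld)
  note C0 = cdgas0D[OF C]
  have "\<one> \<noteq> \<zero>" by (rule scalars_nontrivial[OF fld M.module_axioms C0(3) one_closed])
  then have "\<one>\<^bsub>K_level C 0\<^esub> {} \<noteq> \<zero>\<^bsub>K_level C 0\<^esub> {}" by simp
  then have ne: "\<one>\<^bsub>K_level C 0\<^esub> \<noteq> \<zero>\<^bsub>K_level C 0\<^esub>" by metis
  have "\<exists>r\<in>carrier R. f = r \<odot>\<^bsub>K_level C 0\<^esub> \<one>\<^bsub>K_level C 0\<^esub>" if f: "f \<in> carrier (K_level C 0)" for f
  proof -
    have "f {} \<in> hpart C 0" using tensor_carrierD[OF K_carrierD(1)[OF f], of "{}"] by simp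
    then obtain r where r: "r \<in> carrier R" "f {} = r \<odot> \<one>" using C0(2) by blast
    have "f = r \<odot>\<^bsub>K_level C 0\<^esub> \<one>\<^bsub>K_level C 0\<^esub>"
      using r K.smult_closed[OF r(1) K.one_closed] by (intro K_0_eqI[OF f]) simp_all
    then show ?thesis using r(1) by blast
  qed
  moreover note K.smult_closed[OF _ K.one_closed]
  ultimately show ?thesis
    by (intro ground_fieldI[OF fld K.module ne K.one_closed])
qed

text \<open>A finite spanning set is in particular a finite set of algebra generators.\<close>

lemma K_fin_gen:
  assumes fld: "field R" and C: "C \<in> cdgas\<^sub>0_fg R"
  shows "fin_gen_algebra R (K_level C n)"
proof -
  interpret K: algebra R "K_level C n" by (rule K_algebra)
  let ?K = "K_level C n"
  obtain G where G: "finite G" "G \<subseteq> carrier ?K" "carrier ?K \<subseteq> lspan ?K (carrier R) G"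
    using K_level_finite_span[OF assms] by blast
  let ?H = "G \<union> (\<lambda>r. r \<odot>\<^bsub>?K\<^esub> \<one>\<^bsub>?K\<^esub>) ` carrier R"
  have Hc: "?H \<subseteq> carrier ?K" using G(2) K.smult_closed[OF _ K.one_closed] by blast
  have "x \<in> generate_ring ?K ?H" if "x \<in> lspan ?K (carrier R) G" for x
    using that
  proof (induction rule: lspan.induct)
    case lspan_zero
    show ?case by (rule K.zero_in_generate)
  next
    case (lspan_step r b y)
    have b: "b \<in> carrier ?K" using lspan_step G by blast
    have "(r \<odot>\<^bsub>?K\<^esub> \<one>\<^bsub>?K\<^esub>) \<otimes>\<^bsub>?K\<^esub> b = r \<odot>\<^bsub>?K\<^esub> b"
      using K.smult_assoc2[OF lspan_step(1) K.one_closed b] K.l_one[OF b] by simp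
    moreover have "(r \<odot>\<^bsub>?K\<^esub> \<one>\<^bsub>?K\<^esub>) \<otimes>\<^bsub>?K\<^esub> b \<in> generate_ring ?K ?H"
      using lspan_step by (intro generate_ring.eng_mult generate_ring.incl) auto
    ultimately show ?case using lspan_step by (metis generate_ring.eng_add)
  qed
  then have "generate_ring ?K ?H = carrier ?K"
    using G(3) K.generate_ring_incl[OF Hc] by blast
  then show ?thesis unfolding fin_gen_algebra_def using G by blast
qed

end

lemma level_K_alg: "level (K_alg C) = K_level C"
  by (simp add: K_alg_def)

lemma K_alg_cCom0: "field R \<Longrightarrow> C \<in> cdgas\<^sub>0 R \<Longrightarrow> K_alg C \<in> cCom\<^sub>0 R"
  using cdga.K_0_ground_field[OF cdga.intro, of C R] K_alg_cCom[of C R] cdgas0D(1)[of C R]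
  by (simp add: cCom\<^sub>0_def level_K_alg)

lemma K_alg_cCom0_fg: "field R \<Longrightarrow> C \<in> cdgas\<^sub>0_fg R \<Longrightarrow> K_alg C \<in> cCom\<^sub>0_fg R"
  using cdga.K_fin_gen[OF cdga.intro, of C R] K_alg_cCom0[of R C] cdgas0D(1)[of C R]
  by (simp add: cCom\<^sub>0_fg_def cdgas\<^sub>0_fg_def level_K_alg)

subsection \<open>Augmentation ideals\<close>

lemma aug_ideal_ideal:
  assumes A: "A \<in> cCom R"
  shows "ideal (aug_ideal A n) (level A n)"
proof -
  interpret L: algebra R "level A n" by (rule cComD(1)[OF A])
  interpret L0: algebra R "level A 0" by (rule cComD(1)[OF A])
  interpret ring_hom_ring "level A n" "level A 0" "cmap A n 0 (collapse n)"
    using cComD(2)[OF A collapse_Delta, of n] L.ring_axioms L0.ring_axioms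
    by (intro ring_hom_ringI2) (auto simp: alg_hom_def)
  show ?thesis unfolding aug_ideal_def by (rule kernel_is_ideal)
qed

lemma mem_aug_ideal_iff: "x \<in> aug_ideal A n \<longleftrightarrow> x \<in> carrier (level A n) \<and> cmap A n 0 (collapse n) x = \<zero>\<^bsub>level A 0\<^esub>"
  by (auto simp: aug_ideal_def a_kernel_def kernel_def)

lemma alg_hom_zero:
  assumes "algebra R M" "algebra R N" "f \<in> alg_hom R M N"
  shows "f \<zero>\<^bsub>M\<^esub> = \<zero>\<^bsub>N\<^esub>"
proof -
  interpret M: algebra R M by fact
  interpret N: algebra R N by fact
  show ?thesis using alg_homD(5)[OF assms(3), of "\<zero>\<^bsub>R\<^esub>" "\<zero>\<^bsub>M\<^esub>"] alg_homD(1)[OF assms(3), of "\<zero>\<^bsub>M\<^esub>"] by simp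
qed

lemma alg_hom_minus:
  assumes "algebra R M" "algebra R N" "f \<in> alg_hom R M N" "x \<in> carrier M" "y \<in> carrier M"
  shows "f (x \<ominus>\<^bsub>M\<^esub> y) = f x \<ominus>\<^bsub>N\<^esub> f y"
proof -
  interpret M: algebra R M by fact
  interpret N: algebra R N by fact
  have "f (\<ominus>\<^bsub>R\<^esub> \<one>\<^bsub>R\<^esub> \<odot>\<^bsub>M\<^esub> y) = \<ominus>\<^bsub>R\<^esub> \<one>\<^bsub>R\<^esub> \<odot>\<^bsub>N\<^esub> f y" using assms by (intro alg_homD(5)) auto
  then have "f (\<ominus>\<^bsub>M\<^esub> y) = \<ominus>\<^bsub>N\<^esub> f y"
    using assms alg_homD(1)[OF assms(3,5)] M.smult_l_minus[of "\<one>\<^bsub>R\<^esub>" y] N.smult_l_minus[of "\<one>\<^bsub>R\<^esub>" "f y"] by simp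
  then show ?thesis using assms by (simp add: a_minus_def alg_homD(3)[OF assms(3)])
qed

lemma ccom_hom_aug_ideal:
  assumes A: "A \<in> cCom R" and B: "B \<in> cCom R" and \<phi>: "\<phi> \<in> ccom_hom R A B" and x: "x \<in> aug_ideal A n"
  shows "\<phi> n x \<in> aug_ideal B n"
  using x alg_homD(1)[OF ccom_homD(1)[OF \<phi>]] ccom_homD(3)[OF \<phi> collapse_Delta, of x n]
    alg_hom_zero[OF cComD(1)[OF A] cComD(1)[OF B] ccom_homD(1)[OF \<phi>]]
  by (simp add: mem_aug_ideal_iff)

lemma cmap_aug_ideal:
  assumes A: "A \<in> cCom R" and \<alpha>: "\<alpha> \<in> Delta m n" and x: "x \<in> aug_ideal A m"
  shows "cmap A m n \<alpha> x \<in> aug_ideal A n"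
  using x alg_homD(1)[OF cComD(2)[OF A \<alpha>]] cmap_collapse[OF A \<alpha>, of x]
  by (simp add: mem_aug_ideal_iff)

lemma aug_decomposition:
  assumes A: "A \<in> cCom\<^sub>0 R" and x: "x \<in> carrier (level A n)"
  shows "\<exists>r\<in>carrier R. x \<ominus>\<^bsub>level A n\<^esub> r \<odot>\<^bsub>level A n\<^esub> \<one>\<^bsub>level A n\<^esub> \<in> aug_ideal A n"
proof -
  note A' = cCom0D(1)[OF A]
  interpret L: algebra R "level A n" by (rule cComD(1)[OF A'])
  interpret L0: algebra R "level A 0" by (rule cComD(1)[OF A'])
  have h: "cmap A n 0 (collapse n) \<in> alg_hom R (level A n) (level A 0)" by (rule cComD(2)[OF A' collapse_Delta])
  obtain r where r: "r \<in> carrier R" "cmap A n 0 (collapse n) x = r \<odot>\<^bsub>level A 0\<^esub> \<one>\<^bsub>level A 0\<^esub>"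
    using cCom0D(2)[OF A alg_homD(1)[OF h x]] by blast
  then show ?thesis using x
    by (intro bexI[of _ r]) (simp_all add: mem_aug_ideal_iff alg_hom_minus[OF cComD(1)[OF A'] cComD(1)[OF A'] h] alg_homD(5,4)[OF h])
qed

lemma scalar_aug_ideal:
  assumes fld: "field R" and A: "A \<in> cCom\<^sub>0 R" and r: "r \<in> carrier R"
    and m: "r \<odot>\<^bsub>level A n\<^esub> \<one>\<^bsub>level A n\<^esub> \<in> aug_ideal A n"
  shows "r = \<zero>\<^bsub>R\<^esub>"
proof -
  note A' = cCom0D(1)[OF A]
  interpret L: algebra R "level A n" by (rule cComD(1)[OF A'])
  interpret L0: algebra R "level A 0" by (rule cComD(1)[OF A'])
  have h: "cmap A n 0 (collapse n) \<in> alg_hom R (level A n) (level A 0)" by (rule cComD(2)[OF A' collapse_Delta])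
  have "r \<odot>\<^bsub>level A 0\<^esub> \<one>\<^bsub>level A 0\<^esub> = \<zero>\<^bsub>R\<^esub> \<odot>\<^bsub>level A 0\<^esub> \<one>\<^bsub>level A 0\<^esub>"
    using m r by (simp add: mem_aug_ideal_iff alg_homD(5,4)[OF h])
  then show ?thesis using inj_onD[OF cCom0D(3)[OF A]] r by auto
qed

context reduced_hom
begin

text \<open>The filtration by the least number of indices. It starts with everything and vanishes at
  k = n + 2, as subsets of {..n} have at most n + 1 elements.\<close>

definition Fil :: "nat \<Rightarrow> nat \<Rightarrow> (nat set \<Rightarrow> 'c) set"
  where "Fil n k = {f \<in> carrier (K_level B n). \<forall>S\<subseteq>{..n}. card S < k \<longrightarrow> f S = \<zero>}"

text \<open>In each term of a product at U either S is empty, where the factor from the augmentation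
  ideal vanishes, or the complement of S has fewer elements than U, where the other factor vanishes
  by induction.\<close>

lemma eta_ideal_pow: "x \<in> ideal_pow (level A n) (aug_ideal A n) k \<Longrightarrow> x \<in> carrier (level A n) \<and> \<eta> n x \<in> Fil n k"
proof (induction k arbitrary: x)
  case 0
  then show ?case by (simp add: Fil_def eta_K)
next
  case (Suc k)
  interpret L: algebra R "level A n" by (rule cComD(1)[OF A'])
  from Suc.prems have "x \<in> ideal_prod (level A n) (aug_ideal A n) (ideal_pow (level A n) (aug_ideal A n) k)" by simp
  then show ?case
  proof (induction rule: ideal_prod.induct)
    case (prod i j)
    have i: "i \<in> carrier (level A n)" "\<eta> n i {} = \<zero>" using eta_aug_ideal[OF prod(1)] by auto
    have j: "j \<in> carrier (level A n)" "\<And>S. S \<subseteq> {..n} \<Longrightarrow> card S < k \<Longrightarrow> \<eta> n j S = \<zero>"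
      using Suc.IH[OF prod(2)] by (auto simp: Fil_def)
    have "\<eta> n (i \<otimes>\<^bsub>level A n\<^esub> j) U = \<zero>" if U: "U \<subseteq> {..n}" "card U < Suc k" for U
      unfolding eta_mult[OF i(1) j(1) U(1)]
    proof (rule add.finprod_one_eqI)
      fix S assume "S \<in> Pow U"
      then have S: "S \<subseteq> U" "S \<subseteq> {..n}" "U - S \<subseteq> {..n}" "finite S" "finite U"
        using U finite_subset[of U "{..n}"] finite_subset[of S "{..n}"] by auto
      have c: "\<eta> n i S \<in> carrier B" "\<eta> n j (U - S) \<in> carrier B" using S eta_carrier i j by auto
      have "\<eta> n i S \<otimes> \<eta> n j (U - S) = \<zero>"
      proof (cases "S = {}")
        case True
        then show ?thesis using i c by simp
      next
        case False
        then have "card S > 0" using S by (simp add: card_gt_0_iff)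
        moreover have "card (U - S) = card U - card S" "card S \<le> card U" using S by (simp_all add: card_Diff_subset card_mono)
        ultimately have "card (U - S) < k" using U by linarith
        then show ?thesis using j(2)[OF S(3)] c by simp
      qed
      then show "sgn_mult B (inversions (U - S) S) (\<eta> n i S \<otimes> \<eta> n j (U - S)) = \<zero>" by simp
    qed
    then show ?case using i j by (simp add: Fil_def eta_K)
  next
    case (sum s t)
    then show ?case by (auto simp: Fil_def eta_K eta_add)
  qed
qed

lemma Fil_zero: "f \<in> Fil n (n + 2) \<Longrightarrow> f = \<zero>\<^bsub>K_level B n\<^esub>"
proof -
  assume f: "f \<in> Fil n (n + 2)"
  have "card S < n + 2" if "S \<subseteq> {..n}" for S using card_mono[OF _ that] by simp
  then show ?thesis using f K_zero_closed by (intro K_eqI[of _ n]) (auto simp: Fil_def)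
qed

lemma eta_nilpotent: "x \<in> ideal_pow (level A n) (aug_ideal A n) (n + 2) \<Longrightarrow> \<eta> n x = \<zero>\<^bsub>K_level B n\<^esub>"
  using eta_ideal_pow Fil_zero by blast

end

text \<open>The identity is itself a morphism into \<open>K_alg C\<close>, so what holds for the
  image of the augmentation ideal holds for the ideal. This is the reason why \<open>K_alg C\<close>
  agrees with its completion.\<close>

lemma K_alg_nilpotent:
  assumes fld: "field R" and C: "C \<in> cdgas\<^sub>0 R"
  shows "ideal_pow (K_level C n) (aug_ideal (K_alg C) n) (n + 2) \<subseteq> {\<zero>\<^bsub>K_level C n\<^esub>}"
proof
  note C' = cdgas0D(1)[OF C]
  interpret reduced_hom R C "K_alg C" "ccom_id (K_alg C)"
    by (intro reduced_hom.intro reduced_hom_axioms.intro cdga.intro fld K_alg_cCom0 C ccom_id_hom K_alg_cCom C')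
  fix x assume x: "x \<in> ideal_pow (K_level C n) (aug_ideal (K_alg C) n) (n + 2)"
  then have "x \<in> carrier (K_level C n)" "ccom_id (K_alg C) n x = \<zero>\<^bsub>K_level C n\<^esub>"
    using eta_ideal_pow[of x n "n + 2"] eta_nilpotent[of x n] by (simp_all add: level_K_alg)
  then show "x \<in> {\<zero>\<^bsub>K_level C n\<^esub>}" by (simp add: ccom_id_def level_K_alg)
qed

section \<open>Adic completion\<close>

locale adic = algebra R M for R and M (structure) +
  fixes I
  assumes I: "ideal I M"
begin

abbreviation "P \<equiv> ideal_pow M I"
abbreviation "cmpl \<equiv> adic_completion M I"

lemma P_ideal: "ideal (P k) M"
  by (induction k) (auto intro: oneideal ideal_prod_is_ideal I)

lemma P_Suc: "P (Suc k) \<subseteq> P k"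
  using ideal_prod_inter[OF I P_ideal[of k]] by simp

lemma P_antimono: "j \<le> k \<Longrightarrow> P k \<subseteq> P j"
  by (rule lift_Suc_antimono_le[of P]) (use P_Suc in auto)

lemma P_carrier: "x \<in> P k \<Longrightarrow> x \<in> carrier M"
  using ideal.Icarr[OF P_ideal] .

lemma P_add: "x \<in> P k \<Longrightarrow> y \<in> P k \<Longrightarrow> x \<oplus> y \<in> P k"
  using additive_subgroup.a_closed[OF ideal.axioms(1)[OF P_ideal]] .

lemma P_zero: "\<zero> \<in> P k"
  using additive_subgroup.zero_closed[OF ideal.axioms(1)[OF P_ideal]] .

lemma P_neg: "x \<in> P k \<Longrightarrow> \<ominus> x \<in> P k"
  using additive_subgroup.a_inv_closed[OF ideal.axioms(1)[OF P_ideal]] .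

lemma P_minus: "x \<in> P k \<Longrightarrow> y \<in> P k \<Longrightarrow> x \<ominus> y \<in> P k"
  by (simp add: a_minus_def P_add P_neg)

lemma P_mult_l: "x \<in> carrier M \<Longrightarrow> y \<in> P k \<Longrightarrow> x \<otimes> y \<in> P k"
  using ideal.I_l_closed[OF P_ideal] by blast

lemma P_mult_r: "x \<in> P k \<Longrightarrow> y \<in> carrier M \<Longrightarrow> x \<otimes> y \<in> P k"
  using ideal.I_r_closed[OF P_ideal] by blast

lemma P_smult: "r \<in> carrier R \<Longrightarrow> x \<in> P k \<Longrightarrow> r \<odot> x \<in> P k"
  using P_mult_l[of "r \<odot> \<one>" x k] smult_assoc2[of r "\<one>" x] P_carrier[of x k] by simp

lemma P_finsum: "(\<And>a. a \<in> A \<Longrightarrow> f a \<in> P k) \<Longrightarrow> finsum M f A \<in> P k"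
  by (rule ring.ideal_finsum[OF cring.axioms(1)[OF M_cring] P_ideal])

lemma P_mult: "x \<in> P j \<Longrightarrow> y \<in> P k \<Longrightarrow> x \<otimes> y \<in> P (j + k)"
proof (induction j arbitrary: x)
  case 0
  then show ?case by (simp add: P_mult_l)
next
  case (Suc j)
  from Suc.prems(1) have "x \<in> ideal_prod M I (P j)" by simp
  then show ?case
  proof (induction rule: ideal_prod.induct)
    case (prod i z)
    have "(i \<otimes> z) \<otimes> y = i \<otimes> (z \<otimes> y)"
      using prod ideal.Icarr[OF I] P_carrier Suc.prems by (intro m_assoc) auto
    then show ?case using ideal_prod.prod[OF prod(1) Suc.IH[OF prod(2) Suc.prems(2)]] by simp
  next
    case (sum s t)
    have "ideal_prod M I (P j) \<subseteq> carrier M" using ideal_prod_in_carrier[OF I P_ideal] .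
    then have "(s \<oplus> t) \<otimes> y = s \<otimes> y \<oplus> t \<otimes> y"
      using sum P_carrier[OF Suc.prems(2)] by (intro l_distr) auto
    then show ?case using P_add[OF sum(3,4)] by simp
  qed
qed

lemma P_1: "P 1 = I"
proof
  show "P 1 \<subseteq> I" using ideal_prod_inter[OF I oneideal] by simp
  show "I \<subseteq> P 1"
  proof
    fix x assume x: "x \<in> I"
    then have "x \<otimes> \<one> \<in> P 1" by (auto intro!: ideal_prod.prod)
    then show "x \<in> P 1" using ideal.Icarr[OF I x] by simp
  qed
qed

text \<open>Sequences of representatives for the elements of the completion. The term with index k
  counts only modulo \<open>P k\<close>, and all calculations in the completion are done termwise on
  such sequences.\<close>

definition coh :: "(nat \<Rightarrow> 'c) \<Rightarrow> bool"
  where "coh a \<longleftrightarrow> (\<forall>k. a k \<in> carrier M \<and> a (Suc k) \<ominus> a k \<in> P k)"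

definition L :: "(nat \<Rightarrow> 'c) \<Rightarrow> nat \<Rightarrow> 'c set"
  where "L a = (\<lambda>k. P k +> a k)"

lemma coset_eq_iff: "a \<in> carrier M \<Longrightarrow> b \<in> carrier M \<Longrightarrow> P k +> a = P k +> b \<longleftrightarrow> a \<ominus> b \<in> P k"
  by (rule quotient_eq_iff_same_a_r_cos[OF P_ideal, symmetric])

lemma mem_coset: "a \<in> carrier M \<Longrightarrow> x \<in> P k +> a \<longleftrightarrow> x \<in> carrier M \<and> x \<ominus> a \<in> P k"
proof -
  assume a: "a \<in> carrier M"
  have "x \<in> carrier M" if "x \<in> P k +> a"
    using that a P_carrier by (auto simp: a_r_coset_def')
  moreover have "x \<in> P k +> x" if "x \<in> carrier M"
    using that P_zero by (force simp: a_r_coset_def')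
  moreover have "P k +> a = P k +> x" if "x \<in> P k +> a"
  proof -
    from that obtain h where h: "h \<in> P k" "x = h \<oplus> a" by (auto simp: a_r_coset_def')
    have "x \<ominus> a = h" using h a P_carrier[OF h(1)] by (simp add: a_minus_def M.a_assoc M.r_neg)
    then show ?thesis using coset_eq_iff[of x a k] h a P_carrier[OF h(1)] by simp
  qed
  ultimately show ?thesis using coset_eq_iff[of x a k] a by metis
qed

lemma cohD: "coh a \<Longrightarrow> a k \<in> carrier M" "coh a \<Longrightarrow> a (Suc k) \<ominus> a k \<in> P k"
  by (simp_all add: coh_def)

lemma minus_split: "x \<in> carrier M \<Longrightarrow> y \<in> carrier M \<Longrightarrow> z \<in> carrier M \<Longrightarrow>
    x \<ominus> z = (x \<ominus> y) \<oplus> (y \<ominus> z)"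
proof -
  assume c: "x \<in> carrier M" "y \<in> carrier M" "z \<in> carrier M"
  then have "\<ominus> y \<oplus> (y \<oplus> \<ominus> z) = \<ominus> z" by (intro M.r_neg1) auto
  with c show ?thesis by (simp only: a_minus_def M.a_assoc M.a_closed M.a_inv_closed)
qed

lemma P_trans: "x \<in> carrier M \<Longrightarrow> y \<in> carrier M \<Longrightarrow> z \<in> carrier M \<Longrightarrow>
    x \<ominus> y \<in> P k \<Longrightarrow> y \<ominus> z \<in> P k \<Longrightarrow> x \<ominus> z \<in> P k"
  by (subst minus_split[of x y z]) (rule P_add | assumption)+

lemma coh_le: "coh a \<Longrightarrow> j \<le> k \<Longrightarrow> a k \<ominus> a j \<in> P j"
proof (induction k)
  case 0
  then show ?case using cohD(1)[of a 0] P_zero[of 0] by (simp add: a_minus_def M.r_neg)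
next
  case (Suc k)
  show ?case
  proof (cases "j = Suc k")
    case True
    then show ?thesis using cohD(1)[OF Suc.prems(1), of "Suc k"] P_zero[of "Suc k"] by (simp add: a_minus_def M.r_neg)
  next
    case False
    then have "j \<le> k" using Suc.prems by simp
    then have "a (Suc k) \<ominus> a k \<in> P j" using cohD(2)[OF Suc.prems(1), of k] P_antimono by blast
    then show ?thesis using Suc \<open>j \<le> k\<close> cohD(1)[OF Suc.prems(1)] by - (rule P_trans[of _ "a k"], auto)
  qed
qed

lemma L_carrier: "coh a \<Longrightarrow> L a \<in> carrier cmpl"
proof -
  assume a: "coh a"
  have "P (Suc k) +> a (Suc k) \<subseteq> P k +> a k" for k
  proof
    fix x assume "x \<in> P (Suc k) +> a (Suc k)"
    then have x: "x \<in> carrier M" "x \<ominus> a (Suc k) \<in> P k"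
      using mem_coset[OF cohD(1)[OF a], of x "Suc k" "Suc k"] P_Suc[of k] by auto
    then have "x \<ominus> a k \<in> P k" using cohD[OF a] by - (rule P_trans[of x "a (Suc k)"], auto)
    then show "x \<in> P k +> a k" using mem_coset[OF cohD(1)[OF a]] x by blast
  qed
  moreover have "P k +> a k \<in> carrier (M Quot P k)" for k
    unfolding FactRing_def using M.a_rcosetsI[OF _ cohD(1)[OF a], of "P k"] P_carrier by (simp add: subset_iff)
  ultimately show ?thesis by (simp add: adic_completion_def L_def)
qed

lemma L_exists: "x \<in> carrier cmpl \<Longrightarrow> \<exists>a. coh a \<and> x = L a \<and> (\<forall>k. a k \<in> carrier M)"
proof -
  assume x: "x \<in> carrier cmpl"
  have "\<exists>a. a \<in> carrier M \<and> x k = P k +> a" for k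
    using x by (simp add: adic_completion_def FactRing_def A_RCOSETS_def') blast
  then obtain a where a: "\<And>k. a k \<in> carrier M" "\<And>k. x k = P k +> a k" by metis
  have "a (Suc k) \<ominus> a k \<in> P k" for k
  proof -
    have "a (Suc k) \<in> x (Suc k)" unfolding a(2) using a(1) P_zero by (simp del: ideal_pow.simps add: mem_coset a_minus_def M.r_neg)
    moreover have "x (Suc k) \<subseteq> x k" using x by (simp add: adic_completion_def)
    ultimately show ?thesis unfolding a(2) using mem_coset[OF a(1)] by blast
  qed
  then have "coh a" using a(1) by (simp add: coh_def)
  then show ?thesis using a by (intro exI[of _ a]) (auto simp: L_def)
qed

lemma L_eq_iff: "(\<And>k. a k \<in> carrier M) \<Longrightarrow> (\<And>k. b k \<in> carrier M) \<Longrightarrow> L a = L b \<longleftrightarrow> (\<forall>k. a k \<ominus> b k \<in> P k)"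
  using coset_eq_iff by (auto simp: L_def fun_eq_iff)

lemma L_mult: "(\<And>k. a k \<in> carrier M) \<Longrightarrow> (\<And>k. b k \<in> carrier M) \<Longrightarrow> L a \<otimes>\<^bsub>cmpl\<^esub> L b = L (\<lambda>k. a k \<otimes> b k)"
  by (simp add: adic_completion_def L_def FactRing_def ideal.rcoset_mult_add[OF P_ideal])

lemma L_add: "(\<And>k. a k \<in> carrier M) \<Longrightarrow> (\<And>k. b k \<in> carrier M) \<Longrightarrow> L a \<oplus>\<^bsub>cmpl\<^esub> L b = L (\<lambda>k. a k \<oplus> b k)"
  by (simp add: adic_completion_def L_def FactRing_def abelian_subgroup.a_rcos_sum[OF abelian_subgroupI3[OF ideal.axioms(1)[OF P_ideal] M.abelian_group_axioms]])

lemma L_one: "\<one>\<^bsub>cmpl\<^esub> = L (\<lambda>_. \<one>)"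
  by (simp add: adic_completion_def L_def FactRing_def)

lemma coset_zero: "P k +> \<zero> = P k"
  using P_carrier by (force simp: a_r_coset_def')

lemma L_zero: "\<zero>\<^bsub>cmpl\<^esub> = L (\<lambda>_. \<zero>)"
  by (simp add: adic_completion_def L_def FactRing_def coset_zero)

lemma L_smult:
  assumes r: "r \<in> carrier R" and a: "\<And>k. a k \<in> carrier M"
  shows "r \<odot>\<^bsub>cmpl\<^esub> L a = L (\<lambda>k. r \<odot> a k)"
proof -
  have "(\<Union>x\<in>P k +> a k. P k +> r \<odot> x) = P k +> r \<odot> a k" for k
  proof -
    have "P k +> r \<odot> x = P k +> r \<odot> a k" if "x \<in> P k +> a k" for x
    proof -
      have x: "x \<in> carrier M" "x \<ominus> a k \<in> P k" using mem_coset[OF a] that by auto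
      have "r \<odot> x \<ominus> r \<odot> a k = r \<odot> (x \<ominus> a k)"
        using r x a by (simp add: a_minus_def smult_r_distr smult_r_minus)
      then show ?thesis using coset_eq_iff[of "r \<odot> x" "r \<odot> a k" k] P_smult[OF r x(2)] r x a by simp
    qed
    moreover have "a k \<in> P k +> a k" using mem_coset[OF a] a P_zero by (simp add: a_minus_def M.r_neg)
    ultimately show ?thesis by blast
  qed
  then show ?thesis by (simp add: adic_completion_def L_def)
qed

lemma coh_const: "x \<in> carrier M \<Longrightarrow> coh (\<lambda>_. x)"
  by (simp add: coh_def a_minus_def M.r_neg P_zero)

lemma coh_add:
  assumes a: "coh a" and b: "coh b"
  shows "coh (\<lambda>k. a k \<oplus> b k)"
proof -
  have "(a (Suc k) \<oplus> b (Suc k)) \<ominus> (a k \<oplus> b k) = (a (Suc k) \<ominus> a k) \<oplus> (b (Suc k) \<ominus> b k)" for k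
    using cohD(1)[OF a] cohD(1)[OF b] by (simp add: a_minus_def M.minus_add M.a_ac)
  then show ?thesis using cohD[OF a] cohD[OF b] P_add by (simp add: coh_def)
qed

lemma mult_diff:
  assumes "x \<in> carrier M" "y \<in> carrier M" "x' \<in> carrier M" "y' \<in> carrier M"
  shows "x \<otimes> y \<ominus> x' \<otimes> y' = (x \<ominus> x') \<otimes> y \<oplus> x' \<otimes> (y \<ominus> y')"
proof -
  have "(x \<ominus> x') \<otimes> y \<oplus> x' \<otimes> (y \<ominus> y') =
     (x \<otimes> y \<ominus> x' \<otimes> y) \<oplus> (x' \<otimes> y \<ominus> x' \<otimes> y')"
    using assms by (simp add: a_minus_def l_distr r_distr l_minus r_minus)
  then show ?thesis using assms minus_split[of "x \<otimes> y" "x' \<otimes> y" "x' \<otimes> y'"] by simp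
qed

lemma coh_mult:
  assumes a: "coh a" and b: "coh b"
  shows "coh (\<lambda>k. a k \<otimes> b k)"
  unfolding coh_def
proof (intro allI conjI)
  fix k
  show "a (Suc k) \<otimes> b (Suc k) \<ominus> a k \<otimes> b k \<in> P k"
    using P_mult_r[OF cohD(2)[OF a, of k] cohD(1)[OF b]] P_mult_l[OF cohD(1)[OF a] cohD(2)[OF b, of k]] P_add cohD(1)[OF a] cohD(1)[OF b]
    by (simp add: mult_diff)
qed (use cohD(1)[OF a] cohD(1)[OF b] in simp)

lemma coh_smult:
  assumes r: "r \<in> carrier R" and a: "coh a"
  shows "coh (\<lambda>k. r \<odot> a k)"
proof -
  have "r \<odot> a (Suc k) \<ominus> r \<odot> a k = r \<odot> (a (Suc k) \<ominus> a k)" for k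
    using r cohD(1)[OF a] by (simp add: a_minus_def smult_r_distr smult_r_minus)
  then show ?thesis using cohD[OF a] P_smult[OF r] r by (simp add: coh_def)
qed

lemma cmpl_algebra: "algebra R cmpl"
proof -
  note [simp] = L_zero L_one L_add L_mult L_smult L_carrier coh_const coh_add coh_mult coh_smult
  have ab: "abelian_group cmpl"
  proof (rule abelian_groupI)
    fix x assume "x \<in> carrier cmpl"
    then obtain a where a: "coh a" "x = L a" "\<forall>k. a k \<in> carrier M" by (blast dest!: L_exists)
    then show "\<exists>y\<in>carrier cmpl. y \<oplus>\<^bsub>cmpl\<^esub> x = \<zero>\<^bsub>cmpl\<^esub>"
      using coh_smult[of "\<ominus>\<^bsub>R\<^esub> \<one>\<^bsub>R\<^esub>" a]
      by (intro bexI[of _ "L (\<lambda>k. (\<ominus>\<^bsub>R\<^esub> \<one>\<^bsub>R\<^esub>) \<odot> a k)"]) (simp_all add: smult_l_minus M.l_neg)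
  qed ((((drule L_exists)+)?, (elim exE conjE)?, simp add: M.a_ac)[1])+
  have "cring cmpl"
    by (rule cringI[OF ab comm_monoidI])
      ((((drule L_exists)+)?, (elim exE conjE)?, (simp add: m_assoc l_distr | simp add: m_comm))[1])+
  then show ?thesis
    by (rule algebraI[OF R_cring])
      (((drule L_exists)+, elim exE conjE, simp add: smult_l_distr smult_r_distr smult_assoc1 smult_assoc2)[1])+
qed

lemma to_completion_eq: "to_completion M I x = L (\<lambda>_. x)"
  by (simp add: to_completion_def L_def)

lemma to_completion_hom: "to_completion M I \<in> alg_hom R M cmpl"
proof -
  have "to_completion M I \<in> ring_hom M cmpl"
    by (rule ring_hom_memI) (simp_all add: to_completion_eq L_mult L_add L_one L_carrier coh_const)
  then show ?thesis by (simp add: alg_hom_def to_completion_eq L_smult)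
qed

text \<open>The kernel of the projection to the quotient by \<open>P k\<close>. These ideals define
  the inverse limit topology; whether they are the powers of \<open>B 1\<close> is a separate
  question.\<close>

definition B :: "nat \<Rightarrow> (nat \<Rightarrow> 'c set) set"
  where "B k = {x \<in> carrier cmpl. x k = P k}"

lemma L_B_iff: "coh a \<Longrightarrow> L a \<in> B k \<longleftrightarrow> a k \<in> P k"
  using coset_eq_iff[of "a k" "\<zero>" k] cohD(1)[of a k] L_carrier[of a]
  by (simp add: B_def L_def coset_zero a_minus_def)

lemma B_carrier: "x \<in> B k \<Longrightarrow> x \<in> carrier cmpl"
  by (simp add: B_def)

sublocale cmpl: algebra R cmpl
  by (rule cmpl_algebra)

lemma L_neg: "coh a \<Longrightarrow> \<ominus>\<^bsub>cmpl\<^esub> L a = L (\<lambda>k. \<ominus> a k)"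
  using cmpl.smult_l_minus[of "\<one>\<^bsub>R\<^esub>" "L a"] L_smult[of "\<ominus>\<^bsub>R\<^esub> \<one>\<^bsub>R\<^esub>" a]
  by (simp add: L_carrier cohD smult_l_minus)

lemma coh_neg: "coh a \<Longrightarrow> coh (\<lambda>k. \<ominus> a k)"
  using coh_smult[of "\<ominus>\<^bsub>R\<^esub> \<one>\<^bsub>R\<^esub>" a] by (simp add: smult_l_minus cohD)

lemma L_minus: "coh a \<Longrightarrow> coh b \<Longrightarrow> L a \<ominus>\<^bsub>cmpl\<^esub> L b = L (\<lambda>k. a k \<ominus> b k)"
  by (simp add: a_minus_def L_neg L_add cohD)

lemma B_add: "x \<in> B k \<Longrightarrow> y \<in> B k \<Longrightarrow> x \<oplus>\<^bsub>cmpl\<^esub> y \<in> B k"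
proof -
  assume xy: "x \<in> B k" "y \<in> B k"
  then obtain a b where "coh a" "x = L a" "coh b" "y = L b" by (blast dest: B_carrier dest!: L_exists)
  then show ?thesis using xy by (simp add: L_add cohD L_B_iff coh_add P_add)
qed

text \<open>By coherence, a sequence whose term with index i lies in \<open>P i\<close> stays in
  \<open>P i\<close> from there on, so both factors may be evaluated at the common index j +
  k.\<close>

lemma B_mult: "x \<in> B j \<Longrightarrow> y \<in> B k \<Longrightarrow> x \<otimes>\<^bsub>cmpl\<^esub> y \<in> B (j + k)"
proof -
  assume xy: "x \<in> B j" "y \<in> B k"
  then obtain a b where ab: "coh a" "x = L a" "coh b" "y = L b" by (blast dest: B_carrier dest!: L_exists)
  have shift: "c l \<in> P i" if "coh c" "c i \<in> P i" "i \<le> l" for c i l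
    using P_add[OF coh_le[OF that(1,3)] that(2)] cohD(1)[OF that(1)] by (simp add: a_minus_def M.a_assoc M.l_neg)
  have "a (j + k) \<in> P j" "b (j + k) \<in> P k" using shift[of a j "j + k"] shift[of b k "j + k"] xy ab by (simp_all add: L_B_iff)
  then show ?thesis using ab by (simp add: L_mult cohD L_B_iff coh_mult P_mult)
qed

lemma B_0: "B 0 = carrier cmpl"
proof (intro equalityI subsetI)
  fix x assume x: "x \<in> carrier cmpl"
  then obtain a where a: "coh a" "x = L a" by (blast dest!: L_exists)
  then show "x \<in> B 0" using cohD(1)[OF a(1), of 0] by (simp add: L_B_iff)
qed (simp add: B_def)

lemma B_ideal: "ideal (B k) cmpl"
proof (rule idealI[OF cmpl.ring_axioms])
  show "subgroup (B k) (add_monoid cmpl)"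
  proof
    show "\<one>\<^bsub>add_monoid cmpl\<^esub> \<in> B k" by (simp add: L_zero L_B_iff coh_const P_zero)
    fix x assume x: "x \<in> B k"
    then obtain a where a: "coh a" "x = L a" by (blast dest: B_carrier dest!: L_exists)
    then have "\<ominus>\<^bsub>cmpl\<^esub> x \<in> B k" using x by (simp add: L_neg L_B_iff coh_neg P_neg)
    then show "inv\<^bsub>add_monoid cmpl\<^esub> x \<in> B k" by (simp add: a_inv_def)
  qed (auto simp: B_add B_carrier)
  fix x y assume "x \<in> B k" "y \<in> carrier cmpl"
  then show "y \<otimes>\<^bsub>cmpl\<^esub> x \<in> B k" "x \<otimes>\<^bsub>cmpl\<^esub> y \<in> B k"
    using B_mult[of y 0 x k] B_mult[of x k y 0] by (simp_all add: B_0)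
qed

lemma coh_minus: "coh a \<Longrightarrow> coh b \<Longrightarrow> coh (\<lambda>k. a k \<ominus> b k)"
  unfolding a_minus_def by (intro coh_add coh_neg)

lemma diff_B_iff: "coh a \<Longrightarrow> coh b \<Longrightarrow> L a \<ominus>\<^bsub>cmpl\<^esub> L b \<in> B k \<longleftrightarrow> a k \<ominus> b k \<in> P k"
  by (simp only: L_minus L_B_iff coh_minus)

text \<open>The limit is the diagonal of the coherent sequences that represent the
  \<open>X k\<close>.\<close>

lemma B_complete:
  assumes X: "\<And>k. X k \<in> carrier cmpl" "\<And>k. X (Suc k) \<ominus>\<^bsub>cmpl\<^esub> X k \<in> B k"
  shows "\<exists>x\<in>carrier cmpl. \<forall>k. x \<ominus>\<^bsub>cmpl\<^esub> X k \<in> B k"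
proof -
  have "\<forall>k. \<exists>a. coh a \<and> X k = L a" using L_exists[OF X(1)] by blast
  then obtain a where a: "\<And>k. coh (a k)" "\<And>k. X k = L (a k)" by metis
  have d: "a (Suc k) k \<ominus> a k k \<in> P k" for k using X(2)[of k] a by (simp add: diff_B_iff)
  have "a (Suc k) (Suc k) \<ominus> a k k \<in> P k" for k
    using cohD[OF a(1)] d[of k] by - (rule P_trans[of _ "a (Suc k) k"], auto)
  then have c: "coh (\<lambda>k. a k k)" using cohD(1)[OF a(1)] by (simp add: coh_def)
  have "L (\<lambda>k. a k k) \<ominus>\<^bsub>cmpl\<^esub> X k \<in> B k" for k
    unfolding a(2) diff_B_iff[OF c a(1)] using cohD(1)[OF a(1)] P_zero by (simp add: a_minus_def M.r_neg)
  then show ?thesis using L_carrier[OF c] by blast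
qed

lemma B_separated:
  assumes "x \<in> carrier cmpl" "\<And>k. x \<in> B k"
  shows "x = \<zero>\<^bsub>cmpl\<^esub>"
proof -
  obtain a where a: "coh a" "x = L a" using assms(1) by (blast dest!: L_exists)
  then have "a k \<in> P k" for k using assms(2)[of k] by (simp add: L_B_iff)
  then have "L a = L (\<lambda>_. \<zero>)" using cohD(1)[OF a(1)] by (subst L_eq_iff) (auto simp: a_minus_def)
  then show ?thesis using a by (simp add: L_zero)
qed

lemma L_finsum:
  assumes "finite S" "\<And>s. s \<in> S \<Longrightarrow> coh (g s)"
  shows "(\<Oplus>\<^bsub>cmpl\<^esub>s\<in>S. L (g s)) = L (\<lambda>j. \<Oplus>s\<in>S. g s j) \<and> coh (\<lambda>j. \<Oplus>s\<in>S. g s j)"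
  using assms
proof (induction S rule: finite_induct)
  case empty
  show ?case by (simp add: L_zero coh_const)
next
  case (insert t S)
  have eq: "(\<Oplus>s\<in>insert t S. g s j) = g t j \<oplus> (\<Oplus>s\<in>S. g s j)" for j
    using insert cohD(1) by (intro M.finsum_insert) auto
  have "(\<Oplus>\<^bsub>cmpl\<^esub>s\<in>insert t S. L (g s)) = L (g t) \<oplus>\<^bsub>cmpl\<^esub> (\<Oplus>\<^bsub>cmpl\<^esub>s\<in>S. L (g s))"
    using insert L_carrier by (intro cmpl.finsum_insert) auto
  also have "\<dots> = L (\<lambda>j. g t j \<oplus> (\<Oplus>s\<in>S. g s j))"
    using insert cohD(1) by (simp add: L_add)
  finally show ?case using insert coh_add[of "g t" "\<lambda>j. \<Oplus>s\<in>S. g s j"] by (simp add: eq)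
qed

end

text \<open>The sums of this form are closed under addition and under multiplication by ring
  elements. Hence the elements that multiply J into them form an ideal; it contains S and so
  \<open>Idl S\<close>.\<close>

lemma (in cring) ideal_prod_generators:
  assumes S: "finite S" "S \<subseteq> carrier R" and J: "ideal J R" and y: "y \<in> ideal_prod R (Idl S) J"
  shows "\<exists>c\<in>S \<rightarrow> J. y = (\<Oplus>s\<in>S. s \<otimes> c s)"
proof -
  interpret J: ideal J R by (rule J)
  define Y where "Y = {y. \<exists>c\<in>S \<rightarrow> J. y = (\<Oplus>s\<in>S. s \<otimes> c s)}"
  have Yadd: "y \<oplus> z \<in> Y" if yz: "y \<in> Y" "z \<in> Y" for y z
  proof -
    obtain c where c: "c \<in> S \<rightarrow> J" "y = (\<Oplus>s\<in>S. s \<otimes> c s)" using yz(1) by (auto simp: Y_def)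
    obtain d where d: "d \<in> S \<rightarrow> J" "z = (\<Oplus>s\<in>S. s \<otimes> d s)" using yz(2) by (auto simp: Y_def)
    have cl: "c s \<in> carrier R" "d s \<in> carrier R" "s \<in> carrier R" if "s \<in> S" for s using J.Icarr[OF funcset_mem[OF c(1) that]] J.Icarr[OF funcset_mem[OF d(1) that]] that S(2) by auto
    have "y \<oplus> z = (\<Oplus>s\<in>S. s \<otimes> c s \<oplus> s \<otimes> d s)" unfolding c(2) d(2) by (rule finsum_addf[symmetric]) (use cl in auto)
    also have "\<dots> = (\<Oplus>s\<in>S. s \<otimes> (c s \<oplus> d s))" by (rule finsum_cong') (use cl in \<open>auto simp: r_distr\<close>)
    finally show ?thesis unfolding Y_def using c(1) d(1) by (auto intro!: bexI[of _ "\<lambda>s. c s \<oplus> d s"])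
  qed
  have Ymult: "x \<otimes> y \<in> Y" if yx: "y \<in> Y" "x \<in> carrier R" for x y
  proof -
    obtain c where c: "c \<in> S \<rightarrow> J" "y = (\<Oplus>s\<in>S. s \<otimes> c s)" using yx(1) by (auto simp: Y_def)
    have cl: "c s \<in> carrier R" "s \<in> carrier R" if "s \<in> S" for s using J.Icarr[OF funcset_mem[OF c(1) that]] that S(2) by auto
    have "x \<otimes> y = (\<Oplus>s\<in>S. x \<otimes> (s \<otimes> c s))" unfolding c(2) by (rule finsum_rdistr) (use yx(2) cl S(1) in auto)
    also have "\<dots> = (\<Oplus>s\<in>S. s \<otimes> (x \<otimes> c s))" by (rule finsum_cong') (use cl yx(2) in \<open>auto simp: m_lcomm\<close>)
    finally show ?thesis unfolding Y_def using c(1) yx(2) J.I_l_closed by (auto intro!: bexI[of _ "\<lambda>s. x \<otimes> c s"])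
  qed
  have Y0: "\<zero> \<in> Y"
  proof -
    have "\<zero> = (\<Oplus>s\<in>S. s \<otimes> \<zero>)" using S by (intro add.finprod_one_eqI[symmetric]) auto
    then show ?thesis unfolding Y_def by (auto intro!: bexI[of _ "\<lambda>_. \<zero>"])
  qed
  define T where "T = {i \<in> carrier R. \<forall>j\<in>J. i \<otimes> j \<in> Y}"
  have "ideal T R"
  proof (rule idealI[OF ring_axioms])
    show "subgroup T (add_monoid R)"
    proof
      show "x \<otimes>\<^bsub>add_monoid R\<^esub> y \<in> T" if "x \<in> T" "y \<in> T" for x y
        using that Yadd J.Icarr by (auto simp: T_def l_distr)
      show "\<one>\<^bsub>add_monoid R\<^esub> \<in> T" using Y0 J.Icarr by (auto simp: T_def)
      fix x assume x: "x \<in> T"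
      have "(\<ominus> x) \<otimes> j = x \<otimes> (\<ominus> j)" if "j \<in> J" for j
        using x that J.Icarr by (simp add: T_def l_minus r_minus)
      then have "\<ominus> x \<in> T" using x J.a_inv_closed by (auto simp: T_def)
      then show "inv\<^bsub>add_monoid R\<^esub> x \<in> T" by (simp add: a_inv_def)
    qed (auto simp: T_def)
    fix a x assume a: "a \<in> T" and x: "x \<in> carrier R"
    then show "x \<otimes> a \<in> T" using Ymult J.Icarr by (auto simp: T_def m_assoc)
    then show "a \<otimes> x \<in> T" using a x m_comm[of a x] by (simp add: T_def)
  qed
  moreover have "S \<subseteq> T"
  proof
    fix s assume s: "s \<in> S"
    have "s \<otimes> j \<in> Y" if j: "j \<in> J" for j
    proof -
      have jc: "j \<in> carrier R" "s \<in> carrier R" using j J.Icarr s S by auto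
      have "(\<Oplus>t\<in>S. t \<otimes> (if s = t then j else \<zero>)) = (\<Oplus>t\<in>S. if s = t then t \<otimes> j else \<zero>)"
        by (rule finsum_cong') (use jc S in auto)
      also have "\<dots> = s \<otimes> j" by (rule finsum_singleton) (use jc S s in auto)
      finally show ?thesis unfolding Y_def using j by (auto intro!: bexI[of _ "\<lambda>t. if s = t then j else \<zero>"])
    qed
    then show "s \<in> T" using s S by (auto simp: T_def)
  qed
  ultimately have sub: "Idl S \<subseteq> T" by (rule genideal_minimal)
  have "y \<in> Y" using y
  proof (induction rule: ideal_prod.induct)
    case (prod i j)
    then show ?case using sub by (auto simp: T_def)
  qed (rule Yadd)
  then show ?thesis by (simp add: Y_def)
qed

locale adic_fg = adic +
  fixes S
  assumes S: "finite S" "S \<subseteq> carrier M" "I = Idl S"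
begin

lemma P_generators: "y \<in> P (Suc k) \<Longrightarrow> \<exists>c\<in>S \<rightarrow> P k. y = (\<Oplus>s\<in>S. s \<otimes> c s)"
  using ideal_prod_generators[OF S(1,2) P_ideal[of k]] by (simp add: S(3)[symmetric])

abbreviation "hat s \<equiv> L (\<lambda>_. s)"

lemma hat_B: "s \<in> S \<Longrightarrow> hat s \<in> B 1"
proof -
  assume s: "s \<in> S"
  then have "s \<in> I" "s \<in> carrier M" using genideal_self[OF S(2)] S by blast+
  then show ?thesis by (simp only: L_B_iff[OF coh_const] P_1)
qed

text \<open>Representatives of a coherent sequence are expanded in the generators step by step, so that
  the coefficients are again coherent.\<close>

lemma B_generators:
  assumes x: "x \<in> B (Suc k)"
  shows "\<exists>y\<in>S \<rightarrow> B k. x = (\<Oplus>\<^bsub>cmpl\<^esub>s\<in>S. hat s \<otimes>\<^bsub>cmpl\<^esub> y s)"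
proof -
  obtain a where a: "coh a" "x = L a" using x by (blast dest: B_carrier dest!: L_exists)
  have ac: "a j \<in> carrier M" for j using cohD(1)[OF a(1)] .
  have "a (Suc k) \<in> P (Suc k)" using x a by (simp add: L_B_iff)
  then obtain e where e: "e \<in> S \<rightarrow> P k" "a (Suc k) = (\<Oplus>s\<in>S. s \<otimes> e s)"
    using P_generators by blast
  have "\<exists>c\<in>S \<rightarrow> P (j + k). a (Suc (Suc (j + k))) \<ominus> a (Suc (j + k)) = (\<Oplus>s\<in>S. s \<otimes> c s)" for j
    using P_generators[OF cohD(2)[OF a(1), of "Suc (j + k)"]] .
  then obtain c where c: "\<And>j. c j \<in> S \<rightarrow> P (j + k)"
    "\<And>j. a (Suc (Suc (j + k))) \<ominus> a (Suc (j + k)) = (\<Oplus>s\<in>S. s \<otimes> c j s)" by metis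
  \<comment> \<open>\<open>D j s\<close> adds up the corrections for the differences of consecutive
    terms of a. Dividing by generators loses one power of the ideal, hence the index Suc (j + k):
    these differences lie in \<open>P (Suc (j + k))\<close> and give corrections in
    \<open>P (j + k)\<close>, so that \<open>D\<close> is coherent and stays in
    \<open>P k\<close>.\<close>
  define D where "D j = rec_nat e (\<lambda>j d s. d s \<oplus> c j s) j" for j
  have D0: "D 0 = e" and DS: "D (Suc j) = (\<lambda>s. D j s \<oplus> c j s)" for j by (simp_all add: D_def)
  have DP: "D j s \<in> P k" if "s \<in> S" for j s
  proof (induction j)
    case 0
    show ?case using e that by (auto simp: D0)
  next
    case (Suc j)
    have "c j s \<in> P k" using c(1)[of j] that P_antimono[of k "j + k"] by auto
    then show ?case using Suc by (simp add: DS P_add)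
  qed
  have Dc: "D j s \<in> carrier M" and cc: "c j s \<in> carrier M" and sc: "s \<in> carrier M" if "s \<in> S" for j s
    using P_carrier[OF DP[OF that]] c(1)[of j] that P_carrier S(2) by auto
  have Dsum: "(\<Oplus>s\<in>S. s \<otimes> D j s) = a (Suc (j + k))" for j
  proof (induction j)
    case 0
    show ?case using e by (simp add: D0)
  next
    case (Suc j)
    have "(\<Oplus>s\<in>S. s \<otimes> D (Suc j) s) = (\<Oplus>s\<in>S. s \<otimes> D j s \<oplus> s \<otimes> c j s)"
      by (rule M.finsum_cong') (use Dc cc sc in \<open>auto simp: DS r_distr\<close>)
    also have "\<dots> = (\<Oplus>s\<in>S. s \<otimes> D j s) \<oplus> (\<Oplus>s\<in>S. s \<otimes> c j s)"
      by (rule M.finsum_addf) (use Dc cc sc in auto)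
    also have "\<dots> = a (Suc (j + k)) \<oplus> (a (Suc (Suc (j + k))) \<ominus> a (Suc (j + k)))"
      by (simp only: Suc c(2))
    also have "\<dots> = a (Suc (Suc j + k))" using ac by (simp add: a_minus_def M.a_comm[of "a (Suc (Suc (j + k)))"] M.r_neg2)
    finally show ?case .
  qed
  have Dcoh: "coh (\<lambda>j. D j s)" if s: "s \<in> S" for s
    unfolding coh_def
  proof (intro allI conjI)
    fix j
    have "D (Suc j) s \<ominus> D j s = c j s"
      using Dc[OF s] cc[OF s] by (simp add: DS a_minus_def M.a_assoc M.a_comm[of "c j s"] M.r_neg1 M.r_neg2)
    then show "D (Suc j) s \<ominus> D j s \<in> P j" using c(1)[of j] s P_antimono[of j "j + k"] by auto
  qed (rule Dc[OF s])
  have "(\<Oplus>\<^bsub>cmpl\<^esub>s\<in>S. hat s \<otimes>\<^bsub>cmpl\<^esub> L (\<lambda>j. D j s)) = (\<Oplus>\<^bsub>cmpl\<^esub>s\<in>S. L (\<lambda>j. s \<otimes> D j s))"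
    by (rule cmpl.finsum_cong') (auto simp: L_mult Dc sc intro!: L_carrier coh_mult coh_const Dcoh)
  also have "\<dots> = L (\<lambda>j. \<Oplus>s\<in>S. s \<otimes> D j s)"
    using L_finsum[OF S(1), of "\<lambda>s j. s \<otimes> D j s"] coh_mult[OF coh_const[OF sc] Dcoh] by blast
  \<comment> \<open>The sums are the terms of a with the index shifted by k + 1, which represent the
    same element by coherence.\<close>
  also have "\<dots> = L a"
    unfolding Dsum using coh_le[OF a(1)] ac by (subst L_eq_iff) auto
  finally have "x = (\<Oplus>\<^bsub>cmpl\<^esub>s\<in>S. hat s \<otimes>\<^bsub>cmpl\<^esub> L (\<lambda>j. D j s))" using a by simp
  then show ?thesis
  proof (rule bexI[of _ "\<lambda>s. L (\<lambda>j. D j s)"])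
    show "(\<lambda>s. L (\<lambda>j. D j s)) \<in> S \<rightarrow> B k" using Dcoh DP by (auto simp: L_B_iff)
  qed
qed

text \<open>One inclusion is multiplicativity of \<open>B\<close>. The other needs the finite
  generating set, over which each element of \<open>B (Suc k)\<close> is a sum of generators times
  elements of \<open>B k\<close>. The adic topology of the completion is thereby the inverse limit
  topology.\<close>

lemma ideal_pow_B: "ideal_pow cmpl (B 1) k = B k"
proof (induction k)
  case 0
  show ?case by (simp add: B_0)
next
  case (Suc k)
  show ?case
  proof (intro equalityI subsetI)
    fix x assume "x \<in> ideal_pow cmpl (B 1) (Suc k)"
    then have "x \<in> ideal_prod cmpl (B 1) (B k)" by (simp only: ideal_pow.simps Suc)
    then show "x \<in> B (Suc k)"
    proof (induction rule: ideal_prod.induct)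
      case (prod i j)
      then show ?case using B_mult[of i 1 j k] by simp
    qed (rule B_add)
  next
    fix x assume "x \<in> B (Suc k)"
    then obtain y where y: "y \<in> S \<rightarrow> B k" "x = (\<Oplus>\<^bsub>cmpl\<^esub>s\<in>S. hat s \<otimes>\<^bsub>cmpl\<^esub> y s)" using B_generators by blast
    interpret J: ideal "ideal_prod cmpl (B 1) (B k)" cmpl
      by (rule cmpl.ideal_prod_is_ideal[OF B_ideal B_ideal])
    have T: "hat s \<otimes>\<^bsub>cmpl\<^esub> y s \<in> ideal_prod cmpl (B 1) (B k)" if "s \<in> S" for s
      using hat_B[OF that] y(1) that by (intro ideal_prod.prod) auto
    have "x \<in> ideal_prod cmpl (B 1) (B k)" unfolding y(2) by (rule cmpl.ideal_finsum[OF J.ideal_axioms T])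
    then show "x \<in> ideal_pow cmpl (B 1) (Suc k)" by (simp only: ideal_pow.simps Suc)
  qed
qed

lemma B_1_generated: "B 1 = Idl\<^bsub>cmpl\<^esub> (hat ` S)"
proof
  have hc: "hat ` S \<subseteq> carrier cmpl" using hat_B B_carrier by blast
  show "Idl\<^bsub>cmpl\<^esub> (hat ` S) \<subseteq> B 1" using hat_B by (intro cmpl.genideal_minimal B_ideal) auto
  interpret J: ideal "Idl\<^bsub>cmpl\<^esub> (hat ` S)" cmpl by (rule cmpl.genideal_ideal[OF hc])
  show "B 1 \<subseteq> Idl\<^bsub>cmpl\<^esub> (hat ` S)"
  proof
    fix x assume "x \<in> B 1"
    then obtain y where y: "y \<in> S \<rightarrow> B 0" "x = (\<Oplus>\<^bsub>cmpl\<^esub>s\<in>S. hat s \<otimes>\<^bsub>cmpl\<^esub> y s)"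
      using B_generators[of x 0] by auto
    have T: "hat s \<otimes>\<^bsub>cmpl\<^esub> y s \<in> Idl\<^bsub>cmpl\<^esub> (hat ` S)" if "s \<in> S" for s
      using cmpl.genideal_self[OF hc] y(1) that B_0 by (intro J.I_r_closed) auto
    show "x \<in> Idl\<^bsub>cmpl\<^esub> (hat ` S)" unfolding y(2) by (rule cmpl.ideal_finsum[OF J.ideal_axioms T])
  qed
qed

end

section \<open>Complete local rings are Noetherian\<close>

text \<open>Every sequence has a monotone subsequence, and a decreasing one of natural numbers is
  constant from some place on.\<close>

lemma nat_mono_subseq:
  fixes g :: "nat \<Rightarrow> nat"
  shows "\<exists>r :: nat \<Rightarrow> nat. strict_mono r \<and> mono (\<lambda>n. g (r n))"
proof -
  obtain r where r: "strict_mono r" "monoseq (\<lambda>n. g (r n))" using seq_monosub by blast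
  consider "incseq (\<lambda>n. g (r n))" | "decseq (\<lambda>n. g (r n))" using r(2) monoseq_iff by blast
  then show ?thesis
  proof cases
    case 1
    then show ?thesis using r(1) by blast
  next
    case 2
    define m where "m = (LEAST m. \<exists>n. g (r n) = m)"
    have "\<exists>n. g (r n) = m" unfolding m_def by (rule LeastI_ex) blast
    then obtain N where N: "g (r N) = m" ..
    have "g (r (N + n)) = m" for n
      using decseqD[OF 2, of N "N + n"] N Least_le[of "\<lambda>m. \<exists>n. g (r n) = m" "g (r (N + n))"] unfolding m_def by (metis (mono_tags, lifting) le_add1 le_antisym)
    then have "mono (\<lambda>n. g (r (N + n)))" by (simp add: mono_def)
    moreover have "strict_mono (\<lambda>n. r (N + n))" using r(1) by (simp add: strict_mono_def)
    ultimately show ?thesis by blast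
  qed
qed

text \<open>One coordinate after another: passing to a further subsequence does not spoil the
  coordinates that are already monotone.\<close>

lemma mono_subseq_finite:
  fixes g :: "'i \<Rightarrow> nat \<Rightarrow> nat"
  assumes "finite T"
  shows "\<exists>r :: nat \<Rightarrow> nat. strict_mono r \<and> (\<forall>p\<in>T. mono (\<lambda>n. g p (r n)))"
  using assms
proof (induction T rule: finite_induct)
  case empty
  show ?case by (intro exI[of _ id]) (simp add: strict_mono_def)
next
  case (insert p T)
  then obtain r :: "nat \<Rightarrow> nat" where r: "strict_mono r" "\<forall>p\<in>T. mono (\<lambda>n. g p (r n))" by blast
  obtain s :: "nat \<Rightarrow> nat" where s: "strict_mono s" "mono (\<lambda>n. g p (r (s n)))" using nat_mono_subseq[of "\<lambda>n. g p (r n)"] by blast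
  have "mono (\<lambda>n. g q (r (s n)))" if "q \<in> T" for q
    using r(2) that strict_mono_mono[OF s(1)] by (auto simp: mono_def)
  then show ?case using s r(1) strict_mono_o[OF r(1) s(1)] by (intro exI[of _ "\<lambda>n. r (s n)"]) (simp add: o_def)
qed

text \<open>Dickson's lemma, for monomials encoded as natural numbers with prime factors in \<open>T\<close>.\<close>

lemma finite_dvd_basis:
  fixes L :: "nat set"
  assumes T: "finite T" and L: "\<And>n. n \<in> L \<Longrightarrow> n > 0 \<and> prime_factors n \<subseteq> T"
  shows "\<exists>F\<subseteq>L. finite F \<and> (\<forall>j\<in>L. \<exists>i\<in>F. i dvd j)"
proof -
  \<comment> \<open>The elements that are minimal for divisibility. If there were infinitely many, a
    subsequence along which the multiplicities of all primes in T increase would contain two of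
    them, one dividing the other.\<close>
  define F where "F = {n \<in> L. \<forall>m\<in>L. m dvd n \<longrightarrow> m = n}"
  have "\<exists>i\<in>F. i dvd j" if j: "j \<in> L" for j
  proof -
    define i where "i = (LEAST i. i \<in> L \<and> i dvd j)"
    have i: "i \<in> L \<and> i dvd j" unfolding i_def by (rule LeastI[of _ j]) (simp add: j)
    have "m = i" if m: "m \<in> L" "m dvd i" for m
    proof -
      have "i \<le> m" unfolding i_def by (rule Least_le) (use m i dvd_trans in blast)
      moreover have "m \<le> i" using m L i by (intro dvd_imp_le) auto
      ultimately show ?thesis by simp
    qed
    then show ?thesis using i by (auto simp: F_def)
  qed
  moreover have "finite F"
  proof (rule ccontr)
    assume inf: "infinite F"
    let ?f = "enumerate F"
    have fF: "?f n \<in> F" for n using enumerate_in_set[OF inf] .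
    obtain r :: "nat \<Rightarrow> nat" where r: "strict_mono r" "\<And>p. p \<in> T \<Longrightarrow> mono (\<lambda>n. multiplicity p (?f (r n)))"
      using mono_subseq_finite[OF T, of "\<lambda>p n. multiplicity p (?f n)"] by blast
    have pos: "?f n > 0" and pf: "prime_factors (?f n) \<subseteq> T" for n using L[of "?f n"] fF[of n] by (auto simp: F_def)
    have "?f (r 0) dvd ?f (r 1)"
    proof (rule multiplicity_le_imp_dvd)
      fix p :: nat assume p: "normalization_semidom_class.prime p"
      show "multiplicity p (?f (r 0)) \<le> multiplicity p (?f (r 1))"
      proof (cases "p \<in> T")
        case True
        then show ?thesis using monoD[OF r(2)[OF True], of 0 1] by simp
      next
        case False
        then show ?thesis using pf[of "r 0"] p by (auto simp: prime_factors_multiplicity)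
      qed
    qed (use pos[of "r 0"] in simp)
    then have "?f (r 0) = ?f (r 1)" using fF[of "r 0"] fF[of "r 1"] by (auto simp: F_def)
    then show False using enumerate_mono[OF strict_monoD[OF r(1), of 0 1] inf] by simp
  qed
  moreover have "F \<subseteq> L" by (auto simp: F_def)
  ultimately show ?thesis by blast
qed

text \<open>Completeness for a finitely generated ideal with residue field R; that M is local and
  Noetherian is derived from this.\<close>

locale complete_adic = adic_fg +
  assumes fld: "field R"
    and bij: "bij_betw (to_completion M I) (carrier M) (carrier cmpl)"
    and scalar: "x \<in> carrier M \<Longrightarrow> \<exists>r\<in>carrier R. x \<ominus> r \<odot> \<one> \<in> I"
    and proper: "\<one> \<notin> I"
begin

sublocale F: field R by (rule fld)
sublocale I: ideal I M by (rule I)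

lemma P_separated: "x \<in> carrier M \<Longrightarrow> (\<And>k. x \<in> P k) \<Longrightarrow> x = \<zero>"
proof -
  assume x: "x \<in> carrier M" "\<And>k. x \<in> P k"
  then have "to_completion M I x = to_completion M I \<zero>"
    unfolding to_completion_eq by (subst L_eq_iff) (simp_all add: a_minus_def del: ideal_pow.simps)
  then show ?thesis using inj_onD[OF bij_betw_imp_inj_on[OF bij]] x by simp
qed

lemma P_complete: "coh a \<Longrightarrow> \<exists>x\<in>carrier M. \<forall>k. x \<ominus> a k \<in> P k"
proof -
  assume a: "coh a"
  then obtain x where x: "x \<in> carrier M" "L a = to_completion M I x"
    using L_carrier[OF a] bij_betw_imp_surj_on[OF bij] by blast
  then have "L (\<lambda>_. x) = L a" by (simp add: to_completion_eq)
  then show ?thesis using L_eq_iff[of "\<lambda>_. x" a] cohD(1)[OF a] x(1) by auto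
qed

text \<open>The inverse is the limit of the partial sums of the geometric series in a, which satisfy
  the recursion that defines \<open>s\<close>.\<close>

lemma one_minus_unit:
  assumes a: "a \<in> I"
  shows "\<exists>s\<in>carrier M. (\<one> \<ominus> a) \<otimes> s = \<one>"
proof -
  define s where "s = rec_nat \<one> (\<lambda>_ t. \<one> \<oplus> a \<otimes> t)"
  have s0: "s 0 = \<one>" and sS: "s (Suc k) = \<one> \<oplus> a \<otimes> s k" for k by (simp_all add: s_def)
  have ac: "a \<in> carrier M" using a I.Icarr by blast
  have sc: "s k \<in> carrier M" for k by (induction k) (simp_all add: s0 sS ac)
  have step: "s (Suc k) \<ominus> s k \<in> P k" for k
  proof (induction k)
    case (Suc k)
    have "s (Suc (Suc k)) \<ominus> s (Suc k) = a \<otimes> (s (Suc k) \<ominus> s k)"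
    proof -
      have "s (Suc (Suc k)) \<ominus> s (Suc k) = (\<one> \<oplus> a \<otimes> s (Suc k)) \<ominus> (\<one> \<oplus> a \<otimes> s k)"
        by (simp only: sS)
      also have "\<dots> = a \<otimes> s (Suc k) \<ominus> a \<otimes> s k"
        using ac sc by (simp add: a_minus_def M.minus_add M.a_ac M.r_neg2 M.r_neg1)
      also have "\<dots> = a \<otimes> (s (Suc k) \<ominus> s k)"
        using ac sc by (simp add: a_minus_def r_distr r_minus)
      finally show ?thesis .
    qed
    then show ?case using ideal_prod.prod[OF a Suc] by simp
  qed (simp add: sc)
  then obtain x where x: "x \<in> carrier M" "\<And>k. x \<ominus> s k \<in> P k"
    using P_complete[of s] sc by (auto simp: coh_def)
  let ?z = "(\<one> \<ominus> a) \<otimes> x \<ominus> \<one>"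
  \<comment> \<open>The defect 1 - (1 - a) s_k is the difference of the consecutive partial sums
    s_{k+1} and s_k, so the limit x has no defect modulo any \<open>P k\<close>.\<close>
  have "?z \<in> P k" for k
  proof -
    have "s (Suc k) \<ominus> s k = \<one> \<ominus> (\<one> \<ominus> a) \<otimes> s k"
      using ac sc[of k] by (simp add: sS a_minus_def l_distr l_minus M.minus_add M.a_ac)
    then have "\<one> \<ominus> (\<one> \<ominus> a) \<otimes> s k \<in> P k" using step[of k] by simp
    from P_neg[OF this] have 1: "(\<one> \<ominus> a) \<otimes> s k \<ominus> \<one> \<in> P k"
      using ac sc[of k] by (simp add: a_minus_def M.minus_add M.a_comm del: ideal_pow.simps)
    have "(\<one> \<ominus> a) \<otimes> (x \<ominus> s k) \<in> P k" using x ac by (intro P_mult_l) auto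
    then have 2: "(\<one> \<ominus> a) \<otimes> x \<ominus> (\<one> \<ominus> a) \<otimes> s k \<in> P k"
      using x ac sc[of k] by (simp add: a_minus_def r_distr r_minus del: ideal_pow.simps)
    show ?thesis by (rule P_trans[OF _ _ _ 2 1]) (use x ac sc[of k] in simp_all)
  qed
  then have "?z = \<zero>" using x(1) ac by (intro P_separated) auto
  then have "(\<one> \<ominus> a) \<otimes> x = \<one>" using x(1) ac by simp
  then show ?thesis using x(1) by blast
qed

text \<open>An element outside I is, up to a nonzero scalar, of the form 1 - a with a in I, hence a
  unit.\<close>

lemma ideal_full:
  assumes J: "ideal J M" and x: "x \<in> J" "x \<notin> I"
  shows "J = carrier M"
proof -
  interpret J: ideal J M by (rule J)
  have xc: "x \<in> carrier M" using x J.Icarr by blast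
  obtain r where r: "r \<in> carrier R" "x \<ominus> r \<odot> \<one> \<in> I" using scalar[OF xc] by blast
  have "r \<noteq> \<zero>\<^bsub>R\<^esub>" using r x(2) xc by (auto simp: a_minus_def)
  then have ru: "r \<in> Units R" using r F.field_Units by blast
  let ?s = "inv\<^bsub>R\<^esub> r"
  have s: "?s \<in> carrier R" "?s \<otimes>\<^bsub>R\<^esub> r = \<one>\<^bsub>R\<^esub>" using ru by auto
  \<comment> \<open>Chosen so that 1 - \<open>?a\<close> is x divided by its residue r.\<close>
  let ?a = "(?s \<odot> \<one>) \<otimes> \<ominus> (x \<ominus> r \<odot> \<one>)"
  have a: "?a \<in> I" using r(2) s by (intro I.I_l_closed) auto
  have "?s \<odot> (r \<odot> \<one>) = \<one>" using smult_assoc1[of ?s r "\<one>"] s r by simp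
  then have "?a = \<one> \<ominus> ?s \<odot> x"
    using s r xc by (simp add: a_minus_def smult_assoc2 smult_r_distr smult_r_minus M.minus_add M.a_comm)
  then have "\<one> \<ominus> ?a = ?s \<odot> x" using s xc by (simp add: a_minus_def M.minus_add M.r_neg2)
  then obtain t where t: "t \<in> carrier M" "(?s \<odot> x) \<otimes> t = \<one>" using one_minus_unit[OF a] by auto
  have "(?s \<odot> x) \<otimes> t = x \<otimes> (?s \<odot> t)"
    using s xc t m_comm[of x "?s \<odot> t"] m_comm[of x t] by (simp add: smult_assoc2)
  then have "\<one> \<in> J" using t s x(1) J.I_r_closed[of x "?s \<odot> t"] by simp
  then show ?thesis by (rule J.one_imp_carrier)
qed

lemma I_maximal: "maximalideal I M"
  by (rule maximalidealI[OF I]) (use proper ideal_full in blast)+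

lemma maximal_unique: "maximalideal J M \<Longrightarrow> J = I"
proof -
  assume "maximalideal J M"
  then interpret J: maximalideal J M .
  have "J \<subseteq> I" using ideal_full[OF J.ideal_axioms] J.I_notcarr by blast
  then show ?thesis using J.I_maximal[OF I] proper I.a_subset by blast
qed

lemma max_ideal_eq: "max_ideal M = I"
  unfolding max_ideal_def using I_maximal maximal_unique by (rule the_equality)

lemma scalar_I: "r \<in> carrier R \<Longrightarrow> r \<odot> \<one> \<in> I \<Longrightarrow> r = \<zero>\<^bsub>R\<^esub>"
proof (rule ccontr)
  assume r: "r \<in> carrier R" "r \<odot> \<one> \<in> I" "r \<noteq> \<zero>\<^bsub>R\<^esub>"
  then have "inv\<^bsub>R\<^esub> r \<in> carrier R" "inv\<^bsub>R\<^esub> r \<otimes>\<^bsub>R\<^esub> r = \<one>\<^bsub>R\<^esub>" using F.field_Units by auto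
  then have "inv\<^bsub>R\<^esub> r \<odot> (r \<odot> \<one>) = \<one>" "inv\<^bsub>R\<^esub> r \<odot> (r \<odot> \<one>) \<in> I"
    using smult_assoc1[of "inv\<^bsub>R\<^esub> r" r "\<one>"] r P_smult[of "inv\<^bsub>R\<^esub> r" "r \<odot> \<one>" 1] by (simp_all add: P_1 del: One_nat_def ideal_pow.simps)
  then show False using proper by simp
qed

lemma residue_field: "bij_betw (\<lambda>r. I +> (r \<odot> \<one>)) (carrier R) (carrier (M Quot I))"
  unfolding bij_betw_def
proof (intro conjI equalityI subsetI)
  show "inj_on (\<lambda>r. I +> (r \<odot> \<one>)) (carrier R)"
  proof (rule inj_onI)
    fix r s assume rs: "r \<in> carrier R" "s \<in> carrier R" "I +> (r \<odot> \<one>) = I +> (s \<odot> \<one>)"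
    then have "r \<odot> \<one> \<ominus> s \<odot> \<one> \<in> I" using quotient_eq_iff_same_a_r_cos[OF I] by simp
    moreover have "r \<odot> \<one> \<ominus> s \<odot> \<one> = (r \<ominus>\<^bsub>R\<^esub> s) \<odot> \<one>"
      using rs by (simp add: a_minus_def smult_l_distr smult_l_minus)
    ultimately have "r \<ominus>\<^bsub>R\<^esub> s = \<zero>\<^bsub>R\<^esub>" using rs by (intro scalar_I) auto
    then show "r = s" using rs by (simp add: R.r_right_minus_eq)
  qed
next
  fix X assume "X \<in> (\<lambda>r. I +> (r \<odot> \<one>)) ` carrier R"
  then show "X \<in> carrier (M Quot I)" using M.a_rcosetsI[OF I.a_subset] by (auto simp: FactRing_def)
next
  fix X assume "X \<in> carrier (M Quot I)"
  then obtain x where x: "x \<in> carrier M" "X = I +> x" by (auto simp: FactRing_def A_RCOSETS_def')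
  obtain r where r: "r \<in> carrier R" "x \<ominus> r \<odot> \<one> \<in> I" using scalar[OF x(1)] by blast
  then have "X = I +> (r \<odot> \<one>)" using quotient_eq_iff_same_a_r_cos[OF I x(1), of "r \<odot> \<one>"] x by simp
  then show "X \<in> (\<lambda>r. I +> (r \<odot> \<one>)) ` carrier R" using r by blast
qed

end

text \<open>A monomial in the generators \<open>x p\<close>, \<open>p \<in> T\<close>, is encoded as the product of the corresponding primes,
  so that the order of the natural numbers is a monomial order.\<close>

locale monomial_order = complete_adic +
  fixes T :: "nat set" and x :: "nat \<Rightarrow> 'c" and q :: nat
  assumes T: "finite T" "\<And>p. p \<in> T \<Longrightarrow> normalization_semidom_class.prime p" "\<And>p. p \<in> T \<Longrightarrow> p \<le> q" and q: "q > 1"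
    and x: "x ` T = S"
begin

lemma xc: "p \<in> T \<Longrightarrow> x p \<in> carrier M"
  using x S by blast

lemma xI: "p \<in> T \<Longrightarrow> x p \<in> I"
  using genideal_self[OF S(2)] x S(3) by blast

text \<open>The monomial coded by n. Numbers that are 0 or have a prime factor outside T code no
  monomial and get the value 0, so that the filtration below can be indexed by all natural
  numbers.\<close>

definition e :: "nat \<Rightarrow> 'c"
  where "e n = (if n > 0 \<and> prime_factors n \<subseteq> T then \<Otimes>p\<in>T. x p [^] multiplicity p n else \<zero>)"

lemma e_closed [simp]: "e n \<in> carrier M"
  using xc by (auto simp: e_def intro!: finprod_closed)

lemma e_mult:
  assumes "m > 0" "n > 0"
  shows "e (m * n) = e m \<otimes> e n"
proof (cases "prime_factors m \<subseteq> T \<and> prime_factors n \<subseteq> T")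
  case True
  have "(\<Otimes>p\<in>T. x p [^] multiplicity p (m * n)) =
      (\<Otimes>p\<in>T. x p [^] multiplicity p m \<otimes> x p [^] multiplicity p n)"
    using xc assms T(2) by (intro finprod_cong') (auto simp: prime_elem_multiplicity_mult_distrib nat_pow_mult)
  also have "\<dots> = (\<Otimes>p\<in>T. x p [^] multiplicity p m) \<otimes> (\<Otimes>p\<in>T. x p [^] multiplicity p n)"
    using xc by (intro finprod_multf) auto
  finally show ?thesis using True assms by (simp add: e_def prime_factors_product)
next
  case False
  then have "e (m * n) = \<zero>" and "e m = \<zero> \<or> e n = \<zero>" using assms by (auto simp: e_def prime_factors_product)
  then show ?thesis using e_closed[of m] e_closed[of n] by (auto simp del: e_closed)
qed

lemma e_1: "e 1 = \<one>"
  by (simp add: e_def finprod_one_eqI)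

lemma e_prime:
  assumes p: "p \<in> T"
  shows "e p = x p"
proof -
  have pp: "normalization_semidom_class.prime p" using T(2)[OF p] .
  have "(\<Otimes>r\<in>T. x r [^] multiplicity r p) = (\<Otimes>r\<in>T. if p = r then x r else \<one>)"
  proof (rule finprod_cong')
    fix r assume r: "r \<in> T"
    show "x r [^] multiplicity r p = (if p = r then x r else \<one>)"
    proof (cases "p = r")
      case True
      then show ?thesis using pp xc[OF r] by (simp add: multiplicity_prime)
    next
      case False
      then have "\<not> r dvd p" using primes_dvd_imp_eq[OF T(2)[OF r] pp] by blast
      then have "multiplicity r p = 0" by (rule not_dvd_imp_multiplicity_0)
      then show ?thesis using False by simp
    qed
  qed (use xc in auto)
  also have "\<dots> = x p" using p T(1) xc by (intro finprod_singleton) auto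
  finally show ?thesis using p pp prime_gt_0_nat[OF pp] by (simp add: e_def prime_prime_factors)
qed

text \<open>A product of primes not exceeding q that is at least q ^ k has at least k factors, each
  of which contributes an element of I.\<close>

lemma e_P: "q ^ k \<le> n \<Longrightarrow> e n \<in> P k"
proof (induction k arbitrary: n)
  case (Suc k)
  show ?case
  proof (cases "n > 1 \<and> prime_factors n \<subseteq> T")
    case True
    obtain p where p: "normalization_semidom_class.prime p" "p dvd n" using prime_factor_nat[of n] True by auto
    then have pT: "p \<in> T" using True by (auto simp: in_prime_factors_iff)
    obtain m where m: "n = p * m" using p(2) by blast
    have "q * q ^ k \<le> p * m" using Suc.prems m by simp
    also have "\<dots> \<le> q * m" by (rule mult_le_mono1[OF T(3)[OF pT]])
    finally have "q * q ^ k \<le> q * m" .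
    then have "q ^ k \<le> m" using q by simp
    then have "x p \<otimes> e m \<in> P (Suc k)" using ideal_prod.prod[OF xI[OF pT] Suc.IH] by simp
    moreover have "p > 0" "m > 0" using True m by (auto intro!: Nat.gr0I)
    ultimately show ?thesis using e_mult[of p m] e_prime[OF pT] m by (simp del: ideal_pow.simps)
  next
    case False
    have "q ^ Suc k > 1" using q by (intro one_less_power) auto
    then have "e n = \<zero>" using False Suc.prems by (simp add: e_def)
    then show ?thesis using P_zero by (simp only:)
  qed
qed simp

text \<open>The filtration by the monomial order. By \<open>e_P\<close> it runs into every power of
  I, while consecutive steps differ by a single monomial.\<close>

definition G :: "nat \<Rightarrow> 'c set"
  where "G n = Idl (e ` {n..})"

lemma G_ideal: "ideal (G n) M"
  unfolding G_def by (intro genideal_ideal) auto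

lemma e_G: "n \<le> m \<Longrightarrow> e m \<in> G n"
  unfolding G_def by (rule set_mp[OF genideal_self]) auto

lemma G_least: "ideal J M \<Longrightarrow> (\<And>m. n \<le> m \<Longrightarrow> e m \<in> J) \<Longrightarrow> G n \<subseteq> J"
  unfolding G_def by (rule genideal_minimal) auto

lemma G_carrier: "y \<in> G n \<Longrightarrow> y \<in> carrier M"
  using ideal.Icarr[OF G_ideal] .

lemma G_zero: "\<zero> \<in> G n"
  using additive_subgroup.zero_closed[OF ideal.axioms(1)[OF G_ideal]] .

lemma G_add: "y \<in> G n \<Longrightarrow> z \<in> G n \<Longrightarrow> y \<oplus> z \<in> G n"
  using additive_subgroup.a_closed[OF ideal.axioms(1)[OF G_ideal]] .

lemma G_neg: "y \<in> G n \<Longrightarrow> \<ominus> y \<in> G n"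
  using additive_subgroup.a_inv_closed[OF ideal.axioms(1)[OF G_ideal]] .

lemma G_minus: "y \<in> G n \<Longrightarrow> z \<in> G n \<Longrightarrow> y \<ominus> z \<in> G n"
  by (simp add: a_minus_def G_add G_neg)

lemma G_mult: "y \<in> carrier M \<Longrightarrow> z \<in> G n \<Longrightarrow> y \<otimes> z \<in> G n"
  using ideal.I_l_closed[OF G_ideal] .

lemma ideal_smult: "ideal J M \<Longrightarrow> r \<in> carrier R \<Longrightarrow> y \<in> J \<Longrightarrow> r \<odot> y \<in> J"
  using ideal.I_l_closed[of J M y "r \<odot> \<one>"] smult_assoc2[of r "\<one>" y] ideal.Icarr[of J M y] by simp

lemma G_0: "G 0 = carrier M"
proof -
  interpret G0: ideal "G 0" M by (rule G_ideal)
  show ?thesis using e_G[of 0 1] unfolding e_1 by (intro G0.one_imp_carrier) simp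
qed

lemma G_P: "q ^ k \<le> n \<Longrightarrow> G n \<subseteq> P k"
  by (intro G_least P_ideal e_P) simp

text \<open>The colon ideal of J by y. With it, a claim about products of y with the elements of an
  ideal need only be checked on generators of that ideal.\<close>

lemma ideal_preimage:
  assumes J: "ideal J M" and y: "y \<in> carrier M"
  shows "ideal {z \<in> carrier M. z \<otimes> y \<in> J} M"
proof (rule idealI[OF cring.axioms(1)[OF M_cring]])
  interpret J: ideal J M by (rule J)
  show "subgroup {z \<in> carrier M. z \<otimes> y \<in> J} (add_monoid M)"
  proof
    fix z assume z: "z \<in> {z \<in> carrier M. z \<otimes> y \<in> J}"
    then have "\<ominus> z \<in> {z \<in> carrier M. z \<otimes> y \<in> J}" using y by (simp add: l_minus)
    then show "inv\<^bsub>add_monoid M\<^esub> z \<in> {z \<in> carrier M. z \<otimes> y \<in> J}" by (simp add: a_inv_def)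
  qed (use y in \<open>auto simp: l_distr\<close>)
  fix a z assume a: "a \<in> {z \<in> carrier M. z \<otimes> y \<in> J}" and z: "z \<in> carrier M"
  then have "z \<otimes> (a \<otimes> y) \<in> J" by (auto intro: J.I_l_closed)
  then show "z \<otimes> a \<in> {z \<in> carrier M. z \<otimes> y \<in> J}" using a z y by (simp add: m_assoc)
  then show "a \<otimes> z \<in> {z \<in> carrier M. z \<otimes> y \<in> J}" using a z m_comm[of a z] by simp
qed

text \<open>A generator of I multiplies the code of a monomial by a prime, hence by at least
  2.\<close>

lemma e_step: "y \<in> I \<Longrightarrow> y \<otimes> e n \<in> G (Suc n)"
proof -
  assume "y \<in> I"
  moreover have "Idl S \<subseteq> {z \<in> carrier M. z \<otimes> e n \<in> G (Suc n)}"
  proof (rule genideal_minimal[OF ideal_preimage[OF G_ideal e_closed]], rule subsetI)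
    fix s assume "s \<in> S"
    then obtain p where p: "p \<in> T" "s = x p" using x by blast
    have "x p \<otimes> e n \<in> G (Suc n)"
    proof (cases "n = 0")
      case True
      then have "x p \<otimes> e n = \<zero>" using xc[OF p(1)] by (simp add: e_def)
      then show ?thesis using G_zero by simp
    next
      case False
      have "p > 1" using prime_gt_1_nat[OF T(2)[OF p(1)]] .
      then have "2 * n \<le> p * n" by (intro mult_le_mono1) simp
      then have "Suc n \<le> p * n" using False by linarith
      then show ?thesis using e_G[of "Suc n" "p * n"] e_mult[of p n] e_prime[OF p(1)] \<open>p > 1\<close> False by simp
    qed
    then show "s \<in> {z \<in> carrier M. z \<otimes> e n \<in> G (Suc n)}" using p xc by simp
  qed
  ultimately show ?thesis using S(3) by blast
qed

text \<open>Multiplication by m is strictly increasing on codes, the compatibility with products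
  that is required of a monomial order.\<close>

lemma e_mult_G:
  assumes m: "m > 0" and g: "g \<in> G (Suc i)"
  shows "e m \<otimes> g \<in> G (Suc (m * i))"
proof -
  have "G (Suc i) \<subseteq> {z \<in> carrier M. z \<otimes> e m \<in> G (Suc (m * i))}"
  proof (rule G_least[OF ideal_preimage[OF G_ideal e_closed]])
    fix j assume j: "Suc i \<le> j"
    have "m * Suc i \<le> m * j" using j by (rule mult_le_mono2)
    then have "Suc (m * i) \<le> m * j" using m by simp
    then show "e j \<in> {z \<in> carrier M. z \<otimes> e m \<in> G (Suc (m * i))}"
      using e_G[of "Suc (m * i)" "m * j"] e_mult[of m j] m j m_comm[of "e m" "e j"] by simp
  qed
  then show ?thesis using g m_comm[of "e m" g] G_carrier[OF g] by auto
qed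

text \<open>I multiplies e n into the next step, so modulo \<open>G (Suc n)\<close> a multiple of e
  n depends only on the residue of its factor in R. The quotient is therefore spanned by e n over
  R.\<close>

lemma G_decomp:
  assumes y: "y \<in> G n"
  shows "\<exists>r\<in>carrier R. y \<ominus> r \<odot> e n \<in> G (Suc n)"
proof -
  define Y where "Y = {y \<in> carrier M. \<exists>r\<in>carrier R. y \<ominus> r \<odot> e n \<in> G (Suc n)}"
  have Yadd: "y \<oplus> z \<in> Y" if yz: "y \<in> Y" "z \<in> Y" for y z
  proof -
    obtain r where r: "r \<in> carrier R" "y \<ominus> r \<odot> e n \<in> G (Suc n)" using yz(1) by (auto simp: Y_def)
    obtain s where s: "s \<in> carrier R" "z \<ominus> s \<odot> e n \<in> G (Suc n)" using yz(2) by (auto simp: Y_def)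
    have c: "y \<in> carrier M" "z \<in> carrier M" using yz by (auto simp: Y_def)
    have "(y \<oplus> z) \<ominus> (r \<oplus>\<^bsub>R\<^esub> s) \<odot> e n = (y \<ominus> r \<odot> e n) \<oplus> (z \<ominus> s \<odot> e n)"
      using c r(1) s(1) by (simp add: a_minus_def smult_l_distr M.minus_add M.a_ac)
    then show ?thesis using G_add[OF r(2) s(2)] r(1) s(1) c by (auto simp: Y_def intro!: bexI[of _ "r \<oplus>\<^bsub>R\<^esub> s"])
  qed
  have Ymult: "a \<otimes> y \<in> Y" if ya: "y \<in> Y" "a \<in> carrier M" for a y
  proof -
    obtain r where r: "r \<in> carrier R" "y \<ominus> r \<odot> e n \<in> G (Suc n)" using ya(1) by (auto simp: Y_def)
    obtain s where s: "s \<in> carrier R" "a \<ominus> s \<odot> \<one> \<in> I" using scalar[OF ya(2)] by blast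
    have c: "y \<in> carrier M" using ya by (auto simp: Y_def)
    have 1: "a \<otimes> (y \<ominus> r \<odot> e n) \<in> G (Suc n)" by (rule G_mult[OF ya(2) r(2)])
    have 2: "r \<odot> ((a \<ominus> s \<odot> \<one>) \<otimes> e n) \<in> G (Suc n)"
      by (rule ideal_smult[OF G_ideal r(1) e_step[OF s(2)]])
    have ar: "a \<otimes> (r \<odot> e n) = r \<odot> (a \<otimes> e n)"
      using smult_assoc2[of r "e n" a] r ya(2) m_comm[of "r \<odot> e n" a] m_comm[of "e n" a] by simp
    have "a \<otimes> (y \<ominus> r \<odot> e n) = a \<otimes> y \<ominus> r \<odot> (a \<otimes> e n)"
      using ya(2) c r(1) by (simp add: a_minus_def r_distr r_minus ar)
    moreover have "r \<odot> ((a \<ominus> s \<odot> \<one>) \<otimes> e n) = r \<odot> (a \<otimes> e n) \<ominus> (r \<otimes>\<^bsub>R\<^esub> s) \<odot> e n"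
      using ya(2) r(1) s(1) by (simp add: a_minus_def l_distr l_minus smult_r_distr smult_r_minus smult_assoc1 smult_assoc2)
    ultimately have "a \<otimes> y \<ominus> (r \<otimes>\<^bsub>R\<^esub> s) \<odot> e n \<in> G (Suc n)"
      using G_add[OF 1 2] minus_split[of "a \<otimes> y" "r \<odot> (a \<otimes> e n)" "(r \<otimes>\<^bsub>R\<^esub> s) \<odot> e n"] ya(2) c r(1) s(1)
      by simp
    then show ?thesis using r(1) s(1) c ya(2) by (auto simp: Y_def intro!: bexI[of _ "r \<otimes>\<^bsub>R\<^esub> s"])
  qed
  have Y0: "y \<in> Y" if "y \<in> G (Suc n)" for y
    using that G_carrier[OF that] by (auto simp: Y_def a_minus_def intro!: bexI[of _ "\<zero>\<^bsub>R\<^esub>"])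
  have "ideal Y M"
  proof (rule idealI[OF cring.axioms(1)[OF M_cring]])
    show "subgroup Y (add_monoid M)"
    proof
      fix y assume y: "y \<in> Y"
      then have yc: "y \<in> carrier M" by (simp add: Y_def)
      have "\<ominus> \<one> \<otimes> y \<in> Y" by (rule Ymult[OF y]) simp
      then show "inv\<^bsub>add_monoid M\<^esub> y \<in> Y" using yc by (simp add: l_minus a_inv_def[symmetric])
    next
      show "\<one>\<^bsub>add_monoid M\<^esub> \<in> Y" using Y0 G_zero by simp
    qed (auto simp: Yadd, auto simp: Y_def)
    fix y a assume ya: "y \<in> Y" "a \<in> carrier M"
    then show "a \<otimes> y \<in> Y" by (rule Ymult)
    then show "y \<otimes> a \<in> Y" using ya m_comm[of y a] by (simp add: Y_def)
  qed
  then have "G n \<subseteq> Y"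
  proof (rule G_least)
    fix m assume "n \<le> m"
    then consider "m = n" | "Suc n \<le> m" by linarith
    then show "e m \<in> Y"
    proof cases
      case 1
      then show ?thesis using G_zero
        by (auto simp: Y_def a_minus_def M.r_neg intro!: bexI[of _ "\<one>\<^bsub>R\<^esub>"])
    next
      case 2
      then show ?thesis by (intro Y0 e_G)
    qed
  qed
  then show ?thesis using y by (auto simp: Y_def)
qed

text \<open>A standard basis argument. \<open>L\<close> holds the leading monomials of elements of
  J, and \<open>b\<close> picks elements of J whose leading monomials form a finite basis of
  \<open>L\<close> for divisibility. The leading term of any c in J is a multiple of that of some
  \<open>b i\<close> and can be removed; the coefficients used on the way converge by
  completeness.\<close>

lemma ideal_finite:
  assumes J: "ideal J M"
  shows "\<exists>A\<subseteq>carrier M. finite A \<and> J = Idl A"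
proof -
  interpret J: ideal J M by (rule J)
  define L where "L = {n. n > 0 \<and> prime_factors n \<subseteq> T \<and> (\<exists>b\<in>J. b \<ominus> e n \<in> G (Suc n))}"
  obtain F where F: "F \<subseteq> L" "finite F" "\<And>j. j \<in> L \<Longrightarrow> \<exists>i\<in>F. i dvd j"
    using finite_dvd_basis[OF T(1), of L] by (auto simp: L_def)
  have "\<forall>i\<in>F. \<exists>b. b \<in> J \<and> b \<ominus> e i \<in> G (Suc i)" using F(1) by (auto simp: L_def)
  then obtain b where b: "\<And>i. i \<in> F \<Longrightarrow> b i \<in> J" "\<And>i. i \<in> F \<Longrightarrow> b i \<ominus> e i \<in> G (Suc i)" by metis
  have bc: "b i \<in> carrier M" if "i \<in> F" for i using b(1)[OF that] by (rule J.Icarr)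
  have ipos: "i > 0" if "i \<in> F" for i using F(1) that by (auto simp: L_def)
  \<comment> \<open>A correction at the monomial n uses the factor e m with n = m * i and i at most
    \<open>D\<close>, so q ^ k * D \<le> n forces q ^ k \<le> m and puts the factor into
    \<open>P k\<close>. The element 1 keeps \<open>D\<close> positive when \<open>F\<close> is
    empty.\<close>
  define D where "D = Max (insert 1 F)"
  have D: "D > 0" "\<And>i. i \<in> F \<Longrightarrow> i \<le> D"
    using F(2) Max_ge[of "insert 1 F" 1] Max_ge[of "insert 1 F"] by (simp_all add: D_def Suc_le_eq)
  define comb where "comb s = (\<Oplus>i\<in>F. s i \<otimes> b i)" for s
  have comb_closed: "comb s \<in> carrier M" if "s \<in> F \<rightarrow> carrier M" for s
    using that bc by (auto simp: comb_def intro!: M.finsum_closed)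
  have comb_add: "comb (\<lambda>i. s i \<oplus> t i) = comb s \<oplus> comb t" if st: "s \<in> F \<rightarrow> carrier M" "t \<in> F \<rightarrow> carrier M" for s t
  proof -
    have c: "s i \<in> carrier M" "t i \<in> carrier M" if "i \<in> F" for i using st that by auto
    have "comb (\<lambda>i. s i \<oplus> t i) = (\<Oplus>i\<in>F. s i \<otimes> b i \<oplus> t i \<otimes> b i)"
      unfolding comb_def by (rule M.finsum_cong') (use c bc in \<open>auto simp: l_distr\<close>)
    also have "\<dots> = comb s \<oplus> comb t"
      unfolding comb_def by (rule M.finsum_addf) (use c bc in auto)
    finally show ?thesis .
  qed
  have Jcomb: "comb s \<in> J" if s: "s \<in> F \<rightarrow> carrier M" for s
  proof -
    have "s j \<otimes> b j \<in> J" if "j \<in> F" for j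
      using b(1)[OF that] funcset_mem[OF s that] by (rule J.I_l_closed)
    then show ?thesis unfolding comb_def by (rule ring.ideal_finsum[OF cring.axioms(1)[OF M_cring] J])
  qed
  have step: "\<exists>a\<in>F \<rightarrow> carrier M. c \<ominus> comb a \<in> G (Suc n) \<and> (\<forall>i\<in>F. \<forall>k. q ^ k * D \<le> n \<longrightarrow> a i \<in> P k)"
    if cJ: "c \<in> J" and cG: "c \<in> G n" for c n
  proof -
    have cc: "c \<in> carrier M" using cJ by (rule J.Icarr)
    obtain r where r: "r \<in> carrier R" "c \<ominus> r \<odot> e n \<in> G (Suc n)" using G_decomp[OF cG] by blast
    show ?thesis
    proof (cases "n \<in> L")
      case True
      obtain i where i: "i \<in> F" "i dvd n" using F(3)[OF True] by blast
      obtain m where m: "n = m * i" using i(2) by (metis dvd_def mult.commute)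
      have mpos: "m > 0" using True m by (auto simp: L_def intro: Nat.gr0I)
      define a where "a = (\<lambda>j. if i = j then r \<odot> e m else \<zero>)"
      have ac: "a \<in> F \<rightarrow> carrier M" using r(1) by (auto simp: a_def)
      have "comb a = (\<Oplus>j\<in>F. if i = j then (r \<odot> e m) \<otimes> b j else \<zero>)"
        unfolding comb_def by (rule M.finsum_cong') (use r(1) bc in \<open>auto simp: a_def\<close>)
      also have "\<dots> = (r \<odot> e m) \<otimes> b i"
        by (rule M.finsum_singleton[OF i(1) F(2)]) (use r(1) bc in auto)
      finally have ca: "comb a = r \<odot> (e m \<otimes> b i)" using r(1) bc[OF i(1)] by (simp add: smult_assoc2)
      have 1: "r \<odot> (e m \<otimes> (b i \<ominus> e i)) \<in> G (Suc n)"
        unfolding m by (rule ideal_smult[OF G_ideal r(1) e_mult_G[OF mpos b(2)[OF i(1)]]])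
      have "r \<odot> (e m \<otimes> (b i \<ominus> e i)) = r \<odot> (e m \<otimes> b i) \<ominus> r \<odot> e n"
        using r(1) bc[OF i(1)] e_mult[OF mpos ipos[OF i(1)]]
        by (simp add: a_minus_def r_distr r_minus smult_r_distr smult_r_minus m)
      then have "(c \<ominus> r \<odot> e n) \<ominus> (comb a \<ominus> r \<odot> e n) \<in> G (Suc n)"
        using G_minus[OF r(2) 1] by (simp only: ca)
      moreover have "(c \<ominus> r \<odot> e n) \<ominus> (comb a \<ominus> r \<odot> e n) = c \<ominus> comb a"
        using cc r(1) comb_closed[OF ac] by (simp add: a_minus_def M.minus_add M.a_ac M.r_neg1 M.r_neg)
      moreover have "a j \<in> P k" if "j \<in> F" "q ^ k * D \<le> n" for j k
      proof (cases "i = j")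
        case True
        have "m * i \<le> m * D" using D(2)[OF i(1)] by (rule mult_le_mono2)
        then have "q ^ k * D \<le> m * D" using that(2) m by linarith
        then have "q ^ k \<le> m" using D(1) by simp
        then show ?thesis using True P_smult[OF r(1) e_P] by (simp add: a_def)
      next
        case False
        then show ?thesis using P_zero by (simp only: a_def if_False)
      qed
      ultimately show ?thesis using ac by (intro bexI[of _ a]) auto
    next
      case False
      \<comment> \<open>As n is not in \<open>L\<close>, the term r \<odot> e n is 0: otherwise c
        divided by r would be an element of J with leading monomial n.\<close>
      have "r \<odot> e n \<in> G (Suc n)"
      proof (cases "n > 0 \<and> prime_factors n \<subseteq> T \<and> r \<noteq> \<zero>\<^bsub>R\<^esub>")
        case True
        then have s: "inv\<^bsub>R\<^esub> r \<in> carrier R" "inv\<^bsub>R\<^esub> r \<otimes>\<^bsub>R\<^esub> r = \<one>\<^bsub>R\<^esub>" using r(1) F.field_Units by auto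
        have "inv\<^bsub>R\<^esub> r \<odot> (c \<ominus> r \<odot> e n) \<in> G (Suc n)" by (rule ideal_smult[OF G_ideal s(1) r(2)])
        moreover have "inv\<^bsub>R\<^esub> r \<odot> (c \<ominus> r \<odot> e n) = inv\<^bsub>R\<^esub> r \<odot> c \<ominus> e n"
          using s r(1) cc smult_assoc1[of "inv\<^bsub>R\<^esub> r" r "e n"] by (simp add: a_minus_def smult_r_distr smult_r_minus)
        ultimately have "n \<in> L" using True ideal_smult[OF J s(1) cJ] by (auto simp: L_def)
        then show ?thesis using False by simp
      next
        case False
        then have "e n = \<zero> \<or> r = \<zero>\<^bsub>R\<^esub>" by (auto simp: e_def)
        then have "r \<odot> e n = \<zero>" using r(1) by auto
        then show ?thesis using G_zero by simp
      qed
      from G_add[OF r(2) this] have "c \<in> G (Suc n)" using cc r(1) by (simp add: a_minus_def M.a_assoc M.l_neg)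
      moreover have "comb (\<lambda>_. \<zero>) = \<zero>"
      proof -
        have "comb (\<lambda>_. \<zero>) = (\<Oplus>i\<in>F. \<zero>)" unfolding comb_def by (rule M.finsum_cong') (use bc in auto)
        then show ?thesis by simp
      qed
      ultimately show ?thesis using cc P_zero
        by (intro bexI[of _ "\<lambda>_. \<zero>"]) (auto simp: a_minus_def simp del: ideal_pow.simps)
    qed
  qed
  have "J \<subseteq> Idl (b ` F)"
  proof
    fix c assume c: "c \<in> J"
    have cc: "c \<in> carrier M" using c by (rule J.Icarr)
    \<comment> \<open>The coefficients are chosen one monomial after another; from stage q ^ k * D
      on they change by elements of \<open>P k\<close> only.\<close>
    have "\<exists>\<sigma>. \<forall>n. (\<sigma> n \<in> F \<rightarrow> carrier M \<and> c \<ominus> comb (\<sigma> n) \<in> G n) \<and>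
        (\<forall>i\<in>F. \<forall>k. q ^ k * D \<le> n \<longrightarrow> \<sigma> (Suc n) i \<ominus> \<sigma> n i \<in> P k)"
    proof (rule dependent_nat_choice)
      show "\<exists>s. s \<in> F \<rightarrow> carrier M \<and> c \<ominus> comb s \<in> G 0"
        using comb_closed[of "\<lambda>_. \<zero>"] cc by (intro exI[of _ "\<lambda>_. \<zero>"]) (simp add: G_0)
    next
      fix s n assume s: "s \<in> F \<rightarrow> carrier M \<and> c \<ominus> comb s \<in> G n"
      have "c \<ominus> comb s \<in> J" using c Jcomb s by (simp add: a_minus_def J.a_closed)
      then obtain a where a: "a \<in> F \<rightarrow> carrier M" "(c \<ominus> comb s) \<ominus> comb a \<in> G (Suc n)"
        "\<And>i k. i \<in> F \<Longrightarrow> q ^ k * D \<le> n \<Longrightarrow> a i \<in> P k"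
        using step[OF _ conjunct2[OF s]] by blast
      let ?t = "\<lambda>i. s i \<oplus> a i"
      have "c \<ominus> comb ?t = (c \<ominus> comb s) \<ominus> comb a"
        using comb_add[of s a] s a(1) comb_closed[of s] comb_closed[OF a(1)] cc by (simp add: a_minus_def M.minus_add M.a_assoc)
      moreover have "?t i \<ominus> s i = a i" if "i \<in> F" for i
      proof -
        have "s i \<in> carrier M" "a i \<in> carrier M" using s a(1) that by auto
        then show ?thesis by (simp add: a_minus_def M.a_comm[of "s i" "a i"] M.a_assoc M.r_neg)
      qed
      moreover have "?t \<in> F \<rightarrow> carrier M" using s a(1) by auto
      ultimately show "\<exists>t. (t \<in> F \<rightarrow> carrier M \<and> c \<ominus> comb t \<in> G (Suc n)) \<and>
          (\<forall>i\<in>F. \<forall>k. q ^ k * D \<le> n \<longrightarrow> t i \<ominus> s i \<in> P k)"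
        using a(2,3) by (intro exI[of _ ?t]) (simp del: ideal_pow.simps)
    qed
    then obtain \<sigma> where \<sigma>: "\<And>n. \<sigma> n \<in> F \<rightarrow> carrier M" "\<And>n. c \<ominus> comb (\<sigma> n) \<in> G n"
      "\<And>n i k. i \<in> F \<Longrightarrow> q ^ k * D \<le> n \<Longrightarrow> \<sigma> (Suc n) i \<ominus> \<sigma> n i \<in> P k" by blast
    have \<sigma>c: "\<sigma> n i \<in> carrier M" if "i \<in> F" for n i using \<sigma>(1)[of n] that by auto
    have tele: "\<sigma> n i \<ominus> \<sigma> (q ^ k * D) i \<in> P k" if i: "i \<in> F" and n: "q ^ k * D \<le> n" for n i k
      using n
    proof (induction n rule: dec_induct)
      case base
      show ?case using \<sigma>c[OF i] P_zero by (simp add: a_minus_def M.r_neg del: ideal_pow.simps)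
    next
      case (step n)
      show ?case by (rule P_trans[OF \<sigma>c[OF i] \<sigma>c[OF i] \<sigma>c[OF i] \<sigma>(3)[OF i step(1)] step.IH])
    qed
    \<comment> \<open>The k-th approximation is taken at stage q ^ k * D, from which on the
      coefficient is fixed modulo \<open>P k\<close>; this makes the approximations a coherent
      sequence.\<close>
    have "\<exists>s\<in>carrier M. \<forall>k. s \<ominus> \<sigma> (q ^ k * D) i \<in> P k" if i: "i \<in> F" for i
    proof -
      have "q ^ k * D \<le> q ^ Suc k * D" for k using q by simp
      then have "coh (\<lambda>k. \<sigma> (q ^ k * D) i)" unfolding coh_def using \<sigma>c[OF i] tele[OF i] by blast
      then show ?thesis by (rule P_complete)
    qed
    then obtain s where s: "\<And>i. i \<in> F \<Longrightarrow> s i \<in> carrier M" "\<And>i k. i \<in> F \<Longrightarrow> s i \<ominus> \<sigma> (q ^ k * D) i \<in> P k"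
      by metis
    have sF: "s \<in> F \<rightarrow> carrier M" using s(1) by blast
    have "c \<ominus> comb s \<in> P k" for k
    proof -
      let ?t = "\<sigma> (q ^ k * D)" and ?d = "\<lambda>i. s i \<ominus> \<sigma> (q ^ k * D) i"
      have d: "?d \<in> F \<rightarrow> carrier M" using s(1) \<sigma>c by auto
      have "comb s = comb (\<lambda>i. ?t i \<oplus> ?d i)"
        unfolding comb_def
      proof (rule M.finsum_cong')
        fix i assume i: "i \<in> F"
        have "?t i \<oplus> ?d i = s i" using s(1)[OF i] \<sigma>c[OF i] by (simp add: a_minus_def M.a_comm[of "s i"] M.r_neg2)
        then show "s i \<otimes> b i = (?t i \<oplus> ?d i) \<otimes> b i" by simp
      qed (use s(1) \<sigma>c bc in auto)
      also have "\<dots> = comb ?t \<oplus> comb ?d" by (rule comb_add[OF \<sigma>(1) d])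
      finally have "c \<ominus> comb s = (c \<ominus> comb ?t) \<ominus> comb ?d"
        using cc comb_closed[OF \<sigma>(1)] comb_closed[OF d] by (simp add: a_minus_def M.minus_add M.a_assoc)
      moreover have "comb ?d \<in> P k"
        unfolding comb_def
      proof (rule P_finsum)
        fix i assume i: "i \<in> F"
        show "?d i \<otimes> b i \<in> P k" by (rule P_mult_r[OF s(2)[OF i] bc[OF i]])
      qed
      moreover have "q ^ k \<le> q ^ k * D" using D(1) by simp
      then have "c \<ominus> comb ?t \<in> P k" using G_P \<sigma>(2) by blast
      ultimately show ?thesis using P_minus by (simp only:)
    qed
    then have "c \<ominus> comb s = \<zero>" using cc comb_closed[OF sF] by (intro P_separated) auto
    then have "c = comb s" using cc comb_closed[OF sF] by simp
    moreover have "comb s \<in> Idl (b ` F)"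
    proof -
      have bF: "b ` F \<subseteq> carrier M" using bc by blast
      interpret B: ideal "Idl (b ` F)" M by (rule genideal_ideal[OF bF])
      have sb: "s i \<otimes> b i \<in> Idl (b ` F)" if "i \<in> F" for i
        using genideal_self[OF bF] that s(1)[OF that] by (intro B.I_l_closed) auto
      then show ?thesis unfolding comb_def by (rule ring.ideal_finsum[OF cring.axioms(1)[OF M_cring] B.ideal_axioms])
    qed
    ultimately show "c \<in> Idl (b ` F)" by simp
  qed
  moreover have "Idl (b ` F) \<subseteq> J" using b(1) by (intro genideal_minimal[OF J]) blast
  ultimately show ?thesis using bc F(2) by (intro exI[of _ "b ` F"]) auto
qed

end

context complete_adic
begin

lemma noetherian: "noetherian_ring M"
proof -
  have "infinite {p :: nat. normalization_semidom_class.prime p}" by (rule primes_infinite)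
  then obtain T where T: "T \<subseteq> {p :: nat. normalization_semidom_class.prime p}" "finite T" "card T = card S"
    by (meson infinite_arbitrarily_large)
  then obtain x where x: "bij_betw x T S" using S(1) finite_same_card_bij by blast
  \<comment> \<open>Any distinct primes serve, one for each generator. The number 2 in the maximum
    ensures q > 1 when there are no generators.\<close>
  interpret monomial_order R M I S T x "Max (insert 2 T)"
  proof
    show "p \<le> Max (insert 2 T)" if "p \<in> T" for p using T(2) that by simp
    have "2 \<le> Max (insert 2 T)" using T(2) by (intro Max_ge) auto
    then show "1 < Max (insert 2 T)" by linarith
  qed (use T x in \<open>auto simp: bij_betw_def\<close>)
  show ?thesis using ideal_finite by (intro ring.noetherian_ringI[OF cring.axioms(1)[OF M_cring]])
qed

theorem complete_local: "complete_local_noetherian R M"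
  unfolding complete_local_noetherian_def max_ideal_eq
  using algebra_axioms noetherian I_maximal maximal_unique bij residue_field by blast

end

section \<open>Completion of reduced cosimplicial algebras\<close>

lemma alg_hom_restrict:
  assumes M: "algebra R M" and f: "f \<in> alg_hom R M N"
  shows "(\<lambda>x\<in>carrier M. f x) \<in> alg_hom R M N"
proof -
  interpret algebra R M by (rule M)
  have "(\<lambda>x\<in>carrier M. f x) \<in> ring_hom M N"
    by (rule ring_hom_memI) (simp_all add: alg_homD[OF f])
  then show ?thesis by (simp add: alg_hom_def alg_homD[OF f])
qed

context adic
begin

lemma to_completion_bij:
  assumes sep: "\<And>x. x \<in> carrier M \<Longrightarrow> (\<And>k. x \<in> P k) \<Longrightarrow> x = \<zero>"
    and cpl: "\<And>a. coh a \<Longrightarrow> \<exists>x\<in>carrier M. \<forall>k. x \<ominus> a k \<in> P k"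
  shows "bij_betw (to_completion M I) (carrier M) (carrier cmpl)"
  unfolding bij_betw_def
proof (intro conjI equalityI subsetI)
  show "inj_on (to_completion M I) (carrier M)"
  proof (rule inj_onI)
    fix x y assume xy: "x \<in> carrier M" "y \<in> carrier M" "to_completion M I x = to_completion M I y"
    then have "x \<ominus> y \<in> P k" for k using L_eq_iff[of "\<lambda>_. x" "\<lambda>_. y"] by (simp add: to_completion_eq)
    then have "x \<ominus> y = \<zero>" using xy by (intro sep) auto
    then show "x = y" using xy by simp
  qed
next
  fix z assume "z \<in> to_completion M I ` carrier M"
  then show "z \<in> carrier cmpl" by (auto simp: to_completion_eq intro!: L_carrier coh_const)
next
  fix z assume "z \<in> carrier cmpl"
  then obtain a where a: "coh a" "z = L a" using L_exists by blast
  obtain x where x: "x \<in> carrier M" "\<And>k. x \<ominus> a k \<in> P k" using cpl[OF a(1)] by blast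
  then have "L (\<lambda>_. x) = L a" using L_eq_iff[of "\<lambda>_. x" a] cohD(1)[OF a(1)] by simp
  then show "z \<in> to_completion M I ` carrier M"
    unfolding a(2) using x(1) by (intro image_eqI[of _ _ x]) (simp_all add: to_completion_eq)
qed

text \<open>Each algebra generator becomes an element of I after subtraction of its scalar residue.
  Every element of M is then congruent to a scalar modulo the shifted generators, and for an element
  of I this scalar is 0 by \<open>triv\<close>.\<close>

lemma ideal_generated_by_shifts:
  assumes S: "S \<subseteq> carrier M" "finite S" "generate_ring M (S \<union> (\<lambda>r. r \<odot> \<one>) ` carrier R) = carrier M"
    and \<epsilon>: "\<And>s. s \<in> S \<Longrightarrow> \<epsilon> s \<in> carrier R" "\<And>s. s \<in> S \<Longrightarrow> s \<ominus> \<epsilon> s \<odot> \<one> \<in> I"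
    and triv: "\<And>r. r \<in> carrier R \<Longrightarrow> r \<odot> \<one> \<in> I \<Longrightarrow> r = \<zero>\<^bsub>R\<^esub>"
  shows "\<exists>S'\<subseteq>carrier M. finite S' \<and> I = Idl S'"
proof -
  interpret I: ideal I M by (rule I)
  define S' where "S' = (\<lambda>s. s \<ominus> \<epsilon> s \<odot> \<one>) ` S"
  have S'I: "S' \<subseteq> I" using \<epsilon>(2) by (auto simp: S'_def)
  have S'c: "S' \<subseteq> carrier M" using S'I I.a_subset by blast
  interpret J: ideal "Idl S'" M by (rule genideal_ideal[OF S'c])
  have JI: "Idl S' \<subseteq> I" by (rule genideal_minimal[OF I S'I])
  have gen: "\<exists>r\<in>carrier R. x \<ominus> r \<odot> \<one> \<in> Idl S'"
    if "x \<in> generate_ring M (S \<union> (\<lambda>r. r \<odot> \<one>) ` carrier R)" for x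
    using that
  proof (induction rule: generate_ring.induct)
    case one
    show ?case by (rule bexI[of _ "\<one>\<^bsub>R\<^esub>"]) (simp_all add: a_minus_def M.r_neg)
  next
    case (incl h)
    then consider "h \<in> S" | r where "r \<in> carrier R" "h = r \<odot> \<one>" by blast
    then show ?case
    proof cases
      case 1
      then show ?thesis using \<epsilon>(1) genideal_self[OF S'c] by (auto simp: S'_def)
    next
      case 2
      then show ?thesis by (intro bexI[of _ r]) (simp_all add: a_minus_def M.r_neg)
    qed
  next
    case (a_inv h)
    then obtain r where r: "r \<in> carrier R" "h \<ominus> r \<odot> \<one> \<in> Idl S'" by blast
    have hc: "h \<in> carrier M" using a_inv(1) S(3) by simp
    have "\<ominus> (h \<ominus> r \<odot> \<one>) = \<ominus> h \<ominus> (\<ominus>\<^bsub>R\<^esub> r) \<odot> \<one>"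
      using hc r(1) by (simp add: a_minus_def M.minus_add smult_l_minus)
    then show ?case using J.a_inv_closed[OF r(2)] r(1) by (intro bexI[of _ "\<ominus>\<^bsub>R\<^esub> r"]) simp_all
  next
    case (eng_add h k)
    then obtain r s where r: "r \<in> carrier R" "h \<ominus> r \<odot> \<one> \<in> Idl S'"
      and s: "s \<in> carrier R" "k \<ominus> s \<odot> \<one> \<in> Idl S'" by blast
    have hc: "h \<in> carrier M" "k \<in> carrier M" using eng_add(1,2) S(3) by simp_all
    have "(h \<oplus> k) \<ominus> (r \<oplus>\<^bsub>R\<^esub> s) \<odot> \<one> =
        (h \<ominus> r \<odot> \<one>) \<oplus> (k \<ominus> s \<odot> \<one>)"
      using hc r(1) s(1) by (simp add: a_minus_def smult_l_distr M.minus_add M.a_ac)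
    then show ?case using J.a_closed[OF r(2) s(2)] r(1) s(1) by (intro bexI[of _ "r \<oplus>\<^bsub>R\<^esub> s"]) simp_all
  next
    case (eng_mult h k)
    then obtain r s where r: "r \<in> carrier R" "h \<ominus> r \<odot> \<one> \<in> Idl S'"
      and s: "s \<in> carrier R" "k \<ominus> s \<odot> \<one> \<in> Idl S'" by blast
    have hc: "h \<in> carrier M" "k \<in> carrier M" using eng_mult(1,2) S(3) by simp_all
    have "(r \<odot> \<one>) \<otimes> (s \<odot> \<one>) = (r \<otimes>\<^bsub>R\<^esub> s) \<odot> \<one>"
      using r(1) s(1) by (simp add: smult_assoc1 smult_assoc2)
    then have "h \<otimes> k \<ominus> (r \<otimes>\<^bsub>R\<^esub> s) \<odot> \<one> =
        (h \<ominus> r \<odot> \<one>) \<otimes> k \<oplus> (r \<odot> \<one>) \<otimes> (k \<ominus> s \<odot> \<one>)"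
      using mult_diff[of h k "r \<odot> \<one>" "s \<odot> \<one>"] hc r(1) s(1) by simp
    moreover have "\<dots> \<in> Idl S'"
      using hc r s by (intro J.a_closed J.I_r_closed J.I_l_closed) auto
    ultimately show ?case using r(1) s(1) by (intro bexI[of _ "r \<otimes>\<^bsub>R\<^esub> s"]) simp_all
  qed
  have "I \<subseteq> Idl S'"
  proof
    fix x assume x: "x \<in> I"
    have xc: "x \<in> carrier M" using I.Icarr[OF x] .
    then obtain r where r: "r \<in> carrier R" "x \<ominus> r \<odot> \<one> \<in> Idl S'" using gen[of x] S(3) by auto
    have "x \<oplus> \<ominus> (x \<ominus> r \<odot> \<one>) \<in> I" using x r(2) JI by (intro I.a_closed I.a_inv_closed) auto
    moreover have "x \<oplus> \<ominus> (x \<ominus> r \<odot> \<one>) = r \<odot> \<one>"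
      using xc r(1) by (simp add: a_minus_def M.minus_add M.r_neg2)
    ultimately have "r = \<zero>\<^bsub>R\<^esub>" using triv[OF r(1)] by simp
    then show "x \<in> Idl S'" using r xc by (simp add: a_minus_def)
  qed
  then have "I = Idl S'" using JI by blast
  moreover have "finite S'" using S(2) by (simp add: S'_def)
  ultimately show ?thesis using S'c by blast
qed

end

locale adic_hom = M: adic R M I + N: adic R N J for R (structure) and M (structure) and I and N (structure) and J +
  fixes f
  assumes f: "f \<in> alg_hom R M N" and fI: "\<And>x. x \<in> I \<Longrightarrow> f x \<in> J"
begin

lemma f_closed: "x \<in> carrier M \<Longrightarrow> f x \<in> carrier N"
  by (rule alg_homD(1)[OF f])

lemma f_P: "x \<in> M.P k \<Longrightarrow> f x \<in> N.P k"
proof (induction k arbitrary: x)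
  case 0
  then show ?case by (simp add: f_closed)
next
  case (Suc k)
  from Suc.prems have "x \<in> ideal_prod M I (M.P k)" by simp
  then show ?case
  proof (induction rule: ideal_prod.induct)
    case (prod i j)
    have "i \<in> carrier M" "j \<in> carrier M" using ideal.Icarr[OF M.I prod(1)] M.P_carrier[OF prod(2)] .
    then show ?case using ideal_prod.prod[OF fI[OF prod(1)] Suc.IH[OF prod(2)]] by (simp add: alg_homD(2)[OF f])
  next
    case (sum s t)
    have "s \<in> carrier M" "t \<in> carrier M" using sum(1,2) M.ideal_prod_in_carrier[OF M.I M.P_ideal] by auto
    then show ?case using N.P_add[OF sum(3,4)] by (simp add: alg_homD(3)[OF f])
  qed
qed

lemma f_coh: "M.coh a \<Longrightarrow> N.coh (\<lambda>k. f (a k))"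
  using f_P f_closed alg_hom_minus[OF M.algebra_axioms N.algebra_axioms f] unfolding M.coh_def N.coh_def
  by metis

text \<open>The union in \<open>completion_map\<close> is taken over equal cosets, since f maps the
  powers of I into those of J.\<close>

lemma completion_map_L:
  assumes a: "M.coh a"
  shows "completion_map N J f (M.L a) = N.L (\<lambda>k. f (a k))"
proof
  fix k
  note ac = M.cohD(1)[OF a, of k]
  have "N.P k +>\<^bsub>N\<^esub> f x = N.P k +>\<^bsub>N\<^esub> f (a k)" if "x \<in> M.P k +>\<^bsub>M\<^esub> a k" for x
  proof -
    have x: "x \<in> carrier M" "x \<ominus>\<^bsub>M\<^esub> a k \<in> M.P k" using M.mem_coset[OF ac] that by auto
    have "f x \<ominus>\<^bsub>N\<^esub> f (a k) \<in> N.P k"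
      using f_P[OF x(2)] alg_hom_minus[OF M.algebra_axioms N.algebra_axioms f x(1) ac] by simp
    then show ?thesis using N.coset_eq_iff[OF f_closed[OF x(1)] f_closed[OF ac]] by blast
  qed
  moreover have "a k \<in> M.P k +>\<^bsub>M\<^esub> a k" using M.mem_coset[OF ac] ac M.P_zero by (simp add: a_minus_def M.M.r_neg)
  ultimately show "completion_map N J f (M.L a) k = N.L (\<lambda>k. f (a k)) k"
    unfolding completion_map_def M.L_def N.L_def by blast
qed

lemma completion_map_hom: "completion_map N J f \<in> alg_hom R M.cmpl N.cmpl"
proof -
  note [simp] = completion_map_L f_coh M.L_mult M.L_add M.L_smult N.L_mult N.L_add N.L_smult
    M.coh_mult M.coh_add M.coh_smult N.L_carrier alg_homD[OF f] f_closed
  have "completion_map N J f \<in> ring_hom M.cmpl N.cmpl"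
  proof (rule ring_hom_memI)
    show "completion_map N J f z \<in> carrier N.cmpl" if "z \<in> carrier M.cmpl" for z
      using M.L_exists[OF that] by (elim exE conjE) simp
    show "completion_map N J f (z \<otimes>\<^bsub>M.cmpl\<^esub> w) = completion_map N J f z \<otimes>\<^bsub>N.cmpl\<^esub> completion_map N J f w"
      if "z \<in> carrier M.cmpl" "w \<in> carrier M.cmpl" for z w
      using M.L_exists[OF that(1)] M.L_exists[OF that(2)] by (elim exE conjE) simp
    show "completion_map N J f (z \<oplus>\<^bsub>M.cmpl\<^esub> w) = completion_map N J f z \<oplus>\<^bsub>N.cmpl\<^esub> completion_map N J f w"
      if "z \<in> carrier M.cmpl" "w \<in> carrier M.cmpl" for z w
      using M.L_exists[OF that(1)] M.L_exists[OF that(2)] by (elim exE conjE) simp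
    show "completion_map N J f \<one>\<^bsub>M.cmpl\<^esub> = \<one>\<^bsub>N.cmpl\<^esub>"
      by (simp add: M.L_one N.L_one M.coh_const)
  qed
  moreover have "completion_map N J f (r \<odot>\<^bsub>M.cmpl\<^esub> z) = r \<odot>\<^bsub>N.cmpl\<^esub> completion_map N J f z"
    if "r \<in> carrier R" "z \<in> carrier M.cmpl" for r z
    using M.L_exists[OF that(2)] that(1) by (elim exE conjE) simp
  ultimately show ?thesis by (simp add: alg_hom_def)
qed

end

section \<open>Completion as a functor on cosimplicial algebras\<close>

lemma level_compl: "level (compl A) n = adic_completion (level A n) (aug_ideal A n)"
  by (simp add: compl_def)

lemma cmap_compl: "cmap (compl A) m n \<alpha> = completion_map (level A n) (aug_ideal A n) (cmap A m n \<alpha>)"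
  by (simp add: compl_def)

lemma adic_level: "A \<in> cCom R \<Longrightarrow> adic R (level A n) (aug_ideal A n)"
  by (intro adic.intro adic_axioms.intro aug_ideal_ideal cComD(1))

lemma adic_hom_cmap:
  assumes A: "A \<in> cCom R" and \<alpha>: "\<alpha> \<in> Delta m n"
  shows "adic_hom R (level A m) (aug_ideal A m) (level A n) (aug_ideal A n) (cmap A m n \<alpha>)"
  by (intro adic_hom.intro adic_hom_axioms.intro adic_level A cComD(2) \<alpha> cmap_aug_ideal[OF A \<alpha>])

lemma adic_hom_ccom:
  assumes A: "A \<in> cCom R" and B: "B \<in> cCom R" and \<phi>: "\<phi> \<in> ccom_hom R A B"
  shows "adic_hom R (level A n) (aug_ideal A n) (level B n) (aug_ideal B n) (\<phi> n)"
  by (intro adic_hom.intro adic_hom_axioms.intro adic_level A B ccom_homD(1)[OF \<phi>] ccom_hom_aug_ideal[OF A B \<phi>])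

lemma compl_cCom:
  assumes A: "A \<in> cCom R"
  shows "compl A \<in> cCom R"
proof -
  have "cmap (compl A) n n (\<lambda>i\<in>{..n}. i) x = x" if x: "x \<in> carrier (level (compl A) n)" for n x
  proof -
    have d: "(\<lambda>i\<in>{..n}. i) \<in> Delta n n" by (auto simp: Delta_def mono_on_def)
    interpret h: adic_hom R "level A n" "aug_ideal A n" "level A n" "aug_ideal A n" "cmap A n n (\<lambda>i\<in>{..n}. i)"
      by (rule adic_hom_cmap[OF A d])
    obtain a where a: "h.M.coh a" "x = h.M.L a" using h.M.L_exists x by (auto simp: level_compl)
    then show ?thesis using cComD(3)[OF A h.M.cohD(1)[OF a(1)]] by (simp add: cmap_compl h.completion_map_L)
  qed
  moreover have "cmap (compl A) l n (compose {..l} \<beta> \<alpha>) x = cmap (compl A) m n \<beta> (cmap (compl A) l m \<alpha> x)"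
    if \<alpha>: "\<alpha> \<in> Delta l m" and \<beta>: "\<beta> \<in> Delta m n" and x: "x \<in> carrier (level (compl A) l)" for l m n \<alpha> \<beta> x
  proof -
    have d: "compose {..l} \<beta> \<alpha> \<in> Delta l n"
      using \<alpha> \<beta> by (auto simp: Delta_def mono_on_def compose_def PiE_def Pi_def)
    interpret f: adic_hom R "level A l" "aug_ideal A l" "level A m" "aug_ideal A m" "cmap A l m \<alpha>" by (rule adic_hom_cmap[OF A \<alpha>])
    interpret g: adic_hom R "level A m" "aug_ideal A m" "level A n" "aug_ideal A n" "cmap A m n \<beta>" by (rule adic_hom_cmap[OF A \<beta>])
    interpret h: adic_hom R "level A l" "aug_ideal A l" "level A n" "aug_ideal A n" "cmap A l n (compose {..l} \<beta> \<alpha>)"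
      by (rule adic_hom_cmap[OF A d])
    obtain a where a: "f.M.coh a" "x = f.M.L a" using f.M.L_exists x by (auto simp: level_compl)
    then show ?thesis using cComD(4)[OF A \<alpha> \<beta> f.M.cohD(1)[OF a(1)]]
      by (simp add: cmap_compl f.completion_map_L g.completion_map_L h.completion_map_L f.f_coh)
  qed
  moreover have "algebra R (level (compl A) n)" for n
    unfolding level_compl by (rule adic.cmpl_algebra[OF adic_level[OF A]])
  moreover have "cmap (compl A) m n \<alpha> \<in> alg_hom R (level (compl A) m) (level (compl A) n)" if "\<alpha> \<in> Delta m n" for m n \<alpha>
    unfolding level_compl cmap_compl by (rule adic_hom.completion_map_hom[OF adic_hom_cmap[OF A that]])
  ultimately show ?thesis unfolding cCom_def by blast
qed

lemma to_compl_hom: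
  assumes A: "A \<in> cCom R"
  shows "to_compl A \<in> ccom_hom R A (compl A)"
proof -
  have "to_compl A n (cmap A m n \<alpha> x) = cmap (compl A) m n \<alpha> (to_compl A m x)"
    if \<alpha>: "\<alpha> \<in> Delta m n" and x: "x \<in> carrier (level A m)" for m n \<alpha> x
  proof -
    interpret f: adic_hom R "level A m" "aug_ideal A m" "level A n" "aug_ideal A n" "cmap A m n \<alpha>" by (rule adic_hom_cmap[OF A \<alpha>])
    show ?thesis using x f.f_closed[OF x]
      by (simp add: to_compl_def cmap_compl f.M.to_completion_eq f.N.to_completion_eq f.completion_map_L f.M.coh_const)
  qed
  moreover have "to_compl A n \<in> alg_hom R (level A n) (level (compl A) n)" for n
    unfolding to_compl_def level_compl
    by (rule alg_hom_restrict[OF cComD(1)[OF A] adic.to_completion_hom[OF adic_level[OF A]]])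
  ultimately show ?thesis by (simp add: ccom_hom_def to_compl_def)
qed

lemma compl_map_hom:
  assumes A: "A \<in> cCom R" and B: "B \<in> cCom R" and \<phi>: "\<phi> \<in> ccom_hom R A B"
  shows "compl_map A B \<phi> \<in> ccom_hom R (compl A) (compl B)"
proof -
  have "compl_map A B \<phi> n (cmap (compl A) m n \<alpha> x) = cmap (compl B) m n \<alpha> (compl_map A B \<phi> m x)"
    if \<alpha>: "\<alpha> \<in> Delta m n" and x: "x \<in> carrier (level (compl A) m)" for m n \<alpha> x
  proof -
    interpret f: adic_hom R "level A m" "aug_ideal A m" "level A n" "aug_ideal A n" "cmap A m n \<alpha>" by (rule adic_hom_cmap[OF A \<alpha>])
    interpret g: adic_hom R "level B m" "aug_ideal B m" "level B n" "aug_ideal B n" "cmap B m n \<alpha>" by (rule adic_hom_cmap[OF B \<alpha>])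
    interpret m: adic_hom R "level A m" "aug_ideal A m" "level B m" "aug_ideal B m" "\<phi> m" by (rule adic_hom_ccom[OF A B \<phi>])
    interpret n: adic_hom R "level A n" "aug_ideal A n" "level B n" "aug_ideal B n" "\<phi> n" by (rule adic_hom_ccom[OF A B \<phi>])
    obtain a where a: "f.M.coh a" "x = f.M.L a" using f.M.L_exists x by (auto simp: level_compl)
    then show ?thesis using ccom_homD(3)[OF \<phi> \<alpha> f.M.cohD(1)[OF a(1)]]
      by (simp add: compl_map_def level_compl cmap_compl f.completion_map_L g.completion_map_L m.completion_map_L n.completion_map_L
          f.f_coh m.f_coh f.M.L_carrier f.N.L_carrier)
  qed
  moreover have "compl_map A B \<phi> n \<in> alg_hom R (level (compl A) n) (level (compl B) n)" for n
    unfolding compl_map_def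
    by (rule alg_hom_restrict[OF cComD(1)[OF compl_cCom[OF A]]])
      (unfold level_compl, rule adic_hom.completion_map_hom[OF adic_hom_ccom[OF A B \<phi>]])
  ultimately show ?thesis by (simp add: ccom_hom_def compl_map_def)
qed

lemma compl_map_L:
  assumes A: "A \<in> cCom R" and B: "B \<in> cCom R" and \<phi>: "\<phi> \<in> ccom_hom R A B"
    and a: "adic.coh (level A n) (aug_ideal A n) a"
  shows "compl_map A B \<phi> n (adic.L (level A n) (aug_ideal A n) a) = adic.L (level B n) (aug_ideal B n) (\<lambda>k. \<phi> n (a k))"
    and "adic.coh (level B n) (aug_ideal B n) (\<lambda>k. \<phi> n (a k))"
proof -
  interpret n: adic_hom R "level A n" "aug_ideal A n" "level B n" "aug_ideal B n" "\<phi> n" by (rule adic_hom_ccom[OF A B \<phi>])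
  show "compl_map A B \<phi> n (n.M.L a) = n.N.L (\<lambda>k. \<phi> n (a k))" "n.N.coh (\<lambda>k. \<phi> n (a k))"
    using a by (simp_all add: compl_map_def level_compl n.M.L_carrier n.completion_map_L n.f_coh)
qed

lemma compl_map_id:
  assumes A: "A \<in> cCom R"
  shows "compl_map A A (ccom_id A) = ccom_id (compl A)"
proof (rule ccom_hom_eqI[OF compl_map_hom[OF A A ccom_id_hom[OF A]] ccom_id_hom[OF compl_cCom[OF A]]])
  fix n x assume x: "x \<in> carrier (level (compl A) n)"
  interpret a: adic R "level A n" "aug_ideal A n" by (rule adic_level[OF A])
  obtain a where a: "a.coh a" "x = a.L a" using a.L_exists x by (auto simp: level_compl)
  have "compl_map A A (ccom_id A) n x = a.L (\<lambda>k. ccom_id A n (a k))"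
    unfolding a(2) by (rule compl_map_L(1)[OF A A ccom_id_hom[OF A] a(1)])
  also have "\<dots> = ccom_id (compl A) n x" using x a a.cohD(1)[OF a(1)] by (simp add: ccom_id_def)
  finally show "compl_map A A (ccom_id A) n x = ccom_id (compl A) n x" .
qed

lemma compl_map_comp:
  assumes A: "A \<in> cCom R" and B: "B \<in> cCom R" and E: "E \<in> cCom R"
    and \<phi>: "\<phi> \<in> ccom_hom R A B" and \<psi>: "\<psi> \<in> ccom_hom R B E"
  shows "compl_map A E (ccom_comp A \<psi> \<phi>) = ccom_comp (compl A) (compl_map B E \<psi>) (compl_map A B \<phi>)"
proof (rule ccom_hom_eqI)
  note \<psi>\<phi> = ccom_comp_hom[OF A \<phi> \<psi>]
  show "compl_map A E (ccom_comp A \<psi> \<phi>) \<in> ccom_hom R (compl A) (compl E)" by (rule compl_map_hom[OF A E \<psi>\<phi>])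
  show "ccom_comp (compl A) (compl_map B E \<psi>) (compl_map A B \<phi>) \<in> ccom_hom R (compl A) (compl E)"
    by (rule ccom_comp_hom[OF compl_cCom[OF A] compl_map_hom[OF A B \<phi>] compl_map_hom[OF B E \<psi>]])
  fix n x assume x: "x \<in> carrier (level (compl A) n)"
  interpret a: adic R "level A n" "aug_ideal A n" by (rule adic_level[OF A])
  obtain a where a: "a.coh a" "x = a.L a" using a.L_exists x by (auto simp: level_compl)
  then show "compl_map A E (ccom_comp A \<psi> \<phi>) n x = ccom_comp (compl A) (compl_map B E \<psi>) (compl_map A B \<phi>) n x"
    using x a.cohD(1)[OF a(1)]
    by (simp add: compl_map_L[OF A E \<psi>\<phi>] compl_map_L[OF A B \<phi>] compl_map_L[OF B E \<psi>] ccom_comp_apply)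
qed

lemma to_compl_natural:
  assumes A: "A \<in> cCom R" and B: "B \<in> cCom R" and \<phi>: "\<phi> \<in> ccom_hom R A B"
  shows "ccom_comp A (compl_map A B \<phi>) (to_compl A) = ccom_comp A (to_compl B) \<phi>"
proof (rule ccom_hom_eqI)
  show "ccom_comp A (compl_map A B \<phi>) (to_compl A) \<in> ccom_hom R A (compl B)"
    by (rule ccom_comp_hom[OF A to_compl_hom[OF A] compl_map_hom[OF A B \<phi>]])
  show "ccom_comp A (to_compl B) \<phi> \<in> ccom_hom R A (compl B)"
    by (rule ccom_comp_hom[OF A \<phi> to_compl_hom[OF B]])
  fix n x assume x: "x \<in> carrier (level A n)"
  interpret a: adic R "level A n" "aug_ideal A n" by (rule adic_level[OF A])
  interpret b: adic R "level B n" "aug_ideal B n" by (rule adic_level[OF B])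
  show "ccom_comp A (compl_map A B \<phi>) (to_compl A) n x = ccom_comp A (to_compl B) \<phi> n x"
    using x alg_homD(1)[OF ccom_homD(1)[OF \<phi>] x] compl_map_L(1)[OF A B \<phi> a.coh_const[OF x]]
    by (simp add: ccom_comp_apply to_compl_def a.to_completion_eq b.to_completion_eq)
qed

lemma aug_ideal_0:
  assumes A: "A \<in> cCom R"
  shows "aug_ideal A 0 = {\<zero>\<^bsub>level A 0\<^esub>}"
proof -
  interpret algebra R "level A 0" by (rule cComD(1)[OF A])
  have "collapse 0 = (\<lambda>i\<in>{..0}. i)" by (auto simp: fun_eq_iff)
  then have "cmap A 0 0 (collapse 0) x = x" if "x \<in> carrier (level A 0)" for x using cComD(3)[OF A that] by simp
  then show ?thesis by (auto simp: mem_aug_ideal_iff)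
qed

lemma ideal_pow_0_aug:
  assumes A: "A \<in> cCom R" and k: "k > 0"
  shows "ideal_pow (level A 0) (aug_ideal A 0) k = {\<zero>\<^bsub>level A 0\<^esub>}"
proof -
  interpret a: adic R "level A 0" "aug_ideal A 0" by (rule adic_level[OF A])
  have "a.P k \<subseteq> a.P 1" using k by (intro a.P_antimono) simp
  also have "\<dots> = aug_ideal A 0" by (rule a.P_1)
  also have "\<dots> = {\<zero>\<^bsub>level A 0\<^esub>}" by (rule aug_ideal_0[OF A])
  finally have "a.P k \<subseteq> {\<zero>\<^bsub>level A 0\<^esub>}" .
  moreover have "{\<zero>\<^bsub>level A 0\<^esub>} \<subseteq> a.P k" using a.P_zero[of k] by (simp only: insert_subset empty_subsetI simp_thms)
  ultimately show ?thesis by (rule subset_antisym)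
qed

text \<open>The augmentation ideal of level 0 is zero, so completion does not change that
  level.\<close>

lemma compl_cCom0:
  assumes fld: "field R" and A: "A \<in> cCom\<^sub>0 R"
  shows "compl A \<in> cCom\<^sub>0 R"
proof -
  note A' = cCom0D(1)[OF A]
  interpret F: field R by (rule fld)
  interpret a: adic R "level A 0" "aug_ideal A 0" by (rule adic_level[OF A'])
  have "\<one>\<^bsub>level A 0\<^esub> \<noteq> \<zero>\<^bsub>level A 0\<^esub>"
    by (rule scalars_nontrivial[OF fld a.module cCom0D(3)[OF A] a.one_closed])
  then have ne: "\<one>\<^bsub>a.cmpl\<^esub> \<noteq> \<zero>\<^bsub>a.cmpl\<^esub>"
    using a.L_eq_iff[of "\<lambda>_. \<one>\<^bsub>level A 0\<^esub>" "\<lambda>_. \<zero>\<^bsub>level A 0\<^esub>"] ideal_pow_0_aug[OF A', of 1]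
    by (auto simp: a.L_one a.L_zero a_minus_def simp del: ideal_pow.simps)
  have "\<exists>r\<in>carrier R. x = r \<odot>\<^bsub>a.cmpl\<^esub> \<one>\<^bsub>a.cmpl\<^esub>" if x: "x \<in> carrier a.cmpl" for x
  proof -
    obtain a where a: "a.coh a" "x = a.L a" using a.L_exists[OF x] by blast
    obtain r where r: "r \<in> carrier R" "a 1 = r \<odot>\<^bsub>level A 0\<^esub> \<one>\<^bsub>level A 0\<^esub>"
      using cCom0D(2)[OF A a.cohD(1)[OF a(1)]] by blast
    have "a k \<ominus>\<^bsub>level A 0\<^esub> a 1 \<in> a.P k" for k
    proof (cases "k = 0")
      case True
      then show ?thesis using a.cohD(1)[OF a(1)] by simp
    next
      case False
      then show ?thesis using a.coh_le[OF a(1), of 1 k] ideal_pow_0_aug[OF A', of 1] ideal_pow_0_aug[OF A', of k]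
        by (simp del: ideal_pow.simps)
    qed
    then have "a.L a = a.L (\<lambda>_. a 1)" using a.cohD(1)[OF a(1)] by (subst a.L_eq_iff) auto
    then have "x = r \<odot>\<^bsub>a.cmpl\<^esub> \<one>\<^bsub>a.cmpl\<^esub>" using a r by (simp add: a.L_one a.L_smult)
    then show ?thesis using r(1) by blast
  qed
  moreover note a.cmpl.smult_closed[OF _ a.cmpl.one_closed]
  ultimately have "is_ground_field R a.cmpl (carrier a.cmpl)"
    by (intro ground_fieldI[OF fld a.cmpl.module ne a.cmpl.one_closed])
  then show ?thesis using compl_cCom[OF A'] by (simp add: cCom\<^sub>0_def level_compl)
qed

text \<open>In level 0 the augmentation ideal is zero, so the image of a coherent sequence vanishes
  there iff all its terms with positive index lie in the augmentation ideal. By coherence the term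
  with index 1 decides this.\<close>

lemma aug_ideal_compl:
  assumes A: "A \<in> cCom R"
  shows "aug_ideal (compl A) n = adic.B (level A n) (aug_ideal A n) 1"
proof (rule Set.set_eqI)
  fix x
  interpret f: adic_hom R "level A n" "aug_ideal A n" "level A 0" "aug_ideal A 0" "cmap A n 0 (collapse n)"
    by (rule adic_hom_cmap[OF A collapse_Delta])
  show "x \<in> aug_ideal (compl A) n \<longleftrightarrow> x \<in> f.M.B 1"
  proof (cases "x \<in> carrier f.M.cmpl")
    case True
    then obtain a where a: "f.M.coh a" "x = f.M.L a" using f.M.L_exists by blast
    note ac = f.M.cohD(1)[OF a(1)]
    let ?z = "\<lambda>k. cmap A n 0 (collapse n) (a k)"
    have "x \<in> aug_ideal (compl A) n \<longleftrightarrow> f.N.L ?z = f.N.L (\<lambda>_. \<zero>\<^bsub>level A 0\<^esub>)"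
      using True a by (simp add: mem_aug_ideal_iff level_compl cmap_compl f.completion_map_L f.N.L_zero)
    also have "\<dots> \<longleftrightarrow> (\<forall>k. ?z k \<in> f.N.P k)"
      using f.f_closed[OF ac] by (subst f.N.L_eq_iff) (auto simp: a_minus_def simp del: ideal_pow.simps)
    also have "\<dots> \<longleftrightarrow> a 1 \<in> aug_ideal A n"
    proof
      assume "\<forall>k. ?z k \<in> f.N.P k"
      then have "?z 1 \<in> f.N.P 1" by blast
      then have "?z 1 \<in> aug_ideal A 0" by (simp only: f.N.P_1)
      then have "?z 1 = \<zero>\<^bsub>level A 0\<^esub>" by (simp only: aug_ideal_0[OF A] singleton_iff)
      then show "a 1 \<in> aug_ideal A n" using ac[of 1] by (simp add: mem_aug_ideal_iff del: One_nat_def)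
    next
      assume a1: "a 1 \<in> aug_ideal A n"
      show "\<forall>k. ?z k \<in> f.N.P k"
      proof
        fix k
        show "?z k \<in> f.N.P k"
        proof (cases "k = 0")
          case True
          then show ?thesis using f.f_closed[OF ac] by simp
        next
          case False
          have "a k \<ominus>\<^bsub>level A n\<^esub> a 1 \<in> f.M.P 1" using False by (intro f.M.coh_le[OF a(1)]) simp
          moreover have "a 1 \<in> f.M.P 1" using a1 by (simp only: f.M.P_1)
          ultimately have "(a k \<ominus>\<^bsub>level A n\<^esub> a 1) \<oplus>\<^bsub>level A n\<^esub> a 1 \<in> f.M.P 1" by (rule f.M.P_add)
          then have "a k \<in> aug_ideal A n" using ac unfolding f.M.P_1 by (simp add: a_minus_def f.M.M.a_assoc f.M.M.l_neg)
          then have "?z k = \<zero>\<^bsub>level A 0\<^esub>" by (simp add: mem_aug_ideal_iff)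
          then show ?thesis using f.N.P_zero by (simp only:)
        qed
      qed
    qed
    also have "\<dots> \<longleftrightarrow> x \<in> f.M.B 1" unfolding a(2) f.M.L_B_iff[OF a(1)] f.M.P_1 ..
    finally show ?thesis .
  next
    case False
    then show ?thesis using f.M.B_carrier by (auto simp: mem_aug_ideal_iff level_compl)
  qed
qed

section \<open>Complete local Noetherian levels\<close>

lemma fin_gen_aug_ideals_fg:
  assumes fld: "field R" and A: "A \<in> cCom\<^sub>0_fg R"
  shows "fin_gen_aug_ideals A"
  unfolding fin_gen_aug_ideals_def
proof
  fix n
  let ?M = "level A n" and ?I = "aug_ideal A n"
  have A0: "A \<in> cCom\<^sub>0 R" and fg: "fin_gen_algebra R ?M" using A by (auto simp: cCom\<^sub>0_fg_def)
  note A' = cCom0D(1)[OF A0]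
  interpret a: adic R ?M ?I by (rule adic_level[OF A'])
  obtain S where S: "S \<subseteq> carrier ?M" "finite S" "generate_ring ?M (S \<union> (\<lambda>r. r \<odot>\<^bsub>?M\<^esub> \<one>\<^bsub>?M\<^esub>) ` carrier R) = carrier ?M"
    using fg by (auto simp: fin_gen_algebra_def)
  have "\<forall>s\<in>S. \<exists>r. r \<in> carrier R \<and> s \<ominus>\<^bsub>?M\<^esub> r \<odot>\<^bsub>?M\<^esub> \<one>\<^bsub>?M\<^esub> \<in> ?I" using aug_decomposition[OF A0] S(1) by blast
  then obtain \<epsilon> where \<epsilon>: "\<And>s. s \<in> S \<Longrightarrow> \<epsilon> s \<in> carrier R" "\<And>s. s \<in> S \<Longrightarrow> s \<ominus>\<^bsub>?M\<^esub> \<epsilon> s \<odot>\<^bsub>?M\<^esub> \<one>\<^bsub>?M\<^esub> \<in> ?I" by metis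
  show "\<exists>S\<subseteq>carrier ?M. finite S \<and> ?I = Idl\<^bsub>?M\<^esub> S"
    by (rule a.ideal_generated_by_shifts[OF S \<epsilon>]) (use scalar_aug_ideal[OF fld A0] in auto)
qed

lemma adic_fg_level:
  assumes A: "A \<in> cCom R" and fg: "fin_gen_aug_ideals A"
  shows "\<exists>S. adic_fg R (level A n) (aug_ideal A n) S"
proof -
  obtain S where "S \<subseteq> carrier (level A n)" "finite S" "aug_ideal A n = Idl\<^bsub>level A n\<^esub> S"
    using fg unfolding fin_gen_aug_ideals_def by blast
  then show ?thesis by (intro exI[of _ S] adic_fg.intro adic_fg_axioms.intro adic_level[OF A])
qed

lemma one_notin_aug_ideal:
  assumes fld: "field R" and A: "A \<in> cCom\<^sub>0 R"
  shows "\<one>\<^bsub>level A n\<^esub> \<notin> aug_ideal A n"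
proof
  interpret F: field R by (rule fld)
  interpret algebra R "level A n" by (rule cComD(1)[OF cCom0D(1)[OF A]])
  assume "\<one>\<^bsub>level A n\<^esub> \<in> aug_ideal A n"
  then have "\<one>\<^bsub>R\<^esub> \<odot>\<^bsub>level A n\<^esub> \<one>\<^bsub>level A n\<^esub> \<in> aug_ideal A n" by simp
  from scalar_aug_ideal[OF fld A F.one_closed this] show False by simp
qed

text \<open>The Noetherian property of the levels comes from \<open>complete_adic\<close>:
  completeness and finite generation of the augmentation ideal imply it.\<close>

lemma cAlg0I:
  assumes fld: "field R" and A: "A \<in> cCom\<^sub>0 R" and fg: "fin_gen_aug_ideals A"
    and bij: "\<And>n. bij_betw (to_completion (level A n) (aug_ideal A n)) (carrier (level A n))
      (carrier (adic_completion (level A n) (aug_ideal A n)))"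
  shows "A \<in> cAlg\<^sub>0 R"
proof -
  note A' = cCom0D(1)[OF A]
  have "complete_local_noetherian R (level A n) \<and> max_ideal (level A n) = aug_ideal A n" for n
  proof -
    obtain S where S: "adic_fg R (level A n) (aug_ideal A n) S" using adic_fg_level[OF A' fg] by blast
    interpret complete_adic R "level A n" "aug_ideal A n" S
      by (intro complete_adic.intro complete_adic_axioms.intro S fld bij aug_decomposition[OF A] one_notin_aug_ideal[OF fld A])
    show ?thesis using complete_local max_ideal_eq by blast
  qed
  then show ?thesis using A cmap_aug_ideal[OF A'] by (auto simp: cAlg\<^sub>0_def)
qed

text \<open>The augmentation ideal has quotient R, so it is maximal and hence the only maximal
  ideal; as the levels are Noetherian, it is finitely generated.\<close>

lemma cAlg0D:
  assumes fld: "field R" and A: "A \<in> cAlg\<^sub>0 R"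
  shows "A \<in> cCom\<^sub>0 R" and "max_ideal (level A n) = aug_ideal A n" and "fin_gen_aug_ideals A"
proof -
  show A0: "A \<in> cCom\<^sub>0 R" using A by (simp add: cAlg\<^sub>0_def)
  note A' = cCom0D(1)[OF A0]
  have cln: "complete_local_noetherian R (level A n)" for n using A by (simp add: cAlg\<^sub>0_def)
  show "max_ideal (level A n) = aug_ideal A n"
  proof -
    interpret F: field R by (rule fld)
    interpret algebra R "level A n" by (rule cComD(1)[OF A'])
    interpret I: ideal "aug_ideal A n" "level A n" by (rule aug_ideal_ideal[OF A'])
    have "maximalideal (aug_ideal A n) (level A n)"
    proof (rule maximalidealI[OF I.ideal_axioms])
      show "carrier (level A n) \<noteq> aug_ideal A n" using one_notin_aug_ideal[OF fld A0] one_closed by blast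
      fix J assume J: "ideal J (level A n)" "aug_ideal A n \<subseteq> J"
      interpret J: ideal J "level A n" by (rule J(1))
      show "J = aug_ideal A n \<or> J = carrier (level A n)"
      proof (cases "J \<subseteq> aug_ideal A n")
        case True
        then show ?thesis using J(2) by blast
      next
        case False
        then obtain x where x: "x \<in> J" "x \<notin> aug_ideal A n" by blast
        have xc: "x \<in> carrier (level A n)" using J.Icarr[OF x(1)] .
        obtain r where r: "r \<in> carrier R" "x \<ominus>\<^bsub>level A n\<^esub> r \<odot>\<^bsub>level A n\<^esub> \<one>\<^bsub>level A n\<^esub> \<in> aug_ideal A n"
          using aug_decomposition[OF A0 xc] by blast
        have r0: "r \<noteq> \<zero>\<^bsub>R\<^esub>" using r x(2) xc by (auto simp: a_minus_def)
        have s: "inv\<^bsub>R\<^esub> r \<in> carrier R" "inv\<^bsub>R\<^esub> r \<otimes>\<^bsub>R\<^esub> r = \<one>\<^bsub>R\<^esub>" using r(1) r0 F.field_Units by auto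
        have "x \<oplus>\<^bsub>level A n\<^esub> \<ominus>\<^bsub>level A n\<^esub> (x \<ominus>\<^bsub>level A n\<^esub> r \<odot>\<^bsub>level A n\<^esub> \<one>\<^bsub>level A n\<^esub>) \<in> J"
          using x(1) r(2) J(2) by (intro J.a_closed J.a_inv_closed) auto
        moreover have "x \<oplus>\<^bsub>level A n\<^esub> \<ominus>\<^bsub>level A n\<^esub> (x \<ominus>\<^bsub>level A n\<^esub> r \<odot>\<^bsub>level A n\<^esub> \<one>\<^bsub>level A n\<^esub>) = r \<odot>\<^bsub>level A n\<^esub> \<one>\<^bsub>level A n\<^esub>"
          using xc r(1) by (simp add: a_minus_def M.minus_add M.r_neg2)
        ultimately have "(inv\<^bsub>R\<^esub> r \<odot>\<^bsub>level A n\<^esub> \<one>\<^bsub>level A n\<^esub>) \<otimes>\<^bsub>level A n\<^esub> (r \<odot>\<^bsub>level A n\<^esub> \<one>\<^bsub>level A n\<^esub>) \<in> J"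
          using s(1) by (intro J.I_l_closed) auto
        then have "\<one>\<^bsub>level A n\<^esub> \<in> J"
          using s r(1) smult_assoc1[of "inv\<^bsub>R\<^esub> r" r "\<one>\<^bsub>level A n\<^esub>"] by (simp add: smult_assoc2)
        then show ?thesis using J.one_imp_carrier by blast
      qed
    qed
    moreover have "\<exists>!I. maximalideal I (level A n)" using cln by (simp add: complete_local_noetherian_def)
    ultimately show ?thesis unfolding max_ideal_def by (intro the1_equality)
  qed
  show "fin_gen_aug_ideals A"
    unfolding fin_gen_aug_ideals_def
  proof
    fix n
    have "noetherian_ring (level A n)" using cln by (simp add: complete_local_noetherian_def)
    then show "\<exists>S\<subseteq>carrier (level A n). finite S \<and> aug_ideal A n = Idl\<^bsub>level A n\<^esub> S"
      by (rule noetherian_ring.finetely_gen[OF _ aug_ideal_ideal[OF A']])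
  qed
qed

text \<open>Cosimplicial morphisms commute with the augmentations, and the maximal ideals are the
  augmentation ideals, so locality is automatic.\<close>

lemma local_ccom_hom_eq:
  assumes fld: "field R" and A: "A \<in> cAlg\<^sub>0 R" and B: "B \<in> cAlg\<^sub>0 R"
  shows "local_ccom_hom R A B = ccom_hom R A B"
  using ccom_hom_aug_ideal[OF cCom0D(1)[OF cAlg0D(1)[OF fld A]] cCom0D(1)[OF cAlg0D(1)[OF fld B]]]
  by (auto simp: local_ccom_hom_def cAlg0D(2)[OF fld A] cAlg0D(2)[OF fld B])

lemma ideal_pow_compl:
  assumes A: "A \<in> cCom R" and fg: "fin_gen_aug_ideals A"
  shows "ideal_pow (level (compl A) n) (aug_ideal (compl A) n) k = adic.B (level A n) (aug_ideal A n) k"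
proof -
  obtain S where "adic_fg R (level A n) (aug_ideal A n) S" using adic_fg_level[OF A fg] by blast
  then interpret adic_fg R "level A n" "aug_ideal A n" S .
  show ?thesis unfolding aug_ideal_compl[OF A] level_compl by (rule ideal_pow_B)
qed

text \<open>By finite generation the powers of the augmentation ideal of the completion are the
  ideals \<open>B\<close>, for which separatedness and completeness are built into the inverse
  limit.\<close>

lemma compl_cAlg0:
  assumes fld: "field R" and A: "A \<in> cCom\<^sub>0 R" and fg: "fin_gen_aug_ideals A"
  shows "compl A \<in> cAlg\<^sub>0 R"
proof (rule cAlg0I[OF fld compl_cCom0[OF fld A]])
  note A' = cCom0D(1)[OF A]
  show "fin_gen_aug_ideals (compl A)"
    unfolding fin_gen_aug_ideals_def
  proof
    fix n
    obtain S where "adic_fg R (level A n) (aug_ideal A n) S" using adic_fg_level[OF A' fg] by blast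
    then interpret adic_fg R "level A n" "aug_ideal A n" S .
    have "aug_ideal (compl A) n = Idl\<^bsub>level (compl A) n\<^esub> (hat ` S)"
      unfolding aug_ideal_compl[OF A'] level_compl by (rule B_1_generated)
    moreover have "hat ` S \<subseteq> carrier (level (compl A) n)" using B_carrier[OF hat_B] by (auto simp: level_compl)
    ultimately show "\<exists>S\<subseteq>carrier (level (compl A) n). finite S \<and> aug_ideal (compl A) n = Idl\<^bsub>level (compl A) n\<^esub> S"
      using S(1) by blast
  qed
  fix n
  interpret a: adic R "level A n" "aug_ideal A n" by (rule adic_level[OF A'])
  interpret c: adic R "level (compl A) n" "aug_ideal (compl A) n" by (rule adic_level[OF compl_cCom[OF A']])
  have P: "c.P k = a.B k" for k by (rule ideal_pow_compl[OF A' fg])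
  show "bij_betw (to_completion (level (compl A) n) (aug_ideal (compl A) n)) (carrier (level (compl A) n)) (carrier c.cmpl)"
  proof (rule c.to_completion_bij)
    fix x assume x: "x \<in> carrier (level (compl A) n)" "\<And>k. x \<in> c.P k"
    show "x = \<zero>\<^bsub>level (compl A) n\<^esub>" using a.B_separated[of x] x(1) x(2)[unfolded P] by (simp add: level_compl)
  next
    fix X assume X: "c.coh X"
    have "X k \<in> carrier a.cmpl" for k using c.cohD(1)[OF X] by (simp only: level_compl)
    moreover have "X (Suc k) \<ominus>\<^bsub>a.cmpl\<^esub> X k \<in> a.B k" for k
      using c.cohD(2)[OF X, of k] unfolding P by (simp only: level_compl)
    ultimately show "\<exists>x\<in>carrier (level (compl A) n). \<forall>k. x \<ominus>\<^bsub>level (compl A) n\<^esub> X k \<in> c.P k"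
      unfolding P unfolding level_compl by (rule a.B_complete)
  qed
qed

text \<open>The augmentation ideal is nilpotent in each level, so coherent sequences are constant
  from index n + 2 on.\<close>

lemma K_alg_completion_bij:
  assumes fld: "field R" and C: "C \<in> cdgas\<^sub>0 R"
  shows "bij_betw (to_completion (level (K_alg C) n) (aug_ideal (K_alg C) n)) (carrier (level (K_alg C) n))
      (carrier (adic_completion (level (K_alg C) n) (aug_ideal (K_alg C) n)))"
proof -
  interpret a: adic R "level (K_alg C) n" "aug_ideal (K_alg C) n" by (rule adic_level[OF K_alg_cCom[OF cdgas0D(1)[OF C]]])
  have nil: "x = \<zero>\<^bsub>level (K_alg C) n\<^esub>" if "x \<in> a.P (n + 2)" for x
    using K_alg_nilpotent[OF fld C, of n] that by (auto simp: level_K_alg)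
  show ?thesis
  proof (rule a.to_completion_bij)
    fix x assume "\<And>k. x \<in> a.P k"
    then show "x = \<zero>\<^bsub>level (K_alg C) n\<^esub>" by (rule nil)
  next
    fix u assume u: "a.coh u"
    have "u (n + 2) \<ominus>\<^bsub>level (K_alg C) n\<^esub> u k \<in> a.P k" for k
    proof (cases "k \<le> n + 2")
      case True
      then show ?thesis by (rule a.coh_le[OF u])
    next
      case False
      then have "u k \<ominus>\<^bsub>level (K_alg C) n\<^esub> u (n + 2) = \<zero>\<^bsub>level (K_alg C) n\<^esub>"
        by (intro nil a.coh_le[OF u]) simp
      then have "u k = u (n + 2)" using a.cohD(1)[OF u] by simp
      then show ?thesis using a.coh_le[OF u, of k k] by simp
    qed
    then show "\<exists>x\<in>carrier (level (K_alg C) n). \<forall>k. x \<ominus>\<^bsub>level (K_alg C) n\<^esub> u k \<in> a.P k"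
      using a.cohD(1)[OF u] by blast
  qed
qed

lemma K_alg_cAlg0:
  assumes fld: "field R" and C: "C \<in> cdgas\<^sub>0_fg R"
  shows "K_alg C \<in> cAlg\<^sub>0 R"
proof -
  have C0: "C \<in> cdgas\<^sub>0 R" using C by (simp add: cdgas\<^sub>0_fg_def)
  show ?thesis
    by (rule cAlg0I[OF fld K_alg_cCom0[OF fld C0] fin_gen_aug_ideals_fg[OF fld K_alg_cCom0_fg[OF fld C]] K_alg_completion_bij[OF fld C0]])
qed

subsection \<open>Continuous morphisms out of the completion\<close>

text \<open>Since a morphism \<open>A \<rightarrow> K_alg C\<close> kills \<open>I\<^sup>n\<^sup>+\<^sup>2\<close> in level \<open>n\<close>, it can be evaluated at an element of the
  completion through any representative modulo \<open>I\<^sup>n\<^sup>+\<^sup>2\<close>.\<close>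

definition cont_ext :: "('r, 'a) cosimp \<Rightarrow> (nat \<Rightarrow> 'a \<Rightarrow> 'b) \<Rightarrow> nat \<Rightarrow> (nat \<Rightarrow> 'a set) \<Rightarrow> 'b"
  where "cont_ext A \<phi> = (\<lambda>n. \<lambda>x\<in>carrier (level (compl A) n). \<phi> n (SOME y. y \<in> x (n + 2)))"

context reduced_hom
begin

lemma eta_diff:
  assumes "x \<in> carrier (level A n)" "y \<in> carrier (level A n)"
    and "x \<ominus>\<^bsub>level A n\<^esub> y \<in> ideal_pow (level A n) (aug_ideal A n) (n + 2)"
  shows "\<eta> n x = \<eta> n y"
proof -
  interpret L: algebra R "level A n" by (rule cComD(1)[OF A'])
  interpret K: algebra R "K_level B n" by (rule K_algebra)
  have h: "\<eta> n \<in> alg_hom R (level A n) (K_level B n)" using ccom_homD(1)[OF \<eta>, of n] by (simp add: level_K_alg)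
  have "\<eta> n x \<ominus>\<^bsub>K_level B n\<^esub> \<eta> n y = \<zero>\<^bsub>K_level B n\<^esub>"
    using eta_nilpotent[OF assms(3)] alg_hom_minus[OF L.algebra_axioms K.algebra_axioms h assms(1,2)] by simp
  then show ?thesis using alg_homD(1)[OF h assms(1)] alg_homD(1)[OF h assms(2)] by (simp only: K.r_right_minus_eq)
qed

text \<open>The index k is left free because comparing two levels, or respecting the continuity
  bound of a morphism, calls for a later representative than the one at n + 2.\<close>

lemma cont_ext_L:
  assumes a: "adic.coh (level A n) (aug_ideal A n) a" and k: "k \<ge> n + 2"
  shows "cont_ext A \<eta> n (adic.L (level A n) (aug_ideal A n) a) = \<eta> n (a k)"
proof -
  interpret a: adic R "level A n" "aug_ideal A n" by (rule adic_level[OF A'])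
  note ac = a.cohD(1)[OF a]
  let ?y = "SOME y. y \<in> a.L a (n + 2)"
  have "a (n + 2) \<in> a.L a (n + 2)"
    unfolding a.L_def using a.mem_coset[OF ac] ac a.coh_le[OF a, of "n + 2" "n + 2"] by blast
  then have "?y \<in> a.L a (n + 2)" by (rule someI)
  then have y: "?y \<in> carrier (level A n)" "?y \<ominus>\<^bsub>level A n\<^esub> a (n + 2) \<in> a.P (n + 2)"
    unfolding a.L_def using a.mem_coset[OF ac] by blast+
  have "\<eta> n ?y = \<eta> n (a (n + 2))" by (rule eta_diff[OF y(1) ac y(2)])
  also have "\<dots> = \<eta> n (a k)" by (rule eta_diff[OF ac ac a.coh_le[OF a k], symmetric])
  finally show ?thesis using a.L_carrier[OF a] by (simp add: cont_ext_def level_compl)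
qed

lemma cont_ext_to_compl: "ccom_comp A (cont_ext A \<eta>) (to_compl A) = \<eta>"
proof -
  have "ccom_comp A (cont_ext A \<eta>) (to_compl A) n x = \<eta> n x" for n x
  proof (cases "x \<in> carrier (level A n)")
    case True
    interpret a: adic R "level A n" "aug_ideal A n" by (rule adic_level[OF A'])
    show ?thesis using True cont_ext_L[OF a.coh_const[OF True] order_refl]
      by (simp add: ccom_comp_apply to_compl_def a.to_completion_eq)
  next
    case False
    then show ?thesis using extensional_arb[OF ccom_homD(2)[OF \<eta>]] by (simp add: ccom_comp_def compose_def)
  qed
  then show ?thesis by (rule ext[OF ext])
qed

lemma cont_ext_hom: "cont_ext A \<eta> \<in> cont_hom R A (K_alg B)"
proof -
  have h: "\<eta> n \<in> alg_hom R (level A n) (K_level B n)" for n using ccom_homD(1)[OF \<eta>, of n] by (simp add: level_K_alg)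
  have 1: "cont_ext A \<eta> n \<in> alg_hom R (level (compl A) n) (K_level B n)" for n
  proof -
    interpret a: adic R "level A n" "aug_ideal A n" by (rule adic_level[OF A'])
    note [simp] = a.L_mult a.L_add a.L_smult a.coh_mult a.coh_add a.coh_smult a.L_carrier
      cont_ext_L[OF _ order_refl] alg_homD[OF h]
    have "cont_ext A \<eta> n \<in> ring_hom a.cmpl (K_level B n)"
    proof (rule ring_hom_memI)
      show "cont_ext A \<eta> n z \<in> carrier (K_level B n)" if "z \<in> carrier a.cmpl" for z
        using a.L_exists[OF that] by (elim exE conjE) simp
      show "cont_ext A \<eta> n (z \<otimes>\<^bsub>a.cmpl\<^esub> w) = cont_ext A \<eta> n z \<otimes>\<^bsub>K_level B n\<^esub> cont_ext A \<eta> n w"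
        if "z \<in> carrier a.cmpl" "w \<in> carrier a.cmpl" for z w
        using a.L_exists[OF that(1)] a.L_exists[OF that(2)] by (elim exE conjE) simp
      show "cont_ext A \<eta> n (z \<oplus>\<^bsub>a.cmpl\<^esub> w) = cont_ext A \<eta> n z \<oplus>\<^bsub>K_level B n\<^esub> cont_ext A \<eta> n w"
        if "z \<in> carrier a.cmpl" "w \<in> carrier a.cmpl" for z w
        using a.L_exists[OF that(1)] a.L_exists[OF that(2)] by (elim exE conjE) simp
      show "cont_ext A \<eta> n \<one>\<^bsub>a.cmpl\<^esub> = \<one>\<^bsub>K_level B n\<^esub>"
        by (simp add: a.L_one a.coh_const del: K_level_simps)
    qed
    moreover have "cont_ext A \<eta> n (r \<odot>\<^bsub>a.cmpl\<^esub> z) = r \<odot>\<^bsub>K_level B n\<^esub> cont_ext A \<eta> n z"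
      if "r \<in> carrier R" "z \<in> carrier a.cmpl" for r z
      using a.L_exists[OF that(2)] that(1) by (elim exE conjE) simp
    ultimately show ?thesis by (simp add: alg_hom_def level_compl)
  qed
  have 2: "cont_ext A \<eta> n (cmap (compl A) m n \<alpha> x) = cmap (K_alg B) m n \<alpha> (cont_ext A \<eta> m x)"
    if \<alpha>: "\<alpha> \<in> Delta m n" and x: "x \<in> carrier (level (compl A) m)" for m n \<alpha> x
  proof -
    interpret f: adic_hom R "level A m" "aug_ideal A m" "level A n" "aug_ideal A n" "cmap A m n \<alpha>" by (rule adic_hom_cmap[OF A' \<alpha>])
    obtain a where a: "f.M.coh a" "x = f.M.L a" using f.M.L_exists x by (auto simp: level_compl)
    \<comment> \<open>An index that is late enough both for level m and for level n.\<close>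
    let ?k = "m + n + 2"
    have "cont_ext A \<eta> n (cmap (compl A) m n \<alpha> x) = \<eta> n (cmap A m n \<alpha> (a ?k))"
      unfolding a(2) cmap_compl f.completion_map_L[OF a(1)] by (rule cont_ext_L[OF f.f_coh[OF a(1)]]) simp
    also have "\<dots> = cmap (K_alg B) m n \<alpha> (\<eta> m (a ?k))" by (rule ccom_homD(3)[OF \<eta> \<alpha> f.M.cohD(1)[OF a(1)]])
    also have "\<eta> m (a ?k) = cont_ext A \<eta> m x" unfolding a(2) by (rule cont_ext_L[OF a(1), symmetric]) simp
    finally show ?thesis .
  qed
  have 3: "\<exists>k. \<forall>x\<in>carrier (level (compl A) n). x k = \<zero>\<^bsub>level A n Quot ideal_pow (level A n) (aug_ideal A n) k\<^esub> \<longrightarrow>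
      cont_ext A \<eta> n x = \<zero>\<^bsub>level (K_alg B) n\<^esub>" for n
  proof (intro exI ballI impI)
    interpret a: adic R "level A n" "aug_ideal A n" by (rule adic_level[OF A'])
    fix x assume x: "x \<in> carrier (level (compl A) n)" "x (n + 2) = \<zero>\<^bsub>level A n Quot a.P (n + 2)\<^esub>"
    then have xB: "x \<in> a.B (n + 2)" by (simp only: a.B_def level_compl FactRing_def ring.simps mem_Collect_eq simp_thms)
    obtain a where a: "a.coh a" "x = a.L a" using a.L_exists x(1) by (auto simp: level_compl)
    have "a (n + 2) \<in> a.P (n + 2)" using xB a by (simp only: a.L_B_iff)
    then show "cont_ext A \<eta> n x = \<zero>\<^bsub>level (K_alg B) n\<^esub>"
      unfolding a(2) cont_ext_L[OF a(1) order_refl] level_K_alg by (rule eta_nilpotent)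
  qed
  have 4: "cont_ext A \<eta> n \<in> extensional (carrier (level (compl A) n))" for n by (simp add: cont_ext_def)
  show ?thesis unfolding cont_hom_def ccom_hom_def mem_Collect_eq
    using 1 2 3 4 by (simp only: level_K_alg Int_iff simp_thms) blast
qed

end

lemma reduced_homI:
  assumes "field R" "A \<in> cCom\<^sub>0 R" "C \<in> cdgas R" "\<phi> \<in> ccom_hom R A (K_alg C)"
  shows "reduced_hom R C A \<phi>"
  using assms by (intro reduced_hom.intro reduced_hom_axioms.intro cdga.intro)

lemma cont_homD:
  assumes A: "A \<in> cCom R" and \<psi>: "\<psi> \<in> cont_hom R A B"
  shows "\<psi> \<in> ccom_hom R (compl A) B"
    and "\<exists>k. \<forall>x\<in>adic.B (level A n) (aug_ideal A n) k. \<psi> n x = \<zero>\<^bsub>level B n\<^esub>"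
proof -
  interpret a: adic R "level A n" "aug_ideal A n" by (rule adic_level[OF A])
  show "\<psi> \<in> ccom_hom R (compl A) B" using \<psi> by (simp add: cont_hom_def)
  obtain k where "\<forall>x\<in>carrier (level (compl A) n). x k = \<zero>\<^bsub>level A n Quot a.P k\<^esub> \<longrightarrow> \<psi> n x = \<zero>\<^bsub>level B n\<^esub>"
    using \<psi> unfolding cont_hom_def by blast
  then show "\<exists>k. \<forall>x\<in>a.B k. \<psi> n x = \<zero>\<^bsub>level B n\<^esub>"
    by (intro exI[of _ k]) (simp add: a.B_def level_compl FactRing_def del: ideal_pow.simps)
qed

text \<open>A continuous morphism is determined by its values on the image of A: an element of the
  completion and the image of a late term of its sequence differ by an element of some
  \<open>B k\<close> that the morphism kills.\<close>

lemma cont_ext_unique: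
  assumes fld: "field R" and A: "A \<in> cCom\<^sub>0 R" and C: "C \<in> cdgas R" and \<psi>: "\<psi> \<in> cont_hom R A (K_alg C)"
  shows "cont_ext A (ccom_comp A \<psi> (to_compl A)) = \<psi>"
proof -
  note A' = cCom0D(1)[OF A]
  note \<psi>h = cont_homD(1)[OF A' \<psi>]
  let ?\<phi> = "ccom_comp A \<psi> (to_compl A)"
  have \<phi>: "?\<phi> \<in> ccom_hom R A (K_alg C)" by (rule ccom_comp_hom[OF A' to_compl_hom[OF A'] \<psi>h])
  interpret reduced_hom R C A ?\<phi> by (rule reduced_homI[OF fld A C \<phi>])
  show ?thesis
  proof (rule ccom_hom_eqI[OF cont_homD(1)[OF A' cont_ext_hom] \<psi>h])
    fix n x assume x: "x \<in> carrier (level (compl A) n)"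
    interpret a: adic R "level A n" "aug_ideal A n" by (rule adic_level[OF A'])
    interpret K: algebra R "K_level C n" by (rule K_algebra)
    obtain a where a: "a.coh a" "x = a.L a" using a.L_exists x by (auto simp: level_compl)
    obtain k where k: "\<And>y. y \<in> a.B k \<Longrightarrow> \<psi> n y = \<zero>\<^bsub>K_level C n\<^esub>"
      using cont_homD(2)[OF A' \<psi>, of n] by (auto simp: level_K_alg)
    \<comment> \<open>Late enough for the continuity bound k and for the bound n + 2 of
      \<open>cont_ext\<close>.\<close>
    let ?j = "k + n + 2"
    note ac = a.cohD(1)[OF a(1)]
    have h: "\<psi> n \<in> alg_hom R a.cmpl (K_level C n)" using ccom_homD(1)[OF \<psi>h, of n] by (simp add: level_K_alg level_compl)
    have xc: "a.L a \<in> carrier a.cmpl" "a.L (\<lambda>_. a ?j) \<in> carrier a.cmpl" using a.L_carrier[OF a(1)] a.L_carrier[OF a.coh_const[OF ac]] .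
    have "a ?j \<ominus>\<^bsub>level A n\<^esub> a k \<in> a.P k" by (rule a.coh_le[OF a(1)]) simp
    then have "a.L (\<lambda>_. a ?j) \<ominus>\<^bsub>a.cmpl\<^esub> a.L a \<in> a.B k" by (simp only: a.diff_B_iff[OF a.coh_const[OF ac] a(1)])
    then have "\<psi> n (a.L (\<lambda>_. a ?j)) \<ominus>\<^bsub>K_level C n\<^esub> \<psi> n (a.L a) = \<zero>\<^bsub>K_level C n\<^esub>"
      using k alg_hom_minus[OF a.cmpl_algebra K.algebra_axioms h xc(2,1)] by simp
    then have "\<psi> n (a.L (\<lambda>_. a ?j)) = \<psi> n (a.L a)"
      using alg_homD(1)[OF h xc(1)] alg_homD(1)[OF h xc(2)] by (simp only: K.r_right_minus_eq)
    moreover have "?\<phi> n (a ?j) = \<psi> n (a.L (\<lambda>_. a ?j))"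
      using ac by (simp add: ccom_comp_apply to_compl_def a.to_completion_eq)
    moreover have "cont_ext A ?\<phi> n x = ?\<phi> n (a ?j)" unfolding a(2) by (rule cont_ext_L[OF a(1)]) simp
    ultimately show "cont_ext A ?\<phi> n x = \<psi> n x" using a(2) by simp
  qed
qed

lemma cont_ext_bij:
  assumes fld: "field R" and A: "A \<in> cCom\<^sub>0 R" and C: "C \<in> cdgas R"
  shows "bij_betw (cont_ext A) (ccom_hom R A (K_alg C)) (cont_hom R A (K_alg C))"
proof (rule bij_betw_byWitness[where f' = "\<lambda>\<psi>. ccom_comp A \<psi> (to_compl A)"])
  note A' = cCom0D(1)[OF A]
  note r = reduced_homI[OF fld A C]
  show "\<forall>\<phi>\<in>ccom_hom R A (K_alg C). ccom_comp A (cont_ext A \<phi>) (to_compl A) = \<phi>"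
    using reduced_hom.cont_ext_to_compl[OF r] by blast
  show "\<forall>\<psi>\<in>cont_hom R A (K_alg C). cont_ext A (ccom_comp A \<psi> (to_compl A)) = \<psi>"
    using cont_ext_unique[OF fld A C] by blast
  show "cont_ext A ` ccom_hom R A (K_alg C) \<subseteq> cont_hom R A (K_alg C)"
    using reduced_hom.cont_ext_hom[OF r] by blast
  show "(\<lambda>\<psi>. ccom_comp A \<psi> (to_compl A)) ` cont_hom R A (K_alg C) \<subseteq> ccom_hom R A (K_alg C)"
    using ccom_comp_hom[OF A' to_compl_hom[OF A'] cont_homD(1)[OF A']] by blast
qed

lemma K_map_cont_ext:
  assumes fld: "field R" and A: "A \<in> cCom\<^sub>0 R" and C: "C \<in> cdgas R" and C': "C' \<in> cdgas R"
    and \<phi>: "\<phi> \<in> ccom_hom R A (K_alg C)" and g: "g \<in> cdga_hom R C C'"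
  shows "ccom_comp (compl A) (K_map C g) (cont_ext A \<phi>) = cont_ext A (ccom_comp A (K_map C g) \<phi>)"
proof -
  note A' = cCom0D(1)[OF A]
  have h: "ccom_comp A (K_map C g) \<phi> \<in> ccom_hom R A (K_alg C')" by (rule ccom_comp_hom[OF A' \<phi> K_map_hom[OF C C' g]])
  interpret r: reduced_hom R C A \<phi> by (rule reduced_homI[OF fld A C \<phi>])
  interpret s: reduced_hom R C' A "ccom_comp A (K_map C g) \<phi>" by (rule reduced_homI[OF fld A C' h])
  show ?thesis
  proof (rule ccom_hom_eqI)
    show "ccom_comp (compl A) (K_map C g) (cont_ext A \<phi>) \<in> ccom_hom R (compl A) (K_alg C')"
      by (rule ccom_comp_hom[OF compl_cCom[OF A'] cont_homD(1)[OF A' r.cont_ext_hom] K_map_hom[OF C C' g]])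
    show "cont_ext A (ccom_comp A (K_map C g) \<phi>) \<in> ccom_hom R (compl A) (K_alg C')"
      by (rule cont_homD(1)[OF A' s.cont_ext_hom])
    fix n x assume x: "x \<in> carrier (level (compl A) n)"
    interpret a: adic R "level A n" "aug_ideal A n" by (rule adic_level[OF A'])
    obtain a where a: "a.coh a" "x = a.L a" using a.L_exists x by (auto simp: level_compl)
    show "ccom_comp (compl A) (K_map C g) (cont_ext A \<phi>) n x = cont_ext A (ccom_comp A (K_map C g) \<phi>) n x"
      using x a.cohD(1)[OF a(1)] unfolding a(2)
      by (simp add: ccom_comp_apply r.cont_ext_L[OF a(1) order_refl] s.cont_ext_L[OF a(1) order_refl])
  qed
qed

text \<open>Automatic continuity: in level n a morphism into \<open>K_alg C\<close> kills the power
  n + 2 of the augmentation ideal of the completion, and finite generation identifies this power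
  with the kernel to the corresponding quotient of A.\<close>

lemma ccom_hom_compl_cont:
  assumes fld: "field R" and A: "A \<in> cCom\<^sub>0 R" and fg: "fin_gen_aug_ideals A" and C: "C \<in> cdgas R"
    and \<psi>: "\<psi> \<in> ccom_hom R (compl A) (K_alg C)"
  shows "\<psi> \<in> cont_hom R A (K_alg C)"
proof -
  note cA = cCom0D(1)[OF A]
  interpret reduced_hom R C "compl A" \<psi> by (rule reduced_homI[OF fld compl_cCom0[OF fld A] C \<psi>])
  have "\<psi> n x = \<zero>\<^bsub>level (K_alg C) n\<^esub>"
    if x: "x \<in> carrier (level (compl A) n)" "x (n + 2) = \<zero>\<^bsub>level A n Quot ideal_pow (level A n) (aug_ideal A n) (n + 2)\<^esub>" for n x
  proof -
    interpret a: adic R "level A n" "aug_ideal A n" by (rule adic_level[OF cA])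
    have "x \<in> a.B (n + 2)" using x by (simp only: a.B_def level_compl FactRing_def ring.simps mem_Collect_eq simp_thms)
    then show ?thesis unfolding level_K_alg by (intro eta_nilpotent) (simp only: ideal_pow_compl[OF cA fg])
  qed
  then show ?thesis using \<psi> unfolding cont_hom_def by blast
qed

text \<open>The inverse is the adjoint of the continuous extension of the unit of A, and both
  composites are compared with identities on adjuncts. On the side of the completion its unit must
  be recovered from the restriction to A, and for this it has to be continuous.\<close>

lemma D_map_to_compl_iso:
  assumes fld: "field R" and A: "A \<in> cCom\<^sub>0 R" and fg: "fin_gen_aug_ideals A"
  shows "D_map R A (compl A) (to_compl A) \<in> cdga_iso R (D_star R A) (D_star R (compl A))"
proof -
  note A' = cCom0D(1)[OF A]
  note cA = compl_cCom[OF A']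
  let ?D = "D_star R A" and ?D' = "D_star R (compl A)" and ?t = "D_map R A (compl A) (to_compl A)"
  note D = D_star_cdgas[OF A'] and D' = D_star_cdgas[OF cA]
  note t = D_map_char[OF A' cA to_compl_hom[OF A']]
  interpret r: reduced_hom R ?D A "D_unit R A" by (rule reduced_homI[OF fld A D D_unit_hom[OF A']])
  have "cont_ext A (D_unit R A) \<in> ccom_hom R (compl A) (K_alg ?D)" by (rule cont_homD(1)[OF A' r.cont_ext_hom])
  then have "cont_ext A (D_unit R A) \<in> adjunct R (compl A) ` cdga_hom R ?D' ?D"
    by (simp only: bij_betw_imp_surj_on[OF adjunct_bij[OF cA D]])
  then obtain g where g': "cont_ext A (D_unit R A) = adjunct R (compl A) g" "g \<in> cdga_hom R ?D' ?D" by (rule imageE)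
  note g = g'(2) g'(1)[symmetric]
  have "cdga_comp ?D g ?t = cdga_id ?D"
  proof (rule adjunct_inj[OF A' D cdga_comp_hom[OF D t(1) g(1)] cdga_id_hom[OF D]])
    show "adjunct R A (cdga_comp ?D g ?t) = adjunct R A (cdga_id ?D)"
      unfolding adjunct_comp_left[OF A' cA to_compl_hom[OF A']] g(2) r.cont_ext_to_compl adjunct_id[OF A'] ..
  qed
  moreover have "cdga_comp ?D' ?t g = cdga_id ?D'"
  proof (rule adjunct_inj[OF cA D' cdga_comp_hom[OF D' g(1) t(1)] cdga_id_hom[OF D']])
    have "adjunct R (compl A) (cdga_comp ?D' ?t g) = ccom_comp (compl A) (K_map ?D ?t) (cont_ext A (D_unit R A))"
      unfolding adjunct_comp_right[OF cA D g(1)] g(2) ..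
    also have "\<dots> = cont_ext A (ccom_comp A (K_map ?D ?t) (D_unit R A))"
      by (rule K_map_cont_ext[OF fld A D D' D_unit_hom[OF A'] t(1)])
    also have "\<dots> = cont_ext A (ccom_comp A (D_unit R (compl A)) (to_compl A))" using t(2) by (simp add: adjunct_def)
    also have "\<dots> = D_unit R (compl A)"
      by (rule cont_ext_unique[OF fld A D' ccom_hom_compl_cont[OF fld A fg D' D_unit_hom[OF cA]]])
    also have "\<dots> = adjunct R (compl A) (cdga_id ?D')" by (rule adjunct_id[OF cA, symmetric])
    finally show "adjunct R (compl A) (cdga_comp ?D' ?t g) = adjunct R (compl A) (cdga_id ?D')" .
  qed
  ultimately have gt: "g (?t x) = x" if "x \<in> carrier ?D" for x
    using that by (auto simp: cdga_comp_def cdga_id_def compose_def dest: fun_cong[of _ _ x])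
  have tg: "?t (g x) = x" if "x \<in> carrier ?D'" for x
    using fun_cong[OF \<open>cdga_comp ?D' ?t g = cdga_id ?D'\<close>, of x] that by (simp add: cdga_comp_def cdga_id_def compose_def)
  have "bij_betw ?t (carrier ?D) (carrier ?D')"
    using gt tg alg_homD(1)[OF cdga_homD(1)[OF t(1)]] alg_homD(1)[OF cdga_homD(1)[OF g(1)]]
    by (intro bij_betw_byWitness[where f' = g]) auto
  then show ?thesis using t(1) by (simp add: cdga_iso_def)
qed

text \<open>Here continuity is demanded of the morphisms out of the completion, which takes the
  place of the finiteness condition in \<open>D_map_to_compl_iso\<close>.\<close>

lemma cont_hom_represented:
  assumes fld: "field R" and A: "A \<in> cCom\<^sub>0 R" and C: "C \<in> cdgas R"
  shows "bij_betw (\<lambda>g. ccom_comp (compl A) (K_map (D_star R A) g) (cont_ext A (D_unit R A)))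
    (cdga_hom R (D_star R A) C) (cont_hom R A (K_alg C))"
proof -
  note A' = cCom0D(1)[OF A]
  have "bij_betw (cont_ext A \<circ> adjunct R A) (cdga_hom R (D_star R A) C) (cont_hom R A (K_alg C))"
    by (rule bij_betw_trans[OF adjunct_bij[OF A' C] cont_ext_bij[OF fld A C]])
  moreover have "ccom_comp (compl A) (K_map (D_star R A) g) (cont_ext A (D_unit R A)) = (cont_ext A \<circ> adjunct R A) g"
    if "g \<in> cdga_hom R (D_star R A) C" for g
    using K_map_cont_ext[OF fld A D_star_cdgas[OF A'] C D_unit_hom[OF A'] that] by (simp add: adjunct_def)
  ultimately show ?thesis by (subst bij_betw_cong) auto
qed

lemma cCom0_fgD: "A \<in> cCom\<^sub>0_fg R \<Longrightarrow> A \<in> cCom\<^sub>0 R"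
  by (simp add: cCom\<^sub>0_fg_def)

lemma cdgas0_fgD: "C \<in> cdgas\<^sub>0_fg R \<Longrightarrow> C \<in> cdgas\<^sub>0 R"
  by (simp add: cdgas\<^sub>0_fg_def)

theorem proposition3p12:
  fixes R :: "'r ring"
  assumes "field R"
    and char_zero: "\<forall>n::nat. n > 0 \<longrightarrow> [n] \<cdot>\<^bsub>R\<^esub> \<one>\<^bsub>R\<^esub> \<noteq> \<zero>\<^bsub>R\<^esub>"
  shows
    \<comment> \<open>\<open>K_alg\<close> is a functor from cdgas to cosimplicial commutative algebras\<close>
    "(\<forall>C\<in>(cdgas R :: ('r, 'c) dga set).
        K_alg C \<in> cCom R \<and> K_map C (cdga_id C) = ccom_id (K_alg C)) \<and>
     (\<forall>C\<in>(cdgas R :: ('r, 'c) dga set). \<forall>C'\<in>(cdgas R :: ('r, 'd) dga set).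
        \<forall>g\<in>cdga_hom R C C'. K_map C g \<in> ccom_hom R (K_alg C) (K_alg C')) \<and>
     (\<forall>C\<in>(cdgas R :: ('r, 'c) dga set). \<forall>C'\<in>(cdgas R :: ('r, 'd) dga set).
        \<forall>C''\<in>(cdgas R :: ('r, 'f) dga set). \<forall>g\<in>cdga_hom R C C'. \<forall>h\<in>cdga_hom R C' C''.
        K_map C (cdga_comp C h g) = ccom_comp (K_alg C) (K_map C' h) (K_map C g)) \<and>
    \<comment> \<open>\<open>D_star\<close> is a functor in the opposite direction\<close>
     (\<forall>A\<in>(cCom R :: ('r, 'a) cosimp set).
        D_star R A \<in> cdgas R \<and> D_unit R A \<in> ccom_hom R A (K_alg (D_star R A)) \<and>
        D_map R A A (ccom_id A) = cdga_id (D_star R A)) \<and>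
     (\<forall>A\<in>(cCom R :: ('r, 'a) cosimp set). \<forall>B\<in>(cCom R :: ('r, 'b) cosimp set).
        \<forall>\<phi>\<in>ccom_hom R A B. D_map R A B \<phi> \<in> cdga_hom R (D_star R A) (D_star R B)) \<and>
     (\<forall>A\<in>(cCom R :: ('r, 'a) cosimp set). \<forall>B\<in>(cCom R :: ('r, 'b) cosimp set).
        \<forall>E\<in>(cCom R :: ('r, 'e) cosimp set). \<forall>\<phi>\<in>ccom_hom R A B. \<forall>\<psi>\<in>ccom_hom R B E.
        D_map R A E (ccom_comp A \<psi> \<phi>) = cdga_comp (D_star R A) (D_map R B E \<psi>) (D_map R A B \<phi>)) \<and>
    \<comment> \<open>they are adjoint: a bijection of hom-sets, natural in both variables\<close>
     (\<forall>A\<in>(cCom R :: ('r, 'a) cosimp set). \<forall>C\<in>(cdgas R :: ('r, 'c) dga set).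
        bij_betw (adjunct R A) (cdga_hom R (D_star R A) C) (ccom_hom R A (K_alg C))) \<and>
     (\<forall>A\<in>(cCom R :: ('r, 'a) cosimp set). \<forall>B\<in>(cCom R :: ('r, 'b) cosimp set).
        \<forall>C\<in>(cdgas R :: ('r, 'c) dga set). \<forall>\<phi>\<in>ccom_hom R A B. \<forall>g\<in>cdga_hom R (D_star R B) C.
        adjunct R A (cdga_comp (D_star R A) g (D_map R A B \<phi>)) = ccom_comp A (adjunct R B g) \<phi>) \<and>
     (\<forall>A\<in>(cCom R :: ('r, 'a) cosimp set). \<forall>C\<in>(cdgas R :: ('r, 'c) dga set).
        \<forall>C'\<in>(cdgas R :: ('r, 'd) dga set). \<forall>g\<in>cdga_hom R (D_star R A) C. \<forall>h\<in>cdga_hom R C C'.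
        adjunct R A (cdga_comp (D_star R A) h g) = ccom_comp A (K_map C h) (adjunct R A g)) \<and>
    \<comment> \<open>(1): the adjunction restricts to the full subcategories of finitely generated reduced objects\<close>
     (\<forall>A\<in>(cCom\<^sub>0_fg R :: ('r, 'a) cosimp set). D_star R A \<in> cdgas\<^sub>0_fg R) \<and>
     (\<forall>C\<in>(cdgas\<^sub>0_fg R :: ('r, 'c) dga set). K_alg C \<in> cCom\<^sub>0_fg R) \<and>
     (\<forall>A\<in>(cCom\<^sub>0_fg R :: ('r, 'a) cosimp set). \<forall>C\<in>(cdgas\<^sub>0_fg R :: ('r, 'c) dga set).
        bij_betw (adjunct R A) (cdga_hom R (D_star R A) C) (ccom_hom R A (K_alg C))) \<and>
    \<comment> \<open>(2), the comparison of \<open>D_star\<close> on \<open>A\<close> and on its completion, which are reduced\<close>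
     (\<forall>A\<in>(cCom\<^sub>0 R :: ('r, 'a) cosimp set).
        compl A \<in> cCom\<^sub>0 R \<and> to_compl A \<in> ccom_hom R A (compl A) \<and>
        D_star R A \<in> cdgas\<^sub>0 R \<and> D_star R (compl A) \<in> cdgas\<^sub>0 R \<and>
        D_map R A (compl A) (to_compl A) \<in> cdga_hom R (D_star R A) (D_star R (compl A))) \<and>
     (\<forall>A\<in>(cCom\<^sub>0 R :: ('r, 'a) cosimp set). \<forall>B\<in>(cCom\<^sub>0 R :: ('r, 'b) cosimp set).
        \<forall>\<phi>\<in>ccom_hom R A B. compl_map A B \<phi> \<in> ccom_hom R (compl A) (compl B) \<and>
          cdga_comp (D_star R A) (D_map R (compl A) (compl B) (compl_map A B \<phi>))
              (D_map R A (compl A) (to_compl A)) =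
            cdga_comp (D_star R A) (D_map R B (compl B) (to_compl B)) (D_map R A B \<phi>)) \<and>
     (\<forall>A\<in>(cCom\<^sub>0 R :: ('r, 'a) cosimp set). fin_gen_aug_ideals A \<longrightarrow>
        D_map R A (compl A) (to_compl A) \<in> cdga_iso R (D_star R A) (D_star R (compl A))) \<and>
    \<comment> \<open>for all of \<open>cCom\<^sub>0\<close>, \<open>D_star R A\<close> is the value of the left adjoint at the topological completion\<close>
     (\<forall>A\<in>(cCom\<^sub>0 R :: ('r, 'a) cosimp set).
        \<exists>\<eta>\<in>cont_hom R A (K_alg (D_star R A)). ccom_comp A \<eta> (to_compl A) = D_unit R A \<and>
          (\<forall>C\<in>(cdgas R :: ('r, 'c) dga set).
             bij_betw (\<lambda>g. ccom_comp (compl A) (K_map (D_star R A) g) \<eta>)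
               (cdga_hom R (D_star R A) C) (cont_hom R A (K_alg C)))) \<and>
    \<comment> \<open>(2), the completion functor\<close>
     (\<forall>A\<in>(cCom\<^sub>0_fg R :: ('r, 'a) cosimp set).
        fin_gen_aug_ideals A \<and> compl A \<in> cAlg\<^sub>0 R \<and>
        compl_map A A (ccom_id A) = ccom_id (compl A)) \<and>
     (\<forall>A\<in>(cCom\<^sub>0_fg R :: ('r, 'a) cosimp set). \<forall>B\<in>(cCom\<^sub>0_fg R :: ('r, 'b) cosimp set).
        \<forall>\<phi>\<in>ccom_hom R A B. compl_map A B \<phi> \<in> local_ccom_hom R (compl A) (compl B)) \<and>
     (\<forall>A\<in>(cCom\<^sub>0_fg R :: ('r, 'a) cosimp set). \<forall>B\<in>(cCom\<^sub>0_fg R :: ('r, 'b) cosimp set).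
        \<forall>E\<in>(cCom\<^sub>0_fg R :: ('r, 'e) cosimp set). \<forall>\<phi>\<in>ccom_hom R A B. \<forall>\<psi>\<in>ccom_hom R B E.
        compl_map A E (ccom_comp A \<psi> \<phi>) =
          ccom_comp (compl A) (compl_map B E \<psi>) (compl_map A B \<phi>)) \<and>
    \<comment> \<open>(2), the adjunction on complete local Noetherian algebras\<close>
     (\<forall>A\<in>(cAlg\<^sub>0 R :: ('r, 'a) cosimp set). D_star R A \<in> cdgas\<^sub>0_fg R) \<and>
     (\<forall>C\<in>(cdgas\<^sub>0_fg R :: ('r, 'c) dga set). K_alg C \<in> cAlg\<^sub>0 R) \<and>
     (\<forall>C\<in>(cdgas\<^sub>0_fg R :: ('r, 'c) dga set). \<forall>C'\<in>(cdgas\<^sub>0_fg R :: ('r, 'd) dga set).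
        \<forall>g\<in>cdga_hom R C C'. K_map C g \<in> local_ccom_hom R (K_alg C) (K_alg C')) \<and>
     (\<forall>A\<in>(cAlg\<^sub>0 R :: ('r, 'a) cosimp set). \<forall>C\<in>(cdgas\<^sub>0_fg R :: ('r, 'c) dga set).
        bij_betw (adjunct R A) (cdga_hom R (D_star R A) C) (local_ccom_hom R A (K_alg C))) \<and>
    \<comment> \<open>(2), this adjunction extends the one in (1) along the completion functor\<close>
     (\<forall>C\<in>(cdgas\<^sub>0_fg R :: ('r, 'c) dga set).
        to_compl (K_alg C) \<in> local_ccom_hom R (K_alg C) (compl (K_alg C)) \<and>
        (\<forall>n. bij_betw (to_compl (K_alg C) n) (carrier (level (K_alg C) n))
               (carrier (level (compl (K_alg C)) n)))) \<and>
     (\<forall>A\<in>(cCom\<^sub>0_fg R :: ('r, 'a) cosimp set). \<forall>C\<in>(cdgas\<^sub>0_fg R :: ('r, 'c) dga set).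
        \<forall>g\<in>cdga_hom R (D_star R (compl A)) C.
        adjunct R A (cdga_comp (D_star R A) g (D_map R A (compl A) (to_compl A))) =
          ccom_comp A (adjunct R (compl A) g) (to_compl A))"
proof (intro conjI ballI impI allI, goal_cases)
  case (12 A C C' g h)
  show ?case by (rule adjunct_comp_right[OF 12(1,2,4)])
next
  case (22 A B \<phi>)
  note A = cCom0D(1)[OF 22(1)] and B = cCom0D(1)[OF 22(2)]
  \<comment> \<open>Both sides are \<open>D_map\<close> of one morphism from A to the completion of
    B, by naturality of \<open>to_compl\<close>.\<close>
  show ?case
    unfolding D_map_comp[OF A compl_cCom[OF A] compl_cCom[OF B] to_compl_hom[OF A] compl_map_hom[OF A B 22(3)], symmetric]
      D_map_comp[OF A B compl_cCom[OF B] 22(3) to_compl_hom[OF B], symmetric] to_compl_natural[OF A B 22(3)] ..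
next
  case (24 A)
  note A = cCom0D(1)[OF 24]
  interpret reduced_hom R "D_star R A" A "D_unit R A"
    by (rule reduced_homI[OF assms(1) 24 D_star_cdgas[OF A] D_unit_hom[OF A]])
  \<comment> \<open>The required arrow is the continuous extension of the unit.\<close>
  show ?case
    by (intro bexI[OF _ cont_ext_hom] conjI ballI cont_ext_to_compl cont_hom_represented[OF assms(1) 24])
next
  case (28 A B \<phi>)
  have "compl A \<in> cAlg\<^sub>0 R" "compl B \<in> cAlg\<^sub>0 R"
    using 28 by (auto intro!: compl_cAlg0[OF assms(1)] fin_gen_aug_ideals_fg[OF assms(1)] dest: cCom0_fgD)
  from local_ccom_hom_eq[OF assms(1) this] compl_map_hom[OF cCom0D(1)[OF cCom0_fgD[OF 28(1)]] cCom0D(1)[OF cCom0_fgD[OF 28(2)]] 28(3)]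
  show ?case by simp
next
  case (32 C C' g)
  from local_ccom_hom_eq[OF assms(1) K_alg_cAlg0[OF assms(1) 32(1)] K_alg_cAlg0[OF assms(1) 32(2)]]
    K_map_hom[OF cdgas0D(1)[OF cdgas0_fgD[OF 32(1)]] cdgas0D(1)[OF cdgas0_fgD[OF 32(2)]] 32(3)]
  show ?case by simp
next
  case (33 A C)
  from local_ccom_hom_eq[OF assms(1) 33(1) K_alg_cAlg0[OF assms(1) 33(2)]]
    adjunct_bij[OF cCom0D(1)[OF cAlg0D(1)[OF assms(1) 33(1)]] cdgas0D(1)[OF cdgas0_fgD[OF 33(2)]]]
  show ?case by simp
next
  case (34 C)
  note K = K_alg_cCom0_fg[OF assms(1) 34]
  have "compl (K_alg C) \<in> cAlg\<^sub>0 R"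
    by (rule compl_cAlg0[OF assms(1) cCom0_fgD[OF K] fin_gen_aug_ideals_fg[OF assms(1) K]])
  from local_ccom_hom_eq[OF assms(1) K_alg_cAlg0[OF assms(1) 34] this] to_compl_hom[OF cCom0D(1)[OF cCom0_fgD[OF K]]]
  show ?case by simp
next
  case (35 C n)
  from K_alg_completion_bij[OF assms(1) cdgas0_fgD[OF 35], of n] show ?case
    unfolding to_compl_def level_compl by (subst bij_betw_cong[where g = "to_completion (level (K_alg C) n) (aug_ideal (K_alg C) n)"]) auto
qed (fast intro: assms(1) K_alg_cCom K_map_id K_map_hom K_map_comp D_star_cdgas D_unit_hom D_map_id D_map_char(1) D_map_comp adjunct_bij
    D_star_cdgas0_fg K_alg_cCom0_fg K_alg_cAlg0 compl_cCom compl_cCom0 compl_cAlg0 D_star_cdgas0 to_compl_hom compl_map_hom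
    compl_map_id compl_map_comp D_map_to_compl_iso fin_gen_aug_ideals_fg adjunct_comp_left
    cCom0D(1) cCom0_fgD cdgas0D(1) cdgas0_fgD cAlg0D)+

end
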